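(* Let $F$ be a field of characteristic $p\geq 0$ and let $G$ be a group such that the group algebra $FG$ is non-modular. The group $V(FG)$ of normalized units of $FG$ is locally nilpotent if and only if $G$ is a locally nilpotent group, the torsion part $\mathfrak{t}(G)$ is an abelian group, and one of the following conditions holds: (i) $\mathfrak{t}(G)$ is a central subgroup of $G$; (ii) $F$ is a prime field of characteristic $p=2^t-1$ (for some integer $t$), the exponent of $\mathfrak{t}(G)$ divides $p^2-1$, and $g^{-1}ag=a^p$ for all $a\in\mathfrak{t}(G)$ and all $g\in G\setminus C_G(\mathfrak{t}(G))$.
   Context: $V(FG)$ denotes the group of normalized units of $FG$, i.e. the units $\sum_{g}\alpha_g g$ of $FG$ with augmentation $\sum_g\alpha_g=1$. The group algebra $FG$ over a field $F$ of characteristic $p\ge 0$ is called modular if $p>0$ and $G$ contains an element of order $p$, and non-modular otherwise. $\mathfrak{t}(G)$ is the torsion part of $G$, i.e. the set of elements of finite order of $G$ (a priori not necessarily a subgroup), and $C_G(\mathfrak{t}(G))$ is its centralizer in $G$. A group is called locally nilpotent if all its finitely generated subgroups are nilpotent. *)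

theory Defs
  imports "HOL-Algebra.Algebra"
begin

section \<open>Groups\<close>

text \<open>The \<open>n\<close>-th entry is the subgroup usually written \<open>\<gamma>\<^sub>n\<^sub>+\<^sub>1(G)\<close>.\<close>

primrec lower_central_series :: "('g, 'b) monoid_scheme \<Rightarrow> nat \<Rightarrow> 'g set" where
  "lower_central_series G 0 = carrier G"
| "lower_central_series G (Suc n) =
     generate G (\<Union>x \<in> lower_central_series G n. \<Union>y \<in> carrier G.
       {x \<otimes>\<^bsub>G\<^esub> y \<otimes>\<^bsub>G\<^esub> inv\<^bsub>G\<^esub> x \<otimes>\<^bsub>G\<^esub> inv\<^bsub>G\<^esub> y})"

definition nilpotent_group :: "('g, 'b) monoid_scheme \<Rightarrow> bool" where
  "nilpotent_group G \<longleftrightarrow> group G \<and> (\<exists>n. lower_central_series G n = {\<one>\<^bsub>G\<^esub>})"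

definition locally_nilpotent_group :: "('g, 'b) monoid_scheme \<Rightarrow> bool" where
  "locally_nilpotent_group G \<longleftrightarrow>
     group G \<and> (\<forall>S. S \<subseteq> carrier G \<and> finite S \<longrightarrow> nilpotent_group (G\<lparr>carrier := generate G S\<rparr>))"

definition torsion_part :: "('g, 'b) monoid_scheme \<Rightarrow> 'g set" where
  "torsion_part G = {g \<in> carrier G. \<exists>n::nat. n > 0 \<and> g [^]\<^bsub>G\<^esub> n = \<one>\<^bsub>G\<^esub>}"

definition centralizer :: "('g, 'b) monoid_scheme \<Rightarrow> 'g set \<Rightarrow> 'g set" where
  "centralizer G S = {g \<in> carrier G. \<forall>s \<in> S. g \<otimes>\<^bsub>G\<^esub> s = s \<otimes>\<^bsub>G\<^esub> g}"

definition group_center :: "('g, 'b) monoid_scheme \<Rightarrow> 'g set" where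
  "group_center G = centralizer G (carrier G)"

text \<open>The value \<open>0\<close> stands for an infinite (unbounded) exponent; it divides no nonzero number.\<close>

definition group_exponent :: "('g, 'b) monoid_scheme \<Rightarrow> nat" where
  "group_exponent G =
     (if \<exists>n::nat. n > 0 \<and> (\<forall>g \<in> carrier G. g [^]\<^bsub>G\<^esub> n = \<one>\<^bsub>G\<^esub>)
      then LEAST n::nat. n > 0 \<and> (\<forall>g \<in> carrier G. g [^]\<^bsub>G\<^esub> n = \<one>\<^bsub>G\<^esub>)
      else 0)"

section \<open>Fields\<close>

definition ring_characteristic :: "('f, 'b) ring_scheme \<Rightarrow> nat" where
  "ring_characteristic R =
     (if \<exists>n::nat. n > 0 \<and> [n] \<cdot>\<^bsub>R\<^esub> \<one>\<^bsub>R\<^esub> = \<zero>\<^bsub>R\<^esub>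
      then LEAST n::nat. n > 0 \<and> [n] \<cdot>\<^bsub>R\<^esub> \<one>\<^bsub>R\<^esub> = \<zero>\<^bsub>R\<^esub>
      else 0)"

definition prime_field :: "('f, 'b) ring_scheme \<Rightarrow> bool" where
  "prime_field F \<longleftrightarrow> field F \<and> (\<forall>K. subfield K F \<longrightarrow> K = carrier F)"

section \<open>Group algebras\<close>

definition ga_support :: "('f, 'b) ring_scheme \<Rightarrow> ('g, 'c) monoid_scheme \<Rightarrow> ('g \<Rightarrow> 'f) \<Rightarrow> 'g set" where
  "ga_support F G u = {g \<in> carrier G. u g \<noteq> \<zero>\<^bsub>F\<^esub>}"

text \<open>
  The formal sum with coefficients \<open>\<alpha>\<^sub>g\<close> is the function \<open>g \<mapsto> \<alpha>\<^sub>g\<close>, of finite support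
  and \<open>undefined\<close> outside the carrier of \<open>G\<close>. In the product, the coefficient of \<open>x\<close> is the sum of
  \<open>u y \<otimes> v z\<close> over all pairs with \<open>y \<otimes> z = x\<close>; it is indexed by \<open>y\<close>, and restricted to the support
  of \<open>u\<close> because \<open>finsum\<close> is trivial on infinite index sets.
\<close>

definition group_algebra ::
    "('f, 'b) ring_scheme \<Rightarrow> ('g, 'c) monoid_scheme \<Rightarrow> ('g \<Rightarrow> 'f) ring" where
  "group_algebra F G =
     \<lparr> carrier = {u \<in> carrier G \<rightarrow>\<^sub>E carrier F. finite (ga_support F G u)},
       monoid.mult = (\<lambda>u v. \<lambda>x \<in> carrier G.
         \<Oplus>\<^bsub>F\<^esub>y \<in> ga_support F G u. u y \<otimes>\<^bsub>F\<^esub> v (inv\<^bsub>G\<^esub> y \<otimes>\<^bsub>G\<^esub> x)),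
       one = (\<lambda>x \<in> carrier G. if x = \<one>\<^bsub>G\<^esub> then \<one>\<^bsub>F\<^esub> else \<zero>\<^bsub>F\<^esub>),
       ring.zero = (\<lambda>x \<in> carrier G. \<zero>\<^bsub>F\<^esub>),
       ring.add = (\<lambda>u v. \<lambda>x \<in> carrier G. u x \<oplus>\<^bsub>F\<^esub> v x) \<rparr>"

definition augmentation ::
    "('f, 'b) ring_scheme \<Rightarrow> ('g, 'c) monoid_scheme \<Rightarrow> ('g \<Rightarrow> 'f) \<Rightarrow> 'f" where
  "augmentation F G u = (\<Oplus>\<^bsub>F\<^esub>g \<in> ga_support F G u. u g)"

definition normalized_units ::
    "('f, 'b) ring_scheme \<Rightarrow> ('g, 'c) monoid_scheme \<Rightarrow> ('g \<Rightarrow> 'f) monoid" where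
  "normalized_units F G =
     (units_of (group_algebra F G))
       \<lparr>carrier := {u \<in> Units (group_algebra F G). augmentation F G u = \<one>\<^bsub>F\<^esub>}\<rparr>"

definition modular_group_algebra :: "('f, 'b) ring_scheme \<Rightarrow> ('g, 'c) monoid_scheme \<Rightarrow> bool" where
  "modular_group_algebra F G \<longleftrightarrow>
     ring_characteristic F > 0 \<and> (\<exists>g \<in> carrier G. group.ord G g = ring_characteristic F)"

end

theory Submission
  imports Defs "HOL-Number_Theory.Number_Theory"
begin

text \<open>
  Let \<open>T\<close> be the torsion part of \<open>G\<close> and \<open>V\<close> the group of normalized units.

  For sufficiency it is enough to consider finitely many units; they lie in the group algebra of a
  finitely generated nilpotent subgroup \<open>H\<close>, and \<open>D = H \<inter> T\<close> is abelian and normal in \<open>H\<close> with a torsion-free nilpotent,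
  hence orderable, quotient (\<open>nilpotent_positive_cone\<close>). As the algebra is non-modular, the group
  algebra of \<open>D\<close> is reduced (\<open>reduced_finite_abelian\<close>), and \<open>H\<close> acts on it trivially or through
  the Frobenius map. The argument that determines the units of polynomial rings over reduced rings
  shows that every unit is, on the factors of a finite direct decomposition, homogeneous with respect
  to the grading by the cosets of \<open>D\<close> (\<open>unit_decomposition\<close>). So iterated commutators descend in
  \<open>H\<close> until they have degree zero (\<open>commutator_support\<close>); after that, in case (ii), every further
  commutator is a \<open>(p - 1)\<close>-th power and the exponent of the units of degree zero is absorbed
  (\<open>commutator_exponent\<close>).

  Necessity rests on the Engel condition in \<open>V\<close>. If \<open>w\<close> is
  a torsion unit and \<open>S\<close> the sum of its powers, the nilpotent elements \<open>(n - S) x S\<close> must vanish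
  (\<open>torsion_unit_average\<close>). Consequently cyclic torsion subgroups of \<open>G\<close> are normal and idempotents
  of their group algebras are central (\<open>torsion_conj\<close>, \<open>idempotent_invariant\<close>). Suppose that \<open>g\<close>
  moves a torsion element \<open>a\<close>. Conjugation by \<open>g\<close> has finite order on the abelian group of units in
  the group algebra of \<open>a\<close>, and is unipotent there; therefore every such unit \<open>u\<close> has a power that
  equals the same power of its conjugate (\<open>unit_power_invariant\<close>). With \<open>u = 1 + 4 a\<close> this is
  impossible in characteristic zero (\<open>torsion_central_char_zero\<close>). In characteristic \<open>p\<close>, \<open>g\<close> induces
  a nontrivial unipotent automorphism on a finite field that is a direct factor of a finite subring
  (\<open>moved_component\<close>). The order of its multiplicative group then has no prime divisors beyond those
  of the fixed field, and an elementary case of Zsigmondy's theorem leaves only the field with \<open>p\<^sup>2\<close>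
  elements and \<open>p + 1\<close> a power of two (\<open>unipotent_automorphism\<close>); hence \<open>g\<close> acts on \<open>a\<close> as the
  \<open>p\<close>-th power. Applied to \<open>u = 1 + l a\<close>, the equality of powers shows that every scalar \<open>l\<close> lies in a finite
  field (\<open>coefficient_frobenius_fixed\<close>), so that it can be included in the finite subring;
  it is fixed by \<open>g\<close> and therefore belongs to the prime field. Finally, two torsion elements that do not
  commute would generate a group with a quaternion subgroup, whose group algebra contains too many
  involutions (\<open>torsion_commute\<close>).
\<close>

section \<open>Lower central series and local nilpotency\<close>

abbreviation (input) comm_of where
 "comm_of G x y \<equiv> x \<otimes>\<^bsub>G\<^esub> y \<otimes>\<^bsub>G\<^esub> inv\<^bsub>G\<^esub> x \<otimes>\<^bsub>G\<^esub> inv\<^bsub>G\<^esub> y"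

lemma (in group) lower_central_series_subgroup:
 "subgroup (lower_central_series G n) G"
proof (induction n)
 case 0 then show ?case by (simp add: subgroup_self)
next
 case (Suc n)
 have "(\<Union>x\<in>lower_central_series G n. \<Union>y\<in>carrier G. {comm_of G x y}) \<subseteq> carrier G"
  using subgroup.subset[OF Suc] by auto
 then show ?case by (simp add: generate_is_subgroup)
qed

lemma (in group) lower_central_series_commutator:
 assumes "x \<in> lower_central_series G n" "y \<in> carrier G"
 shows "comm_of G x y \<in> lower_central_series G (Suc n)"
 using assms by (auto intro!: generate.incl)

lemma (in group) lower_central_series_subset_chain:
 assumes W: "\<And>n. subgroup (W n) G" and W0: "W 0 = carrier G"
  and step: "\<And>n x y. x \<in> W n \<Longrightarrow> y \<in> carrier G \<Longrightarrow> comm_of G x y \<in> W (Suc n)"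
 shows "lower_central_series G n \<subseteq> W n"
proof (induction n)
 case 0 then show ?case by (simp add: W0)
next
 case (Suc n)
 have "(\<Union>x\<in>lower_central_series G n. \<Union>y\<in>carrier G. {comm_of G x y}) \<subseteq> W (Suc n)"
  using Suc step by blast
 then show ?case using generate_subgroup_incl[OF _ W[of "Suc n"]] by simp
qed

text \<open>
  Every nilpotency proof below exhibits a descending chain of subgroups that starts above the generators; the
  lower central series of the generated group then stays inside the chain.
\<close>

lemma (in group) nilpotent_generateI:
 assumes W: "\<And>n. subgroup (W n) G" and S: "S \<subseteq> W 0"
  and step: "\<And>n x y. x \<in> W n \<Longrightarrow> y \<in> W 0 \<Longrightarrow> comm_of G x y \<in> W (Suc n)"
  and fin: "W m = {\<one>}"
 shows "nilpotent_group (G\<lparr>carrier := generate G S\<rparr>)"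
proof -
 let ?K = "generate G S"
 have Sc: "S \<subseteq> carrier G" using S subgroup.subset[OF W[of 0]] by blast
 have K: "subgroup ?K G" by (rule generate_is_subgroup[OF Sc])
 have KW: "?K \<subseteq> W 0" by (rule generate_subgroup_incl[OF S W])
 interpret K: group "G\<lparr>carrier := ?K\<rparr>" by (rule subgroup.subgroup_is_group[OF K is_group])
 have inv: "inv\<^bsub>G\<lparr>carrier := ?K\<rparr>\<^esub> x = inv x" if "x \<in> ?K" for x
  using m_inv_consistent[OF K that] .
 have *: "lower_central_series (G\<lparr>carrier := ?K\<rparr>) n \<subseteq> W n \<inter> ?K" for n
 proof (rule K.lower_central_series_subset_chain)
  show "subgroup (W n \<inter> ?K) (G\<lparr>carrier := ?K\<rparr>)" for n
   using subgroup_incl[OF subgroups_Inter_pair[OF W[of n] K] K] by simp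
 next
  show "W 0 \<inter> ?K = carrier (G\<lparr>carrier := ?K\<rparr>)" using KW by auto
 next
  fix n x y assume x: "x \<in> W n \<inter> ?K" and "y \<in> carrier (G\<lparr>carrier := ?K\<rparr>)"
  then have y: "y \<in> ?K" by simp
  have "comm_of G x y \<in> W (Suc n)" using step[of x n y] x y KW by auto
  moreover have "comm_of G x y \<in> ?K"
   using x y K by (simp add: subgroup.m_closed subgroup.m_inv_closed)
  ultimately show "comm_of (G\<lparr>carrier := ?K\<rparr>) x y \<in> W (Suc n) \<inter> ?K"
   using x y by (simp add: inv)
 qed
 have "lower_central_series (G\<lparr>carrier := ?K\<rparr>) m = {\<one>}"
  using *[of m] fin subgroup.one_closed[OF K.lower_central_series_subgroup, of m] by auto
 then show ?thesis
  unfolding nilpotent_group_def using K.is_group by auto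
qed

lemma (in group_hom) image_lower_central_series:
 "h ` lower_central_series G n \<subseteq> lower_central_series H n"
proof (induction n)
 case 0 then show ?case by auto
next
 case (Suc n)
 let ?X = "\<Union>x\<in>lower_central_series G n. \<Union>y\<in>carrier G. {comm_of G x y}"
 have sub: "lower_central_series G n \<subseteq> carrier G"
  using G.lower_central_series_subgroup subgroup.subset by blast
 have X: "?X \<subseteq> carrier G" using sub by auto
 have "h ` ?X \<subseteq> lower_central_series H (Suc n)"
 proof
  fix z assume "z \<in> h ` ?X"
  then obtain x y where xy: "x \<in> lower_central_series G n" "y \<in> carrier G" "z = h (comm_of G x y)"
   by blast
  then have "z = comm_of H (h x) (h y)" using sub by auto
  moreover have "h x \<in> lower_central_series H n" using xy(1) Suc by blast
  ultimately show "z \<in> lower_central_series H (Suc n)"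
   using H.lower_central_series_commutator[of "h x" n "h y"] xy(2) by simp
 qed
 then have "generate H (h ` ?X) \<subseteq> lower_central_series H (Suc n)"
  by (rule H.generate_subgroup_incl[OF _ H.lower_central_series_subgroup])
 then show ?case using generate_img[OF X] by simp
qed

lemma locally_nilpotent_inj_hom:
 assumes hom: "group_hom G V h" and inj: "inj_on h (carrier G)"
  and V: "locally_nilpotent_group V"
 shows "locally_nilpotent_group G"
proof -
 interpret group_hom G V h by (rule hom)
 have "nilpotent_group (G\<lparr>carrier := generate G S\<rparr>)" if S: "S \<subseteq> carrier G" "finite S" for S
 proof -
  let ?K = "generate G S" and ?L = "generate V (h ` S)"
  have hS: "h ` S \<subseteq> carrier V" using S by auto
  have K: "subgroup ?K G" and L: "subgroup ?L V"
   using G.generate_is_subgroup[OF S(1)] H.generate_is_subgroup[OF hS] by auto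
  have gK: "group (G\<lparr>carrier := ?K\<rparr>)" and gL: "group (V\<lparr>carrier := ?L\<rparr>)"
   using subgroup.subgroup_is_group[OF K] subgroup.subgroup_is_group[OF L] by auto
  have Kc: "?K \<subseteq> carrier G" using subgroup.subset[OF K] .
  have "h ` ?K = ?L" using generate_img[OF S(1)] by simp
  moreover have "h (x \<otimes>\<^bsub>G\<^esub> y) = h x \<otimes>\<^bsub>V\<^esub> h y" if "x \<in> ?K" "y \<in> ?K" for x y
   using that Kc by (intro hom_mult) blast+
  ultimately have "h \<in> hom (G\<lparr>carrier := ?K\<rparr>) (V\<lparr>carrier := ?L\<rparr>)"
   by (intro homI) auto
  then interpret r: group_hom "G\<lparr>carrier := ?K\<rparr>" "V\<lparr>carrier := ?L\<rparr>" h
   using gK gL by (intro group_hom.intro group_hom_axioms.intro)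
  have "nilpotent_group (V\<lparr>carrier := ?L\<rparr>)"
   using V hS S(2) unfolding locally_nilpotent_group_def by auto
  then obtain n where n: "lower_central_series (V\<lparr>carrier := ?L\<rparr>) n = {\<one>\<^bsub>V\<^esub>}"
   unfolding nilpotent_group_def by auto
  have sub: "subgroup (lower_central_series (G\<lparr>carrier := ?K\<rparr>) n) (G\<lparr>carrier := ?K\<rparr>)"
   by (rule r.G.lower_central_series_subgroup)
  have "x = \<one>\<^bsub>G\<^esub>" if "x \<in> lower_central_series (G\<lparr>carrier := ?K\<rparr>) n" for x
  proof -
   have "x \<in> carrier G" using subgroup.subset[OF sub] that Kc by auto
   moreover have "h x = \<one>\<^bsub>V\<^esub>" using r.image_lower_central_series[of n] n that by auto
   ultimately show ?thesis using inj_onD[OF inj, of x "\<one>\<^bsub>G\<^esub>"] by simp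
  qed
  moreover have "\<one>\<^bsub>G\<^esub> \<in> lower_central_series (G\<lparr>carrier := ?K\<rparr>) n"
   using subgroup.one_closed[OF sub] by simp
  ultimately have "lower_central_series (G\<lparr>carrier := ?K\<rparr>) n = {\<one>\<^bsub>G\<^esub>}"
   by blast
  then show ?thesis unfolding nilpotent_group_def using gK by auto
 qed
 then show ?thesis unfolding locally_nilpotent_group_def by auto
qed

text \<open>
  Inside the nilpotent group generated by \<open>x\<close> and \<open>y\<close> the \<open>n\<close>-th
  iterated commutator lies in the \<open>n\<close>-th term of the lower central series. The necessity of the
  conditions rests on this Engel property of the unit group.
\<close>

lemma locally_nilpotent_engel:
 assumes V: "locally_nilpotent_group V" and x: "x \<in> carrier V" and y: "y \<in> carrier V"
 shows "\<exists>n. ((\<lambda>z. comm_of V z y) ^^ n) x = \<one>\<^bsub>V\<^esub>"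
proof -
 interpret group V using V unfolding locally_nilpotent_group_def by simp
 let ?K = "generate V {x, y}"
 have xy: "{x, y} \<subseteq> carrier V" using x y by simp
 have K: "subgroup ?K V" by (rule generate_is_subgroup[OF xy])
 interpret K: group "V\<lparr>carrier := ?K\<rparr>" by (rule subgroup.subgroup_is_group[OF K is_group])
 have yK: "y \<in> ?K" and xK: "x \<in> ?K" by (auto intro: generate.incl)
 have "((\<lambda>z. comm_of V z y) ^^ n) x \<in> lower_central_series (V\<lparr>carrier := ?K\<rparr>) n" for n
 proof (induction n)
  case 0 then show ?case using xK by simp
 next
  case (Suc n)
  let ?z = "((\<lambda>z. comm_of V z y) ^^ n) x"
  have z: "?z \<in> ?K" using Suc subgroup.subset[OF K.lower_central_series_subgroup] by fastforce
  have "comm_of (V\<lparr>carrier := ?K\<rparr>) ?z y \<in> lower_central_series (V\<lparr>carrier := ?K\<rparr>) (Suc n)"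
   using K.lower_central_series_commutator[OF Suc] yK by simp
  then show ?case using m_inv_consistent[OF K z] m_inv_consistent[OF K yK] by simp
 qed
 moreover obtain n where "lower_central_series (V\<lparr>carrier := ?K\<rparr>) n = {\<one>\<^bsub>V\<^esub>}"
 proof -
  have "nilpotent_group (V\<lparr>carrier := ?K\<rparr>)"
   using V xy unfolding locally_nilpotent_group_def by blast
  then show ?thesis using that unfolding nilpotent_group_def by auto
 qed
 ultimately show ?thesis by blast
qed

lemma (in group) cauchy_prime_order:
 assumes "finite (carrier G)" "Factorial_Ring.prime q" "q dvd order G"
 shows "\<exists>x \<in> carrier G. ord x = q"
proof -
 obtain m where "order G = q ^ 1 * m" using assms(3) by auto
 then obtain H where H: "subgroup H G" "card H = q ^ 1"
  using sylow_thm[OF assms(2) is_group _ assms(1)] by blast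
 have "card H \<noteq> card {\<one>}" using H(2) prime_gt_1_nat[OF assms(2)] by simp
 then have "H \<noteq> {\<one>}" by auto
 then obtain x where x: "x \<in> H" "x \<noteq> \<one>"
  using subgroup.one_closed[OF H(1)] by blast
 have xc: "x \<in> carrier G" using x subgroup.subset[OF H(1)] by blast
 interpret H: group "G\<lparr>carrier := H\<rparr>" by (rule subgroup.subgroup_is_group[OF H(1) is_group])
 have "x [^]\<^bsub>G\<lparr>carrier := H\<rparr>\<^esub> order (G\<lparr>carrier := H\<rparr>) = \<one>"
  using H.pow_order_eq_1[of x] x by simp
 moreover have "order (G\<lparr>carrier := H\<rparr>) = q" using H(2) by (simp add: order_def)
 ultimately have "x [^] q = \<one>" using nat_pow_consistent[of x q H] by simp
 then have "ord x dvd q" using xc pow_eq_id by simp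
 then have "ord x = q" using assms(2) x(2) xc ord_eq_1[of x] unfolding prime_nat_iff by metis
 then show ?thesis using xc by blast
qed

section \<open>Ordering the quotients of a nilpotent group by isolated normal subgroups\<close>

lemma (in group) inv_cancels [simp]:
 "x \<in> carrier G \<Longrightarrow> z \<in> carrier G \<Longrightarrow> inv x \<otimes> (x \<otimes> z) = z"
 "x \<in> carrier G \<Longrightarrow> z \<in> carrier G \<Longrightarrow> x \<otimes> (inv x \<otimes> z) = z"
 by (simp_all add: m_assoc[symmetric])

text \<open>
  A torsion-free abelian group can be ordered, here for the quotient of \<open>M\<close> by \<open>N\<close>,
  without forming the quotient: \<open>Q\<close> is the preimage of the set of positive elements. A maximal
  \<open>Q\<close> with the first four properties exists by Zorn; if neither \<open>x\<close> nor its inverse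
  were in it, it could be enlarged by one of them.
\<close>

lemma (in group) factor_order:
 assumes M: "subgroup M G" and N: "subgroup N G" and NM: "N \<subseteq> M"
  and comm: "\<And>x y. x \<in> M \<Longrightarrow> y \<in> M \<Longrightarrow> comm_of G x y \<in> N"
  and iso: "\<And>x n. x \<in> M \<Longrightarrow> n > 0 \<Longrightarrow> x [^] (n::nat) \<in> N \<Longrightarrow> x \<in> N"
 shows "\<exists>Q. Q \<subseteq> M \<and> Q \<inter> N = {} \<and> (\<forall>q\<in>Q. \<forall>r\<in>Q. q \<otimes> r \<in> Q) \<and> (\<forall>n\<in>N. \<forall>q\<in>Q. n \<otimes> q \<in> Q) \<and>
   (\<forall>x\<in>M. x \<in> N \<or> x \<in> Q \<or> inv x \<in> Q)"
proof -
 define F where "F = {Q. Q \<subseteq> M \<and> Q \<inter> N = {} \<and> (\<forall>q\<in>Q. \<forall>r\<in>Q. q \<otimes> r \<in> Q) \<and> (\<forall>n\<in>N. \<forall>q\<in>Q. n \<otimes> q \<in> Q)}"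
 have Mc: "M \<subseteq> carrier G" using subgroup.subset[OF M] .
 have "\<exists>Q\<in>F. \<forall>E\<in>F. Q \<subseteq> E \<longrightarrow> E = Q"
 proof (rule subset_Zorn_nonempty)
  show "F \<noteq> {}" unfolding F_def by (rule ex_in_conv[THEN iffD1], rule exI[of _ "{}"]) simp
 next
  fix C assume C: "C \<noteq> {}" "subset.chain F C"
  then have CF: "C \<subseteq> F" and lin: "\<And>E Y. E \<in> C \<Longrightarrow> Y \<in> C \<Longrightarrow> E \<subseteq> Y \<or> Y \<subseteq> E"
   unfolding subset_chain_def by auto
  have "q \<otimes> r \<in> \<Union>C" if qr: "q \<in> \<Union>C" "r \<in> \<Union>C" for q r
  proof -
   obtain E Y where XY: "E \<in> C" "Y \<in> C" "q \<in> E" "r \<in> Y" using qr by blast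
   then obtain W where "W \<in> C" "q \<in> W" "r \<in> W" using lin[of E Y] by blast
   then show ?thesis using CF unfolding F_def by blast
  qed
  moreover have "n \<otimes> q \<in> \<Union>C" if "n \<in> N" "q \<in> \<Union>C" for n q
   using that CF unfolding F_def by blast
  moreover have "\<Union>C \<subseteq> M" "\<Union>C \<inter> N = {}" using CF unfolding F_def by blast+
  ultimately show "\<Union>C \<in> F" unfolding F_def by simp
 qed
 then obtain Q where Q: "Q \<in> F" and max: "\<And>E. E \<in> F \<Longrightarrow> Q \<subseteq> E \<Longrightarrow> E = Q" by blast
 have QM: "Q \<subseteq> M" and QN: "Q \<inter> N = {}" and QQ: "\<And>q r. q \<in> Q \<Longrightarrow> r \<in> Q \<Longrightarrow> q \<otimes> r \<in> Q"
  and NQ: "\<And>n q. n \<in> N \<Longrightarrow> q \<in> Q \<Longrightarrow> n \<otimes> q \<in> Q" using Q unfolding F_def by auto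
 have inN: "a \<otimes> r \<otimes> inv a \<in> Q \<union> N" if "a \<in> M" "r \<in> Q \<union> N" for a r
 proof -
  have r: "r \<in> M" using that QM NM by blast
  have "a \<otimes> r \<otimes> inv a = comm_of G a r \<otimes> r"
   using that(1) r Mc by (simp add: m_assoc subset_iff)
  moreover have "comm_of G a r \<otimes> r \<in> Q \<union> N"
   using comm[OF that(1) r] that(2) NQ subgroup.m_closed[OF N] by blast
  ultimately show ?thesis by metis
 qed
 have QN_mult: "a \<otimes> b \<in> Q \<union> N" if "a \<in> Q \<union> N" "b \<in> Q \<union> N" for a b
 proof (cases "a \<in> Q \<and> b \<in> N")
  case True
  then have ab: "a \<in> M" "b \<in> M" "a \<in> carrier G" "b \<in> carrier G" using QM NM Mc by auto
  have "a \<otimes> b = (a \<otimes> b \<otimes> inv a) \<otimes> a" using ab by (simp add: m_assoc)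
  moreover have "a \<otimes> b \<otimes> inv a = comm_of G a b \<otimes> b" using ab by (simp add: m_assoc)
  moreover have "comm_of G a b \<otimes> b \<in> N" using comm[OF ab(1,2)] True subgroup.m_closed[OF N] by blast
  ultimately show ?thesis using NQ True by (metis UnI1)
 next
  case False then show ?thesis using that QQ NQ subgroup.m_closed[OF N] by blast
 qed
 have key: "\<exists>k>0. inv (x [^] (k::nat)) \<in> Q" if x: "x \<in> M" "x \<notin> N" "x \<notin> Q" for x
 proof (rule ccontr)
  assume neg: "\<not> ?thesis"
  have xc: "x \<in> carrier G" using x Mc by blast
  have xk: "x [^] (k::nat) \<in> M" for k
  proof (induction k)
   case 0 then show ?case using subgroup.one_closed[OF M] by simp
  next
   case (Suc k) then show ?case using subgroup.m_closed[OF M _ x(1)] by simp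
  qed
  define R where "R = Q \<union> {r \<otimes> x [^] (k::nat) | r k. r \<in> Q \<union> N \<and> k > 0}"
  have R1: "r \<otimes> x [^] k \<in> R" if "r \<in> Q \<union> N" "k > 0" for r and k :: nat
   using that unfolding R_def by blast
  have "q \<otimes> r \<in> R" if qr: "q \<in> R \<union> N" "r \<in> R" for q r
  proof -
   consider "q \<in> Q \<union> N" "r \<in> Q" | s k where "q \<in> Q \<union> N" "s \<in> Q \<union> N" "k > 0" "r = s \<otimes> x [^] (k::nat)"
    | s k where "s \<in> Q \<union> N" "k > 0" "q = s \<otimes> x [^] (k::nat)" "r \<in> Q"
    | s k t l where "s \<in> Q \<union> N" "k > 0" "q = s \<otimes> x [^] (k::nat)" "t \<in> Q \<union> N" "l > 0" "r = t \<otimes> x [^] (l::nat)"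
    using qr unfolding R_def by blast
   then show ?thesis
   proof cases
    case 1
    then show ?thesis using QQ NQ unfolding R_def by blast
   next
    case 2
    have "q \<otimes> r = (q \<otimes> s) \<otimes> x [^] k" using 2 QM NM Mc xc by (auto simp: m_assoc subset_iff)
    then show ?thesis using R1[OF QN_mult[OF 2(1,2)] 2(3)] by simp
   next
    case 3
    have sr: "s \<in> carrier G" "r \<in> carrier G" using 3 QM NM Mc by auto
    have "q \<otimes> r = (s \<otimes> (x [^] k \<otimes> r \<otimes> inv (x [^] k))) \<otimes> x [^] k"
     using 3 sr xc by (simp add: m_assoc)
    moreover have "s \<otimes> (x [^] k \<otimes> r \<otimes> inv (x [^] k)) \<in> Q \<union> N"
     using QN_mult[OF 3(1) inN[OF xk[of k]]] 3 by blast
    ultimately show ?thesis using R1 3(2) by simp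
   next
    case 4
    have sr: "s \<in> carrier G" "t \<in> carrier G" using 4 QM NM Mc by auto
    have "q \<otimes> r = (s \<otimes> (x [^] k \<otimes> t \<otimes> inv (x [^] k))) \<otimes> (x [^] k \<otimes> x [^] l)"
     using 4 sr xc by (simp add: m_assoc)
    also have "\<dots> = (s \<otimes> (x [^] k \<otimes> t \<otimes> inv (x [^] k))) \<otimes> x [^] (k + l)"
     using xc by (simp add: nat_pow_mult)
    finally have "q \<otimes> r = (s \<otimes> (x [^] k \<otimes> t \<otimes> inv (x [^] k))) \<otimes> x [^] (k + l)" .
    moreover have "s \<otimes> (x [^] k \<otimes> t \<otimes> inv (x [^] k)) \<in> Q \<union> N"
     using QN_mult[OF 4(1) inN[OF xk[of k] 4(4)]] .
    ultimately show ?thesis using R1[of _ "k + l"] 4(2) by simp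
   qed
  qed
  then have RR: "\<forall>q\<in>R. \<forall>r\<in>R. q \<otimes> r \<in> R" "\<forall>q\<in>N. \<forall>r\<in>R. q \<otimes> r \<in> R" by auto
  have RM: "R \<subseteq> M"
   using QM NM xk unfolding R_def by (auto intro!: subgroup.m_closed[OF M])
  have RN: "R \<inter> N = {}"
  proof (rule ccontr)
   assume "R \<inter> N \<noteq> {}"
   then obtain r and k :: nat where r: "r \<in> Q \<union> N" "k > 0" "r \<otimes> x [^] k \<in> N"
    using QN unfolding R_def by blast
   have rc: "r \<in> carrier G" using r QM NM Mc by auto
   show False
   proof (cases "r \<in> N")
    case True
    have "inv r \<otimes> (r \<otimes> x [^] k) \<in> N"
     using True r(3) subgroup.m_closed[OF N] subgroup.m_inv_closed[OF N] by blast
    moreover have "inv r \<otimes> (r \<otimes> x [^] k) = x [^] k" using rc xc by simp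
    ultimately show False using iso[OF x(1) r(2)] x(2) by simp
   next
    case False
    have "inv (r \<otimes> x [^] k) \<otimes> r \<in> Q"
     using NQ[OF subgroup.m_inv_closed[OF N r(3)]] r(1) False by blast
    moreover have "inv (r \<otimes> x [^] k) \<otimes> r = inv (x [^] k)"
     using rc xc by (simp add: inv_mult_group m_assoc)
    ultimately show False using neg r(2) by metis
   qed
  qed
  have "R \<in> F" unfolding F_def using RR RM RN by simp
  then have "R = Q" using max[of R] unfolding R_def by blast
  moreover have "x \<in> R" using R1[of \<one> 1] subgroup.one_closed[OF N] xc by simp
  ultimately show False using x(3) by simp
 qed
 have "x \<in> N \<or> x \<in> Q \<or> inv x \<in> Q" if x: "x \<in> M" for x
 proof (rule ccontr)
  assume neg: "\<not> ?thesis"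
  have xc: "x \<in> carrier G" using x Mc by blast
  obtain k where k: "k > 0" "inv (x [^] (k::nat)) \<in> Q" using key[of x] neg x by blast
  have ix: "inv x \<in> M" using subgroup.m_inv_closed[OF M x] .
  have "inv x \<notin> N" using neg subgroup.m_inv_closed[OF N, of "inv x"] xc by auto
  then obtain l where l: "l > 0" "inv (inv x [^] (l::nat)) \<in> Q" using key[OF ix] neg by blast
  have pw: "y [^] (Suc n) \<in> Q" if "y \<in> Q" for y and n :: nat
  proof (induction n)
   case 0 then show ?case using that QM Mc by auto
  next
   case (Suc n) then show ?case using QQ[OF Suc that] by simp
  qed
  have pw': "y [^] n \<in> Q" if "y \<in> Q" "n > 0" for y and n :: nat
   using pw[OF that(1), of "n - 1"] that(2) by simp
  have "inv (x [^] k) [^] l \<in> Q" using pw'[OF k(2) l(1)] .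
  moreover have "inv (inv x [^] l) [^] k \<in> Q" using pw'[OF l(2) k(1)] .
  ultimately have "inv (x [^] k) [^] l \<otimes> inv (inv x [^] l) [^] k \<in> Q" by (rule QQ)
  moreover have "inv (x [^] k) [^] l = inv (x [^] (k * l))"
   using xc by (simp add: nat_pow_inv nat_pow_pow)
  moreover have "inv (inv x [^] l) [^] k = x [^] (k * l)"
   using xc by (simp add: nat_pow_inv nat_pow_pow mult.commute)
  ultimately have "inv (x [^] (k * l)) \<otimes> x [^] (k * l) \<in> Q" by metis
  then have "\<one> \<in> Q" using xc by simp
  then show False using QN subgroup.one_closed[OF N] by blast
 qed
 then have "Q \<subseteq> M \<and> Q \<inter> N = {} \<and> (\<forall>q\<in>Q. \<forall>r\<in>Q. q \<otimes> r \<in> Q) \<and> (\<forall>n\<in>N. \<forall>q\<in>Q. n \<otimes> q \<in> Q) \<and>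
   (\<forall>x\<in>M. x \<in> N \<or> x \<in> Q \<or> inv x \<in> Q)"
  using QM QN QQ NQ by (intro conjI ballI) assumption+
 then show ?thesis by (rule exI)
qed

text \<open>
  The preimage in \<open>H\<close> of the set of positive elements for a bi-invariant order on the quotient of
  \<open>H\<close> by \<open>D\<close>. Working with preimages avoids quotient types.
\<close>

definition positive_cone :: "('g, 'b) monoid_scheme \<Rightarrow> 'g set \<Rightarrow> 'g set \<Rightarrow> 'g set \<Rightarrow> bool" where
 "positive_cone G D H P \<longleftrightarrow> P \<subseteq> H \<and> P \<inter> D = {} \<and>
   (\<forall>x\<in>P. \<forall>y\<in>P. x \<otimes>\<^bsub>G\<^esub> y \<in> P) \<and> (\<forall>d\<in>D. \<forall>x\<in>P. d \<otimes>\<^bsub>G\<^esub> x \<in> P) \<and>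
   (\<forall>h\<in>carrier G. \<forall>x\<in>P. h \<otimes>\<^bsub>G\<^esub> x \<otimes>\<^bsub>G\<^esub> inv\<^bsub>G\<^esub> h \<in> P) \<and>
   (\<forall>x\<in>H. x \<in> D \<or> x \<in> P \<or> inv\<^bsub>G\<^esub> x \<in> P)"

text \<open>The preimages of the upper central series of the quotient by \<open>D\<close>.\<close>

primrec upper_series :: "('g, 'b) monoid_scheme \<Rightarrow> 'g set \<Rightarrow> nat \<Rightarrow> 'g set" where
 "upper_series G D 0 = D"
| "upper_series G D (Suc i) =
  {x \<in> carrier G. \<forall>h \<in> carrier G. comm_of G x h \<in> upper_series G D i}"

lemma (in group) comm_of_mult:
 "\<lbrakk>x \<in> carrier G; y \<in> carrier G; h \<in> carrier G\<rbrakk> \<Longrightarrow>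
  comm_of G (x \<otimes> y) h = x \<otimes> comm_of G y h \<otimes> inv x \<otimes> comm_of G x h"
 by (simp add: m_assoc inv_mult_group)

lemma (in group) comm_of_inv:
 "\<lbrakk>x \<in> carrier G; h \<in> carrier G\<rbrakk> \<Longrightarrow> inv (comm_of G x h) = comm_of G h x"
 by (simp add: m_assoc inv_mult_group)

lemma (in group) upper_series_normal:
 assumes D: "subgroup D G" and nD: "\<And>g d. g \<in> carrier G \<Longrightarrow> d \<in> D \<Longrightarrow> g \<otimes> d \<otimes> inv g \<in> D"
 shows "subgroup (upper_series G D i) G \<and> upper_series G D i \<subseteq> upper_series G D (Suc i) \<and>
  (\<forall>g \<in> carrier G. \<forall>d \<in> upper_series G D i. g \<otimes> d \<otimes> inv g \<in> upper_series G D i)"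
proof (induction i)
 case 0
 have "D \<subseteq> carrier G" using subgroup.subset[OF D] .
 moreover have "comm_of G x h \<in> D" if "x \<in> D" "h \<in> carrier G" for x h
 proof -
  have "comm_of G x h = x \<otimes> (h \<otimes> inv x \<otimes> inv h)"
   using that subgroup.mem_carrier[OF D] by (simp add: m_assoc)
  then show ?thesis
   using that nD subgroup.m_closed[OF D] subgroup.m_inv_closed[OF D] by simp
 qed
 ultimately show ?case using D nD by auto
next
 case (Suc i)
 let ?Z = "upper_series G D i" and ?Y = "upper_series G D (Suc i)"
 have Z: "subgroup ?Z G" and ZY: "?Z \<subseteq> ?Y"
  and cZ: "\<And>g d. g \<in> carrier G \<Longrightarrow> d \<in> ?Z \<Longrightarrow> g \<otimes> d \<otimes> inv g \<in> ?Z" using Suc by auto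
 have Y: "subgroup ?Y G"
 proof (rule subgroupI)
  show "?Y \<subseteq> carrier G" by auto
  show "?Y \<noteq> {}" using ZY subgroup.one_closed[OF Z] by blast
 next
  fix x assume x: "x \<in> ?Y"
  then have xc: "x \<in> carrier G" by simp
  have "comm_of G (inv x) h \<in> ?Z" if h: "h \<in> carrier G" for h
  proof -
   have "comm_of G (inv x) h = inv x \<otimes> inv (comm_of G x h) \<otimes> inv (inv x)"
    using xc h by (simp add: m_assoc inv_mult_group)
   moreover have "inv (comm_of G x h) \<in> ?Z" using x h subgroup.m_inv_closed[OF Z] by simp
   ultimately show ?thesis using cZ[of "inv x"] xc by simp
  qed
  then show "inv x \<in> ?Y" using xc by simp
 next
  fix x y assume xy: "x \<in> ?Y" "y \<in> ?Y"
  then have c: "x \<in> carrier G" "y \<in> carrier G" by auto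
  have "comm_of G (x \<otimes> y) h \<in> ?Z" if h: "h \<in> carrier G" for h
   using xy c h cZ[of x "comm_of G y h"] subgroup.m_closed[OF Z] by (simp add: comm_of_mult)
  then show "x \<otimes> y \<in> ?Y" using c by simp
 qed
 have cY: "g \<otimes> d \<otimes> inv g \<in> ?Y" if g: "g \<in> carrier G" and d: "d \<in> ?Y" for g d
 proof -
  have dc: "d \<in> carrier G" using d by simp
  have "g \<otimes> d \<otimes> inv g = inv (comm_of G d g) \<otimes> d" using g dc by (simp add: m_assoc inv_mult_group)
  moreover have "inv (comm_of G d g) \<in> ?Z" using d g subgroup.m_inv_closed[OF Z] by simp
  then have "inv (comm_of G d g) \<in> ?Y" using ZY by blast
  ultimately show ?thesis using subgroup.m_closed[OF Y _ d] by metis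
 qed
 have "comm_of G x h \<in> ?Y" if "x \<in> ?Y" "h \<in> carrier G" for x h using that ZY by auto
 then have "?Y \<subseteq> upper_series G D (Suc (Suc i))" by auto
 then show ?case using Y cY by blast
qed

text \<open>
  In a group whose quotient by \<open>D\<close> is torsion-free, the successive quotients of the upper central
  series are torsion-free as well: if a power of \<open>x\<close> is central modulo a lower term, then its
  commutator with \<open>h\<close> has a power in that lower term, so by induction the commutator itself is
  there.
\<close>

lemma (in group) upper_series_isolated:
 assumes D: "subgroup D G" and nD: "\<And>g d. g \<in> carrier G \<Longrightarrow> d \<in> D \<Longrightarrow> g \<otimes> d \<otimes> inv g \<in> D"
  and iso: "\<And>x n. x \<in> carrier G \<Longrightarrow> n > 0 \<Longrightarrow> x [^] (n::nat) \<in> D \<Longrightarrow> x \<in> D"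
  and "x \<in> upper_series G D (Suc i)" "n > 0" "x [^] (n::nat) \<in> upper_series G D i"
 shows "x \<in> upper_series G D i"
 using assms(4-6)
proof (induction i arbitrary: x)
 case 0 then show ?case using iso[of x n] by simp
next
 case (Suc i)
 let ?Z = "upper_series G D i" and ?Y = "upper_series G D (Suc i)"
 note N = upper_series_normal[OF D nD]
 have Z: "subgroup ?Z G" and cZ: "\<And>g d. g \<in> carrier G \<Longrightarrow> d \<in> ?Z \<Longrightarrow> g \<otimes> d \<otimes> inv g \<in> ?Z"
  and Y: "subgroup ?Y G" using N[of i] N[of "Suc i"] by auto
 have xc: "x \<in> carrier G" using Suc.prems by simp
 have "comm_of G x h \<in> ?Z" if h: "h \<in> carrier G" for h
 proof (rule Suc.IH)
  let ?c = "comm_of G x h"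
  show c: "?c \<in> ?Y" using Suc.prems(1) h by simp
  show "n > 0" by fact
  have cc: "?c \<in> carrier G" using xc h by simp
  have ck: "?c [^] k \<in> ?Y" for k :: nat
  proof (induction k)
   case 0 then show ?case using subgroup.one_closed[OF Y] by simp
  next
   case (Suc k) then show ?case using subgroup.m_closed[OF Y Suc c] by simp
  qed
  have "comm_of G (x [^] k) h \<otimes> inv (?c [^] k) \<in> ?Z" for k :: nat
  proof (induction k)
   case 0 then show ?case using subgroup.one_closed[OF Z] h by simp
  next
   case (Suc k)
   let ?z = "comm_of G (x [^] k) h \<otimes> inv (?c [^] k)" and ?w = "comm_of G (?c [^] k) x"
   have w: "?w \<in> ?Z" using ck[of k] xc by simp
   have "comm_of G (x [^] Suc k) h = x \<otimes> comm_of G (x [^] k) h \<otimes> inv x \<otimes> ?c"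
    using comm_of_mult[of x "x [^] k" h] xc h by (simp only: nat_pow_Suc2 nat_pow_closed)
   moreover have "comm_of G (x [^] k) h = ?z \<otimes> ?c [^] k" using xc h cc by (simp add: m_assoc)
   moreover obtain z where z: "z = ?z" by simp
   moreover have zc: "z \<in> carrier G" using z xc h cc by simp
   moreover obtain c where c: "c = ?c" "c \<in> carrier G" using cc by blast
   moreover have "x \<otimes> (z \<otimes> c [^] k) \<otimes> inv x \<otimes> c \<otimes> inv (c [^] Suc k)
     = (x \<otimes> z \<otimes> inv x) \<otimes> inv (comm_of G (c [^] k) x)"
   proof -
    have *: "c \<otimes> inv (c [^] Suc k) = inv (c [^] k)" using c(2) by (simp add: inv_mult_group)
    have "x \<otimes> (z \<otimes> c [^] k) \<otimes> inv x \<otimes> c \<otimes> inv (c [^] Suc k)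
     = x \<otimes> (z \<otimes> c [^] k) \<otimes> inv x \<otimes> (c \<otimes> inv (c [^] Suc k))"
     using xc zc c(2) by (simp only: m_assoc m_closed inv_closed nat_pow_closed)
    also have "\<dots> = (x \<otimes> z \<otimes> inv x) \<otimes> inv (comm_of G (c [^] k) x)"
     unfolding * using xc zc c(2) by (simp add: m_assoc inv_mult_group)
    finally show ?thesis .
   qed
   ultimately have "comm_of G (x [^] Suc k) h \<otimes> inv (?c [^] Suc k) = (x \<otimes> z \<otimes> inv x) \<otimes> inv ?w"
    by metis
   moreover have "x \<otimes> z \<otimes> inv x \<in> ?Z" using cZ[OF xc] Suc z by simp
   ultimately show ?case using subgroup.m_closed[OF Z] subgroup.m_inv_closed[OF Z w] by metis
  qed
  from this[of n] have *: "comm_of G (x [^] n) h \<otimes> inv (?c [^] n) \<in> ?Z" .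
  have "comm_of G (x [^] n) h \<in> ?Z" using Suc.prems(3) h by simp
  then have "inv (comm_of G (x [^] n) h \<otimes> inv (?c [^] n)) \<otimes> comm_of G (x [^] n) h \<in> ?Z"
   using subgroup.m_closed[OF Z subgroup.m_inv_closed[OF Z *]] by blast
  moreover obtain b where "b = comm_of G (x [^] n) h" "b \<in> carrier G" using xc h by simp
  moreover have "inv (b \<otimes> inv (?c [^] n)) \<otimes> b = ?c [^] n" if "b \<in> carrier G" for b
   using that cc by (simp add: inv_mult_group m_assoc)
  ultimately show "?c [^] n \<in> ?Z" by metis
 qed
 then show ?case using xc by simp
qed

text \<open>
  Each factor of the upper central series above \<open>D\<close> is central and torsion-free, so it carries an
  order, which is conjugation invariant because the factor is central. The orders of the factors are combined
  lexicographically.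
\<close>

lemma (in group) nilpotent_positive_cone:
 assumes nil: "lower_central_series G c = {\<one>}"
  and D: "subgroup D G" and nD: "\<And>g d. g \<in> carrier G \<Longrightarrow> d \<in> D \<Longrightarrow> g \<otimes> d \<otimes> inv g \<in> D"
  and iso: "\<And>x n. x \<in> carrier G \<Longrightarrow> n > 0 \<Longrightarrow> x [^] (n::nat) \<in> D \<Longrightarrow> x \<in> D"
 shows "\<exists>P. positive_cone G D (carrier G) P"
proof -
 let ?Z = "upper_series G D"
 note N = upper_series_normal[OF D nD]
 have "lower_central_series G (c - i) \<subseteq> ?Z i" for i
 proof (induction i)
  case 0 then show ?case using nil subgroup.one_closed[OF D] by simp
 next
  case (Suc i)
  show ?case
  proof (cases "i < c")
   case True
   have "x \<in> ?Z (Suc i)" if x: "x \<in> lower_central_series G (c - Suc i)" for x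
   proof -
    have xc: "x \<in> carrier G" using x subgroup.subset[OF lower_central_series_subgroup] by blast
    have "comm_of G x h \<in> ?Z i" if h: "h \<in> carrier G" for h
    proof -
     have "c - i = Suc (c - Suc i)" using True by simp
     then show ?thesis using lower_central_series_commutator[OF x h] Suc by auto
    qed
    then show ?thesis using xc by simp
   qed
   then show ?thesis by blast
  next
   case False
   then have "c - Suc i = c - i" by simp
   then show ?thesis using Suc N[of i] by (metis subset_trans)
  qed
 qed
 from this[of c] have top: "carrier G \<subseteq> ?Z c" by simp
 have "\<exists>P. positive_cone G D (?Z i) P" for i
 proof (induction i)
  case 0
  show ?case unfolding positive_cone_def by (rule exI[of _ "{}"]) simp
 next
  case (Suc i)
  then obtain P where P: "positive_cone G D (?Z i) P" by blast
  have Y: "subgroup (?Z (Suc i)) G" and Z: "subgroup (?Z i) G" and ZY: "?Z i \<subseteq> ?Z (Suc i)"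
   using N[of i] N[of "Suc i"] by auto
  have comm: "comm_of G x y \<in> ?Z i" if "x \<in> ?Z (Suc i)" "y \<in> ?Z (Suc i)" for x y using that by auto
  have iso': "x \<in> ?Z i" if "x \<in> ?Z (Suc i)" "n > 0" "x [^] (n::nat) \<in> ?Z i" for x n
   by (rule upper_series_isolated[OF D nD iso that])
  have "\<exists>Q. Q \<subseteq> ?Z (Suc i) \<and> Q \<inter> ?Z i = {} \<and>
    (\<forall>q\<in>Q. \<forall>r\<in>Q. q \<otimes> r \<in> Q) \<and> (\<forall>n\<in>?Z i. \<forall>q\<in>Q. n \<otimes> q \<in> Q) \<and>
    (\<forall>x\<in>?Z (Suc i). x \<in> ?Z i \<or> x \<in> Q \<or> inv x \<in> Q)"
   by (rule factor_order[OF Y Z ZY]) (erule comm iso', assumption+)+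
  then obtain Q where Q0: "Q \<subseteq> ?Z (Suc i) \<and> Q \<inter> ?Z i = {} \<and>
    (\<forall>q\<in>Q. \<forall>r\<in>Q. q \<otimes> r \<in> Q) \<and> (\<forall>n\<in>?Z i. \<forall>q\<in>Q. n \<otimes> q \<in> Q) \<and>
    (\<forall>x\<in>?Z (Suc i). x \<in> ?Z i \<or> x \<in> Q \<or> inv x \<in> Q)" by (elim exE)
  have Q: "Q \<subseteq> ?Z (Suc i)" "Q \<inter> ?Z i = {}" "\<And>q r. q \<in> Q \<Longrightarrow> r \<in> Q \<Longrightarrow> q \<otimes> r \<in> Q"
   "\<And>n q. n \<in> ?Z i \<Longrightarrow> q \<in> Q \<Longrightarrow> n \<otimes> q \<in> Q" "\<And>x. x \<in> ?Z (Suc i) \<Longrightarrow> x \<in> ?Z i \<or> x \<in> Q \<or> inv x \<in> Q"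
   using Q0 by (elim conjE, blast)+
  have DZ: "D \<subseteq> ?Z j" for j
  proof (induction j)
   case (Suc j) then show ?case using N[of j] by blast
  qed simp
  have Qc: "Q \<subseteq> carrier G" using Q(1) by auto
  have cQ: "h \<otimes> q \<otimes> inv h \<in> Q" if h: "h \<in> carrier G" and q: "q \<in> Q" for h q
  proof -
   have qc: "q \<in> carrier G" using q Qc by blast
   have "h \<otimes> q \<otimes> inv h = inv (comm_of G q h) \<otimes> q" using h qc by (simp add: m_assoc inv_mult_group)
   moreover have "inv (comm_of G q h) \<in> ?Z i" using q Q(1) h subgroup.m_inv_closed[OF Z] by auto
   ultimately show ?thesis using Q(4) q by metis
  qed
  have QP: "q \<otimes> x \<in> Q" if q: "q \<in> Q" and x: "x \<in> ?Z i" for q x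
  proof -
   have c: "q \<in> carrier G" "x \<in> carrier G" using q Qc subgroup.mem_carrier[OF Z x] by auto
   have "q \<otimes> x = (q \<otimes> x \<otimes> inv q) \<otimes> q" using c by (simp add: m_assoc)
   moreover have "q \<otimes> x \<otimes> inv q \<in> ?Z i" using N[of i] c x by blast
   ultimately show ?thesis using Q(4) q by metis
  qed
  have P': "P \<subseteq> ?Z i" "P \<inter> D = {}" "\<And>x y. x \<in> P \<Longrightarrow> y \<in> P \<Longrightarrow> x \<otimes> y \<in> P"
   "\<And>d x. d \<in> D \<Longrightarrow> x \<in> P \<Longrightarrow> d \<otimes> x \<in> P"
   "\<And>h x. h \<in> carrier G \<Longrightarrow> x \<in> P \<Longrightarrow> h \<otimes> x \<otimes> inv h \<in> P"
   "\<And>x. x \<in> ?Z i \<Longrightarrow> x \<in> D \<or> x \<in> P \<or> inv x \<in> P"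
   using P unfolding positive_cone_def by auto
  have "positive_cone G D (?Z (Suc i)) (P \<union> Q)"
   unfolding positive_cone_def
  proof (intro conjI ballI)
   show "P \<union> Q \<subseteq> ?Z (Suc i)" using P'(1) ZY Q(1) by blast
   show "(P \<union> Q) \<inter> D = {}" using P'(2) Q(2) DZ by blast
   show "x \<otimes> y \<in> P \<union> Q" if "x \<in> P \<union> Q" "y \<in> P \<union> Q" for x y
    using that P'(1,3) Q(3,4) QP by blast
   show "d \<otimes> x \<in> P \<union> Q" if "d \<in> D" "x \<in> P \<union> Q" for d x
    using that P'(4) Q(4) DZ by blast
   show "h \<otimes> x \<otimes> inv h \<in> P \<union> Q" if "h \<in> carrier G" "x \<in> P \<union> Q" for h x
    using that P'(5) cQ by blast
   show "x \<in> D \<or> x \<in> P \<union> Q \<or> inv x \<in> P \<union> Q" if "x \<in> ?Z (Suc i)" for x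
    using Q(5)[OF that] P'(6) by blast
  qed
  then show ?case by blast
 qed
 then obtain P where "positive_cone G D (?Z c) P" by blast
 moreover have "?Z c = carrier G" using top subgroup.subset N[of c] by blast
 ultimately show ?thesis by auto
qed

section \<open>The group algebra as a ring\<close>

lemma (in abelian_monoid) finsum_one_term: "f a \<in> carrier G \<Longrightarrow> finsum G f {a} = f a"
 using finsum_insert[of "{}" a f] by (simp add: Pi_iff)

locale grpalg = F: field F + G: group G for F :: "('f, 'b) ring_scheme" and G :: "('g, 'c) monoid_scheme" +
 fixes A :: "('g \<Rightarrow> 'f) ring" (structure)
 assumes A_def: "A = group_algebra F G"
begin

text \<open>
  Short symbols for the operations of the group and of the field leave the plain symbols to the group algebra.
\<close>

abbreviation gmult (infixl "\<bullet>" 70) where "x \<bullet> y \<equiv> x \<otimes>\<^bsub>G\<^esub> y"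
abbreviation gone ("\<one>\<^sub>G") where "\<one>\<^sub>G \<equiv> \<one>\<^bsub>G\<^esub>"
abbreviation ginv ("inv\<^sub>G _" [81] 80) where "inv\<^sub>G x \<equiv> inv\<^bsub>G\<^esub> x"
abbreviation gpow (infixr "[^]\<^sub>G" 75) where "x [^]\<^sub>G n \<equiv> x [^]\<^bsub>G\<^esub> n"
abbreviation fmult (infixl "\<otimes>\<^sub>F" 70) where "x \<otimes>\<^sub>F y \<equiv> x \<otimes>\<^bsub>F\<^esub> y"
abbreviation fadd (infixl "\<oplus>\<^sub>F" 65) where "x \<oplus>\<^sub>F y \<equiv> x \<oplus>\<^bsub>F\<^esub> y"
abbreviation fone ("\<one>\<^sub>F") where "\<one>\<^sub>F \<equiv> \<one>\<^bsub>F\<^esub>"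
abbreviation fzero ("\<zero>\<^sub>F") where "\<zero>\<^sub>F \<equiv> \<zero>\<^bsub>F\<^esub>"
abbreviation fpow (infixr "[^]\<^sub>F" 75) where "x [^]\<^sub>F n \<equiv> x [^]\<^bsub>F\<^esub> n"

abbreviation supp where "supp u \<equiv> ga_support F G u"

text \<open>The element \<open>c g\<close> of the group algebra.\<close>

definition single :: "'f \<Rightarrow> 'g \<Rightarrow> 'g \<Rightarrow> 'f" where
 "single c g = (\<lambda>x \<in> carrier G. if x = g then c else \<zero>\<^sub>F)"

abbreviation dl ("\<delta>") where "dl g \<equiv> single \<one>\<^sub>F g"

lemma supp_iff: "x \<in> supp u \<longleftrightarrow> x \<in> carrier G \<and> u x \<noteq> \<zero>\<^sub>F"
 by (simp add: ga_support_def)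

lemma supp_carrier: "supp u \<subseteq> carrier G" by (auto simp: supp_iff)

lemma carrier_iff: "u \<in> carrier A \<longleftrightarrow>
  u \<in> extensional (carrier G) \<and> (\<forall>x \<in> carrier G. u x \<in> carrier F) \<and> finite (supp u)"
 unfolding A_def group_algebra_def by (simp add: PiE_iff) blast

lemma coeff_closed [simp]: "u \<in> carrier A \<Longrightarrow> x \<in> carrier G \<Longrightarrow> u x \<in> carrier F"
 by (simp add: carrier_iff)

lemma finite_supp [simp]: "u \<in> carrier A \<Longrightarrow> finite (supp u)" by (simp add: carrier_iff)

lemma carrier_ext: "u \<in> carrier A \<Longrightarrow> u \<in> extensional (carrier G)"
 unfolding carrier_iff by blast

lemma ga_eqI:
 "u \<in> carrier A \<Longrightarrow> v \<in> carrier A \<Longrightarrow> (\<And>x. x \<in> carrier G \<Longrightarrow> u x = v x) \<Longrightarrow> u = v"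
 by (rule extensionalityI[of u "carrier G" v]) (simp_all add: carrier_ext)

lemma carrierI:
 assumes "u \<in> extensional (carrier G)" "\<And>x. x \<in> carrier G \<Longrightarrow> u x \<in> carrier F"
  "finite S" "\<And>x. x \<in> carrier G \<Longrightarrow> x \<notin> S \<Longrightarrow> u x = \<zero>\<^sub>F"
 shows "u \<in> carrier A"
proof -
 have "supp u \<subseteq> S" using assms(4) unfolding supp_iff subset_iff by blast
 then show ?thesis using assms(1,2) finite_subset[OF _ assms(3)] unfolding carrier_iff by blast
qed

lemma add_apply [simp]: "x \<in> carrier G \<Longrightarrow> (u \<oplus> v) x = u x \<oplus>\<^sub>F v x"
 and zero_apply [simp]: "x \<in> carrier G \<Longrightarrow> \<zero> x = \<zero>\<^sub>F"
 and one_apply: "x \<in> carrier G \<Longrightarrow> \<one> x = (if x = \<one>\<^sub>G then \<one>\<^sub>F else \<zero>\<^sub>F)"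
 and mult_apply: "x \<in> carrier G \<Longrightarrow>
  (u \<otimes> v) x = (\<Oplus>\<^bsub>F\<^esub>y \<in> supp u. u y \<otimes>\<^sub>F v (inv\<^sub>G y \<bullet> x))"
 and ext_ops: "u \<oplus> v \<in> extensional (carrier G)" "\<zero> \<in> extensional (carrier G)"
  "\<one> \<in> extensional (carrier G)" "u \<otimes> v \<in> extensional (carrier G)"
 unfolding A_def group_algebra_def by simp_all

lemma one_single: "\<one> = \<delta> \<one>\<^sub>G"
 unfolding A_def group_algebra_def single_def by simp

lemma single_closed [simp]: "c \<in> carrier F \<Longrightarrow> single c g \<in> carrier A"
 by (rule carrierI[where S = "{g}"]) (auto simp: single_def)

lemma single_apply: "x \<in> carrier G \<Longrightarrow> single c g x = (if x = g then c else \<zero>\<^sub>F)"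
 by (simp add: single_def)

lemma ga_abelian_group: "abelian_group A"
proof (rule abelian_groupI)
 fix u v assume "u \<in> carrier A" "v \<in> carrier A"
 then show "u \<oplus> v \<in> carrier A"
  by (intro carrierI[where S = "supp u \<union> supp v"]) (auto simp: ext_ops supp_iff)
next
 show "\<zero> \<in> carrier A" by (intro carrierI[where S = "{}"]) (auto simp: ext_ops)
next
 fix u assume u: "u \<in> carrier A"
 let ?v = "\<lambda>x \<in> carrier G. \<ominus>\<^bsub>F\<^esub> u x"
 have v: "?v \<in> carrier A" using u by (intro carrierI[where S = "supp u"]) (auto simp: supp_iff)
 have "?v \<oplus> u = \<zero>" by (rule extensionalityI[OF ext_ops(1,2)]) (simp add: u F.l_neg)
 then show "\<exists>y\<in>carrier A. y \<oplus> u = \<zero>" using v by blast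
qed (auto intro!: extensionalityI[OF ext_ops(1)] ext_ops carrier_ext simp: F.a_ac)

sublocale A: abelian_group A by (rule ga_abelian_group)

lemma minus_apply [simp]: "u \<in> carrier A \<Longrightarrow> x \<in> carrier G \<Longrightarrow> (\<ominus> u) x = \<ominus>\<^bsub>F\<^esub> u x"
proof -
 assume u: "u \<in> carrier A" and x: "x \<in> carrier G"
 have "(u \<oplus> \<ominus> u) x = \<zero>\<^sub>F" using u x by (simp add: A.r_neg)
 then have "u x \<oplus>\<^sub>F (\<ominus> u) x = \<zero>\<^sub>F" using x by simp
 then show ?thesis using u x F.sum_zero_eq_neg[of "(\<ominus> u) x" "u x"] by (simp add: F.a_comm)
qed

lemma mult_apply_superset:
 assumes u: "u \<in> carrier A" and v: "v \<in> carrier A" and S: "finite S" "supp u \<subseteq> S" "S \<subseteq> carrier G"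
  and x: "x \<in> carrier G"
 shows "(u \<otimes> v) x = (\<Oplus>\<^bsub>F\<^esub>y \<in> S. u y \<otimes>\<^sub>F v (inv\<^sub>G y \<bullet> x))"
 unfolding mult_apply[OF x]
proof (rule F.add.finprod_mono_neutral_cong_left[OF S(1,2)])
 fix y assume "y \<in> S - supp u"
 then have "y \<in> carrier G" "u y = \<zero>\<^sub>F" using S(3) by (auto simp: supp_iff)
 then show "u y \<otimes>\<^sub>F v (inv\<^sub>G y \<bullet> x) = \<zero>\<^sub>F" using v x by simp
next
 show "(\<lambda>y. u y \<otimes>\<^sub>F v (inv\<^sub>G y \<bullet> x)) \<in> S \<rightarrow> carrier F" using u v x S(3) by auto
qed simp

lemma supp_mult:
 assumes u: "u \<in> carrier A" and v: "v \<in> carrier A"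
 shows "supp (u \<otimes> v) \<subseteq> (\<lambda>(y, z). y \<bullet> z) ` (supp u \<times> supp v)"
proof
 fix x assume "x \<in> supp (u \<otimes> v)"
 then have x: "x \<in> carrier G" "(u \<otimes> v) x \<noteq> \<zero>\<^sub>F" by (auto simp: supp_iff)
 have "\<exists>y \<in> supp u. u y \<otimes>\<^sub>F v (inv\<^sub>G y \<bullet> x) \<noteq> \<zero>\<^sub>F"
  using x F.add.finprod_one_eqI[of "supp u" "\<lambda>y. u y \<otimes>\<^sub>F v (inv\<^sub>G y \<bullet> x)"]
  unfolding mult_apply[OF x(1)] by blast
 then obtain y where y: "y \<in> supp u" "u y \<otimes>\<^sub>F v (inv\<^sub>G y \<bullet> x) \<noteq> \<zero>\<^sub>F" by blast
 have yc: "y \<in> carrier G" using y(1) by (simp add: supp_iff)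
 have "v (inv\<^sub>G y \<bullet> x) \<noteq> \<zero>\<^sub>F" using y(2) u yc by auto
 then have "inv\<^sub>G y \<bullet> x \<in> supp v" using yc x(1) by (simp add: supp_iff)
 moreover have "x = y \<bullet> (inv\<^sub>G y \<bullet> x)" using yc x(1) by simp
 ultimately show "x \<in> (\<lambda>(y, z). y \<bullet> z) ` (supp u \<times> supp v)" using y(1) by force
qed

lemma mult_closed':
 assumes u: "u \<in> carrier A" and v: "v \<in> carrier A" shows "u \<otimes> v \<in> carrier A"
proof -
 have "finite (supp (u \<otimes> v))"
  by (rule finite_subset[OF supp_mult[OF u v]]) (use u v in simp)
 moreover have "(u \<otimes> v) x \<in> carrier F" if "x \<in> carrier G" for x
  unfolding mult_apply[OF that] using u v that by (intro F.finsum_closed) (auto simp: supp_iff)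
 ultimately show ?thesis unfolding carrier_iff using ext_ops(4) by blast
qed

lemma mult_add_left:
 assumes c: "u \<in> carrier A" "v \<in> carrier A" "w \<in> carrier A"
 shows "(u \<oplus> v) \<otimes> w = u \<otimes> w \<oplus> v \<otimes> w"
proof (rule ga_eqI)
 fix x assume x: "x \<in> carrier G"
 let ?S = "supp u \<union> supp v"
 have S: "finite ?S" "?S \<subseteq> carrier G" using c supp_carrier by auto
 have uv: "supp (u \<oplus> v) \<subseteq> ?S" by (auto simp: supp_iff)
 have "((u \<oplus> v) \<otimes> w) x = (\<Oplus>\<^bsub>F\<^esub>y \<in> ?S. u y \<otimes>\<^sub>F w (inv\<^sub>G y \<bullet> x) \<oplus>\<^sub>F v y \<otimes>\<^sub>F w (inv\<^sub>G y \<bullet> x))"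
  unfolding mult_apply_superset[OF A.a_closed[OF c(1,2)] c(3) S(1) uv S(2) x]
  by (rule F.finsum_cong') (use S(2) c x in \<open>auto simp: F.l_distr subset_iff simp del: Un_iff\<close>)
 also have "\<dots> = (u \<otimes> w) x \<oplus>\<^sub>F (v \<otimes> w) x"
  unfolding mult_apply_superset[OF c(1,3) S(1) _ S(2) x, OF Un_upper1]
   mult_apply_superset[OF c(2,3) S(1) _ S(2) x, OF Un_upper2]
  by (rule F.finsum_addf) (use S(2) c x in \<open>auto simp: subset_iff simp del: Un_iff\<close>)
 finally show "((u \<oplus> v) \<otimes> w) x = (u \<otimes> w \<oplus> v \<otimes> w) x" using x by simp
qed (use c mult_closed' in auto)

lemma mult_add_right:
 assumes c: "u \<in> carrier A" "v \<in> carrier A" "w \<in> carrier A"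
 shows "w \<otimes> (u \<oplus> v) = w \<otimes> u \<oplus> w \<otimes> v"
proof (rule ga_eqI)
 fix x assume x: "x \<in> carrier G"
 have S: "supp w \<subseteq> carrier G" by (rule supp_carrier)
 have "(w \<otimes> (u \<oplus> v)) x = (\<Oplus>\<^bsub>F\<^esub>y \<in> supp w. w y \<otimes>\<^sub>F u (inv\<^sub>G y \<bullet> x) \<oplus>\<^sub>F w y \<otimes>\<^sub>F v (inv\<^sub>G y \<bullet> x))"
  unfolding mult_apply[OF x]
  by (rule F.finsum_cong') (use S c x in \<open>auto simp: F.r_distr subset_iff\<close>)
 also have "\<dots> = (w \<otimes> u) x \<oplus>\<^sub>F (w \<otimes> v) x"
  unfolding mult_apply[OF x]
  by (rule F.finsum_addf) (use S c x in \<open>auto simp: subset_iff\<close>)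
 finally show "(w \<otimes> (u \<oplus> v)) x = (w \<otimes> u \<oplus> w \<otimes> v) x" using x by simp
qed (use c mult_closed' in auto)

lemma single_mult_apply:
 assumes "c \<in> carrier F" "g \<in> carrier G" "v \<in> carrier A" "x \<in> carrier G"
 shows "(single c g \<otimes> v) x = c \<otimes>\<^sub>F v (inv\<^sub>G g \<bullet> x)"
proof -
 have "(single c g \<otimes> v) x = (\<Oplus>\<^bsub>F\<^esub>y \<in> {g}. single c g y \<otimes>\<^sub>F v (inv\<^sub>G y \<bullet> x))"
  by (rule mult_apply_superset) (use assms in \<open>auto simp: supp_iff single_apply split: if_splits\<close>)
 then show ?thesis using assms by (simp add: single_apply F.finsum_one_term)
qed

lemma single_mult_single:
 assumes "c \<in> carrier F" "g \<in> carrier G" "d \<in> carrier F" "h \<in> carrier G"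
 shows "single c g \<otimes> single d h = single (c \<otimes>\<^sub>F d) (g \<bullet> h)"
proof (rule ga_eqI)
 fix x assume x: "x \<in> carrier G"
 have "inv\<^sub>G g \<bullet> x = h \<longleftrightarrow> x = g \<bullet> h" using assms x by (metis G.inv_solve_left)
 then show "(single c g \<otimes> single d h) x = single (c \<otimes>\<^sub>F d) (g \<bullet> h) x"
  using assms x by (simp add: single_mult_apply single_apply)
qed (use assms mult_closed' in auto)

lemma ga_induct [consumes 1, case_names zero add single]:
 assumes u: "u \<in> carrier A" and z: "P \<zero>"
  and add: "\<And>u v. \<lbrakk>u \<in> carrier A; v \<in> carrier A; P u; P v\<rbrakk> \<Longrightarrow> P (u \<oplus> v)"
  and single: "\<And>c g. \<lbrakk>c \<in> carrier F; g \<in> carrier G\<rbrakk> \<Longrightarrow> P (single c g)"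
 shows "P u"
 using u
proof (induction "card (supp u)" arbitrary: u)
 case 0
 then have "supp u = {}" by simp
 then have "u = \<zero>" using 0 by (intro ga_eqI) (auto simp: supp_iff)
 then show ?case using z by simp
next
 case (Suc n)
 then obtain g where g: "g \<in> supp u" by (metis card.empty equals0I nat.distinct(1))
 then have gc: "g \<in> carrier G" by (simp add: supp_iff)
 let ?v = "\<lambda>x \<in> carrier G. if x = g then \<zero>\<^sub>F else u x"
 have v: "?v \<in> carrier A" using Suc(3) by (intro carrierI[where S = "supp u"]) (auto simp: supp_iff)
 have "supp ?v = supp u - {g}" using g by (auto simp: supp_iff split: if_splits)
 then have "n = card (supp ?v)" using Suc(2,3) g by simp
 then have "P ?v" using Suc(1) v by blast
 moreover have "P (single (u g) g)" using Suc(3) gc by (intro single) auto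
 moreover have "?v \<oplus> single (u g) g = u"
  using v Suc(3) gc by (intro ga_eqI) (auto simp: single_apply)
 ultimately show ?case using add[of ?v "single (u g) g"] v Suc(3) gc by simp
qed

lemma mult_zero':
 assumes u: "u \<in> carrier A" shows "\<zero> \<otimes> u = \<zero>" "u \<otimes> \<zero> = \<zero>"
proof -
 show "\<zero> \<otimes> u = \<zero>"
  using u by (intro extensionalityI[OF ext_ops(4,2)])
   (auto simp: mult_apply supp_iff intro!: F.add.finprod_one_eqI)
 show "u \<otimes> \<zero> = \<zero>"
  using u by (intro extensionalityI[OF ext_ops(4,2)])
   (auto simp: mult_apply supp_iff intro!: F.add.finprod_one_eqI)
qed

lemma mult_assoc':
 assumes c: "u \<in> carrier A" "v \<in> carrier A" "w \<in> carrier A"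
 shows "(u \<otimes> v) \<otimes> w = u \<otimes> (v \<otimes> w)"
 using c(1)
proof (induction rule: ga_induct)
 case zero then show ?case using c by (simp add: mult_zero' mult_closed')
next
 case (add u u')
 then show ?case using c by (simp add: mult_add_left mult_closed')
next
 case (single a g)
 show ?case using c(2)
 proof (induction rule: ga_induct)
  case zero then show ?case using single c by (simp add: mult_zero' mult_closed')
 next
  case (add v v')
  then show ?case using single c by (simp add: mult_add_left mult_add_right mult_closed')
 next
  case (single b h)
  note s = \<open>a \<in> carrier F\<close> \<open>g \<in> carrier G\<close> single
  show ?case
   using s c(3) by (intro ga_eqI)
    (auto simp: mult_closed' single_mult_single single_mult_apply G.inv_mult_group G.m_assoc F.m_assoc)
 qed
qed

lemma ga_ring: "ring A"
proof (rule ringI)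
 show "abelian_group A" by (rule ga_abelian_group)
 have one: "\<one> \<in> carrier A" by (simp add: one_single)
 show "monoid A"
 proof (rule monoidI)
  fix u assume u: "u \<in> carrier A"
  show "\<one> \<otimes> u = u"
   using u by (intro ga_eqI) (auto simp: one_single mult_closed' single_mult_apply)
  show "u \<otimes> \<one> = u" using u
  proof (induction rule: ga_induct)
   case zero then show ?case using one by (simp add: mult_zero')
  next
   case (add u v) then show ?case using one by (simp add: mult_add_left)
  next
   case (single c g) then show ?case by (simp add: one_single single_mult_single)
  qed
 qed (use one mult_closed' mult_assoc' in auto)
qed (use mult_add_left mult_add_right in auto)

end

sublocale grpalg \<subseteq> A: ring A by (rule ga_ring)

context grpalg
begin

lemma dl_closed [simp]: "\<delta> g \<in> carrier A" by simp

lemma dl_mult: "g \<in> carrier G \<Longrightarrow> h \<in> carrier G \<Longrightarrow> \<delta> g \<otimes> \<delta> h = \<delta> (g \<bullet> h)"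
 by (simp add: single_mult_single)

lemma dl_inv [simp]: "g \<in> carrier G \<Longrightarrow> \<delta> g \<otimes> \<delta> (inv\<^sub>G g) = \<one>" "g \<in> carrier G \<Longrightarrow> \<delta> (inv\<^sub>G g) \<otimes> \<delta> g = \<one>"
 by (simp_all add: dl_mult one_single)

lemma dl_pow: "g \<in> carrier G \<Longrightarrow> \<delta> g [^] (n::nat) = \<delta> (g [^]\<^sub>G n)"
 by (induction n) (simp_all add: one_single dl_mult)

lemma dl_inject: "g \<in> carrier G \<Longrightarrow> \<delta> g = \<delta> h \<Longrightarrow> g = h"
 using single_apply[of g "\<one>\<^sub>F" g] single_apply[of g "\<one>\<^sub>F" h] by (auto split: if_splits)

lemma scalar_commute:
 assumes "c \<in> carrier F" "u \<in> carrier A"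
 shows "single c \<one>\<^sub>G \<otimes> u = u \<otimes> single c \<one>\<^sub>G"
 using assms(2)
proof (induction rule: ga_induct)
 case zero then show ?case using assms by simp
next
 case (add u v) then show ?case using assms by (simp add: A.l_distr A.r_distr)
next
 case (single d g) then show ?case using assms by (simp add: single_mult_single F.m_comm)
qed

lemma scalar_mult_apply:
 assumes "c \<in> carrier F" "u \<in> carrier A" "x \<in> carrier G"
 shows "(single c \<one>\<^sub>G \<otimes> u) x = c \<otimes>\<^sub>F u x"
 using assms by (simp add: single_mult_apply)

lemma finsum_apply:
 assumes "finite I" "\<And>i. i \<in> I \<Longrightarrow> f i \<in> carrier A" "x \<in> carrier G"
 shows "(\<Oplus>i\<in>I. f i) x = (\<Oplus>\<^bsub>F\<^esub>i\<in>I. f i x)"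
 using assms(1,2)
proof (induction rule: finite_induct)
 case empty then show ?case using assms by simp
next
 case (insert i I)
 then show ?case using assms(3) by (simp add: Pi_iff)
qed

lemma expansion:
 assumes u: "u \<in> carrier A" and S: "finite S" "supp u \<subseteq> S" "S \<subseteq> carrier G"
 shows "u = (\<Oplus>g\<in>S. single (u g) g)"
proof (rule ga_eqI[OF u])
 have c: "\<And>g. g \<in> S \<Longrightarrow> single (u g) g \<in> carrier A" using u S(3) by auto
 show "(\<Oplus>g\<in>S. single (u g) g) \<in> carrier A" using c by (intro A.finsum_closed) auto
 fix x assume x: "x \<in> carrier G"
 have "(\<Oplus>g\<in>S. single (u g) g) x = (\<Oplus>\<^bsub>F\<^esub>g\<in>S. if x = g then u g else \<zero>\<^sub>F)"
  by (subst finsum_apply[OF S(1) c x]) (use u S(3) x in \<open>auto simp: single_apply intro!: F.finsum_cong'\<close>)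
 also have "\<dots> = u x"
 proof (cases "x \<in> S")
  case True then show ?thesis using F.finsum_singleton[of x S u] S u by (auto simp: subset_iff)
 next
  case False
  then have "u x = \<zero>\<^sub>F" using S(2) x by (auto simp: supp_iff)
  moreover have "(\<Oplus>\<^bsub>F\<^esub>g\<in>S. if x = g then u g else \<zero>\<^sub>F) = \<zero>\<^sub>F"
   using False by (intro F.add.finprod_one_eqI) auto
  ultimately show ?thesis by simp
 qed
 finally show "u x = (\<Oplus>g\<in>S. single (u g) g) x" by simp
qed

lemma supp_add: "supp (u \<oplus> v) \<subseteq> supp u \<union> supp v"
 by (auto simp: supp_iff)

lemma supp_minus: "u \<in> carrier A \<Longrightarrow> supp (\<ominus> u) = supp u"
 by (auto simp: supp_iff)

lemma supp_zero [simp]: "supp \<zero> = {}" by (auto simp: supp_iff)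

lemma supp_single: "supp (single c g) \<subseteq> {g}"
 by (auto simp: supp_iff single_apply split: if_splits)

lemma supp_dl: "g \<in> carrier G \<Longrightarrow> supp (\<delta> g) = {g}"
 by (auto simp: supp_iff single_apply split: if_splits)

lemma supp_one [simp]: "supp \<one> = {\<one>\<^sub>G}" by (simp add: one_single supp_dl)

lemma supp_mult_subset:
 assumes "u \<in> carrier A" "v \<in> carrier A" "supp u \<subseteq> S" "supp v \<subseteq> T"
  "\<And>s t. s \<in> S \<Longrightarrow> t \<in> T \<Longrightarrow> s \<bullet> t \<in> W"
 shows "supp (u \<otimes> v) \<subseteq> W"
 using supp_mult[OF assms(1,2)] assms(3-5) by fastforce

lemma supp_finsum:
 assumes "finite I" "\<And>i. i \<in> I \<Longrightarrow> f i \<in> carrier A" "\<And>i. i \<in> I \<Longrightarrow> supp (f i) \<subseteq> S"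
 shows "supp (\<Oplus>i\<in>I. f i) \<subseteq> S"
 using assms
proof (induction rule: finite_induct)
 case (insert i I)
 have "supp (finsum A f (insert i I)) = supp (f i \<oplus> finsum A f I)"
  using insert by (subst A.finsum_insert) auto
 also have "\<dots> \<subseteq> supp (f i) \<union> supp (finsum A f I)" by (rule supp_add)
 finally show ?case using insert by blast
qed simp

abbreviation aug where "aug \<equiv> augmentation F G"

lemma aug_superset:
 assumes u: "u \<in> carrier A" and S: "finite S" "supp u \<subseteq> S" "S \<subseteq> carrier G"
 shows "aug u = (\<Oplus>\<^bsub>F\<^esub>g\<in>S. u g)"
 unfolding augmentation_def
 by (rule F.add.finprod_mono_neutral_cong_left[OF S(1,2)]) (use u S(3) in \<open>auto simp: supp_iff\<close>)

lemma aug_closed [simp]: "u \<in> carrier A \<Longrightarrow> aug u \<in> carrier F"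
 unfolding augmentation_def by (intro F.finsum_closed) (auto simp: supp_iff)

lemma aug_add [simp]:
 assumes c: "u \<in> carrier A" "v \<in> carrier A"
 shows "aug (u \<oplus> v) = aug u \<oplus>\<^sub>F aug v"
proof -
 let ?S = "supp u \<union> supp v"
 have S: "finite ?S" "?S \<subseteq> carrier G" using c supp_carrier by auto
 have "aug (u \<oplus> v) = (\<Oplus>\<^bsub>F\<^esub>g\<in>?S. u g \<oplus>\<^sub>F v g)"
  unfolding aug_superset[OF A.a_closed[OF c] S(1) supp_add S(2)]
  by (rule F.finsum_cong') (use S(2) c in \<open>auto simp: subset_iff simp del: Un_iff\<close>)
 also have "\<dots> = aug u \<oplus>\<^sub>F aug v"
  unfolding aug_superset[OF c(1) S(1) Un_upper1 S(2)] aug_superset[OF c(2) S(1) Un_upper2 S(2)]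
  by (rule F.finsum_addf) (use S(2) c in \<open>auto simp: subset_iff simp del: Un_iff\<close>)
 finally show ?thesis .
qed

lemma aug_single [simp]: "c \<in> carrier F \<Longrightarrow> g \<in> carrier G \<Longrightarrow> aug (single c g) = c"
 using aug_superset[of "single c g" "{g}"] supp_single[of c g]
 by (simp add: single_apply F.finsum_one_term)

lemma aug_zero [simp]: "aug \<zero> = \<zero>\<^sub>F" by (simp add: augmentation_def)

lemma aug_one [simp]: "aug \<one> = \<one>\<^sub>F" by (simp add: one_single)

lemma aug_mult [simp]:
 assumes c: "u \<in> carrier A" "v \<in> carrier A"
 shows "aug (u \<otimes> v) = aug u \<otimes>\<^sub>F aug v"
 using c(1)
proof (induction rule: ga_induct)
 case zero then show ?case using c by simp
next
 case (add u w) then show ?case using c by (simp add: A.l_distr F.l_distr)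
next
 case (single a g)
 show ?case using c(2)
 proof (induction rule: ga_induct)
  case zero then show ?case using single by simp
 next
  case (add u w) then show ?case using single by (simp add: A.r_distr F.r_distr)
 next
  case (single b h)
  with \<open>a \<in> carrier F\<close> \<open>g \<in> carrier G\<close> show ?case by (simp add: single_mult_single)
 qed
qed

lemma aug_minus [simp]: "u \<in> carrier A \<Longrightarrow> aug (\<ominus> u) = \<ominus>\<^bsub>F\<^esub> aug u"
 using aug_add[of u "\<ominus> u"] F.sum_zero_eq_neg[of "aug (\<ominus> u)" "aug u"] by (simp add: A.r_neg F.a_comm)

end

section \<open>Subalgebras spanned by a set; reducedness of finite abelian group algebras\<close>

text \<open>
  An abelian torsion group is locally finite: adjoining one element of finite order to a finite subgroup gives
  a finite subgroup.
\<close>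

lemma (in group) finite_abelian_torsion_hull:
 assumes D: "subgroup D G" and comm: "\<And>x y. x \<in> D \<Longrightarrow> y \<in> D \<Longrightarrow> x \<otimes> y = y \<otimes> x"
  and tors: "\<And>x. x \<in> D \<Longrightarrow> \<exists>n>0. x [^] (n::nat) = \<one>"
  and S: "finite S" "S \<subseteq> D"
 shows "\<exists>B. subgroup B G \<and> finite B \<and> S \<subseteq> B \<and> B \<subseteq> D"
 using S
proof (induction rule: finite_induct)
 case empty
 show ?case using triv_subgroup subgroup.one_closed[OF D] by (intro exI[of _ "{\<one>}"]) simp
next
 case (insert a S)
 then obtain B where B: "subgroup B G" "finite B" "S \<subseteq> B" "B \<subseteq> D" by auto
 have a: "a \<in> D" using insert by simp
 obtain n where n: "n > 0" "a [^] (n::nat) = \<one>" using tors[OF a] by blast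
 have Dc: "D \<subseteq> carrier G" using subgroup.subset[OF D] .
 have ac: "a \<in> carrier G" using a Dc by blast
 have aD: "a [^] (k::nat) \<in> D" for k
 proof (induction k)
  case 0 then show ?case using subgroup.one_closed[OF D] by simp
 next
  case (Suc k) then show ?case using subgroup.m_closed[OF D Suc a] by simp
 qed
 let ?B = "(\<lambda>(b, k). b \<otimes> a [^] k) ` (B \<times> (UNIV::nat set))"
 have mod: "a [^] k = a [^] (k mod n)" for k
 proof -
  have "a [^] k = a [^] (n * (k div n) + k mod n)" by simp
  also have "\<dots> = (a [^] n) [^] (k div n) \<otimes> a [^] (k mod n)"
   using ac by (simp only: nat_pow_mult nat_pow_pow)
  finally show ?thesis using n ac by simp
 qed
 have "?B \<subseteq> (\<lambda>(b, k). b \<otimes> a [^] k) ` (B \<times> {..<n})"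
 proof
  fix x assume "x \<in> ?B"
  then obtain b k where x: "x = b \<otimes> a [^] (k::nat)" "b \<in> B" by auto
  then have "x = (\<lambda>(b, k). b \<otimes> a [^] k) (b, k mod n)" "(b, k mod n) \<in> B \<times> {..<n}"
   using mod[of k] n(1) by auto
  then show "x \<in> (\<lambda>(b, k). b \<otimes> a [^] k) ` (B \<times> {..<n})" by (rule image_eqI)
 qed
 then have fin: "finite ?B" using B(2) finite_subset by blast
 have sub: "subgroup ?B G"
 proof (rule subgroupI)
  show "?B \<subseteq> carrier G" using subgroup.subset[OF B(1)] ac by auto
  show "?B \<noteq> {}" using subgroup.one_closed[OF B(1)] by auto
 next
  fix x assume "x \<in> ?B"
  then obtain b k where x: "x = b \<otimes> a [^] (k::nat)" "b \<in> B" by auto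
  have bc: "b \<in> carrier G" using x(2) B(4) Dc by blast
  have nk: "(n - 1) * k + k = n * k" using n(1) by (cases n) auto
  have "a [^] ((n - 1) * k) \<otimes> a [^] k = a [^] (n * k)"
   using nat_pow_mult[OF ac, of "(n - 1) * k" k] unfolding nk .
  also have "\<dots> = \<one>" using ac n(2) by (simp flip: nat_pow_pow)
  finally have "inv (a [^] k) = a [^] ((n - 1) * k)" using ac by (intro inv_equality) auto
  moreover have "inv x = inv b \<otimes> inv (a [^] k)"
   using comm[of "inv b" "inv (a [^] k)"] x bc ac aD[of k] B(4) subgroup.m_inv_closed[OF D]
   by (simp add: inv_mult_group subset_iff)
  ultimately show "inv x \<in> ?B" using subgroup.m_inv_closed[OF B(1) x(2)] by auto
 next
  fix x y assume "x \<in> ?B" "y \<in> ?B"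
  then obtain b k b' k' where x: "x = b \<otimes> a [^] (k::nat)" "b \<in> B" and y: "y = b' \<otimes> a [^] (k'::nat)" "b' \<in> B"
   by auto
  have bc: "b \<in> carrier G" "b' \<in> carrier G" "b' \<in> D" using x(2) y(2) B(4) Dc by auto
  have "x \<otimes> y = b \<otimes> (a [^] k \<otimes> b') \<otimes> a [^] k'" using x y bc ac by (simp add: m_assoc)
  also have "a [^] k \<otimes> b' = b' \<otimes> a [^] k" by (rule comm[OF aD bc(3)])
  also have "b \<otimes> (b' \<otimes> a [^] k) \<otimes> a [^] k' = (b \<otimes> b') \<otimes> a [^] (k + k')"
   using bc ac by (simp add: m_assoc flip: nat_pow_mult)
  finally show "x \<otimes> y \<in> ?B" using subgroup.m_closed[OF B(1) x(2) y(2)] by auto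
 qed
 have "insert a S \<subseteq> ?B"
 proof -
  have "a = \<one> \<otimes> a [^] (1::nat)" using ac by simp
  then have "a = (\<lambda>(b, k). b \<otimes> a [^] (k::nat)) (\<one>, 1)" by simp
  then have "a \<in> ?B" using subgroup.one_closed[OF B(1)] by (blast intro: image_eqI)
  moreover have "x \<in> ?B" if "x \<in> S" for x
  proof -
   have "x = (\<lambda>(b, k). b \<otimes> a [^] (k::nat)) (x, 0)" "x \<in> B" using that B(3,4) Dc by (auto simp: subset_iff)
   then show ?thesis by (blast intro: image_eqI)
  qed
  ultimately show ?thesis by blast
 qed
 moreover have "?B \<subseteq> D" using B(4) aD subgroup.m_closed[OF D] by auto
 ultimately show ?case using sub fin by blast
qed

context grpalg
begin

text \<open>
  For a subgroup \<open>S\<close> this is the group algebra of \<open>S\<close>, embedded in that of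
  \<open>G\<close>.
\<close>

definition FS where "FS S = {u \<in> carrier A. supp u \<subseteq> S}"

lemma FS_carrier: "u \<in> FS S \<Longrightarrow> u \<in> carrier A" and FS_supp: "u \<in> FS S \<Longrightarrow> supp u \<subseteq> S"
 by (auto simp: FS_def)

lemma FS_zero: "\<zero> \<in> FS S" by (simp add: FS_def)

lemma FS_add: "u \<in> FS S \<Longrightarrow> v \<in> FS S \<Longrightarrow> u \<oplus> v \<in> FS S"
 using supp_add[of u v] by (auto simp: FS_def)

lemma FS_minus: "u \<in> FS S \<Longrightarrow> \<ominus> u \<in> FS S"
 by (auto simp: FS_def supp_minus)

lemma FS_single: "c \<in> carrier F \<Longrightarrow> g \<in> S \<Longrightarrow> single c g \<in> FS S"
 using supp_single[of c g] by (auto simp: FS_def)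

lemma FS_mult:
 assumes "u \<in> FS S" "v \<in> FS T" "\<And>s t. s \<in> S \<Longrightarrow> t \<in> T \<Longrightarrow> s \<bullet> t \<in> W"
 shows "u \<otimes> v \<in> FS W"
 using assms supp_mult_subset[of u v S T W] by (auto simp: FS_def)

lemma FS_one: "\<one>\<^sub>G \<in> S \<Longrightarrow> \<one> \<in> FS S" by (simp add: FS_def)

lemma FS_subgroup_mult: "subgroup S G \<Longrightarrow> u \<in> FS S \<Longrightarrow> v \<in> FS S \<Longrightarrow> u \<otimes> v \<in> FS S"
 by (rule FS_mult) (auto simp: subgroup.m_closed)

lemma FS_subgroup_pow: "subgroup S G \<Longrightarrow> u \<in> FS S \<Longrightarrow> u [^] (n::nat) \<in> FS S"
 by (induction n) (auto simp: FS_subgroup_mult FS_one subgroup.one_closed)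

lemma FS_mono: "u \<in> FS S \<Longrightarrow> S \<subseteq> T \<Longrightarrow> u \<in> FS T" by (auto simp: FS_def)

lemma FS_finsum: "finite I \<Longrightarrow> (\<And>i. i \<in> I \<Longrightarrow> f i \<in> FS S) \<Longrightarrow> (\<Oplus>i\<in>I. f i) \<in> FS S"
 using supp_finsum[of I f S] by (auto simp: FS_def intro!: A.finsum_closed)

lemma FS_induct [consumes 1, case_names zero add single]:
 assumes u: "u \<in> FS S" and z: "P \<zero>"
  and add: "\<And>u v. \<lbrakk>u \<in> FS S; v \<in> FS S; P u; P v\<rbrakk> \<Longrightarrow> P (u \<oplus> v)"
  and single: "\<And>c g. \<lbrakk>c \<in> carrier F; g \<in> S; g \<in> carrier G\<rbrakk> \<Longrightarrow> P (single c g)"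
 shows "P u"
proof -
 have uc: "u \<in> carrier A" and us: "supp u \<subseteq> S" using u by (auto simp: FS_def)
 have "P (\<Oplus>g\<in>Y. single (u g) g)" if "finite Y" "Y \<subseteq> supp u" for Y
  using that
 proof (induction rule: finite_induct)
  case empty then show ?case using z by simp
 next
  case (insert g Y)
  have c: "\<And>x. x \<in> insert g Y \<Longrightarrow> u x \<in> carrier F \<and> x \<in> S \<and> x \<in> carrier G"
   using insert us uc by (auto simp: supp_iff subset_iff)
  then have "(\<Oplus>x\<in>insert g Y. single (u x) x) = single (u g) g \<oplus> (\<Oplus>x\<in>Y. single (u x) x)"
   using insert by (intro A.finsum_insert) auto
  moreover have "(\<Oplus>x\<in>Y. single (u x) x) \<in> FS S"
   using insert c by (intro FS_finsum) (auto simp: FS_single)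
  ultimately show ?case using add[of "single (u g) g"] single c insert FS_single by auto
 qed
 from this[of "supp u"] show ?thesis using expansion[OF uc _ subset_refl supp_carrier] uc by simp
qed

lemma FS_commute:
 assumes S: "S \<subseteq> carrier G" and comm: "\<And>x y. x \<in> S \<Longrightarrow> y \<in> S \<Longrightarrow> x \<bullet> y = y \<bullet> x"
  and u: "u \<in> FS S" and v: "v \<in> FS S"
 shows "u \<otimes> v = v \<otimes> u"
 using u
proof (induction rule: FS_induct)
 case zero then show ?case using FS_carrier[OF v] by simp
next
 case (add u w) then show ?case using FS_carrier v by (simp add: A.l_distr A.r_distr)
next
 case (single a g)
 note a = single
 show ?case using v
 proof (induction rule: FS_induct)
  case zero then show ?case using a by simp
 next
  case (add u w) then show ?case using FS_carrier a by (simp add: A.l_distr A.r_distr)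
 next
  case (single b h)
  then show ?case using a comm[of g h] by (simp add: single_mult_single F.m_comm)
 qed
qed

abbreviation sc where "sc c u \<equiv> single c \<one>\<^sub>G \<otimes> u"

lemma sc_FS: "c \<in> carrier F \<Longrightarrow> u \<in> FS S \<Longrightarrow> sc c u \<in> FS S"
 using FS_mult[of "single c \<one>\<^sub>G" "{\<one>\<^sub>G}" u "S \<inter> carrier G" S] FS_single[of c "\<one>\<^sub>G" "{\<one>\<^sub>G}"]
  FS_def supp_carrier by force

lemma sc_eq_zeroD: "c \<in> carrier F \<Longrightarrow> c \<noteq> \<zero>\<^sub>F \<Longrightarrow> u \<in> carrier A \<Longrightarrow> sc c u = \<zero> \<Longrightarrow> u = \<zero>"
proof (rule ga_eqI)
 fix x assume c: "c \<in> carrier F" "c \<noteq> \<zero>\<^sub>F" and u: "u \<in> carrier A" and z: "sc c u = \<zero>" and x: "x \<in> carrier G"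
 have "c \<otimes>\<^sub>F u x = \<zero>\<^sub>F" using scalar_mult_apply[OF c(1) u x] z x by simp
 then show "u x = \<zero> x" using c u x F.integral[of c "u x"] by simp
qed auto

lemma add_pow_apply: "u \<in> carrier A \<Longrightarrow> x \<in> carrier G \<Longrightarrow> add_pow A (n::nat) u x = add_pow F n (u x)"
 by (induction n) simp_all

lemma add_pow_sc: "u \<in> carrier A \<Longrightarrow> add_pow A (n::nat) u = sc (add_pow F n \<one>\<^sub>F) u"
 by (intro ga_eqI) (simp_all add: add_pow_apply scalar_mult_apply F.add_pow_ldistr)

text \<open>
  Linear algebra over an abstract field in elementary form: a subspace of a finite-dimensional coordinate
  space has a complement.
\<close>

lemma projection_exists:
 assumes "finite Y" "Y \<subseteq> carrier G" "J \<subseteq> FS Y" "\<zero> \<in> J"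
  "\<And>u v. u \<in> J \<Longrightarrow> v \<in> J \<Longrightarrow> u \<oplus> v \<in> J" "\<And>c u. c \<in> carrier F \<Longrightarrow> u \<in> J \<Longrightarrow> sc c u \<in> J"
 shows "\<exists>\<pi>. (\<forall>u \<in> FS Y. \<pi> u \<in> J) \<and> (\<forall>u \<in> FS Y. \<forall>v \<in> FS Y. \<pi> (u \<oplus> v) = \<pi> u \<oplus> \<pi> v) \<and>
  (\<forall>c \<in> carrier F. \<forall>u \<in> FS Y. \<pi> (sc c u) = sc c (\<pi> u)) \<and> (\<forall>u \<in> J. \<pi> u = u)"
 using assms
proof (induction Y arbitrary: J rule: finite_induct)
 case empty
 have "u = \<zero>" if "u \<in> FS {}" for u
  using that by (intro ga_eqI) (auto simp: FS_def supp_iff)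
 then show ?case using empty by (intro exI[of _ id]) auto
next
 case (insert z Y)
 let ?J = "{u \<in> J. u z = \<zero>\<^sub>F}"
 have zc: "z \<in> carrier G" using insert by simp
 have Jc: "\<And>u. u \<in> J \<Longrightarrow> u \<in> carrier A" using insert.prems(2) by (auto simp: FS_def)
 have FSI: "u \<in> FS Y" if "u \<in> FS (insert z Y)" "u z = \<zero>\<^sub>F" for u
  using that by (auto simp: FS_def supp_iff)
 have ex: "\<exists>\<pi>. (\<forall>u \<in> FS Y. \<pi> u \<in> ?J) \<and> (\<forall>u \<in> FS Y. \<forall>v \<in> FS Y. \<pi> (u \<oplus> v) = \<pi> u \<oplus> \<pi> v) \<and>
  (\<forall>c \<in> carrier F. \<forall>u \<in> FS Y. \<pi> (sc c u) = sc c (\<pi> u)) \<and> (\<forall>u \<in> ?J. \<pi> u = u)"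
 proof (rule insert.IH)
  show "?J \<subseteq> FS Y" using insert.prems(2) FSI by blast
  show "\<zero> \<in> ?J" using insert.prems(3) zc by simp
  show "u \<oplus> v \<in> ?J" if "u \<in> ?J" "v \<in> ?J" for u v using that insert.prems(4) zc by auto
  show "sc c u \<in> ?J" if "c \<in> carrier F" "u \<in> ?J" for c u
   using that insert.prems(5) zc Jc by (auto simp: scalar_mult_apply)
 qed (use insert in auto)
 then obtain \<pi> where \<pi>: "\<And>u. u \<in> FS Y \<Longrightarrow> \<pi> u \<in> ?J"
  "\<And>u v. u \<in> FS Y \<Longrightarrow> v \<in> FS Y \<Longrightarrow> \<pi> (u \<oplus> v) = \<pi> u \<oplus> \<pi> v"
  "\<And>c u. c \<in> carrier F \<Longrightarrow> u \<in> FS Y \<Longrightarrow> \<pi> (sc c u) = sc c (\<pi> u)" "\<And>u. u \<in> ?J \<Longrightarrow> \<pi> u = u"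
  by blast
 \<comment> \<open>\<open>h\<close> has coefficient \<open>1\<close> at \<open>z\<close>, and lies in \<open>J\<close> unless \<open>J\<close> vanishes at \<open>z\<close>\<close>
 obtain h where h: "h \<in> FS (insert z Y)" "h z = \<one>\<^sub>F" "h \<in> J \<or> J = ?J"
 proof (cases "\<exists>f\<in>J. f z \<noteq> \<zero>\<^sub>F")
  case True
  then obtain f where f: "f \<in> J" "f z \<noteq> \<zero>\<^sub>F" by blast
  then have fz: "f z \<in> carrier F" using Jc zc by simp
  have i: "inv\<^bsub>F\<^esub> (f z) \<in> carrier F" "inv\<^bsub>F\<^esub> (f z) \<otimes>\<^sub>F f z = \<one>\<^sub>F"
   using f(2) fz F.field_Units by auto
  have "sc (inv\<^bsub>F\<^esub> (f z)) f \<in> J" using insert.prems(5) i f by blast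
  then show ?thesis using that[of "sc (inv\<^bsub>F\<^esub> (f z)) f"] insert.prems(2) i f Jc zc
   by (auto simp: scalar_mult_apply)
 next
  case False
  then show ?thesis using that[of "\<delta> z"] zc FS_single[of "\<one>\<^sub>F" z "insert z Y"] by (auto simp: single_apply)
 qed
 have hc: "h \<in> carrier A" using h(1) FS_carrier by blast
 let ?r = "\<lambda>u. u \<ominus> sc (u z) h"
 have uz: "u z \<in> carrier F" if "u \<in> FS (insert z Y)" for u using that zc FS_carrier by auto
 have r: "?r u \<in> FS Y" if u: "u \<in> FS (insert z Y)" for u
 proof (rule FSI)
  show "?r u \<in> FS (insert z Y)"
   unfolding A.minus_eq using FS_add[OF u FS_minus[OF sc_FS[OF uz[OF u] h(1)]]] .
  show "?r u z = \<zero>\<^sub>F" using FS_carrier[OF u] hc zc h(2) uz[OF u]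
   by (simp add: A.minus_eq scalar_mult_apply F.r_neg)
 qed
 have radd: "?r (u \<oplus> v) = ?r u \<oplus> ?r v" if "u \<in> FS (insert z Y)" "v \<in> FS (insert z Y)" for u v
  using FS_carrier[OF that(1)] FS_carrier[OF that(2)] hc zc
  by (intro ga_eqI) (simp_all add: A.minus_eq scalar_mult_apply F.l_distr F.minus_add F.a_ac)
 have rsc: "?r (sc c u) = sc c (?r u)" if "c \<in> carrier F" "u \<in> FS (insert z Y)" for u c
  using FS_carrier[OF that(2)] hc zc that(1)
  by (intro ga_eqI) (simp_all add: A.minus_eq scalar_mult_apply F.r_distr F.m_assoc F.r_minus)
 show ?case
 proof (cases "J = ?J")
  case True
  show ?thesis
  proof (intro exI[of _ "\<lambda>u. \<pi> (?r u)"] conjI ballI)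
   fix u assume u: "u \<in> J"
   then have "u z = \<zero>\<^sub>F" using True by blast
   then have "?r u = u" using Jc[OF u] hc by (intro ga_eqI) (auto simp: A.minus_eq scalar_mult_apply)
   then show "\<pi> (?r u) = u" using \<pi>(4) u True by auto
  qed (use True \<pi> r radd rsc in auto)
 next
  case False
  then have hJ: "h \<in> J" using h(3) by blast
  have \<pi>J: "\<pi> (?r u) \<in> J" if "u \<in> FS (insert z Y)" for u using \<pi>(1)[OF r[OF that]] by blast
  have sJ: "sc (u z) h \<in> J" if "u \<in> FS (insert z Y)" for u using insert.prems(5)[OF uz[OF that] hJ] .
  show ?thesis
  proof (intro exI[of _ "\<lambda>u. sc (u z) h \<oplus> \<pi> (?r u)"] conjI ballI)
   show "sc (u z) h \<oplus> \<pi> (?r u) \<in> J" if "u \<in> FS (insert z Y)" for u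
    using insert.prems(4) \<pi>J sJ that by blast
  next
   fix u v assume u: "u \<in> FS (insert z Y)" and v: "v \<in> FS (insert z Y)"
   have c: "\<pi> (?r u) \<in> carrier A" "\<pi> (?r v) \<in> carrier A" using Jc \<pi>J u v by auto
   have "sc ((u \<oplus> v) z) h = sc (u z) h \<oplus> sc (v z) h"
    using uz[OF u] uz[OF v] hc zc by (intro ga_eqI) (simp_all add: scalar_mult_apply F.l_distr)
   then show "sc ((u \<oplus> v) z) h \<oplus> \<pi> (?r (u \<oplus> v)) = sc (u z) h \<oplus> \<pi> (?r u) \<oplus> (sc (v z) h \<oplus> \<pi> (?r v))"
    using radd[OF u v] \<pi>(2)[OF r[OF u] r[OF v]] c hc uz[OF u] uz[OF v] by (simp add: A.a_ac)
  next
   fix a u assume a: "a \<in> carrier F" and u: "u \<in> FS (insert z Y)"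
   have c: "\<pi> (?r u) \<in> carrier A" using Jc \<pi>J u by auto
   have "sc (sc a u z) h = sc a (sc (u z) h)"
    using uz[OF u] a FS_carrier[OF u] hc zc by (intro ga_eqI) (simp_all add: scalar_mult_apply F.m_assoc)
   then show "sc (sc a u z) h \<oplus> \<pi> (?r (sc a u)) = sc a (sc (u z) h \<oplus> \<pi> (?r u))"
    using rsc[OF a u] \<pi>(3)[OF a r[OF u]] c hc uz[OF u] a by (simp add: A.r_distr)
  next
   fix u assume u: "u \<in> J"
   then have uF: "u \<in> FS (insert z Y)" using insert.prems(2) by blast
   have "?r u \<in> J"
   proof -
    have "\<ominus> sc (u z) h = sc (\<ominus>\<^bsub>F\<^esub> \<one>\<^sub>F) (sc (u z) h)"
     using uz[OF uF] hc by (intro ga_eqI) (simp_all add: scalar_mult_apply F.l_minus)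
    then show ?thesis unfolding A.minus_eq using insert.prems(4,5) u sJ[OF uF] by simp
   qed
   moreover have "?r u z = \<zero>\<^sub>F" using FS_carrier[OF uF] hc zc h(2) uz[OF uF]
    by (simp add: A.minus_eq scalar_mult_apply F.r_neg)
   ultimately have "\<pi> (?r u) = ?r u" using \<pi>(4) by blast
   moreover have "sc (u z) h \<oplus> ?r u = u"
    using Jc[OF u] hc uz[OF uF] by (simp add: A.minus_eq A.a_lcomm A.r_neg)
   ultimately show "sc (u z) h \<oplus> \<pi> (?r u) = u" by simp
  qed
 qed
qed

text \<open>
  Maschke averaging: since the order of \<open>B\<close> is invertible, a linear projection onto the ideal
  generated by \<open>c\<close> can be averaged to a module homomorphism. Then \<open>c\<close> is a multiple
  of its own square and vanishes.
\<close>

lemma reduced_finite_abelian: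
 assumes B: "subgroup B G" "finite B" and comm: "\<And>x y. x \<in> B \<Longrightarrow> y \<in> B \<Longrightarrow> x \<bullet> y = y \<bullet> x"
  and inv: "add_pow F (card B) \<one>\<^sub>F \<noteq> \<zero>\<^sub>F"
  and c: "c \<in> FS B" and sq: "c \<otimes> c = \<zero>"
 shows "c = \<zero>"
proof -
 have Bc: "B \<subseteq> carrier G" using subgroup.subset[OF B(1)] .
 have cm: "u \<otimes> v = v \<otimes> u" if "u \<in> FS B" "v \<in> FS B" for u v
  by (rule FS_commute[OF Bc _ that]) (rule comm)
 have cc: "c \<in> carrier A" using FS_carrier c by blast
 note FB = FS_carrier[of _ B]
 define J where "J = (\<lambda>y. c \<otimes> y) ` FS B"
 have J: "J \<subseteq> FS B" using FS_subgroup_mult[OF B(1) c] unfolding J_def by blast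
 have J0: "\<zero> \<in> J" unfolding J_def using FS_zero cc by force
 have Jadd: "u \<oplus> v \<in> J" if uv: "u \<in> J" "v \<in> J" for u v
 proof -
  obtain y y' where y: "u = c \<otimes> y" "v = c \<otimes> y'" "y \<in> FS B" "y' \<in> FS B"
   using uv unfolding J_def by blast
  then have "u \<oplus> v = c \<otimes> (y \<oplus> y')" using cc FB by (simp add: A.r_distr)
  then show ?thesis using y FS_add unfolding J_def by blast
 qed
 have Jmult: "w \<otimes> u \<in> J" if wu: "w \<in> FS B" "u \<in> J" for w u
 proof -
  obtain y where y: "u = c \<otimes> y" "y \<in> FS B" using wu unfolding J_def by blast
  have "w \<otimes> u = (w \<otimes> c) \<otimes> y" using y wu cc FB by (simp add: A.m_assoc)
  also have "\<dots> = c \<otimes> (w \<otimes> y)" using y wu cc FB cm[OF wu(1) c] by (simp add: A.m_assoc)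
  finally show ?thesis using FS_subgroup_mult[OF B(1) wu(1) y(2)] unfolding J_def by blast
 qed
 have oneB: "\<one>\<^sub>G \<in> B" by (rule subgroup.one_closed[OF B(1)])
 have Jsc: "sc a u \<in> J" if "a \<in> carrier F" "u \<in> J" for a u
  using Jmult[OF FS_single[OF that(1) oneB] that(2)] .
 obtain \<pi> where \<pi>: "\<And>u. u \<in> FS B \<Longrightarrow> \<pi> u \<in> J"
  "\<And>u v. u \<in> FS B \<Longrightarrow> v \<in> FS B \<Longrightarrow> \<pi> (u \<oplus> v) = \<pi> u \<oplus> \<pi> v"
  "\<And>c u. c \<in> carrier F \<Longrightarrow> u \<in> FS B \<Longrightarrow> \<pi> (sc c u) = sc c (\<pi> u)" "\<And>u. u \<in> J \<Longrightarrow> \<pi> u = u"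
  using projection_exists[OF B(2) Bc J J0 Jadd Jsc] by blast
 have \<pi>c: "\<pi> u \<in> carrier A" if "u \<in> FS B" for u using \<pi>(1)[OF that] J FB by blast
 have \<pi>0: "\<pi> \<zero> = \<zero>" using \<pi>(4)[OF J0] .
 define E where "E = (\<Oplus>t\<in>B. \<delta> (inv\<^sub>G t) \<otimes> \<pi> (\<delta> t))"
 have dB: "\<delta> t \<in> FS B" if "t \<in> B" for t using FS_single[of "\<one>\<^sub>F"] that by simp
 have iB: "inv\<^sub>G t \<in> B" if "t \<in> B" for t using subgroup.m_inv_closed[OF B(1) that] .
 have fs: "(\<Oplus>t\<in>Y. f t) \<in> J" if "finite Y" "\<And>t. t \<in> Y \<Longrightarrow> f t \<in> J" for Y and f :: "'g \<Rightarrow> 'g \<Rightarrow> 'f"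
  using that
 proof (induction rule: finite_induct)
  case (insert t Y)
  have Jc: "J \<subseteq> carrier A" using J FB by blast
  have "(\<Oplus>t\<in>insert t Y. f t) = f t \<oplus> (\<Oplus>t\<in>Y. f t)"
   using insert Jc by (intro A.finsum_insert) auto
  then show ?case using Jadd insert by auto
 qed (use J0 in simp)
 have EJ: "E \<in> J" unfolding E_def using Jmult[OF dB[OF iB] \<pi>(1)[OF dB]] B(2) by (intro fs) auto
 have Ec: "E \<in> carrier A" using EJ J FB by blast
 have yE: "y \<otimes> E = (\<Oplus>r\<in>B. \<delta> (inv\<^sub>G r) \<otimes> \<pi> (\<delta> r \<otimes> y))" if y: "y \<in> FS B" for y
  using y
 proof (induction rule: FS_induct)
  case zero
  have "(\<Oplus>r\<in>B. \<delta> (inv\<^sub>G r) \<otimes> \<pi> (\<delta> r \<otimes> \<zero>)) = \<zero>"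
   by (rule A.add.finprod_one_eqI) (simp add: \<pi>0)
  then show ?case using Ec by simp
 next
  case (add u v)
  have m: "\<And>r w. r \<in> B \<Longrightarrow> w \<in> FS B \<Longrightarrow> \<delta> r \<otimes> w \<in> FS B" using FS_subgroup_mult[OF B(1) dB] .
  have "(\<Oplus>r\<in>B. \<delta> (inv\<^sub>G r) \<otimes> \<pi> (\<delta> r \<otimes> (u \<oplus> v)))
    = (\<Oplus>r\<in>B. \<delta> (inv\<^sub>G r) \<otimes> \<pi> (\<delta> r \<otimes> u) \<oplus> \<delta> (inv\<^sub>G r) \<otimes> \<pi> (\<delta> r \<otimes> v))"
   using add(1,2) FB \<pi>(2)[OF m m] \<pi>c[OF m] Bc
   by (intro A.finsum_cong') (auto simp: A.r_distr)
  also have "\<dots> = u \<otimes> E \<oplus> v \<otimes> E"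
   unfolding add using add(1,2) \<pi>c[OF m] by (intro A.finsum_addf) auto
  finally show ?case using add(1,2) FB Ec by (simp add: A.l_distr)
 next
  case (single a s)
  have "single a s \<otimes> E = (\<Oplus>t\<in>B. single a s \<otimes> (\<delta> (inv\<^sub>G t) \<otimes> \<pi> (\<delta> t)))"
   unfolding E_def using single B(2) \<pi>c[OF dB] by (intro A.finsum_rdistr) auto
  also have "\<dots> = (\<Oplus>t\<in>(\<lambda>r. r \<bullet> s) ` B. single a s \<otimes> (\<delta> (inv\<^sub>G t) \<otimes> \<pi> (\<delta> t)))"
  proof -
   have "(\<lambda>r. r \<bullet> s) ` B = B"
   proof
    show "(\<lambda>r. r \<bullet> s) ` B \<subseteq> B" using single(2) subgroup.m_closed[OF B(1)] by blast
    show "B \<subseteq> (\<lambda>r. r \<bullet> s) ` B"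
    proof
     fix r assume r: "r \<in> B"
     have "r = (r \<bullet> inv\<^sub>G s) \<bullet> s" using r Bc single(3) by (simp add: G.m_assoc subset_iff)
     moreover have "r \<bullet> inv\<^sub>G s \<in> B" using r iB[OF single(2)] subgroup.m_closed[OF B(1)] by blast
     ultimately show "r \<in> (\<lambda>r. r \<bullet> s) ` B" by blast
    qed
   qed
   then show ?thesis by simp
  qed
  also have "\<dots> = (\<Oplus>r\<in>B. single a s \<otimes> (\<delta> (inv\<^sub>G (r \<bullet> s)) \<otimes> \<pi> (\<delta> (r \<bullet> s))))"
  proof (rule A.finsum_reindex)
   show "(\<lambda>t. single a s \<otimes> (\<delta> (inv\<^sub>G t) \<otimes> \<pi> (\<delta> t))) \<in> (\<lambda>r. r \<bullet> s) ` B \<rightarrow> carrier A"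
    using single \<pi>c[OF dB] subgroup.m_closed[OF B(1)] by auto
   show "inj_on (\<lambda>r. r \<bullet> s) B" using single(3) Bc by (auto simp: inj_on_def subset_iff)
  qed
  also have "\<dots> = (\<Oplus>r\<in>B. \<delta> (inv\<^sub>G r) \<otimes> \<pi> (\<delta> r \<otimes> single a s))"
  proof (rule A.finsum_cong'[OF refl])
   show "(\<lambda>r. \<delta> (inv\<^sub>G r) \<otimes> \<pi> (\<delta> r \<otimes> single a s)) \<in> B \<rightarrow> carrier A"
    using \<pi>c[OF FS_subgroup_mult[OF B(1) dB FS_single]] single by auto
   fix r assume r: "r \<in> B"
   have rc: "r \<in> carrier G" using r Bc by blast
   have rs: "r \<bullet> s \<in> B" using r single subgroup.m_closed[OF B(1)] by blast
   have "\<delta> r \<otimes> single a s = sc a (\<delta> (r \<bullet> s))" using rc single by (simp add: single_mult_single)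
   then have p: "\<pi> (\<delta> r \<otimes> single a s) = sc a (\<pi> (\<delta> (r \<bullet> s)))" using \<pi>(3)[OF single(1) dB[OF rs]] by simp
   have "single a s \<otimes> \<delta> (inv\<^sub>G (r \<bullet> s)) = \<delta> (inv\<^sub>G r) \<otimes> single a \<one>\<^sub>G"
    using rc single by (simp add: single_mult_single G.inv_mult_group)
   then show "single a s \<otimes> (\<delta> (inv\<^sub>G (r \<bullet> s)) \<otimes> \<pi> (\<delta> (r \<bullet> s))) = \<delta> (inv\<^sub>G r) \<otimes> \<pi> (\<delta> r \<otimes> single a s)"
    unfolding p using \<pi>c[OF dB[OF rs]] single by (simp flip: A.m_assoc)
  qed
  finally show ?case .
 qed
 have yE': "y \<otimes> E = sc (add_pow F (card B) \<one>\<^sub>F) y" if y: "y \<in> J" for y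
 proof -
  have yF: "y \<in> FS B" using y J by blast
  have "y \<otimes> E = (\<Oplus>r\<in>B. \<delta> (inv\<^sub>G r) \<otimes> \<pi> (\<delta> r \<otimes> y))" by (rule yE[OF yF])
  also have "\<dots> = (\<Oplus>r\<in>B. y)"
  proof (rule A.finsum_cong'[OF refl])
   fix r assume r: "r \<in> B"
   show "\<delta> (inv\<^sub>G r) \<otimes> \<pi> (\<delta> r \<otimes> y) = y"
    using \<pi>(4)[OF Jmult[OF dB[OF r] y]] FB[OF yF] r Bc by (simp add: subset_iff flip: A.m_assoc)
  qed (use FB[OF yF] in auto)
  also have "\<dots> = add_pow A (card B) y" using FB[OF yF] by (rule A.add.finprod_const)
  finally show ?thesis using add_pow_sc[OF FB[OF yF]] by simp
 qed
 obtain y where y: "E = c \<otimes> y" "y \<in> FS B" using EJ unfolding J_def by blast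
 have "E \<otimes> E = (c \<otimes> c) \<otimes> (y \<otimes> y)"
  using y cc FB cm[OF y(2) c] by (simp add: A.m_assoc) (simp flip: A.m_assoc)
 then have "E \<otimes> E = \<zero>" using sq y FB by simp
 then have E0: "E = \<zero>" using sc_eq_zeroD[OF _ inv Ec] yE'[OF EJ] by simp
 have "c \<in> J" unfolding J_def using FS_one[OF oneB] cc by force
 then have "sc (add_pow F (card B) \<one>\<^sub>F) c = \<zero>" using yE'[of c] E0 cc by simp
 then show ?thesis using sc_eq_zeroD[OF _ inv cc] by simp
qed

end

section \<open>Units that are graded by an ordered quotient\<close>

context grpalg
begin

abbreviation V where "V \<equiv> normalized_units F G"

lemma V_simps [simp]: "carrier V = {u \<in> Units A. aug u = \<one>\<^sub>F}" "x \<otimes>\<^bsub>V\<^esub> y = x \<otimes> y" "\<one>\<^bsub>V\<^esub> = \<one>"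
 by (simp_all add: normalized_units_def A_def units_of_def)

lemma V_eq: "V = (units_of A)\<lparr>carrier := {u \<in> Units A. aug u = \<one>\<^sub>F}\<rparr>"
 by (simp add: normalized_units_def A_def)

lemma aug_inv:
 assumes u: "u \<in> Units A" "aug u = \<one>\<^sub>F" shows "aug (inv u) = \<one>\<^sub>F"
proof -
 have c: "u \<in> carrier A" "inv u \<in> carrier A" using u by auto
 have "aug (inv u) = aug (inv u) \<otimes>\<^sub>F aug u" using u(2) c by simp
 also have "\<dots> = aug (inv u \<otimes> u)" using c by (simp only: aug_mult)
 also have "inv u \<otimes> u = \<one>" using u(1) by (rule A.Units_l_inv)
 finally show ?thesis by simp
qed

lemma V_group: "group V"
proof -
 interpret U: group "units_of A" by (rule A.units_group)
 have "subgroup {u \<in> Units A. aug u = \<one>\<^sub>F} (units_of A)"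
 proof (rule U.subgroupI)
  show "{u \<in> Units A. aug u = \<one>\<^sub>F} \<subseteq> carrier (units_of A)" by (auto simp: units_of_def)
  show "{u \<in> Units A. aug u = \<one>\<^sub>F} \<noteq> {}" using A.Units_one_closed aug_one by blast
 next
  fix u assume u: "u \<in> {u \<in> Units A. aug u = \<one>\<^sub>F}"
  then show "inv\<^bsub>units_of A\<^esub> u \<in> {u \<in> Units A. aug u = \<one>\<^sub>F}"
   using aug_inv[of u] by (simp add: A.units_of_inv)
 next
  fix u v assume "u \<in> {u \<in> Units A. aug u = \<one>\<^sub>F}" "v \<in> {u \<in> Units A. aug u = \<one>\<^sub>F}"
  then show "u \<otimes>\<^bsub>units_of A\<^esub> v \<in> {u \<in> Units A. aug u = \<one>\<^sub>F}"
   by (simp add: units_of_mult A.Units_closed)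
 qed
 then show ?thesis unfolding V_eq by (rule subgroup.subgroup_is_group[OF _ U.is_group])
qed

lemma V_inv [simp]: "u \<in> Units A \<Longrightarrow> aug u = \<one>\<^sub>F \<Longrightarrow> inv\<^bsub>V\<^esub> u = inv u"
proof -
 assume u: "u \<in> Units A" "aug u = \<one>\<^sub>F"
 have "aug (inv u) = \<one>\<^sub>F" by (rule aug_inv[OF u])
 then show ?thesis using u by (intro group.inv_equality[OF V_group]) auto
qed

lemma dl_Units: "g \<in> carrier G \<Longrightarrow> \<delta> g \<in> Units A"
 unfolding Units_def by (auto intro!: bexI[of _ "\<delta> (inv\<^sub>G g)"])

lemma inv_dl: "g \<in> carrier G \<Longrightarrow> inv (\<delta> g) = \<delta> (inv\<^sub>G g)"
 by (rule A.inv_char) auto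

text \<open>
  The part of \<open>u\<close> supported in \<open>C\<close>, used with cosets to split \<open>u\<close> into
  homogeneous components.
\<close>

definition restr where "restr u C = (\<lambda>x \<in> carrier G. if x \<in> C then u x else \<zero>\<^sub>F)"

lemma restr_closed [simp]: "u \<in> carrier A \<Longrightarrow> restr u C \<in> carrier A"
 unfolding restr_def by (intro carrierI[where S = "supp u"]) (auto simp: supp_iff)

lemma restr_apply: "x \<in> carrier G \<Longrightarrow> restr u C x = (if x \<in> C then u x else \<zero>\<^sub>F)"
 by (simp add: restr_def)

lemma supp_restr: "supp (restr u C) = supp u \<inter> C"
 by (auto simp: supp_iff restr_apply split: if_splits)

lemma restr_add: "u \<in> carrier A \<Longrightarrow> v \<in> carrier A \<Longrightarrow> restr (u \<oplus> v) C = restr u C \<oplus> restr v C"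
 by (intro ga_eqI) (auto simp: restr_apply)

lemma restr_id: "u \<in> carrier A \<Longrightarrow> supp u \<subseteq> C \<Longrightarrow> restr u C = u"
 by (intro ga_eqI) (auto simp: restr_apply supp_iff subset_iff)

lemma restr_zero: "u \<in> carrier A \<Longrightarrow> supp u \<inter> C = {} \<Longrightarrow> restr u C = \<zero>"
 by (intro ga_eqI) (auto simp: restr_apply supp_iff)

lemma restr_finsum:
 "finite I \<Longrightarrow> (\<And>i. i \<in> I \<Longrightarrow> f i \<in> carrier A) \<Longrightarrow> restr (\<Oplus>i\<in>I. f i) C = (\<Oplus>i\<in>I. restr (f i) C)"
proof (induction rule: finite_induct)
 case empty then show ?case by (simp add: restr_zero)
next
 case (insert i I) then show ?case by (simp add: restr_add Pi_iff)
qed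

lemma restr_sum_partition:
 assumes u: "u \<in> carrier A" and C: "finite C" "disjoint C" "supp u \<subseteq> \<Union>C"
 shows "(\<Oplus>c\<in>C. restr u c) = u"
proof -
 have "(\<Oplus>c\<in>Y. restr u c) = restr u (\<Union>Y)" if "finite Y" "Y \<subseteq> C" for Y
  using that
 proof (induction rule: finite_induct)
  case empty then show ?case using u by (simp add: restr_zero)
 next
  case (insert c Y)
  have "c \<inter> y = {}" if "y \<in> Y" for y
   by (rule disjointD[OF C(2)]) (use insert that in auto)
  then have "c \<inter> \<Union>Y = {}" by blast
  then have "restr u c \<oplus> restr u (\<Union>Y) = restr u (\<Union>(insert c Y))"
   using u by (intro ga_eqI) (auto simp: restr_apply)
  moreover have "(\<Oplus>c\<in>insert c Y. restr u c) = restr u c \<oplus> (\<Oplus>c\<in>Y. restr u c)"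
   using insert u by (intro A.finsum_insert) auto
  ultimately show ?case using insert by simp
 qed
 then show ?thesis using restr_id[OF u C(3)] C(1) by simp
qed

text \<open>Conjugation by the group element \<open>x\<close>.\<close>

definition cj where "cj x d = \<delta> x \<otimes> d \<otimes> \<delta> (inv\<^sub>G x)"

lemma cj_closed [simp]: "x \<in> carrier G \<Longrightarrow> d \<in> carrier A \<Longrightarrow> cj x d \<in> carrier A"
 by (simp add: cj_def)

lemma dl_cancel [simp]:
 "x \<in> carrier G \<Longrightarrow> w \<in> carrier A \<Longrightarrow> \<delta> x \<otimes> (\<delta> (inv\<^sub>G x) \<otimes> w) = w"
 "x \<in> carrier G \<Longrightarrow> w \<in> carrier A \<Longrightarrow> \<delta> (inv\<^sub>G x) \<otimes> (\<delta> x \<otimes> w) = w"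
 by (simp_all flip: A.m_assoc)

lemma cj_mult: "x \<in> carrier G \<Longrightarrow> c \<in> carrier A \<Longrightarrow> d \<in> carrier A \<Longrightarrow> cj x (c \<otimes> d) = cj x c \<otimes> cj x d"
 by (simp add: cj_def A.m_assoc)

lemma cj_cj: "x \<in> carrier G \<Longrightarrow> y \<in> carrier G \<Longrightarrow> d \<in> carrier A \<Longrightarrow> cj x (cj y d) = cj (x \<bullet> y) d"
 by (simp add: cj_def A.m_assoc G.inv_mult_group flip: dl_mult)

lemma cj_dl: "x \<in> carrier G \<Longrightarrow> d \<in> carrier A \<Longrightarrow> cj x d \<otimes> \<delta> x = \<delta> x \<otimes> d"
 by (simp add: cj_def A.m_assoc)

lemma cj_one [simp]: "x \<in> carrier G \<Longrightarrow> cj x \<one> = \<one>" by (simp add: cj_def)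

lemma cj_FS:
 assumes "x \<in> carrier G" "d \<in> FS S" "\<And>s. s \<in> S \<Longrightarrow> s \<in> carrier G \<Longrightarrow> x \<bullet> s \<bullet> inv\<^sub>G x \<in> T"
 shows "cj x d \<in> FS T"
 using assms(2)
proof (induction rule: FS_induct)
 case zero then show ?case using assms(1) FS_zero by (simp add: cj_def)
next
 case (add u v)
 then show ?case using FS_add[of "cj x u" T "cj x v"] assms(1) FS_carrier by (simp add: cj_def A.l_distr A.r_distr)
next
 case (single c g)
 then show ?case using FS_single[of c "x \<bullet> g \<bullet> inv\<^sub>G x" T] assms(1,3) by (simp add: cj_def single_mult_single)
qed

end

locale graded_units = grpalg F G A
 for F :: "('f, 'b) ring_scheme" and G :: "('g, 'c) monoid_scheme" and A :: "('g \<Rightarrow> 'f) ring" (structure) +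
 fixes H D P :: "'g set" and q M :: nat
 assumes H: "subgroup H G" and D: "subgroup D G" and DH: "D \<subseteq> H"
  and Dn: "\<And>h d. h \<in> H \<Longrightarrow> d \<in> D \<Longrightarrow> h \<otimes>\<^bsub>G\<^esub> d \<otimes>\<^bsub>G\<^esub> inv\<^bsub>G\<^esub> h \<in> D"
  and Dcomm: "\<And>x y. x \<in> D \<Longrightarrow> y \<in> D \<Longrightarrow> x \<otimes>\<^bsub>G\<^esub> y = y \<otimes>\<^bsub>G\<^esub> x"
  and cone: "positive_cone (G\<lparr>carrier := H\<rparr>) D H P"
  and reduced: "\<And>c. c \<in> FS D \<Longrightarrow> c \<otimes> c = \<zero> \<Longrightarrow> c = \<zero>"
  and twist: "\<And>h d. h \<in> H \<Longrightarrow> d \<in> FS D \<Longrightarrow> cj h d = d \<or> cj h d = d [^] (q + 1)"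
  and exponent: "\<And>u. u \<in> FS D \<Longrightarrow> u \<in> Units A \<Longrightarrow> u [^] (q ^ M) = \<one>"
begin

lemma Hc: "x \<in> H \<Longrightarrow> x \<in> carrier G" using subgroup.subset[OF H] by blast
lemma Dc: "x \<in> D \<Longrightarrow> x \<in> carrier G" using subgroup.subset[OF D] by blast
lemma H_mult [simp]: "x \<in> H \<Longrightarrow> y \<in> H \<Longrightarrow> x \<bullet> y \<in> H" by (rule subgroup.m_closed[OF H])
lemma H_inv [simp]: "x \<in> H \<Longrightarrow> inv\<^sub>G x \<in> H" by (rule subgroup.m_inv_closed[OF H])
lemma D_mult [simp]: "x \<in> D \<Longrightarrow> y \<in> D \<Longrightarrow> x \<bullet> y \<in> D" by (rule subgroup.m_closed[OF D])
lemma D_inv [simp]: "x \<in> D \<Longrightarrow> inv\<^sub>G x \<in> D" by (rule subgroup.m_inv_closed[OF D])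
lemma D_one [simp]: "\<one>\<^sub>G \<in> D" by (rule subgroup.one_closed[OF D])
lemma H_one [simp]: "\<one>\<^sub>G \<in> H" by (rule subgroup.one_closed[OF H])

lemma FD_commute: "c \<in> FS D \<Longrightarrow> d \<in> FS D \<Longrightarrow> c \<otimes> d = d \<otimes> c"
 by (rule FS_commute[OF _ Dcomm]) (auto simp: Dc)

lemma FD_mult: "c \<in> FS D \<Longrightarrow> d \<in> FS D \<Longrightarrow> c \<otimes> d \<in> FS D" by (rule FS_subgroup_mult[OF D])

lemma cj_FD: "h \<in> H \<Longrightarrow> d \<in> FS D \<Longrightarrow> cj h d \<in> FS D"
 by (rule cj_FS) (auto simp: Hc Dn)

text \<open>
  The twist hypothesis turns \<open>d\<close> into itself or into one of its positive powers, and these are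
  annihilated with \<open>d\<close>.
\<close>

lemma annihilate_cj:
 assumes c: "c \<in> FS D" and d: "d \<in> FS D" and z: "c \<otimes> d = \<zero>" and h: "h \<in> H"
 shows "c \<otimes> cj h d = \<zero>"
proof -
 have cc: "c \<in> carrier A" and dc: "d \<in> carrier A" using c d FS_carrier by auto
 have "c \<otimes> d [^] (q + 1) = (c \<otimes> d) \<otimes> d [^] q"
  using cc dc A.nat_pow_Suc2[OF dc, of q] by (simp add: A.m_assoc)
 then have "c \<otimes> d [^] (q + 1) = \<zero>" using z dc by simp
 then show ?thesis using twist[OF h d] z by auto
qed

text \<open>
  A power of an idempotent is the idempotent itself, so the twist hypothesis leaves it fixed in either case.
\<close>

lemma idempotent_central:
 assumes e: "e \<in> FS D" "e \<otimes> e = e" and h: "h \<in> H"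
 shows "\<delta> h \<otimes> e = e \<otimes> \<delta> h"
proof -
 have ec: "e \<in> carrier A" using e FS_carrier by auto
 have "e [^] Suc n = e" for n using ec e(2) by (induction n) simp_all
 then have "cj h e = e" using twist[OF h e(1)] by auto
 then show ?thesis using cj_dl[of h e] Hc h ec by simp
qed

lemma idempotent_commutes:
 assumes e: "e \<in> FS D" "e \<otimes> e = e" and u: "u \<in> FS H"
 shows "u \<otimes> e = e \<otimes> u"
 using u
proof (induction rule: FS_induct)
 case zero then show ?case using e FS_carrier by simp
next
 case (add u v) then show ?case using e FS_carrier by (simp add: A.l_distr A.r_distr)
next
 case (single c g)
 have ec: "e \<in> carrier A" using e FS_carrier by auto
 have s: "single c g = single c \<one>\<^sub>G \<otimes> \<delta> g" using single by (simp add: single_mult_single)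
 show ?case unfolding s using single(1,3) ec idempotent_central[OF e single(2)] scalar_commute[of c e]
  by (simp add: A.m_assoc) (simp flip: A.m_assoc)
qed

text \<open>The coset of \<open>x\<close> modulo \<open>D\<close>.\<close>

definition cs where "cs x = {y \<in> H. inv\<^sub>G x \<bullet> y \<in> D}"

lemma cs_H: "cs x \<subseteq> H" by (auto simp: cs_def)

lemma cs_self: "x \<in> H \<Longrightarrow> x \<in> cs x" by (simp add: cs_def Hc)

lemma cs_one: "cs \<one>\<^sub>G = D" using DH by (auto simp: cs_def Dc Hc)

lemma csE:
 assumes "y \<in> cs x" "x \<in> H" obtains d where "d \<in> D" "y = x \<bullet> d"
proof -
 have "y = x \<bullet> (inv\<^sub>G x \<bullet> y)" using assms by (simp add: cs_def Hc)
 then show ?thesis using that assms(1) by (auto simp: cs_def)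
qed

lemma csI: "x \<in> H \<Longrightarrow> d \<in> D \<Longrightarrow> x \<bullet> d \<in> cs x"
 using DH by (auto simp: cs_def Hc Dc subset_iff)

lemma cs_eq: assumes "y \<in> cs x" "x \<in> H" shows "cs y = cs x"
proof -
 obtain d where d: "d \<in> D" "y = x \<bullet> d" using csE assms by blast
 have "inv\<^sub>G y \<bullet> z \<in> D \<longleftrightarrow> inv\<^sub>G x \<bullet> z \<in> D" if z: "z \<in> H" for z
 proof -
  have e: "inv\<^sub>G y \<bullet> z = inv\<^sub>G d \<bullet> (inv\<^sub>G x \<bullet> z)"
   using d assms z by (simp add: G.inv_mult_group G.m_assoc Hc Dc)
  have "inv\<^sub>G x \<bullet> z = d \<bullet> (inv\<^sub>G y \<bullet> z)"
   unfolding e using d assms z by (simp add: Hc Dc)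
  then show ?thesis using e d by (metis D_mult D_inv)
 qed
 then show ?thesis by (auto simp: cs_def)
qed

lemma cs_disjoint: "x \<in> H \<Longrightarrow> y \<in> H \<Longrightarrow> cs x \<noteq> cs y \<Longrightarrow> cs x \<inter> cs y = {}"
 using cs_eq by blast

lemma cs_mult: assumes "x \<in> H" "y \<in> H" "a \<in> cs x" "b \<in> cs y" shows "a \<bullet> b \<in> cs (x \<bullet> y)"
proof -
 obtain d where d: "d \<in> D" "a = x \<bullet> d" using csE assms by blast
 obtain d' where d': "d' \<in> D" "b = y \<bullet> d'" using csE assms by blast
 have "inv\<^sub>G y \<bullet> d \<bullet> inv\<^sub>G (inv\<^sub>G y) \<in> D" using Dn[of "inv\<^sub>G y" d] assms d by simp
 then have "(inv\<^sub>G y \<bullet> d \<bullet> y) \<bullet> d' \<in> D" using d' assms by (simp add: Hc)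
 moreover have "a \<bullet> b = (x \<bullet> y) \<bullet> ((inv\<^sub>G y \<bullet> d \<bullet> y) \<bullet> d')"
  using d d' assms by (simp add: G.m_assoc Hc Dc)
 ultimately show ?thesis using csI assms by simp
qed

lemma FS_cs_mult: "x \<in> H \<Longrightarrow> y \<in> H \<Longrightarrow> u \<in> FS (cs x) \<Longrightarrow> v \<in> FS (cs y) \<Longrightarrow> u \<otimes> v \<in> FS (cs (x \<bullet> y))"
 by (rule FS_mult) (auto intro: cs_mult)

abbreviation cmp where "cmp u x \<equiv> restr u (cs x)"

lemma cmp_FS: "u \<in> carrier A \<Longrightarrow> cmp u x \<in> FS (cs x)" by (auto simp: FS_def supp_restr)

lemma cmp_shift: "u \<in> carrier A \<Longrightarrow> x \<in> H \<Longrightarrow> cmp u x \<otimes> \<delta> (inv\<^sub>G x) \<in> FS D"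
 using FS_cs_mult[OF _ _ cmp_FS FS_single[OF _ cs_self], of x "inv\<^sub>G x" u "\<one>\<^sub>F"] by (simp add: Hc cs_one)

lemma cmp_mult:
 assumes c: "c \<in> FS (cs x)" and x: "x \<in> H" and z: "z \<in> H" and v: "v \<in> carrier A"
 shows "cmp (c \<otimes> v) z = c \<otimes> cmp v (inv\<^sub>G x \<bullet> z)"
proof -
 let ?E = "cs (inv\<^sub>G x \<bullet> z)"
 have cc: "c \<in> carrier A" using c FS_carrier by auto
 have v': "v = restr v ?E \<oplus> restr v (- ?E)" using v by (intro ga_eqI) (auto simp: restr_apply)
 have 1: "c \<otimes> restr v ?E \<in> FS (cs z)"
  using FS_cs_mult[OF x _ c cmp_FS[OF v], of "inv\<^sub>G x \<bullet> z"] x z by (simp add: Hc)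
 have "c \<otimes> restr v (- ?E) \<in> FS (- cs z)"
 proof (rule FS_mult[OF c])
  show "restr v (- ?E) \<in> FS (carrier G \<inter> - ?E)" using v supp_carrier by (auto simp: FS_def supp_restr)
  fix s t assume s: "s \<in> cs x" and t: "t \<in> carrier G \<inter> - ?E"
  have sH: "s \<in> H" using s cs_H by blast
  have ix: "inv\<^sub>G s \<in> cs (inv\<^sub>G x)"
  proof -
   obtain d where d: "d \<in> D" "s = x \<bullet> d" using csE s x by blast
   have "x \<bullet> inv\<^sub>G d \<bullet> inv\<^sub>G x \<in> D" using Dn x d by simp
   then show ?thesis using d x DH by (auto simp: cs_def G.inv_mult_group Hc Dc G.m_assoc)
  qed
  show "s \<bullet> t \<in> - cs z"
  proof
   assume "s \<bullet> t \<in> cs z"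
   then have "inv\<^sub>G s \<bullet> (s \<bullet> t) \<in> ?E" using cs_mult[OF _ z ix] x by simp
   then show False using t sH by (simp add: Hc)
  qed
 qed
 then have 2: "cmp (c \<otimes> restr v (- ?E)) z = \<zero>" using cc v by (intro restr_zero) (auto simp: FS_def)
 have "c \<otimes> v = c \<otimes> restr v ?E \<oplus> c \<otimes> restr v (- ?E)"
  using v' cc v by (metis A.r_distr restr_closed)
 then have "cmp (c \<otimes> v) z = cmp (c \<otimes> restr v ?E) z \<oplus> cmp (c \<otimes> restr v (- ?E)) z"
  using cc v by (simp add: restr_add)
 then show ?thesis using 1 2 cc v by (simp add: restr_id FS_def)
qed

definition css where "css u = cs ` supp u"

lemma css_sum: "u \<in> FS H \<Longrightarrow> (\<Oplus>c\<in>css u. restr u c) = u"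
proof (rule restr_sum_partition)
 assume u: "u \<in> FS H"
 show "u \<in> carrier A" using u FS_carrier by auto
 then show "finite (css u)" by (simp add: css_def)
 have s: "supp u \<subseteq> H" using u FS_supp by auto
 then show "disjoint (css u)" unfolding css_def disjoint_def using cs_disjoint by blast
 show "supp u \<subseteq> \<Union> (css u)" using s cs_self by (auto simp: css_def)
qed

lemma cmp_nonzero: assumes "v \<in> carrier A" "y \<in> H" "cmp v y \<noteq> \<zero>"
 obtains y' where "y' \<in> supp v" "y' \<in> cs y" "cs y' = cs y"
proof -
 have "supp v \<inter> cs y \<noteq> {}" using assms restr_zero by blast
 then show ?thesis using that cs_eq assms(2) by blast
qed

text \<open>
  The argument for units of a polynomial ring over a reduced ring. Among the pairs of components with positive
  total degree take one whose degree is extremal and whose product is nonzero; in the corresponding component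
  of \<open>u v\<close>, which is zero, multiplication by a component annihilates all the other terms, and
  reducedness gives a contradiction.
\<close>

lemma zero_products_above:
 fixes Q
 assumes Q: "positive_cone (G\<lparr>carrier := H\<rparr>) D H Q"
  and u: "u \<in> FS H" and v: "v \<in> FS H" and uv: "u \<otimes> v = \<one>"
  and xy: "x \<in> H" "y \<in> H" "x \<bullet> y \<in> Q"
 shows "cmp u x \<otimes> cmp v y = \<zero>"
proof (rule ccontr)
 assume nz: "cmp u x \<otimes> cmp v y \<noteq> \<zero>"
 have uc: "u \<in> carrier A" and vc: "v \<in> carrier A" using u v FS_carrier by auto
 have us: "supp u \<subseteq> H" and vs: "supp v \<subseteq> H" using u v FS_supp by auto
 have iH: "inv\<^bsub>G\<lparr>carrier := H\<rparr>\<^esub> h = inv\<^sub>G h" if "h \<in> H" for h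
  using G.m_inv_consistent[OF H that] .
 have P1: "Q \<subseteq> H" "Q \<inter> D = {}" "\<And>x y. x \<in> Q \<Longrightarrow> y \<in> Q \<Longrightarrow> x \<bullet> y \<in> Q"
  "\<And>d x. d \<in> D \<Longrightarrow> x \<in> Q \<Longrightarrow> d \<bullet> x \<in> Q"
  "\<And>h x. h \<in> H \<Longrightarrow> x \<in> Q \<Longrightarrow> h \<bullet> x \<bullet> inv\<^sub>G h \<in> Q"
  "\<And>x. x \<in> H \<Longrightarrow> x \<in> D \<or> x \<in> Q \<or> inv\<^sub>G x \<in> Q"
  using Q unfolding positive_cone_def by (auto simp: iH)
 have PDr: "x \<bullet> d \<in> Q" if "x \<in> Q" "d \<in> D" for x d
 proof -
  have xH: "x \<in> H" using that P1(1) by blast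
  have "x \<bullet> d = (x \<bullet> d \<bullet> inv\<^sub>G x) \<bullet> x" using xH that by (simp add: G.m_assoc Hc Dc)
  then show ?thesis using P1(4)[OF Dn[OF xH that(2)] that(1)] by simp
 qed
 define lt where "lt a b \<longleftrightarrow> inv\<^sub>G a \<bullet> b \<in> Q" for a b
 define eqv where "eqv a b \<longleftrightarrow> inv\<^sub>G a \<bullet> b \<in> D" for a b
 have split3: "(inv\<^sub>G a \<bullet> b) \<bullet> (inv\<^sub>G b \<bullet> c) = inv\<^sub>G a \<bullet> c" if "a \<in> H" "b \<in> H" "c \<in> H" for a b c
  using that by (simp add: G.m_assoc Hc)
 have tr1: "lt a b \<Longrightarrow> lt b c \<Longrightarrow> lt a c" if "a \<in> H" "b \<in> H" "c \<in> H" for a b c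
  unfolding lt_def using P1(3) split3[OF that] by metis
 have tr2: "lt a b \<Longrightarrow> eqv b c \<Longrightarrow> lt a c" if "a \<in> H" "b \<in> H" "c \<in> H" for a b c
  unfolding lt_def eqv_def using PDr split3[OF that] by metis
 have tr3: "eqv a b \<Longrightarrow> lt b c \<Longrightarrow> lt a c" if "a \<in> H" "b \<in> H" "c \<in> H" for a b c
  unfolding lt_def eqv_def using P1(4) split3[OF that] by metis
 have tr4: "eqv a b \<Longrightarrow> eqv b c \<Longrightarrow> eqv a c" if "a \<in> H" "b \<in> H" "c \<in> H" for a b c
  unfolding eqv_def using D_mult split3[OF that] by metis
 have irr: "\<not> lt a a" if "a \<in> H" for a
  unfolding lt_def using P1(2) D_one Hc[OF that] by auto
 have tri: "eqv a b \<or> lt a b \<or> lt b a" if "a \<in> H" "b \<in> H" for a b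
  using P1(6)[of "inv\<^sub>G a \<bullet> b"] that by (simp add: lt_def eqv_def G.inv_mult_group Hc)
 have rmult: "lt (a \<bullet> c) (b \<bullet> c)" if "lt a b" "a \<in> H" "b \<in> H" "c \<in> H" for a b c
  using P1(5)[of "inv\<^sub>G c" "inv\<^sub>G a \<bullet> b"] that by (simp add: lt_def G.inv_mult_group G.m_assoc Hc)
 define R where "R = (\<lambda>(a, b) (a', b'). lt (a \<bullet> b) (a' \<bullet> b') \<or>
   eqv (a \<bullet> b) (a' \<bullet> b') \<and> lt a a')"
 define B where "B = {(a, b) \<in> supp u \<times> supp v. a \<bullet> b \<in> Q \<and> cmp u a \<otimes> cmp v b \<noteq> \<zero>}"
 have BH: "a \<in> H" "b \<in> H" "a \<bullet> b \<in> Q" if "(a, b) \<in> B" for a b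
  using that us vs unfolding B_def by auto
 have finB: "finite B" by (rule finite_subset[of _ "supp u \<times> supp v"]) (auto simp: B_def uc vc)
 have "B \<noteq> {}"
 proof -
  have "cmp u x \<noteq> \<zero>" "cmp v y \<noteq> \<zero>" using nz uc vc by auto
  then obtain x' y' where x': "x' \<in> supp u" "x' \<in> cs x" "cs x' = cs x" and y': "y' \<in> supp v" "y' \<in> cs y" "cs y' = cs y"
   using cmp_nonzero uc vc xy by metis
  have "x' \<bullet> y' \<in> cs (x \<bullet> y)" using cs_mult x' y' xy by blast
  then obtain d where "d \<in> D" "x' \<bullet> y' = x \<bullet> y \<bullet> d" using csE xy H_mult by blast
  then have "x' \<bullet> y' \<in> Q" using PDr xy by simp
  then have "(x', y') \<in> B" unfolding B_def using x' y' nz by simp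
  then show ?thesis by blast
 qed
 have trR: "transp_on B R"
 proof (rule transp_onI)
  fix p1 p2 p3 assume p: "p1 \<in> B" "p2 \<in> B" "p3 \<in> B" "R p1 p2" "R p2 p3"
  obtain a1 b1 a2 b2 a3 b3 where e: "p1 = (a1, b1)" "p2 = (a2, b2)" "p3 = (a3, b3)"
   by (metis surj_pair)
  have h: "a1 \<in> H" "a2 \<in> H" "a3 \<in> H" using BH p(1-3) e by auto
  have z: "a1 \<bullet> b1 \<in> H" "a2 \<bullet> b2 \<in> H" "a3 \<bullet> b3 \<in> H" using BH p(1-3) e by auto
  show "R p1 p3"
   using p(4,5) tr1[OF z] tr2[OF z] tr3[OF z] tr4[OF z] tr1[OF h] unfolding R_def e prod.case by blast
 qed
 have asR: "asymp_on B R"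
 proof (rule asymp_onI)
  fix p1 p2 assume p: "p1 \<in> B" "p2 \<in> B" "R p1 p2"
  show "\<not> R p2 p1"
  proof
   assume r: "R p2 p1"
   have "R p1 p1" by (rule transp_onD[OF trR p(1,2,1) p(3) r])
   moreover obtain a b where "p1 = (a, b)" by (cases p1)
   ultimately show False using BH[of a b] p(1) irr unfolding R_def by auto
  qed
 qed
 have "\<exists>m\<in>B. \<forall>p\<in>B. p \<noteq> m \<longrightarrow> \<not> R m p"
  by (rule Finite_Set.bex_max_element[OF finB asR trR \<open>B \<noteq> {}\<close>])
 then obtain m where m0: "m \<in> B \<and> (\<forall>p\<in>B. p \<noteq> m \<longrightarrow> \<not> R m p)" unfolding Bex_def by (elim exE)
 have m: "m \<in> B" "\<And>p. p \<in> B \<Longrightarrow> p \<noteq> m \<Longrightarrow> \<not> R m p" using m0 by auto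
 obtain a b where ab: "m = (a, b)" by (cases m)
 have mx: "\<not> R (a, b) p" if "p \<in> B" for p
 proof (cases "p = (a, b)")
  case True
  then show ?thesis using BH[of a b] m(1) ab irr unfolding R_def by auto
 next
  case False then show ?thesis using m that ab by auto
 qed
 have aH: "a \<in> H" and bH: "b \<in> H" and abP: "a \<bullet> b \<in> Q" using BH m(1) ab by auto
 have as: "a \<in> supp u" and nzab: "cmp u a \<otimes> cmp v b \<noteq> \<zero>" using m(1) ab unfolding B_def by auto
 let ?z = "a \<bullet> b"
 have zH: "?z \<in> H" using aH bH by simp
 let ?c = "cmp u a \<otimes> \<delta> (inv\<^sub>G a)"
 have cD: "?c \<in> FS D" by (rule cmp_shift[OF uc aH])
 have cc: "?c \<in> carrier A" using cD FS_carrier by blast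
 have ac: "a \<in> carrier G" and bc: "b \<in> carrier G" using aH bH Hc by auto
 let ?T = "\<lambda>C. cmp (restr u C \<otimes> v) ?z"
 have Tc: "?T C \<in> carrier A" for C using uc vc by simp
 have kill: "?c \<otimes> ?T C = \<zero>" if C: "C \<in> css u" "C \<noteq> cs a" for C
 proof -
  obtain a' where a': "a' \<in> supp u" "C = cs a'" using C unfolding css_def by blast
  have a'H: "a' \<in> H" using a' us by blast
  have a'c: "a' \<in> carrier G" using a'H Hc by blast
  let ?b' = "inv\<^sub>G a' \<bullet> ?z"
  have b'H: "?b' \<in> H" using a'H zH by simp
  have ab': "a' \<bullet> ?b' = ?z" using a'c ac bc by simp
  have T: "?T C = cmp u a' \<otimes> cmp v ?b'" unfolding a'(2) by (rule cmp_mult[OF cmp_FS[OF uc] a'H zH vc])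
  have "\<not> eqv a a'"
  proof
   assume "eqv a a'"
   then have "a' \<in> cs a" unfolding eqv_def cs_def using a'H by simp
   then show False using cs_eq aH C(2) a'(2) by blast
  qed
  then consider "lt a a'" | "lt a' a" using tri[OF aH a'H] by blast
  then show ?thesis
  proof cases
   case 1
   have "cmp u a' \<otimes> cmp v ?b' = \<zero>"
   proof (rule ccontr)
    assume n: "cmp u a' \<otimes> cmp v ?b' \<noteq> \<zero>"
    then have "cmp v ?b' \<noteq> \<zero>" using uc by auto
    then obtain b2 where b2: "b2 \<in> supp v" "b2 \<in> cs ?b'" "cs b2 = cs ?b'" using cmp_nonzero[OF vc b'H] by blast
    have b2H: "b2 \<in> H" using b2 vs by blast
    have "a' \<bullet> b2 \<in> cs ?z" using cs_mult[OF a'H b'H cs_self[OF a'H] b2(2)] ab' by simp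
    then have e: "eqv ?z (a' \<bullet> b2)" unfolding cs_def eqv_def by simp
    have "a' \<bullet> b2 \<in> Q"
     using csE[OF \<open>a' \<bullet> b2 \<in> cs ?z\<close> zH] PDr[OF abP] by metis
    then have "(a', b2) \<in> B" unfolding B_def using a'(1) b2 n by simp
    moreover have "R (a, b) (a', b2)" unfolding R_def using e 1 by simp
    ultimately show False using mx by blast
   qed
   then show ?thesis using T cc by simp
  next
   case 2
   have z0: "cmp u a \<otimes> cmp v ?b' = \<zero>"
   proof (rule ccontr)
    assume n: "cmp u a \<otimes> cmp v ?b' \<noteq> \<zero>"
    then have "cmp v ?b' \<noteq> \<zero>" using uc by auto
    then obtain b2 where b2: "b2 \<in> supp v" "b2 \<in> cs ?b'" "cs b2 = cs ?b'" using cmp_nonzero[OF vc b'H] by blast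
    have b2H: "b2 \<in> H" using b2 vs by blast
    have "a \<bullet> b2 \<in> cs (a \<bullet> ?b')" using cs_mult[OF aH b'H cs_self[OF aH] b2(2)] .
    then have e: "eqv (a \<bullet> ?b') (a \<bullet> b2)" unfolding cs_def eqv_def by simp
    have "lt ?z (a \<bullet> ?b')" using rmult[OF 2 a'H aH b'H] unfolding ab' .
    then have l: "lt ?z (a \<bullet> b2)" using tr2[OF zH _ _ _ e] aH b'H b2H by simp
    then have "?z \<bullet> (inv\<^sub>G ?z \<bullet> (a \<bullet> b2)) \<in> Q" unfolding lt_def by (rule P1(3)[OF abP])
    moreover have "?z \<bullet> (inv\<^sub>G ?z \<bullet> (a \<bullet> b2)) = a \<bullet> b2"
     using ac bc Hc[OF b2H] by (intro G.inv_cancels) auto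
    ultimately have "(a, b2) \<in> B" unfolding B_def using as b2 n by simp
    moreover have "R (a, b) (a, b2)" unfolding R_def using l by simp
    ultimately show False using mx by blast
   qed
   let ?c' = "cmp u a' \<otimes> \<delta> (inv\<^sub>G a')" and ?d' = "cmp v ?b' \<otimes> \<delta> (inv\<^sub>G ?b')"
   have c'D: "?c' \<in> FS D" and d'D: "?d' \<in> FS D" using cmp_shift uc vc a'H b'H by auto
   have b'c: "?b' \<in> carrier G" using b'H Hc by blast
   obtain c' d' c where n: "c' = ?c'" "d' = ?d'" "c = ?c'" by blast
   have dc: "?d' \<in> carrier A" "?c' \<in> carrier A" using c'D d'D FS_carrier by auto
   have "?c \<otimes> cj a ?d' = (cmp u a \<otimes> cmp v ?b') \<otimes> (\<delta> (inv\<^sub>G ?b') \<otimes> \<delta> (inv\<^sub>G a))"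
    using uc vc ac b'c by (simp add: cj_def A.m_assoc)
   then have "?c \<otimes> cj a ?d' = \<zero>" using z0 ac b'c by simp
   then have "?c \<otimes> cj (a' \<bullet> inv\<^sub>G a) (cj a ?d') = \<zero>"
    using annihilate_cj[OF cD cj_FD[OF aH d'D]] a'H aH by simp
   moreover have "a' \<bullet> inv\<^sub>G a \<bullet> a = a'" using ac a'c by (simp add: G.m_assoc)
   ultimately have k: "?c \<otimes> cj a' ?d' = \<zero>" using cj_cj[of "a' \<bullet> inv\<^sub>G a" a ?d'] ac a'c dc by simp
   have "cmp u a' \<otimes> cmp v ?b' = ?c' \<otimes> cj a' ?d' \<otimes> \<delta> (a' \<bullet> ?b')"
    using uc vc a'c b'c by (simp add: cj_def A.m_assoc flip: dl_mult)
   then have "?c \<otimes> ?T C = ?c \<otimes> (?c' \<otimes> cj a' ?d' \<otimes> \<delta> (a' \<bullet> ?b'))" using T by simp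
   also have "\<dots> = (?c \<otimes> ?c') \<otimes> cj a' ?d' \<otimes> \<delta> (a' \<bullet> ?b')"
    using cc dc a'c ac bc by (simp only: A.m_assoc A.m_closed cj_closed dl_closed G.m_closed)
   also have "?c \<otimes> ?c' = ?c' \<otimes> ?c" by (rule FD_commute[OF cD c'D])
   also have "?c' \<otimes> ?c \<otimes> cj a' ?d' \<otimes> \<delta> (a' \<bullet> ?b') = ?c' \<otimes> (?c \<otimes> cj a' ?d') \<otimes> \<delta> (a' \<bullet> ?b')"
    using A.m_assoc[OF dc(2) cc cj_closed[OF a'c dc(1)]] by simp
   also have "\<dots> = \<zero>" using k dc by simp
   finally show ?thesis .
  qed
 qed
 have "cmp (u \<otimes> v) ?z = \<zero>"
 proof -
  have "\<one>\<^sub>G \<notin> cs ?z"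
  proof
   assume "\<one>\<^sub>G \<in> cs ?z"
   then have "inv\<^sub>G ?z \<in> D" unfolding cs_def using ac bc by simp
   then have "inv\<^sub>G (inv\<^sub>G ?z) \<in> D" by (rule D_inv)
   then have "?z \<in> D" using ac bc by (simp only: G.inv_inv G.m_closed)
   then show False using abP P1(2) by blast
  qed
  then show ?thesis unfolding uv by (intro restr_zero) auto
 qed
 moreover have "cmp (u \<otimes> v) ?z = (\<Oplus>C\<in>css u. ?T C)"
 proof -
  have "u \<otimes> v = (\<Oplus>C\<in>css u. restr u C) \<otimes> v" using css_sum[OF u] by simp
  also have "\<dots> = (\<Oplus>C\<in>css u. restr u C \<otimes> v)" using uc vc by (intro A.finsum_ldistr) (auto simp: css_def)
  finally show ?thesis using uc vc by (simp add: restr_finsum css_def)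
 qed
 ultimately have s0: "(\<Oplus>C\<in>css u. ?T C) = \<zero>" by simp
 have fin: "finite (css u)" using uc by (simp add: css_def)
 have "(\<Oplus>C\<in>css u. ?c \<otimes> ?T C) = ?c \<otimes> ?T (cs a)"
 proof -
  have "cs a \<in> css u" using as by (simp add: css_def)
  moreover have "(\<Oplus>C\<in>css u. ?c \<otimes> ?T C) = (\<Oplus>C\<in>css u. if cs a = C then ?c \<otimes> ?T C else \<zero>)"
   by (rule A.finsum_cong'[OF refl]) (use kill cc Tc in auto)
  ultimately show ?thesis
   using A.finsum_singleton[of "cs a" "css u" "\<lambda>C. ?c \<otimes> ?T C"] fin cc Tc by simp
 qed
 moreover have "(\<Oplus>C\<in>css u. ?c \<otimes> ?T C) = ?c \<otimes> (\<Oplus>C\<in>css u. ?T C)"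
  using fin cc Tc by (intro A.finsum_rdistr[symmetric]) auto
 moreover have Ta: "?T (cs a) = cmp u a \<otimes> cmp v b"
 proof -
  have "inv\<^sub>G a \<bullet> ?z = b" using ac bc by simp
  then show ?thesis using cmp_mult[OF cmp_FS[OF uc] aH zH vc] by simp
 qed
 ultimately have c0: "?c \<otimes> (cmp u a \<otimes> cmp v b) = \<zero>" using s0 cc by simp
 let ?d = "cmp v b \<otimes> \<delta> (inv\<^sub>G b)"
 have dD: "?d \<in> FS D" by (rule cmp_shift[OF vc bH])
 have dc: "?d \<in> carrier A" using dD FS_carrier by blast
 have e: "cmp u a \<otimes> cmp v b = (?c \<otimes> cj a ?d) \<otimes> \<delta> ?z"
  using uc vc ac bc by (simp add: cj_def A.m_assoc flip: dl_mult)
 have wD: "?c \<otimes> cj a ?d \<in> FS D" by (rule FD_mult[OF cD cj_FD[OF aH dD]])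
 have wc: "?c \<otimes> cj a ?d \<in> carrier A" using wD FS_carrier by blast
 have "?c \<otimes> (?c \<otimes> cj a ?d) = (?c \<otimes> ((?c \<otimes> cj a ?d) \<otimes> \<delta> ?z)) \<otimes> \<delta> (inv\<^sub>G ?z)"
 proof -
  have zc: "?z \<in> carrier G" using ac bc by simp
  have "(?c \<otimes> ((?c \<otimes> cj a ?d) \<otimes> \<delta> ?z)) \<otimes> \<delta> (inv\<^sub>G ?z) = ?c \<otimes> ((?c \<otimes> cj a ?d) \<otimes> (\<delta> ?z \<otimes> \<delta> (inv\<^sub>G ?z)))"
   using cc wc by (simp only: A.m_assoc A.m_closed dl_closed)
  then show ?thesis using wc dl_inv(1)[OF zc] by simp
 qed
 then have cw: "?c \<otimes> (?c \<otimes> cj a ?d) = \<zero>" using c0 e by simp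
 have "(?c \<otimes> cj a ?d) \<otimes> (?c \<otimes> cj a ?d) = (cj a ?d \<otimes> ?c) \<otimes> (?c \<otimes> cj a ?d)"
  using FD_commute[OF cD cj_FD[OF aH dD]] by simp
 also have "\<dots> = cj a ?d \<otimes> (?c \<otimes> (?c \<otimes> cj a ?d))"
  using cc wc cj_closed[OF ac dc] by (intro A.m_assoc)
 also have "\<dots> = \<zero>" using cw cj_closed[OF ac dc] by simp
 finally have "?c \<otimes> cj a ?d = \<zero>" using reduced[OF wD] by simp
 then show False using nzab e by simp
qed

text \<open>
  The opposite of a positive cone is again a positive cone, so total degrees on both sides of zero are
  covered.
\<close>

lemma zero_products:
 assumes u: "u \<in> FS H" and v: "v \<in> FS H" and uv: "u \<otimes> v = \<one>"
  and xy: "x \<in> H" "y \<in> H" "x \<bullet> y \<notin> D"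
 shows "cmp u x \<otimes> cmp v y = \<zero>"
proof -
 let ?P = "{x \<in> H. inv\<^sub>G x \<in> P}"
 have iH: "inv\<^bsub>G\<lparr>carrier := H\<rparr>\<^esub> h = inv\<^sub>G h" if "h \<in> H" for h
  using G.m_inv_consistent[OF H that] .
 have P1: "P \<subseteq> H" "P \<inter> D = {}" "\<And>x y. x \<in> P \<Longrightarrow> y \<in> P \<Longrightarrow> x \<bullet> y \<in> P"
  "\<And>d x. d \<in> D \<Longrightarrow> x \<in> P \<Longrightarrow> d \<bullet> x \<in> P"
  "\<And>h x. h \<in> H \<Longrightarrow> x \<in> P \<Longrightarrow> h \<bullet> x \<bullet> inv\<^sub>G h \<in> P"
  "\<And>x. x \<in> H \<Longrightarrow> x \<in> D \<or> x \<in> P \<or> inv\<^sub>G x \<in> P"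
  using cone unfolding positive_cone_def by (auto simp: iH)
 have "positive_cone (G\<lparr>carrier := H\<rparr>) D H ?P"
  unfolding positive_cone_def
 proof (intro conjI ballI)
  show "?P \<inter> D = {}" using P1(2) D_inv by blast
  fix x assume x: "x \<in> ?P"
  then have xc: "x \<in> carrier G" "x \<in> H" using Hc by auto
  show "x \<otimes>\<^bsub>G\<lparr>carrier := H\<rparr>\<^esub> y \<in> ?P" if "y \<in> ?P" for y
   using x that P1(3) by (simp add: G.inv_mult_group Hc)
  show "d \<otimes>\<^bsub>G\<lparr>carrier := H\<rparr>\<^esub> x \<in> ?P" if d: "d \<in> D" for d
  proof -
   have "inv\<^sub>G x \<bullet> inv\<^sub>G d = (inv\<^sub>G x \<bullet> inv\<^sub>G d \<bullet> inv\<^sub>G (inv\<^sub>G x)) \<bullet> inv\<^sub>G x"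
    using xc d by (simp add: G.m_assoc Dc)
   moreover have "(inv\<^sub>G x \<bullet> inv\<^sub>G d \<bullet> inv\<^sub>G (inv\<^sub>G x)) \<bullet> inv\<^sub>G x \<in> P"
    using x d by (intro P1(4) Dn) auto
   ultimately have "inv\<^sub>G x \<bullet> inv\<^sub>G d \<in> P" by metis
   then show ?thesis using x d DH by (auto simp: G.inv_mult_group Hc Dc)
  qed
  show "h \<otimes>\<^bsub>G\<lparr>carrier := H\<rparr>\<^esub> x \<otimes>\<^bsub>G\<lparr>carrier := H\<rparr>\<^esub> inv\<^bsub>G\<lparr>carrier := H\<rparr>\<^esub> h \<in> ?P" if "h \<in> carrier (G\<lparr>carrier := H\<rparr>)" for h
   using P1(5)[of h "inv\<^sub>G x"] that x by (simp add: iH G.inv_mult_group Hc G.m_assoc)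
 next
  fix x assume "x \<in> H"
  then show "x \<in> D \<or> x \<in> ?P \<or> inv\<^bsub>G\<lparr>carrier := H\<rparr>\<^esub> x \<in> ?P" using P1(6)[of x] by (auto simp: iH Hc)
 qed auto
 then have "inv\<^sub>G (x \<bullet> y) \<in> P \<Longrightarrow> ?thesis"
  using zero_products_above[where Q = ?P, OF _ u v uv xy(1,2)] xy by simp
 then show ?thesis
  using zero_products_above[OF cone u v uv xy(1,2)] P1(6)[of "x \<bullet> y"] xy by auto
qed

end

section \<open>Commutators of graded units\<close>

lemma (in group) lower_central_series_decreasing:
 "lower_central_series G (Suc n) \<subseteq> lower_central_series G n"
proof (induction n)
 case 0 then show ?case using subgroup.subset[OF lower_central_series_subgroup, of "Suc 0"] by simp
next
 case (Suc n)
 have "(\<Union>x\<in>lower_central_series G (Suc n). \<Union>y\<in>carrier G. {comm_of G x y}) \<subseteq> lower_central_series G (Suc n)"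
  using lower_central_series_commutator[of _ n] Suc by blast
 then show ?case
  using generate_subgroup_incl[OF _ lower_central_series_subgroup]
  by (subst lower_central_series.simps(2)) blast
qed

lemma (in monoid) inv_mult_of_Units:
 assumes "x \<in> Units G" "y \<in> Units G" shows "inv (x \<otimes> y) = inv y \<otimes> inv x"
proof (rule inv_char)
 have c: "x \<in> carrier G" "y \<in> carrier G" "inv x \<in> carrier G" "inv y \<in> carrier G"
  using assms by (auto simp: Units_closed)
 have "x \<otimes> y \<otimes> (inv y \<otimes> inv x) = x \<otimes> (y \<otimes> inv y) \<otimes> inv x" using c by (simp add: m_assoc)
 then show "x \<otimes> y \<otimes> (inv y \<otimes> inv x) = \<one>" using assms c by simp
 have "inv y \<otimes> inv x \<otimes> (x \<otimes> y) = inv y \<otimes> (inv x \<otimes> x) \<otimes> y" using c by (simp add: m_assoc)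
 then show "inv y \<otimes> inv x \<otimes> (x \<otimes> y) = \<one>" using assms c by simp
qed (use assms in \<open>auto simp: Units_closed\<close>)

context graded_units
begin

lemma cmp_mult_inverse:
 assumes u: "u \<in> FS H" and v: "v \<in> FS H" and uv: "u \<otimes> v = \<one>" and x: "x \<in> H"
 shows "cmp u x \<otimes> v = cmp u x \<otimes> cmp v (inv\<^sub>G x)" "u \<otimes> cmp v x = cmp u (inv\<^sub>G x) \<otimes> cmp v x"
proof -
 have uc: "u \<in> carrier A" and vc: "v \<in> carrier A" using u v FS_carrier by auto
 have us: "supp u \<subseteq> H" and vs: "supp v \<subseteq> H" using u v FS_supp by auto
 have cx: "cs (inv\<^sub>G x) = cs y" if "y \<in> H" "x \<bullet> y \<in> D" for y
  using cs_eq[of y "inv\<^sub>G x"] that x by (simp add: cs_def Hc)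
 have cx': "cs (inv\<^sub>G x) = cs y" if y: "y \<in> H" "y \<bullet> x \<in> D" for y
 proof (rule cx[OF y(1)])
  have "x \<bullet> (y \<bullet> x) \<bullet> inv\<^sub>G x \<in> D" using Dn x y by blast
  then show "x \<bullet> y \<in> D" using x y by (simp add: Hc G.m_assoc)
 qed
 have rest: "w \<otimes> r = w \<otimes> cmp r (inv\<^sub>G x)"
  if w: "w \<in> carrier A" and r: "r \<in> FS H" and z: "\<And>y. y \<in> supp r \<Longrightarrow> cs y \<noteq> cs (inv\<^sub>G x) \<Longrightarrow> w \<otimes> cmp r y = \<zero>" for w r
 proof -
  have rc: "r \<in> carrier A" using r FS_carrier by auto
  have "w \<otimes> r = w \<otimes> (\<Oplus>C\<in>css r. restr r C)" using css_sum[OF r] by simp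
  also have "\<dots> = (\<Oplus>C\<in>css r. w \<otimes> restr r C)" using w rc by (intro A.finsum_rdistr) (auto simp: css_def)
  also have "\<dots> = (\<Oplus>C\<in>css r. if cs (inv\<^sub>G x) = C then w \<otimes> restr r C else \<zero>)"
   using w rc z by (intro A.finsum_cong'[OF refl]) (auto simp: css_def)
  also have "\<dots> = w \<otimes> cmp r (inv\<^sub>G x)"
  proof (cases "cs (inv\<^sub>G x) \<in> css r")
   case True
   then show ?thesis using A.finsum_singleton[OF True, of "\<lambda>C. w \<otimes> restr r C"] w rc by (simp add: css_def)
  next
   case False
   have "supp r \<inter> cs (inv\<^sub>G x) = {}" using False cs_eq x H_inv unfolding css_def by blast
   then have "cmp r (inv\<^sub>G x) = \<zero>" using rc by (intro restr_zero) auto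
   moreover have "(\<Oplus>C\<in>css r. if cs (inv\<^sub>G x) = C then w \<otimes> restr r C else \<zero>) = \<zero>"
    using False by (intro A.add.finprod_one_eqI) auto
   ultimately show ?thesis using w by simp
  qed
  finally show ?thesis .
 qed
 have rest': "r \<otimes> w = cmp r (inv\<^sub>G x) \<otimes> w"
  if w: "w \<in> carrier A" and r: "r \<in> FS H" and z: "\<And>y. y \<in> supp r \<Longrightarrow> cs y \<noteq> cs (inv\<^sub>G x) \<Longrightarrow> cmp r y \<otimes> w = \<zero>" for w r
 proof -
  have rc: "r \<in> carrier A" using r FS_carrier by auto
  have "r \<otimes> w = (\<Oplus>C\<in>css r. restr r C) \<otimes> w" using css_sum[OF r] by simp
  also have "\<dots> = (\<Oplus>C\<in>css r. restr r C \<otimes> w)" using w rc by (intro A.finsum_ldistr) (auto simp: css_def)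
  also have "\<dots> = (\<Oplus>C\<in>css r. if cs (inv\<^sub>G x) = C then restr r C \<otimes> w else \<zero>)"
   using w rc z by (intro A.finsum_cong'[OF refl]) (auto simp: css_def)
  also have "\<dots> = cmp r (inv\<^sub>G x) \<otimes> w"
  proof (cases "cs (inv\<^sub>G x) \<in> css r")
   case True
   then show ?thesis using A.finsum_singleton[OF True, of "\<lambda>C. restr r C \<otimes> w"] w rc by (simp add: css_def)
  next
   case False
   have "supp r \<inter> cs (inv\<^sub>G x) = {}" using False cs_eq x H_inv unfolding css_def by blast
   then have "cmp r (inv\<^sub>G x) = \<zero>" using rc by (intro restr_zero) auto
   moreover have "(\<Oplus>C\<in>css r. if cs (inv\<^sub>G x) = C then restr r C \<otimes> w else \<zero>) = \<zero>"
    using False by (intro A.add.finprod_one_eqI) auto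
   ultimately show ?thesis using w by simp
  qed
  finally show ?thesis .
 qed
 show "cmp u x \<otimes> v = cmp u x \<otimes> cmp v (inv\<^sub>G x)"
 proof (rule rest[OF _ v])
  fix y assume y: "y \<in> supp v" "cs y \<noteq> cs (inv\<^sub>G x)"
  then have yH: "y \<in> H" using vs by blast
  show "cmp u x \<otimes> cmp v y = \<zero>" using zero_products[OF u v uv x yH] cx[OF yH] y(2) by metis
 qed (simp add: uc)
 show "u \<otimes> cmp v x = cmp u (inv\<^sub>G x) \<otimes> cmp v x"
 proof (rule rest'[OF _ u])
  fix y assume y: "y \<in> supp u" "cs y \<noteq> cs (inv\<^sub>G x)"
  then have yH: "y \<in> H" using us by blast
  show "cmp u y \<otimes> cmp v x = \<zero>" using zero_products[OF u v uv yH x] cx'[OF yH] y(2) by metis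
 qed (simp add: vc)
qed

text \<open>
  Because components of nonzero total degree annihilate each other, the products of opposite components of
  \<open>u\<close> and \<open>v\<close> are orthogonal idempotents with sum one. On each of the corresponding
  direct factors \<open>u\<close> is homogeneous. This is the substitute for units being trivial in the group
  algebra of an ordered group over a field.
\<close>

lemma unit_decomposition:
 assumes u: "u \<in> FS H" and v: "v \<in> FS H" and uv: "u \<otimes> v = \<one>" and vu: "v \<otimes> u = \<one>"
 shows "\<exists>(I :: 'g set set) e r. finite I \<and> (\<Oplus>i\<in>I. e i) = \<one> \<and>
  (\<forall>i\<in>I. r i \<in> supp u \<and> e i \<in> FS D \<and> e i \<otimes> e i = e i \<and>
   e i \<otimes> u \<in> FS (cs (r i)) \<and> e i \<otimes> v \<in> FS (cs (inv\<^sub>G (r i))))"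
proof -
 have uc: "u \<in> carrier A" and vc: "v \<in> carrier A" using u v FS_carrier by auto
 have us: "supp u \<subseteq> H" using u FS_supp by auto
 have fin: "finite (css u)" using uc by (simp add: css_def)
 have "\<forall>C \<in> css u. \<exists>x. x \<in> supp u \<and> C = cs x" unfolding css_def by blast
 then obtain r where r: "\<And>C. C \<in> css u \<Longrightarrow> r C \<in> supp u \<and> C = cs (r C)" by metis
 let ?e = "\<lambda>C. restr u C \<otimes> v"
 have ec: "?e C \<in> carrier A" for C using uc vc by simp
 have sum: "(\<Oplus>C\<in>css u. ?e C) = \<one>"
 proof -
  have "(\<Oplus>C\<in>css u. ?e C) = (\<Oplus>C\<in>css u. restr u C) \<otimes> v"
   using uc vc fin by (intro A.finsum_ldistr[symmetric]) auto
  then show ?thesis using css_sum[OF u] uv by simp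
 qed
 have rH: "r C \<in> H" if "C \<in> css u" for C using r[OF that] us by blast
 have eD: "?e C \<in> FS D" if C: "C \<in> css u" for C
 proof -
  have "?e C = cmp u (r C) \<otimes> cmp v (inv\<^sub>G (r C))"
   using cmp_mult_inverse(1)[OF u v uv rH[OF C]] r[OF C] by simp
  then show ?thesis
   using FS_cs_mult[OF _ _ cmp_FS[OF uc] cmp_FS[OF vc], of "r C" "inv\<^sub>G (r C)"] rH[OF C] by (simp add: Hc cs_one)
 qed
 have orth: "?e C \<otimes> ?e C' = \<zero>" if C: "C \<in> css u" "C' \<in> css u" "C \<noteq> C'" for C C'
 proof -
  let ?x = "r C" and ?y = "r C'"
  have "?x \<bullet> inv\<^sub>G ?y \<notin> D"
  proof
   assume a: "?x \<bullet> inv\<^sub>G ?y \<in> D"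
   have "inv\<^sub>G ?y \<bullet> (?x \<bullet> inv\<^sub>G ?y) \<bullet> inv\<^sub>G (inv\<^sub>G ?y) \<in> D" by (rule Dn[OF H_inv[OF rH[OF C(2)]] a])
   then have "?x \<in> cs ?y" using rH[OF C(1)] rH[OF C(2)] by (simp add: cs_def Hc G.m_assoc)
   then show False using cs_eq[OF _ rH[OF C(2)]] r C by metis
  qed
  then have z: "cmp u ?x \<otimes> cmp v (inv\<^sub>G ?y) = \<zero>"
   using zero_products[OF u v uv rH[OF C(1)]] rH[OF C(2)] by simp
  have vy: "v \<otimes> cmp u ?y = cmp v (inv\<^sub>G ?y) \<otimes> cmp u ?y"
   by (rule cmp_mult_inverse(2)[OF v u vu rH[OF C(2)]])
  have "?e C \<otimes> ?e C' = cmp u ?x \<otimes> (v \<otimes> cmp u ?y) \<otimes> v"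
   using r C uc vc by (simp add: A.m_assoc)
  also have "\<dots> = (cmp u ?x \<otimes> cmp v (inv\<^sub>G ?y)) \<otimes> (cmp u ?y \<otimes> v)"
   unfolding vy using uc vc by (simp add: A.m_assoc)
  finally show ?thesis using z uc vc by simp
 qed
 have idem: "?e C \<otimes> ?e C = ?e C" if C: "C \<in> css u" for C
 proof -
  have "?e C = ?e C \<otimes> (\<Oplus>C\<in>css u. ?e C)" using sum ec by simp
  also have "\<dots> = (\<Oplus>C'\<in>css u. ?e C \<otimes> ?e C')" using ec fin by (intro A.finsum_rdistr) auto
  also have "\<dots> = (\<Oplus>C'\<in>css u. if C = C' then ?e C \<otimes> ?e C' else \<zero>)"
   by (rule A.finsum_cong'[OF refl]) (use orth[OF C] ec in auto)
  also have "\<dots> = ?e C \<otimes> ?e C" using A.finsum_singleton[OF C fin, of "\<lambda>C'. ?e C \<otimes> ?e C'"] ec by simp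
  finally show ?thesis by simp
 qed
 have eu: "?e C \<otimes> u = restr u C" for C using uc vc vu by (simp add: A.m_assoc)
 show ?thesis
 proof (intro exI[of _ "css u"] exI[of _ ?e] exI[of _ r] conjI ballI)
  fix C assume C: "C \<in> css u"
  show "r C \<in> supp u" using r C by blast
  show "?e C \<otimes> u \<in> FS (cs (r C))" unfolding eu using r[OF C] uc by (auto simp: FS_def supp_restr)
  have "?e C \<otimes> v = v \<otimes> ?e C" using idempotent_commutes[OF eD[OF C] idem[OF C] v] by simp
  also have "\<dots> = (v \<otimes> cmp u (r C)) \<otimes> v" using r[OF C] uc vc by (simp add: A.m_assoc)
  also have "\<dots> = cmp v (inv\<^sub>G (r C)) \<otimes> (cmp u (r C) \<otimes> v)"
   unfolding cmp_mult_inverse(2)[OF v u vu rH[OF C]] using uc vc by (simp add: A.m_assoc)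
  finally have e: "?e C \<otimes> v = cmp v (inv\<^sub>G (r C)) \<otimes> ?e C" using r[OF C] by simp
  have "?e C \<in> FS (cs \<one>\<^sub>G)" using eD[OF C] by (simp add: cs_one)
  then show "?e C \<otimes> v \<in> FS (cs (inv\<^sub>G (r C)))"
   unfolding e using FS_cs_mult[OF _ H_one cmp_FS[OF vc], of "inv\<^sub>G (r C)" "?e C"] rH[OF C] by (simp add: Hc)
  show "?e C \<in> FS D" by (rule eD[OF C])
  show "?e C \<otimes> ?e C = ?e C" by (rule idem[OF C])
 qed (use fin sum in auto)
qed

lemma split_by_idempotents:
 assumes "finite I" "\<And>i. i \<in> I \<Longrightarrow> e i \<in> carrier A" "(\<Oplus>i\<in>I. e i) = \<one>" "w \<in> carrier A"
 shows "w = (\<Oplus>i\<in>I. e i \<otimes> w)"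
proof -
 have "w = (\<Oplus>i\<in>I. e i) \<otimes> w" using assms by simp
 also have "\<dots> = (\<Oplus>i\<in>I. e i \<otimes> w)" using assms by (intro A.finsum_ldistr) auto
 finally show ?thesis .
qed

text \<open>
  On a common refinement of the two decompositions both units are homogeneous, so their commutator is
  homogeneous of the degree given by a commutator of the group.
\<close>

lemma commutator_support:
 assumes u: "u \<in> FS H" "u' \<in> FS H" "u \<otimes> u' = \<one>" "u' \<otimes> u = \<one>"
  and v: "v \<in> FS H" "v' \<in> FS H" "v \<otimes> v' = \<one>" "v' \<otimes> v = \<one>"
  and W: "\<And>x y. x \<in> supp u \<Longrightarrow> y \<in> supp v \<Longrightarrow> cs (comm_of G x y) \<subseteq> W"
 shows "u \<otimes> v \<otimes> u' \<otimes> v' \<in> FS W"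
proof -
 have c: "u \<in> carrier A" "u' \<in> carrier A" "v \<in> carrier A" "v' \<in> carrier A" using u v FS_carrier by auto
 have us: "supp u \<subseteq> H" and vs: "supp v \<subseteq> H" using u v FS_supp by auto
 obtain I e r where e0: "finite (I :: 'g set set)" "(\<Oplus>i\<in>I. e i) = \<one>"
  and e1: "\<forall>i\<in>I. r i \<in> supp u \<and> e i \<in> FS D \<and> e i \<otimes> e i = e i \<and>
   e i \<otimes> u \<in> FS (cs (r i)) \<and> e i \<otimes> u' \<in> FS (cs (inv\<^sub>G (r i)))"
  using unit_decomposition[OF u] by (elim exE conjE) (rule that)
 note e = e0 e1[THEN bspec, THEN conjunct1] e1[THEN bspec, THEN conjunct2, THEN conjunct1]
  e1[THEN bspec, THEN conjunct2, THEN conjunct2, THEN conjunct1]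
  e1[THEN bspec, THEN conjunct2, THEN conjunct2, THEN conjunct2, THEN conjunct1]
  e1[THEN bspec, THEN conjunct2, THEN conjunct2, THEN conjunct2, THEN conjunct2]
 obtain J f s where f0: "finite (J :: 'g set set)" "(\<Oplus>i\<in>J. f i) = \<one>"
  and f1: "\<forall>i\<in>J. s i \<in> supp v \<and> f i \<in> FS D \<and> f i \<otimes> f i = f i \<and>
   f i \<otimes> v \<in> FS (cs (s i)) \<and> f i \<otimes> v' \<in> FS (cs (inv\<^sub>G (s i)))"
  using unit_decomposition[OF v] by (elim exE conjE) (rule that)
 note f = f0 f1[THEN bspec, THEN conjunct1] f1[THEN bspec, THEN conjunct2, THEN conjunct1]
  f1[THEN bspec, THEN conjunct2, THEN conjunct2, THEN conjunct1]
  f1[THEN bspec, THEN conjunct2, THEN conjunct2, THEN conjunct2, THEN conjunct1]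
  f1[THEN bspec, THEN conjunct2, THEN conjunct2, THEN conjunct2, THEN conjunct2]
 have ec: "\<And>i. i \<in> I \<Longrightarrow> e i \<in> carrier A" and fc: "\<And>i. i \<in> J \<Longrightarrow> f i \<in> carrier A"
  using e(4) f(4) FS_carrier by auto
 have piece: "e i \<otimes> (f j \<otimes> (u \<otimes> v \<otimes> u' \<otimes> v')) \<in> FS W" if i: "i \<in> I" and j: "j \<in> J" for i j
 proof -
  let ?E = "e i" and ?F = "f j"
  have E: "?E \<in> carrier A" "?F \<in> carrier A" using ec fc i j by auto
  have FH: "w \<otimes> ?F = ?F \<otimes> w" "w \<otimes> ?E = ?E \<otimes> w" if "w \<in> FS H" for w
   using idempotent_commutes[OF f(4,5)[OF j] that] idempotent_commutes[OF e(4,5)[OF i] that] by auto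
  have FE: "?E \<otimes> ?F = ?F \<otimes> ?E" by (rule FD_commute) (use e(4) f(4) i j in auto)
  obtain a b where a: "a = ?E" and b: "b = ?F" by blast
  have ab: "a \<in> carrier A" "b \<in> carrier A" "a \<otimes> a = a" "b \<otimes> b = b" "a \<otimes> b = b \<otimes> a" using a b E FE e(5)[OF i] f(5)[OF j] by auto
  have cm: "u' \<otimes> a = a \<otimes> u'" "v \<otimes> a = a \<otimes> v" "u \<otimes> b = b \<otimes> u" "u' \<otimes> b = b \<otimes> u'"
   "v \<otimes> b = b \<otimes> v" "u \<otimes> a = a \<otimes> u"
   using FH u v a b by auto
  have "(a \<otimes> u) \<otimes> (b \<otimes> v) \<otimes> ((a \<otimes> u') \<otimes> (b \<otimes> v')) = a \<otimes> (b \<otimes> (u \<otimes> v \<otimes> u' \<otimes> v'))"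
  proof -
   have "(a \<otimes> u) \<otimes> (b \<otimes> v) \<otimes> ((a \<otimes> u') \<otimes> (b \<otimes> v')) = a \<otimes> (u \<otimes> b) \<otimes> (v \<otimes> a) \<otimes> (u' \<otimes> b) \<otimes> v'"
    using c ab(1,2) by (simp add: A.m_assoc)
   also have "\<dots> = a \<otimes> b \<otimes> (u \<otimes> a) \<otimes> (v \<otimes> b) \<otimes> u' \<otimes> v'"
    unfolding cm(2,3,4) using c ab(1,2) by (simp add: A.m_assoc)
   also have "\<dots> = a \<otimes> (b \<otimes> a) \<otimes> (u \<otimes> b) \<otimes> v \<otimes> u' \<otimes> v'"
    unfolding cm(5,6) using c ab(1,2) by (simp add: A.m_assoc)
   also have "\<dots> = (a \<otimes> a) \<otimes> (b \<otimes> b) \<otimes> u \<otimes> v \<otimes> u' \<otimes> v'"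
    unfolding cm(3) ab(5)[symmetric] using c ab(1,2) by (simp add: A.m_assoc)
   also have "\<dots> = a \<otimes> (b \<otimes> (u \<otimes> v \<otimes> u' \<otimes> v'))"
    unfolding ab(3,4) using c ab(1,2) by (simp add: A.m_assoc)
   finally show ?thesis .
  qed
  then have eq: "?E \<otimes> (?F \<otimes> (u \<otimes> v \<otimes> u' \<otimes> v')) = (?E \<otimes> u) \<otimes> (?F \<otimes> v) \<otimes> ((?E \<otimes> u') \<otimes> (?F \<otimes> v'))"
   unfolding a b by (rule sym)
  have rs: "r i \<in> H" "s j \<in> H" using e(3)[OF i] f(3)[OF j] us vs by auto
  have "(?E \<otimes> u) \<otimes> (?F \<otimes> v) \<otimes> ((?E \<otimes> u') \<otimes> (?F \<otimes> v')) \<in>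
    FS (cs ((r i \<bullet> s j) \<bullet> (inv\<^sub>G (r i) \<bullet> inv\<^sub>G (s j))))"
   using rs by (intro FS_cs_mult e(6,7)[OF i] f(6,7)[OF j] H_mult H_inv)
  moreover have "(r i \<bullet> s j) \<bullet> (inv\<^sub>G (r i) \<bullet> inv\<^sub>G (s j)) = comm_of G (r i) (s j)"
   using rs by (simp add: G.m_assoc Hc)
  ultimately have "(?E \<otimes> u) \<otimes> (?F \<otimes> v) \<otimes> ((?E \<otimes> u') \<otimes> (?F \<otimes> v')) \<in> FS (cs (comm_of G (r i) (s j)))"
   by (simp only:)
  then show ?thesis unfolding eq by (rule FS_mono[OF _ W[OF e(3)[OF i] f(3)[OF j]]])
 qed
 let ?w = "u \<otimes> v \<otimes> u' \<otimes> v'"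
 have wc: "?w \<in> carrier A" using c by simp
 have "(\<Oplus>i\<in>I. e i \<otimes> (\<Oplus>j\<in>J. f j \<otimes> ?w)) \<in> FS W"
 proof (rule FS_finsum[OF e(1)])
  fix i assume i: "i \<in> I"
  have "e i \<otimes> (\<Oplus>j\<in>J. f j \<otimes> ?w) = (\<Oplus>j\<in>J. e i \<otimes> (f j \<otimes> ?w))"
   using ec[OF i] fc wc f(1) by (intro A.finsum_rdistr) auto
  then show "e i \<otimes> (\<Oplus>j\<in>J. f j \<otimes> ?w) \<in> FS W" using piece[OF i] f(1) by (simp add: FS_finsum)
 qed
 then show ?thesis
  using split_by_idempotents[OF f(1) fc f(2) wc] split_by_idempotents[OF e(1) ec e(2) wc] by simp
qed

text \<open>
  On a factor where \<open>v\<close> is homogeneous it acts on \<open>u\<close> by the identity or by raising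
  to the power \<open>q + 1\<close>; the commutator is then trivial or the \<open>q\<close>-th power of the
  inverse of \<open>u\<close>.
\<close>

lemma commutator_exponent:
 assumes u: "u \<in> FS D" "u' \<in> FS D" "u \<otimes> u' = \<one>" "u' \<otimes> u = \<one>"
  and v: "v \<in> FS H" "v' \<in> FS H" "v \<otimes> v' = \<one>" "v' \<otimes> v = \<one>"
  and n: "u [^] (q * n) = \<one>"
 shows "(u \<otimes> v \<otimes> u' \<otimes> v') [^] n = \<one>"
proof -
 have c: "u \<in> carrier A" "u' \<in> carrier A" "v \<in> carrier A" "v' \<in> carrier A" using u v FS_carrier by auto
 have vs: "supp v \<subseteq> H" using v FS_supp by auto
 obtain J f s where f0: "finite (J :: 'g set set)" "(\<Oplus>i\<in>J. f i) = \<one>"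
  and f1: "\<forall>i\<in>J. s i \<in> supp v \<and> f i \<in> FS D \<and> f i \<otimes> f i = f i \<and>
   f i \<otimes> v \<in> FS (cs (s i)) \<and> f i \<otimes> v' \<in> FS (cs (inv\<^sub>G (s i)))"
  using unit_decomposition[OF v] by (elim exE conjE) (rule that)
 note f = f0 f1[THEN bspec, THEN conjunct1] f1[THEN bspec, THEN conjunct2, THEN conjunct1]
  f1[THEN bspec, THEN conjunct2, THEN conjunct2, THEN conjunct1]
  f1[THEN bspec, THEN conjunct2, THEN conjunct2, THEN conjunct2, THEN conjunct1]
  f1[THEN bspec, THEN conjunct2, THEN conjunct2, THEN conjunct2, THEN conjunct2]
 have fc: "\<And>i. i \<in> J \<Longrightarrow> f i \<in> carrier A" using f(4) FS_carrier by auto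
 let ?w = "u \<otimes> v \<otimes> u' \<otimes> v'"
 have wc: "?w \<in> carrier A" using c by simp
 have u'n: "u' [^] (q * n) = \<one>"
 proof -
  have "(u \<otimes> u') [^] (q * n) = u [^] (q * n) \<otimes> u' [^] (q * n)"
   using A.pow_mult_distrib[of u u'] u(3,4) c by simp
  then show ?thesis using n u(3) c by simp
 qed
 have "f j \<otimes> ?w [^] n = f j" if j: "j \<in> J" for j
 proof -
  let ?s = "s j" and ?f = "f j"
  have sH: "?s \<in> H" using f(3)[OF j] vs by blast
  have sc: "?s \<in> carrier G" using sH Hc by blast
  let ?d = "(?f \<otimes> v) \<otimes> \<delta> (inv\<^sub>G ?s)" and ?d' = "\<delta> ?s \<otimes> (?f \<otimes> v')"
  have dD: "?d \<in> FS D"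
   using FS_cs_mult[OF sH H_inv[OF sH] f(6)[OF j] FS_single[OF _ cs_self]] sH by (simp add: Hc cs_one)
  have d'D: "?d' \<in> FS D"
   using FS_cs_mult[OF sH H_inv[OF sH] FS_single[OF _ cs_self] f(7)[OF j]] sH by (simp add: Hc cs_one)
  have fcj: "?f \<in> carrier A" using fc j by blast
  have dc: "?d \<in> carrier A" "?d' \<in> carrier A" using dD d'D FS_carrier by auto
  have comf: "w \<otimes> ?f = ?f \<otimes> w" if "w \<in> FS H" for w by (rule idempotent_commutes[OF f(4,5)[OF j] that])
  have uH: "u \<in> FS H" "u' \<in> FS H" using u DH FS_mono by auto
  have dd: "?d \<otimes> ?d' = ?f"
  proof -
   have "?d \<otimes> ?d' = ?f \<otimes> (v \<otimes> ?f) \<otimes> v'" using fcj c sc by (simp add: A.m_assoc)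
   also have "\<dots> = (?f \<otimes> ?f) \<otimes> (v \<otimes> v')" unfolding comf[OF v(1)] using fcj c by (simp add: A.m_assoc)
   also have "\<dots> = ?f" using f(5)[OF j] v(3) fcj by simp
   finally show ?thesis .
  qed
  let ?z = "u \<otimes> cj ?s u'"
  have cjD: "cj ?s u' \<in> FS D" by (rule cj_FD[OF sH u(2)])
  have zD: "?z \<in> FS D" by (rule FD_mult[OF u(1) cjD])
  have cjc: "cj ?s u' \<in> carrier A" and zc: "?z \<in> carrier A" using cjD zD FS_carrier by auto
  have "?d \<otimes> cj ?s u' \<otimes> ?d' = ?f \<otimes> v \<otimes> (u' \<otimes> ?f) \<otimes> v'"
   using fcj c sc by (simp add: A.m_assoc cj_def)
  also have "\<dots> = ?f \<otimes> (v \<otimes> ?f) \<otimes> u' \<otimes> v'" unfolding comf[OF uH(2)] using fcj c by (simp add: A.m_assoc)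
  also have "\<dots> = (?f \<otimes> ?f) \<otimes> (v \<otimes> u' \<otimes> v')" unfolding comf[OF v(1)] using fcj c by (simp add: A.m_assoc)
  finally have dcd: "?d \<otimes> cj ?s u' \<otimes> ?d' = ?f \<otimes> (v \<otimes> u' \<otimes> v')" unfolding f(5)[OF j] .
  have "?d \<otimes> cj ?s u' \<otimes> ?d' = (?d \<otimes> ?d') \<otimes> cj ?s u'"
   using FD_commute[OF cjD d'D] A.m_assoc[OF dc(1) cjc dc(2)] A.m_assoc[OF dc(1) dc(2) cjc] by simp
  then have fv: "?f \<otimes> (v \<otimes> u' \<otimes> v') = ?f \<otimes> cj ?s u'" using dcd dd by simp
  have fw: "?f \<otimes> ?w = ?f \<otimes> ?z"
  proof -
   have "?f \<otimes> ?w = (?f \<otimes> u) \<otimes> (v \<otimes> u' \<otimes> v')" using fcj c by (simp add: A.m_assoc)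
   also have "\<dots> = u \<otimes> (?f \<otimes> (v \<otimes> u' \<otimes> v'))" unfolding comf[OF uH(1), symmetric] using fcj c by (simp add: A.m_assoc)
   also have "\<dots> = (u \<otimes> ?f) \<otimes> cj ?s u'" unfolding fv using fcj c cjc by (simp add: A.m_assoc)
   also have "\<dots> = ?f \<otimes> ?z" unfolding comf[OF uH(1)] using fcj c cjc by (simp add: A.m_assoc)
   finally show ?thesis .
  qed
  have "?f \<otimes> ?w [^] k = ?f \<otimes> ?z [^] k" for k :: nat
  proof (induction k)
   case 0 then show ?case by simp
  next
   case (Suc k)
   have zk: "?z [^] k \<otimes> ?f = ?f \<otimes> ?z [^] k"
    by (rule FD_commute[OF FS_subgroup_pow[OF D zD] f(4)[OF j]])
   have "?f \<otimes> ?w [^] Suc k = (?f \<otimes> ?w [^] k) \<otimes> ?w" using fcj wc by (simp add: A.m_assoc)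
   also have "\<dots> = (?z [^] k \<otimes> ?f) \<otimes> ?w" using Suc zk by simp
   also have "\<dots> = ?z [^] k \<otimes> (?f \<otimes> ?w)" using fcj wc zc by (simp only: A.m_assoc A.nat_pow_closed)
   also have "\<dots> = (?z [^] k \<otimes> ?f) \<otimes> ?z" unfolding fw using fcj zc by (simp only: A.m_assoc A.nat_pow_closed)
   also have "\<dots> = ?f \<otimes> ?z [^] Suc k" unfolding zk using fcj zc by (simp add: A.m_assoc)
   finally show ?case .
  qed
  moreover have "?z [^] n = \<one>"
  proof -
   consider "cj ?s u' = u'" | "cj ?s u' = u' [^] (q + 1)" using twist[OF sH u(2)] by blast
   then show ?thesis
   proof cases
    case 1 then show ?thesis using u(3) by simp
   next
    case 2
    have "?z = (u \<otimes> u') \<otimes> u' [^] q" unfolding 2 using c A.nat_pow_Suc2[of u' q] by (simp add: A.m_assoc)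
    then have "?z = u' [^] q" using u(3) c by simp
    then show ?thesis using u'n c by (simp add: A.nat_pow_pow)
   qed
  qed
  ultimately show ?thesis using fcj by simp
 qed
 then have "(\<Oplus>j\<in>J. f j \<otimes> ?w [^] n) = (\<Oplus>j\<in>J. f j)" using fc by (intro A.finsum_cong') auto
 then show ?thesis using split_by_idempotents[OF f(1) fc f(2), of "?w [^] n"] wc f(2) by simp
qed

text \<open>
  Commutators first descend, degree by degree, along the lower central series until they lie in the group
  algebra of \<open>D\<close>, and from there the exponent drops by a factor \<open>q\<close> in every step
  until it is one.
\<close>

lemma nilpotent_units:
 assumes nil: "lower_central_series (G\<lparr>carrier := H\<rparr>) c = {\<one>\<^sub>G}"
  and S: "\<And>u. u \<in> S \<Longrightarrow> u \<in> carrier V \<and> u \<in> FS H \<and> inv u \<in> FS H"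
 shows "nilpotent_group (V\<lparr>carrier := generate V S\<rparr>)"
proof -
 interpret V: group V by (rule V_group)
 let ?H = "G\<lparr>carrier := H\<rparr>"
 interpret HG: group ?H by (rule subgroup.subgroup_is_group[OF H G.is_group])
 define L where "L n = {x \<bullet> d | x d. x \<in> lower_central_series ?H n \<and> d \<in> D}" for n
 have gH: "lower_central_series ?H n \<subseteq> H" for n using subgroup.subset[OF HG.lower_central_series_subgroup] by simp
 have iH: "inv\<^bsub>?H\<^esub> h = inv\<^sub>G h" if "h \<in> H" for h using G.m_inv_consistent[OF H that] .
 have gm: "x \<bullet> y \<in> lower_central_series ?H n" if "x \<in> lower_central_series ?H n" "y \<in> lower_central_series ?H n" for x y n
  using subgroup.m_closed[OF HG.lower_central_series_subgroup that] by simp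
 have gi: "inv\<^sub>G x \<in> lower_central_series ?H n" if "x \<in> lower_central_series ?H n" for x n
  using subgroup.m_inv_closed[OF HG.lower_central_series_subgroup that] iH[OF subsetD[OF gH that]] by simp
 have g1: "\<one>\<^sub>G \<in> lower_central_series ?H n" for n
  using subgroup.one_closed[OF HG.lower_central_series_subgroup, of n] by simp
 have LH: "L n \<subseteq> H" for n using gH[of n] DH unfolding L_def by (auto simp: subset_iff)
 have DL: "D \<subseteq> L n" for n
 proof
  fix d assume "d \<in> D"
  then show "d \<in> L n" unfolding L_def using g1[of n] Dc[of d] by (intro CollectI exI[of _ "\<one>\<^sub>G"] exI[of _ d]) simp
 qed
 have Lcs: "L n = (\<Union>x\<in>lower_central_series ?H n. cs x)" for n
 proof
  show "L n \<subseteq> (\<Union>x\<in>lower_central_series ?H n. cs x)" unfolding L_def using csI gH by blast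
  show "(\<Union>x\<in>lower_central_series ?H n. cs x) \<subseteq> L n"
  proof
   fix y assume "y \<in> (\<Union>x\<in>lower_central_series ?H n. cs x)"
   then obtain x where x: "x \<in> lower_central_series ?H n" "y \<in> cs x" by blast
   then obtain d where "d \<in> D" "y = x \<bullet> d" using csE gH by blast
   then show "y \<in> L n" unfolding L_def using x by blast
  qed
 qed
 have Lsub: "subgroup (L n) G" for n
 proof (rule G.subgroupI)
  show "L n \<subseteq> carrier G" using LH Hc by blast
  show "L n \<noteq> {}" using DL D_one by blast
 next
  fix a assume "a \<in> L n"
  then obtain x d where a: "a = x \<bullet> d" "x \<in> lower_central_series ?H n" "d \<in> D" unfolding L_def by blast
  have xH: "x \<in> H" using a gH by blast
  have "inv\<^sub>G a = inv\<^sub>G x \<bullet> (x \<bullet> inv\<^sub>G d \<bullet> inv\<^sub>G x)"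
   using a xH by (simp add: G.inv_mult_group G.m_assoc Hc Dc)
  then show "inv\<^sub>G a \<in> L n" unfolding L_def using gi[OF a(2)] Dn[OF xH D_inv[OF a(3)]] by blast
 next
  fix a b assume "a \<in> L n" "b \<in> L n"
  then obtain x y where xy: "x \<in> lower_central_series ?H n" "a \<in> cs x" "y \<in> lower_central_series ?H n" "b \<in> cs y"
   unfolding Lcs by blast
  then have "a \<bullet> b \<in> cs (x \<bullet> y)" using cs_mult gH by blast
  then show "a \<bullet> b \<in> L n" unfolding Lcs using gm[OF xy(1,3)] by blast
 qed
 have Lcomm: "cs (comm_of G a b) \<subseteq> L (Suc n)" if a: "a \<in> L n" and b: "b \<in> H" for a b n
 proof -
  obtain x where x: "x \<in> lower_central_series ?H n" "a \<in> cs x" using a unfolding Lcs by blast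
  have xH: "x \<in> H" using x gH by blast
  have aH: "a \<in> H" using a LH by blast
  obtain d where d: "d \<in> D" "a = x \<bullet> d" using csE x xH by blast
  have "comm_of ?H x b \<in> lower_central_series ?H (Suc n)"
   using HG.lower_central_series_commutator[OF x(1)] b by simp
  then have k: "comm_of G x b \<in> lower_central_series ?H (Suc n)" using iH xH b by simp
  have bi: "b \<in> cs b" "inv\<^sub>G b \<in> cs (inv\<^sub>G b)" using cs_self b by auto
  have "inv\<^sub>G a \<in> cs (inv\<^sub>G x)"
  proof -
   have "inv\<^sub>G a = inv\<^sub>G x \<bullet> (x \<bullet> inv\<^sub>G d \<bullet> inv\<^sub>G x)"
    using d xH by (simp add: G.inv_mult_group G.m_assoc Hc Dc)
   then show ?thesis using csI[of "inv\<^sub>G x"] Dn[OF xH D_inv[OF d(1)]] xH by simp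
  qed
  then have "comm_of G a b \<in> cs (comm_of G x b)"
   using x(2) bi xH b by (intro cs_mult H_mult H_inv)
  then have "cs (comm_of G a b) = cs (comm_of G x b)" using cs_eq xH b by simp
  then show ?thesis unfolding Lcs using k by blast
 qed
 have L0: "L 0 = H"
 proof
  show "H \<subseteq> L 0" unfolding Lcs using cs_self by auto
 qed (rule LH)
 have Lc: "L c = D" unfolding Lcs nil using cs_one by simp
 note Ldec = HG.lower_central_series_decreasing
 have Lge: "L n = D" if "n \<ge> c" for n
  using that
 proof (induction n rule: dec_induct)
  case base then show ?case by (rule Lc)
 next
  case (step n)
  have "L (Suc n) \<subseteq> L n" using Ldec[of n] unfolding Lcs by blast
  then show ?case using step(3) DL by blast
 qed
 define W where "W n = {u \<in> carrier V. u \<in> FS (L n) \<and> inv u \<in> FS (L n) \<and>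
   (n \<ge> c \<longrightarrow> u [^] (q ^ (M - (n - c))) = \<one>)}" for n
 show ?thesis
 proof (rule V.nilpotent_generateI[of W _ "c + M"])
  fix n
  show "subgroup (W n) V"
  proof (rule V.subgroupI)
   show "W n \<subseteq> carrier V" unfolding W_def by blast
   have "\<one> \<in> W n" unfolding W_def using FS_one[OF subgroup.one_closed[OF Lsub]] by simp
   then show "W n \<noteq> {}" by blast
  next
   fix u assume u: "u \<in> W n"
   then have uU: "u \<in> Units A" "aug u = \<one>\<^sub>F" unfolding W_def by auto
   have uc: "u \<in> carrier A" "inv u \<in> carrier A" using uU by (auto simp: A.Units_closed)
   have "inv u [^] k = \<one>" if "u [^] k = \<one>" for k :: nat
   proof -
    have "(u \<otimes> inv u) [^] k = u [^] k \<otimes> inv u [^] k"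
     using A.pow_mult_distrib[of u "inv u"] uc uU by simp
    then show ?thesis using that uc uU by simp
   qed
   then have "inv u \<in> W n" using u uU uc aug_inv unfolding W_def by (simp add: A.Units_inv_Units)
   then show "inv\<^bsub>V\<^esub> u \<in> W n" using uU by simp
  next
   fix u v assume u: "u \<in> W n" and v: "v \<in> W n"
   then have uU: "u \<in> Units A" "aug u = \<one>\<^sub>F" "v \<in> Units A" "aug v = \<one>\<^sub>F" unfolding W_def by auto
   have uc: "u \<in> carrier A" "v \<in> carrier A" using uU by (auto simp: A.Units_closed)
   have "(u \<otimes> v) [^] (q ^ (M - (n - c))) = \<one>" if nc: "n \<ge> c"
   proof -
    have "u \<otimes> v = v \<otimes> u" using u v Lge[OF nc] FD_commute unfolding W_def by auto
    then show ?thesis using A.pow_mult_distrib[of u v] uc u v nc unfolding W_def by simp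
   qed
   moreover have "inv (u \<otimes> v) = inv v \<otimes> inv u" using uU by (simp add: A.inv_mult_of_Units)
   ultimately have "u \<otimes> v \<in> W n"
    using u v uU uc FS_subgroup_mult[OF Lsub] unfolding W_def by simp
   then show "u \<otimes>\<^bsub>V\<^esub> v \<in> W n" by simp
  qed
 next
  have "u \<in> W 0" if u: "u \<in> S" for u
  proof -
   have "u [^] (q ^ M) = \<one>" if "c = 0"
   proof -
    have "H = D" using Lc L0 that by simp
    then show ?thesis using exponent[of u] S[OF u] by simp
   qed
   then show ?thesis using S[OF u] unfolding W_def L0 by simp
  qed
  then show "S \<subseteq> W 0" by blast
 next
  fix n u v assume u: "u \<in> W n" and v: "v \<in> W 0"
  have uU: "u \<in> Units A" "aug u = \<one>\<^sub>F" "v \<in> Units A" "aug v = \<one>\<^sub>F" using u v unfolding W_def by auto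
  have uc: "u \<in> carrier A" "v \<in> carrier A" "inv u \<in> carrier A" "inv v \<in> carrier A" using uU by (auto simp: A.Units_closed)
  have uL: "u \<in> FS (L n)" "inv u \<in> FS (L n)" and vH: "v \<in> FS H" "inv v \<in> FS H"
   using u v unfolding W_def L0 by auto
  have uH: "u \<in> FS H" "inv u \<in> FS H" using uL LH FS_mono by auto
  let ?w = "u \<otimes> v \<otimes> inv u \<otimes> inv v"
  have ui: "u \<otimes> inv u = \<one>" "inv u \<otimes> u = \<one>" "v \<otimes> inv v = \<one>" "inv v \<otimes> v = \<one>" using uU by auto
  have wV: "?w \<in> carrier V"
   using V.m_closed[OF V.m_closed[OF V.m_closed[of u v] V.inv_closed[of u]] V.inv_closed[of v]] uU by simp
  have iw: "inv ?w = v \<otimes> u \<otimes> inv v \<otimes> inv u"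
   using uU uc by (simp add: A.inv_mult_of_Units A.m_assoc A.Units_inv_Units)
  have w1: "?w \<in> FS (L (Suc n))"
   using FS_supp[OF uL(1)] FS_supp[OF vH(1)] by (intro commutator_support[OF uH ui(1,2) vH ui(3,4)] Lcomm) auto
  have w2: "inv ?w \<in> FS (L (Suc n))"
   unfolding iw
  proof (rule commutator_support[OF vH ui(3,4) uH ui(1,2)])
   fix x y assume x: "x \<in> supp v" and y: "y \<in> supp u"
   have xH: "x \<in> H" "y \<in> H" using x y FS_supp[OF vH(1)] FS_supp[OF uH(1)] by auto
   have "comm_of G y x \<in> L (Suc n)"
    using Lcomm[of y n x] cs_self[of "comm_of G y x"] y xH FS_supp[OF uL(1)] by auto
   then have "inv\<^sub>G (comm_of G y x) \<in> L (Suc n)" by (rule subgroup.m_inv_closed[OF Lsub])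
   then have "comm_of G x y \<in> L (Suc n)" using G.comm_of_inv[of y x] xH Hc by simp
   then obtain z where z: "z \<in> lower_central_series ?H (Suc n)" "comm_of G x y \<in> cs z" unfolding Lcs by blast
   then have "cs (comm_of G x y) = cs z" using cs_eq gH by blast
   then show "cs (comm_of G x y) \<subseteq> L (Suc n)" unfolding Lcs using z by blast
  qed
  have "?w [^] (q ^ (M - (Suc n - c))) = \<one>" if nc: "Suc n \<ge> c"
  proof (cases "n \<ge> c")
   case False
   then have "Suc n = c" using nc by simp
   then show ?thesis using exponent[of ?w] w1 wV Lge[of "Suc n"] by simp
  next
   case True
   show ?thesis
   proof (cases "n - c < M")
    case True
    have D': "u \<in> FS D" "inv u \<in> FS D" using uL Lge[OF \<open>n \<ge> c\<close>] by auto
    have "M - (n - c) = Suc (M - (Suc n - c))" using True \<open>n \<ge> c\<close> by simp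
    then have "u [^] (q * q ^ (M - (Suc n - c))) = \<one>" using u \<open>n \<ge> c\<close> unfolding W_def by simp
    then show ?thesis using commutator_exponent[OF D' ui(1,2) vH ui(3,4)] by simp
   next
    case False
    then have "u [^] (1::nat) = \<one>" using u \<open>n \<ge> c\<close> unfolding W_def by simp
    then have "u = \<one>" using uc by simp
    then show ?thesis using uc ui by simp
   qed
  qed
  then have "?w \<in> W (Suc n)" using wV w1 w2 unfolding W_def by simp
  then show "comm_of V u v \<in> W (Suc n)" using uU by simp
 next
  show "W (c + M) = {\<one>\<^bsub>V\<^esub>}"
  proof
   show "W (c + M) \<subseteq> {\<one>\<^bsub>V\<^esub>}" unfolding W_def by (auto simp: A.Units_closed)
   have "\<one> \<in> W (c + M)" unfolding W_def using FS_one[OF subgroup.one_closed[OF Lsub]] by simp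
   then show "{\<one>\<^bsub>V\<^esub>} \<subseteq> W (c + M)" by simp
  qed
 qed
qed

end

section \<open>Sufficiency of the conditions\<close>

lemma (in ring) binomial_commuting:
 assumes c: "x \<in> carrier R" "y \<in> carrier R" "x \<otimes> y = y \<otimes> x"
 shows "(x \<oplus> y) [^] n = (\<Oplus>k\<in>{..n}. add_pow R (n choose k) (x [^] k \<otimes> y [^] (n - k)))"
proof (induction n)
 case 0 then show ?case using c by (simp add: finsum_one_term)
next
 case (Suc n)
 let ?t = "\<lambda>n k. add_pow R (n choose k) (x [^] k \<otimes> y [^] (n - k))"
 let ?a = "\<lambda>k. add_pow R (n choose k) (x [^] Suc k \<otimes> y [^] (n - k))"
 let ?b = "\<lambda>k. add_pow R (n choose k) (x [^] k \<otimes> y [^] (Suc n - k))"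
 have xyk: "y [^] k \<otimes> x = x \<otimes> y [^] k" for k :: nat
 proof (induction k)
  case (Suc k)
  have "y [^] Suc k \<otimes> x = y [^] k \<otimes> (x \<otimes> y)" using c by (simp add: m_assoc)
  also have "\<dots> = (y [^] k \<otimes> x) \<otimes> y" using c by (simp add: m_assoc)
  finally show ?case using Suc c by (simp add: m_assoc)
 qed (use c in simp)
 have "?t n k \<otimes> x = ?a k" for k
 proof -
  have "(x [^] k \<otimes> y [^] (n - k)) \<otimes> x = x [^] k \<otimes> (x \<otimes> y [^] (n - k))"
   using c xyk by (simp add: m_assoc)
  then have "(x [^] k \<otimes> y [^] (n - k)) \<otimes> x = x [^] Suc k \<otimes> y [^] (n - k)"
   using c by (simp add: m_assoc)
  then show ?thesis using c by (simp add: add_pow_ldistr del: nat_pow_Suc)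
 qed
 moreover have "?t n k \<otimes> y = ?b k" if "k \<le> n" for k
 proof -
  have "y [^] (Suc n - k) = y [^] (n - k) \<otimes> y" using that by (simp add: Suc_diff_le)
  then show ?thesis using c by (simp add: add_pow_ldistr m_assoc)
 qed
 moreover have "(x \<oplus> y) [^] Suc n = (\<Oplus>k\<in>{..n}. ?t n k) \<otimes> x \<oplus> (\<Oplus>k\<in>{..n}. ?t n k) \<otimes> y"
  using c Suc by (simp add: r_distr)
 moreover have "(\<Oplus>k\<in>{..n}. ?t n k) \<otimes> x = (\<Oplus>k\<in>{..n}. ?t n k \<otimes> x)"
  "(\<Oplus>k\<in>{..n}. ?t n k) \<otimes> y = (\<Oplus>k\<in>{..n}. ?t n k \<otimes> y)"
  using c by (auto intro!: finsum_ldistr)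
 moreover have "(\<Oplus>k\<in>{..n}. ?t n k \<otimes> y) = (\<Oplus>k\<in>{..n}. ?b k)"
  using calculation(2) c by (intro finsum_cong') auto
 ultimately have "(x \<oplus> y) [^] Suc n = (\<Oplus>k\<in>{..n}. ?a k) \<oplus> (\<Oplus>k\<in>{..n}. ?b k)" by simp
 also have "(\<Oplus>k\<in>{..n}. ?b k) = (\<Oplus>k\<in>{..Suc n}. ?b k)"
  using c by (subst finsum_Suc) (auto simp: binomial_eq_0)
 also have "\<dots> = (\<Oplus>k\<in>{..n}. ?b (Suc k)) \<oplus> ?b 0"
  using c by (intro finsum_Suc2) auto
 also have "(\<Oplus>k\<in>{..n}. ?a k) \<oplus> ((\<Oplus>k\<in>{..n}. ?b (Suc k)) \<oplus> ?b 0)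
   = (\<Oplus>k\<in>{..n}. ?a k \<oplus> ?b (Suc k)) \<oplus> ?b 0"
  using c by (subst finsum_addf) (auto simp: a_assoc)
 also have "(\<Oplus>k\<in>{..n}. ?a k \<oplus> ?b (Suc k)) = (\<Oplus>k\<in>{..n}. ?t (Suc n) (Suc k))"
  using c by (intro finsum_cong') (auto simp: add.nat_pow_mult)
 also have "(\<Oplus>k\<in>{..n}. ?t (Suc n) (Suc k)) \<oplus> ?b 0 = (\<Oplus>k\<in>{..Suc n}. ?t (Suc n) k)"
  using c by (subst finsum_Suc2) auto
 finally show ?case .
qed

lemma (in ring) frobenius_add:
 assumes p: "Factorial_Ring.prime (p::nat)" and char: "\<And>z. z \<in> carrier R \<Longrightarrow> add_pow R p z = \<zero>"
  and c: "x \<in> carrier R" "y \<in> carrier R" "x \<otimes> y = y \<otimes> x"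
 shows "(x \<oplus> y) [^] p = x [^] p \<oplus> y [^] p"
proof -
 let ?t = "\<lambda>k. add_pow R (p choose k) (x [^] k \<otimes> y [^] (p - k))"
 obtain m where m: "p = Suc m" using prime_gt_0_nat[OF p] by (cases p) auto
 obtain l where l: "m = Suc l" using prime_gt_1_nat[OF p] m by (cases m) auto
 have z: "?t k = \<zero>" if "0 < k" "k < p" for k
 proof -
  have "p dvd (p choose k)" using that p by (intro dvd_choose_prime) auto
  then obtain d where d: "(p choose k) = p * d" by (elim dvdE)
  have "?t k = add_pow R d (add_pow R p (x [^] k \<otimes> y [^] (p - k)))"
   unfolding d using c by (simp add: add.nat_pow_pow)
  then show ?thesis using char c by (simp add: add.nat_pow_one)
 qed
 have "(x \<oplus> y) [^] p = (\<Oplus>k\<in>{..p}. ?t k)" by (rule binomial_commuting[OF c])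
 also have "\<dots> = ?t p \<oplus> ((\<Oplus>k\<in>{..l}. ?t (Suc k)) \<oplus> ?t 0)"
 proof -
  have "(\<Oplus>k\<in>{..p}. ?t k) = ?t p \<oplus> (\<Oplus>k\<in>{..m}. ?t k)"
   unfolding m using c by (intro finsum_Suc) auto
  also have "(\<Oplus>k\<in>{..m}. ?t k) = (\<Oplus>k\<in>{..l}. ?t (Suc k)) \<oplus> ?t 0"
   unfolding l using c by (intro finsum_Suc2) auto
  finally show ?thesis .
 qed
 also have "(\<Oplus>k\<in>{..l}. ?t (Suc k)) = \<zero>"
  by (intro add.finprod_one_eqI z) (use m l in auto)
 finally show ?thesis using c by simp
qed

lemma (in group) cauchy_subgroup:
 assumes B: "subgroup B G" "finite B" and q: "Factorial_Ring.prime q" "q dvd card B"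
 shows "\<exists>x \<in> B. ord x = q"
proof -
 interpret B: group "G\<lparr>carrier := B\<rparr>" by (rule subgroup.subgroup_is_group[OF B(1) is_group])
 obtain x where x: "x \<in> B" "B.ord x = q"
  using B.cauchy_prime_order[OF _ q(1)] B(2) q(2) by (auto simp: order_def)
 have xc: "x \<in> carrier G" using subgroup.mem_carrier[OF B(1) x(1)] .
 have "x [^]\<^bsub>G\<lparr>carrier := B\<rparr>\<^esub> q = \<one>" using B.pow_ord_eq_1[of x] x by simp
 then have "x [^] q = \<one>" by (simp only: nat_pow_consistent[symmetric])
 then have "ord x dvd q" using xc pow_eq_id by simp
 moreover have "ord x \<noteq> 1"
 proof
  assume "ord x = 1"
  then have "x = \<one>" using xc ord_eq_1 by simp
  then have "B.ord x = 1" using B.ord_eq_1 x(1) by simp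
  then show False using x(2) q(1) by simp
 qed
 ultimately have "ord x = q" using q(1) unfolding prime_nat_iff by metis
 then show ?thesis using x(1) by blast
qed

context field
begin

lemma add_pow_one_mult: "add_pow R (m * n :: nat) \<one> = add_pow R m \<one> \<otimes> add_pow R n \<one>"
proof -
 have "add_pow R m \<one> \<otimes> add_pow R n \<one> = add_pow R m (add_pow R n \<one>)" by (simp add: add_pow_ldistr)
 then show ?thesis by (simp add: add.nat_pow_pow mult.commute)
qed

lemma add_pow_eq_mult: "x \<in> carrier R \<Longrightarrow> add_pow R (n::nat) x = add_pow R n \<one> \<otimes> x"
 by (simp add: add_pow_ldistr)

lemma characteristic_dvd: "add_pow R (n::nat) \<one> = \<zero> \<longleftrightarrow> ring_characteristic R dvd n"
proof (cases "\<exists>n::nat. n > 0 \<and> add_pow R n \<one> = \<zero>")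
 case False
 then have "ring_characteristic R = 0" unfolding ring_characteristic_def by (simp only: if_False)
 moreover have "add_pow R n \<one> = \<zero> \<longleftrightarrow> n = 0"
  using False by (cases "n = 0") (simp, blast)
 ultimately show ?thesis by simp
next
 case True
 let ?p = "ring_characteristic R"
 have p: "?p = (LEAST n::nat. n > 0 \<and> add_pow R n \<one> = \<zero>)"
  using True unfolding ring_characteristic_def by (simp only: if_True)
 have pp: "?p > 0 \<and> add_pow R ?p \<one> = \<zero>" unfolding p by (rule LeastI_ex[OF True])
 have "add_pow R n \<one> = add_pow R (n mod ?p) \<one>"
 proof -
  have "add_pow R n \<one> = add_pow R (?p * (n div ?p) + n mod ?p) \<one>" by simp
  also have "\<dots> = add_pow R ?p \<one> \<otimes> add_pow R (n div ?p) \<one> \<oplus> add_pow R (n mod ?p) \<one>"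
   by (simp only: add.nat_pow_mult[symmetric] one_closed add_pow_one_mult)
  finally show ?thesis using pp by simp
 qed
 moreover have "add_pow R (n mod ?p) \<one> = \<zero> \<longleftrightarrow> n mod ?p = 0"
 proof
  assume z: "add_pow R (n mod ?p) \<one> = \<zero>"
  show "n mod ?p = 0"
  proof (rule ccontr)
   assume "n mod ?p \<noteq> 0"
   then have "?p \<le> n mod ?p" using z unfolding p by (intro Least_le) simp
   then show False using pp by (meson mod_less_divisor not_le)
  qed
 qed simp
 ultimately show ?thesis by (simp add: mod_eq_0_iff_dvd)
qed

lemma characteristic_prime:
 assumes "ring_characteristic R \<noteq> 0" shows "Factorial_Ring.prime (ring_characteristic R)"
 unfolding prime_nat_iff
proof (intro conjI allI impI)
 let ?p = "ring_characteristic R"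
 have "\<not> ?p dvd 1" using characteristic_dvd[of 1] by simp
 then show "1 < ?p" using assms by (cases "?p = 1") auto
 fix m assume "m dvd ?p"
 then obtain n where n: "?p = m * n" by (elim dvdE)
 then have "add_pow R m \<one> \<otimes> add_pow R n \<one> = \<zero>"
  using characteristic_dvd[of "m * n"] add_pow_one_mult[of m n] by simp
 then have "?p dvd m \<or> ?p dvd n"
  using integral[of "add_pow R m \<one>" "add_pow R n \<one>"] characteristic_dvd by simp
 then show "m = 1 \<or> m = ?p" using n assms
  by (metis dvd_antisym dvd_triv_left dvd_triv_right mult.commute mult_cancel1 nat_mult_1)
qed

lemma prime_field_fermat:
 assumes pf: "prime_field R" and p: "ring_characteristic R = p" "p \<noteq> 0" and x: "x \<in> carrier R"
 shows "x [^] p = x"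
proof -
 have pr: "Factorial_Ring.prime p" using characteristic_prime p by simp
 have char: "add_pow R p z = \<zero>" if "z \<in> carrier R" for z
  using add_pow_eq_mult[OF that, of p] characteristic_dvd[of p] p that by simp
 let ?K = "{x \<in> carrier R. x [^] p = x}"
 have add: "(x \<oplus> y) [^] p = x [^] p \<oplus> y [^] p" if "x \<in> carrier R" "y \<in> carrier R" for x y
  using frobenius_add[OF pr char that m_comm[OF that]] by simp
 have p0: "\<zero> [^] p = \<zero>" using p(2) by (simp add: nat_pow_zero)
 have "subfield ?K R"
 proof (rule subfieldI')
  show "subring ?K R"
  proof (rule subringI)
   fix h assume h: "h \<in> ?K"
   have "h [^] p \<oplus> (\<ominus> h) [^] p = \<zero>" using add[of h "\<ominus> h"] h p0 by (simp add: r_neg)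
   then have "(\<ominus> h) [^] p = \<ominus> (h [^] p)" using h minus_unique[of "h [^] p" "(\<ominus> h) [^] p"]
    by (metis (no_types, lifting) a_inv_closed mem_Collect_eq nat_pow_closed sum_zero_eq_neg a_comm)
   then show "\<ominus> h \<in> ?K" using h by simp
  qed (use add in \<open>auto simp: nat_pow_distrib\<close>)
 next
  fix k assume k: "k \<in> ?K - {\<zero>}"
  then have kU: "k \<in> Units R" "k [^] p = k" by (auto simp: field_Units)
  have "inv k [^] p = inv (k [^] p)"
  proof -
   have kc: "k \<in> carrier R" "inv k \<in> carrier R" using kU(1) by (auto simp: Units_closed)
   have "k [^] p \<otimes> inv k [^] p = (k \<otimes> inv k) [^] p" by (rule nat_pow_distrib[OF kc, symmetric])
   then have "k [^] p \<otimes> inv k [^] p = \<one>" using kU(1) by simp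
   then show ?thesis using comm_inv_char[of "k [^] p" "inv k [^] p"] kc by simp
  qed
  then show "inv k \<in> ?K" using kU by simp
 qed
 then show ?thesis using pf x unfolding prime_field_def by blast
qed

end

context grpalg
begin

lemma characteristic_add_pow:
 assumes "ring_characteristic F = p" "u \<in> carrier A" shows "add_pow A p u = \<zero>"
 using add_pow_sc[OF assms(2), of p] F.characteristic_dvd[of p] assms
 by (intro ga_eqI) (auto simp: add_pow_apply scalar_mult_apply)

lemma card_subgroup_invertible:
 assumes "\<not> modular_group_algebra F G" and B: "subgroup B G" "finite B"
 shows "add_pow F (card B) \<one>\<^sub>F \<noteq> \<zero>\<^sub>F"
proof
 assume "add_pow F (card B) \<one>\<^sub>F = \<zero>\<^sub>F"
 then have d: "ring_characteristic F dvd card B" using F.characteristic_dvd by simp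
 have "card B \<noteq> 0" using B subgroup.one_closed[OF B(1)] by auto
 then have p0: "ring_characteristic F \<noteq> 0" using d by (metis dvd_0_left)
 then obtain x where "x \<in> B" "G.ord x = ring_characteristic F"
  using G.cauchy_subgroup[OF B F.characteristic_prime d] by blast
 then show False using assms(1) p0 subgroup.mem_carrier[OF B(1)] unfolding modular_group_algebra_def by blast
qed

lemma cj_centralizing:
 assumes h: "h \<in> carrier G" and d: "d \<in> FS D" and c: "\<And>x. x \<in> D \<Longrightarrow> h \<bullet> x = x \<bullet> h"
 shows "cj h d = d"
 using d
proof (induction rule: FS_induct)
 case zero then show ?case using h by (simp add: cj_def)
next
 case (add u v)
 then show ?case using h FS_carrier by (simp add: cj_def A.l_distr A.r_distr)
next
 case (single a g)
 then show ?case using h c[of g] by (simp add: cj_def single_mult_single G.m_assoc)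
qed

text \<open>
  An additive map that fixes scalars and raises group elements to the \<open>p\<close>-th power coincides with
  the Frobenius map, because scalars of a prime field are fixed by it.
\<close>

lemma frobenius_FS:
 assumes p: "ring_characteristic F = p" "p \<noteq> 0" and F: "\<And>x. x \<in> carrier F \<Longrightarrow> x [^]\<^sub>F p = x"
  and D: "D \<subseteq> carrier G" "\<And>x y. x \<in> D \<Longrightarrow> y \<in> D \<Longrightarrow> x \<bullet> y = y \<bullet> x"
  and \<phi>: "\<And>u v. \<lbrakk>u \<in> FS D; v \<in> FS D\<rbrakk> \<Longrightarrow> \<phi> (u \<oplus> v) = \<phi> u \<oplus> \<phi> v" "\<phi> \<zero> = \<zero>"
   "\<And>c g. \<lbrakk>c \<in> carrier F; g \<in> D\<rbrakk> \<Longrightarrow> \<phi> (single c g) = single c (g [^]\<^sub>G p)"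
  and d: "d \<in> FS D"
 shows "\<phi> d = d [^] p"
 using d
proof (induction rule: FS_induct)
 case zero then show ?case using p(2) \<phi>(2) by (simp add: A.nat_pow_zero)
next
 case (add u v)
 have pr: "Factorial_Ring.prime p" using F.characteristic_prime p by simp
 have c: "u \<in> carrier A" "v \<in> carrier A" using add FS_carrier by auto
 show ?case
  using A.frobenius_add[OF pr characteristic_add_pow[OF p(1)] c FS_commute[OF D add(1,2)]] add \<phi>(1) by simp
next
 case (single a g)
 have "single a g [^] n = single (a [^]\<^sub>F n) (g [^]\<^sub>G n)" for n :: nat
  using single by (induction n) (simp_all add: one_single single_mult_single)
 then show ?case using single F \<phi>(3) by simp
qed

text \<open>
  A finite set of units and the inverses of its members live in the group algebra of a finitely generated,
  hence nilpotent, subgroup \<open>H\<close>. Let \<open>D\<close> be the set of its torsion elements. In case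
  (i) conjugation is trivial on the group algebra of \<open>D\<close>; in case (ii) it is trivial or the
  Frobenius map, and \<open>p - 1\<close> plays the role of \<open>q\<close>: the exponent \<open>p\<^sup>2 -
  1 = (p - 1) 2\<^sup>t\<close> of the units divides a power of the even number \<open>p - 1\<close>.
\<close>

theorem sufficiency:
 assumes nm: "\<not> modular_group_algebra F G" and p: "ring_characteristic F = p"
  and lnG: "locally_nilpotent_group G"
  and T: "subgroup (torsion_part G) G" and Tc: "comm_group (G\<lparr>carrier := torsion_part G\<rparr>)"
  and alt: "torsion_part G \<subseteq> group_center G
   \<or>
   prime_field F \<and> (\<exists>t::nat. int p = 2 ^ t - 1) \<and>
   int (group_exponent (G\<lparr>carrier := torsion_part G\<rparr>)) dvd (int p) ^ 2 - 1 \<and>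
   (\<forall>a \<in> torsion_part G. \<forall>g \<in> carrier G - centralizer G (torsion_part G).
    inv\<^sub>G g \<bullet> a \<bullet> g = a [^]\<^sub>G p)"
 shows "locally_nilpotent_group V"
proof -
 let ?T = "torsion_part G"
 interpret T: comm_group "G\<lparr>carrier := ?T\<rparr>" by (rule Tc)
 have Tcomm: "x \<bullet> y = y \<bullet> x" if "x \<in> ?T" "y \<in> ?T" for x y
  using T.m_comm[of x y] that by simp
 have Tcar: "?T \<subseteq> carrier G" by (rule subgroup.subset[OF T])
 have FTcomm: "u \<otimes> v = v \<otimes> u" if "u \<in> FS ?T" "v \<in> FS ?T" for u v
  by (rule FS_commute[OF Tcar _ that]) (rule Tcomm)
 have tors: "\<exists>n>0. x [^]\<^sub>G (n::nat) = \<one>\<^sub>G" if "x \<in> ?T" for x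
  using that unfolding torsion_part_def by blast
 have "\<exists>(q::nat) (M::nat). (\<forall>h \<in> carrier G. \<forall>d \<in> FS ?T. cj h d = d \<or> cj h d = d [^] (q + 1)) \<and>
   (\<forall>u \<in> FS ?T. u \<in> Units A \<longrightarrow> u [^] (q ^ M) = \<one>)"
 proof (cases "?T \<subseteq> group_center G")
  case True
  have "cj h d = d" if h: "h \<in> carrier G" and d: "d \<in> FS ?T" for h d
   by (rule cj_centralizing[OF h d]) (use True h in \<open>auto simp: group_center_def centralizer_def\<close>)
  then have "(\<forall>h \<in> carrier G. \<forall>d \<in> FS ?T. cj h d = d \<or> cj h d = d [^] (0 + 1 :: nat)) \<and>
   (\<forall>u \<in> FS ?T. u \<in> Units A \<longrightarrow> u [^] ((0::nat) ^ 1) = \<one>)" by simp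
  then show ?thesis by - (rule exI[where x = "0::nat"], rule exI[where x = "1::nat"])
 next
  case False
  have alt': "prime_field F \<and> (\<exists>t::nat. int p = 2 ^ t - 1) \<and>
   int (group_exponent (G\<lparr>carrier := ?T\<rparr>)) dvd (int p) ^ 2 - 1 \<and>
   (\<forall>a \<in> ?T. \<forall>g \<in> carrier G - centralizer G ?T. inv\<^sub>G g \<bullet> a \<bullet> g = a [^]\<^sub>G p)"
   by (rule disjE[OF alt]) (rule notE[OF False], assumption+)
  have pf: "prime_field F" by (rule alt'[THEN conjunct1])
  have ex: "int (group_exponent (G\<lparr>carrier := ?T\<rparr>)) dvd (int p) ^ 2 - 1"
   by (rule alt'[THEN conjunct2, THEN conjunct2, THEN conjunct1])
  have act: "inv\<^sub>G g \<bullet> a \<bullet> g = a [^]\<^sub>G p"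
   if "a \<in> ?T" "g \<in> carrier G" "g \<notin> centralizer G ?T" for a g
   using alt'[THEN conjunct2, THEN conjunct2, THEN conjunct2, THEN bspec, THEN bspec] that by blast
  obtain t where t: "int p = 2 ^ t - 1" using alt'[THEN conjunct2, THEN conjunct1] by (elim exE)
  let ?e = "group_exponent (G\<lparr>carrier := ?T\<rparr>)"
  have e: "a [^]\<^sub>G ?e = \<one>\<^sub>G" if a: "a \<in> ?T" for a
  proof (cases "\<exists>n::nat. n > 0 \<and> (\<forall>g \<in> carrier (G\<lparr>carrier := ?T\<rparr>). g [^]\<^bsub>G\<lparr>carrier := ?T\<rparr>\<^esub> n = \<one>\<^bsub>G\<lparr>carrier := ?T\<rparr>\<^esub>)")
   case True
   have e: "?e = (LEAST n::nat. n > 0 \<and> (\<forall>g \<in> carrier (G\<lparr>carrier := ?T\<rparr>). g [^]\<^bsub>G\<lparr>carrier := ?T\<rparr>\<^esub> n = \<one>\<^bsub>G\<lparr>carrier := ?T\<rparr>\<^esub>))"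
    using True unfolding group_exponent_def by (simp only: if_True)
   have "\<forall>g \<in> carrier (G\<lparr>carrier := ?T\<rparr>). g [^]\<^bsub>G\<lparr>carrier := ?T\<rparr>\<^esub> ?e = \<one>\<^bsub>G\<lparr>carrier := ?T\<rparr>\<^esub>"
    unfolding e using LeastI_ex[OF True] by blast
   then have "a [^]\<^bsub>G\<lparr>carrier := ?T\<rparr>\<^esub> ?e = \<one>\<^sub>G" using a by simp
   then show ?thesis by (simp only: G.nat_pow_consistent[symmetric])
  next
   case False
   then have "?e = 0" unfolding group_exponent_def by (simp only: if_False)
   then show ?thesis by simp
  qed
  have p0: "p \<noteq> 0"
  proof
   assume "p = 0"
   then have "?e = 1" using ex by simp
   then have "?T = {\<one>\<^sub>G}" using e Tcar subgroup.one_closed[OF T] by force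
   then show False using False by (auto simp: group_center_def centralizer_def)
  qed
  have pr: "Factorial_Ring.prime p" using F.characteristic_prime p p0 by simp
  have p2: "p \<ge> 2" using prime_ge_2_nat[OF pr] .
  have fer: "x [^]\<^sub>F p = x" if "x \<in> carrier F" for x by (rule F.prime_field_fermat[OF pf p p0 that])
  have p21: "int (p * p - 1) = int p ^ 2 - 1" using p2 by (simp add: power2_eq_square of_nat_diff)
  then have ed: "?e dvd p * p - 1" using ex by (metis int_dvd_int_iff)
  have ap: "a [^]\<^sub>G (p * p) = a" if a: "a \<in> ?T" for a
  proof -
   have ac: "a \<in> carrier G" using a Tcar by blast
   obtain k where k: "p * p - 1 = ?e * k" using ed by (elim dvdE)
   have "a [^]\<^sub>G (p * p - 1) = \<one>\<^sub>G" unfolding k using e[OF a] ac by (simp flip: G.nat_pow_pow)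
   moreover have "p * p = Suc (p * p - 1)" using p2 by simp
   ultimately show ?thesis using ac by (metis G.l_one G.nat_pow_Suc)
  qed
  have tw: "cj h d = d \<or> cj h d = d [^] p" if h: "h \<in> carrier G" and d: "d \<in> FS ?T" for h d
  proof (cases "h \<in> centralizer G ?T")
   case True
   then show ?thesis using cj_centralizing[OF h d] by (auto simp: centralizer_def)
  next
   case False
   have "inv\<^sub>G h \<notin> centralizer G ?T"
   proof
    assume a: "inv\<^sub>G h \<in> centralizer G ?T"
    have "h \<bullet> s = s \<bullet> h" if s: "s \<in> ?T" for s
    proof -
     have sc: "s \<in> carrier G" using s Tcar by blast
     have "inv\<^sub>G h \<bullet> s = s \<bullet> inv\<^sub>G h" using a s unfolding centralizer_def by blast
     then have "h \<bullet> (inv\<^sub>G h \<bullet> s) \<bullet> h = h \<bullet> (s \<bullet> inv\<^sub>G h) \<bullet> h" by simp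
     then show ?thesis using h sc by (simp add: G.m_assoc)
    qed
    then show False using False h unfolding centralizer_def by blast
   qed
   then have c: "h \<bullet> a \<bullet> inv\<^sub>G h = a [^]\<^sub>G p" if "a \<in> ?T" for a
    using act[OF that, of "inv\<^sub>G h"] h by simp
   have "cj h d = d [^] p"
   proof (rule frobenius_FS[OF p p0 fer Tcar Tcomm _ _ _ d])
    show "cj h (u \<oplus> v) = cj h u \<oplus> cj h v" if "u \<in> FS ?T" "v \<in> FS ?T" for u v
     using that h FS_carrier by (simp add: cj_def A.l_distr A.r_distr)
    show "cj h \<zero> = \<zero>" using h by (simp add: cj_def)
    show "cj h (single a g) = single a (g [^]\<^sub>G p)" if "a \<in> carrier F" "g \<in> ?T" for a g
     using that h c[OF that(2)] Tcar by (simp add: cj_def single_mult_single subset_iff)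
   qed
   then show ?thesis by blast
  qed
  have sq: "u [^] (p * p) = u" if u: "u \<in> FS ?T" for u
  proof -
   have uc: "u \<in> carrier A" using u FS_carrier by auto
   have "(u [^] p) [^] p = u"
    using u
   proof (induction rule: FS_induct)
    case zero then show ?case using p0 by (simp add: A.nat_pow_zero)
   next
    case (add u v)
    have c: "u \<in> carrier A" "v \<in> carrier A" using add FS_carrier by auto
    have cm: "u \<otimes> v = v \<otimes> u" by (rule FTcomm[OF add(1,2)])
    have "u [^] p \<in> FS ?T" "v [^] p \<in> FS ?T" using FS_subgroup_pow[OF T] add by auto
    then have "u [^] p \<otimes> v [^] p = v [^] p \<otimes> u [^] p" by (rule FTcomm)
    then show ?case
     using A.frobenius_add[OF pr characteristic_add_pow[OF p] c cm]
      A.frobenius_add[OF pr characteristic_add_pow[OF p], of "u [^] p" "v [^] p"] c add by simp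
   next
    case (single a g)
    have "single a g [^] n = single (a [^]\<^sub>F n) (g [^]\<^sub>G n)" for n :: nat
     using single by (induction n) (simp_all add: one_single single_mult_single)
    then have "single a g [^] (p * p) = single (a [^]\<^sub>F (p * p)) (g [^]\<^sub>G (p * p))" .
    then show ?case using single ap[of g] fer[OF single(1)] by (simp add: A.nat_pow_pow flip: F.nat_pow_pow)
   qed
   then show ?thesis using uc by (simp add: A.nat_pow_pow)
  qed
  have "p * p - 1 dvd (p - 1) ^ (t + 1)"
  proof -
   have "t \<noteq> 0" using t p0 by (intro notI) simp
   have tp: "2 ^ t = p + 1"
   proof -
    have "int (2 ^ t) = int (p + 1)" using t by simp
    then show ?thesis by (simp only: of_nat_eq_iff)
   qed
   have "even ((2::nat) ^ t)" using \<open>t \<noteq> 0\<close> by simp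
   then have "even (p + 1)" unfolding tp .
   then have "odd p" by simp
   then have "2 dvd p - 1" using p2 by simp
   then have "2 ^ t dvd (p - 1) ^ t" by (rule dvd_power_same)
   then have "(p - 1) * (p + 1) dvd (p - 1) * (p - 1) ^ t" unfolding tp by (rule mult_dvd_mono[OF dvd_refl])
   then have "(p - 1) * (p + 1) dvd (p - 1) ^ (t + 1)" by simp
   moreover have "(p - 1) * (p + 1) = p * p - 1" using p2 by (simp add: algebra_simps)
   ultimately show ?thesis by simp
  qed
  then obtain k where k: "(p - 1) ^ (t + 1) = (p * p - 1) * k" by (elim dvdE)
  have un: "u [^] ((p - 1) ^ (t + 1)) = \<one>" if u: "u \<in> FS ?T" "u \<in> Units A" for u
  proof -
   have uc: "u \<in> carrier A" using u FS_carrier by auto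
   have "u [^] (p * p - 1) \<otimes> u = u"
   proof -
    have "p * p = Suc (p * p - 1)" using p2 by simp
    then show ?thesis using sq[OF u(1)] uc by (metis A.nat_pow_Suc)
   qed
   then have "(u [^] (p * p - 1) \<otimes> u) \<otimes> inv u = u \<otimes> inv u" by simp
   then have "u [^] (p * p - 1) = \<one>" using u(2) uc by (simp add: A.m_assoc)
   then show ?thesis unfolding k using uc by (simp flip: A.nat_pow_pow)
  qed
  show ?thesis
   using tw un p2 by (intro exI[of _ "p - 1"] exI[of _ "t + 1"]) simp
 qed
 then obtain q M :: nat where tw: "\<And>h d. h \<in> carrier G \<Longrightarrow> d \<in> FS ?T \<Longrightarrow> cj h d = d \<or> cj h d = d [^] (q + 1)"
  and un: "\<And>u. u \<in> FS ?T \<Longrightarrow> u \<in> Units A \<Longrightarrow> u [^] (q ^ M) = \<one>" by blast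
 have "nilpotent_group (V\<lparr>carrier := generate V S\<rparr>)" if S: "S \<subseteq> carrier V" "finite S" for S
 proof -
  let ?S = "(\<Union>u\<in>S. supp u \<union> supp (inv u))"
  let ?H = "generate G ?S"
  have SA: "u \<in> carrier A" "inv u \<in> carrier A" if "u \<in> S" for u using S that by (auto simp: A.Units_closed)
  have finS: "finite ?S" using S SA by auto
  have Sc: "?S \<subseteq> carrier G" using supp_carrier by blast
  have H: "subgroup ?H G" by (rule G.generate_is_subgroup[OF Sc])
  have nH: "nilpotent_group (G\<lparr>carrier := ?H\<rparr>)" using lnG Sc finS unfolding locally_nilpotent_group_def by blast
  then obtain c where c: "lower_central_series (G\<lparr>carrier := ?H\<rparr>) c = {\<one>\<^sub>G}" unfolding nilpotent_group_def by auto
  let ?D = "?T \<inter> ?H"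
  have D: "subgroup ?D G" by (rule G.subgroups_Inter_pair[OF T H])
  interpret HG: group "G\<lparr>carrier := ?H\<rparr>" by (rule subgroup.subgroup_is_group[OF H G.is_group])
  have Tn: "h \<bullet> d \<bullet> inv\<^sub>G h \<in> ?T" if h: "h \<in> carrier G" and d: "d \<in> ?T" for h d
  proof -
   have dc: "d \<in> carrier G" using d Tcar by blast
   have pw: "(h \<bullet> d \<bullet> inv\<^sub>G h) [^]\<^sub>G n = h \<bullet> d [^]\<^sub>G n \<bullet> inv\<^sub>G h" for n :: nat
    using h dc by (induction n) (simp_all add: G.m_assoc)
   obtain n :: nat where n: "n > 0" "d [^]\<^sub>G n = \<one>\<^sub>G" using tors[OF d] by blast
   have "(h \<bullet> d \<bullet> inv\<^sub>G h) [^]\<^sub>G n = \<one>\<^sub>G" using pw[of n] n h by simp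
   then show ?thesis unfolding torsion_part_def using n(1) h dc by auto
  qed
  have Hcar: "?H \<subseteq> carrier G" using subgroup.subset[OF H] .
  have Hm: "h \<bullet> d \<bullet> inv\<^sub>G h \<in> ?H" if "h \<in> ?H" "d \<in> ?H" for h d
   using that subgroup.m_closed[OF H] subgroup.m_inv_closed[OF H] by blast
  have Dn: "h \<bullet> d \<bullet> inv\<^sub>G h \<in> ?D" if "h \<in> ?H" "d \<in> ?D" for h d
   using Tn[of h d] Hm[of h d] that Hcar by blast
  obtain P where P: "positive_cone (G\<lparr>carrier := ?H\<rparr>) ?D ?H P"
  proof -
   have "\<exists>P. positive_cone (G\<lparr>carrier := ?H\<rparr>) ?D (carrier (G\<lparr>carrier := ?H\<rparr>)) P"
   proof (rule HG.nilpotent_positive_cone)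
    show "lower_central_series (G\<lparr>carrier := ?H\<rparr>) c = {\<one>\<^bsub>G\<lparr>carrier := ?H\<rparr>\<^esub>}" using c by simp
    show "subgroup ?D (G\<lparr>carrier := ?H\<rparr>)" using G.subgroup_incl[OF D H] by blast
   next
    fix g d assume gd: "g \<in> carrier (G\<lparr>carrier := ?H\<rparr>)" "d \<in> ?D"
    then have "inv\<^bsub>G\<lparr>carrier := ?H\<rparr>\<^esub> g = inv\<^sub>G g" using G.m_inv_consistent[OF H] by simp
    then show "g \<otimes>\<^bsub>G\<lparr>carrier := ?H\<rparr>\<^esub> d \<otimes>\<^bsub>G\<lparr>carrier := ?H\<rparr>\<^esub> inv\<^bsub>G\<lparr>carrier := ?H\<rparr>\<^esub> g \<in> ?D"
     using Dn gd by simp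
   next
    fix x and n :: nat assume x: "x \<in> carrier (G\<lparr>carrier := ?H\<rparr>)" "n > 0" "x [^]\<^bsub>G\<lparr>carrier := ?H\<rparr>\<^esub> n \<in> ?D"
    then have xn: "x [^]\<^sub>G n \<in> ?T" by (simp only: G.nat_pow_consistent[symmetric]) blast
    have xc: "x \<in> carrier G" "x \<in> ?H" using x(1) Hcar by auto
    obtain m :: nat where m: "m > 0" "(x [^]\<^sub>G n) [^]\<^sub>G m = \<one>\<^sub>G" using tors[OF xn] by blast
    then have "x [^]\<^sub>G (n * m) = \<one>\<^sub>G" using xc by (simp add: G.nat_pow_pow)
    then have "x \<in> ?T" unfolding torsion_part_def using xc m(1) x(2) by (auto intro!: exI[of _ "n * m"])
    then show "x \<in> ?D" using xc by blast
   qed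
   then show ?thesis using that by auto
  qed
  have FD: "FS ?D \<subseteq> FS ?T" using FS_mono by blast
  have gu: "graded_units F G A ?H ?D P q M"
  proof (rule graded_units.intro[OF grpalg_axioms graded_units_axioms.intro])
   show "subgroup ?H G" "subgroup ?D G" "?D \<subseteq> ?H" using H D by auto
   show "h \<bullet> d \<bullet> inv\<^sub>G h \<in> ?D" if "h \<in> ?H" "d \<in> ?D" for h d using Dn that .
   show "x \<bullet> y = y \<bullet> x" if "x \<in> ?D" "y \<in> ?D" for x y using Tcomm that by blast
   show "positive_cone (G\<lparr>carrier := ?H\<rparr>) ?D ?H P" by (rule P)
   show "cj h d = d \<or> cj h d = d [^] (q + 1)" if "h \<in> ?H" "d \<in> FS ?D" for h d
    using tw[of h d] that FD Hcar by blast
   show "u [^] (q ^ M) = \<one>" if "u \<in> FS ?D" "u \<in> Units A" for u using un[of u] that FD by blast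
  next
   fix c assume c: "c \<in> FS ?D" "c \<otimes> c = \<zero>"
   have "finite (supp c)" "supp c \<subseteq> ?D" using finite_supp[OF FS_carrier[OF c(1)]] FS_supp[OF c(1)] by simp_all
   moreover have "x \<bullet> y = y \<bullet> x" if "x \<in> ?D" "y \<in> ?D" for x y using Tcomm that by blast
   moreover have "\<exists>n>0. x [^]\<^sub>G (n::nat) = \<one>\<^sub>G" if "x \<in> ?D" for x using tors that by blast
   ultimately have "\<exists>B. subgroup B G \<and> finite B \<and> supp c \<subseteq> B \<and> B \<subseteq> ?D"
    by (intro G.finite_abelian_torsion_hull[OF D])
   then obtain B where B: "subgroup B G" "finite B" "supp c \<subseteq> B" "B \<subseteq> ?D" by (elim exE conjE)
   have cB: "c \<in> FS B" using c(1) B(3) by (auto simp: FS_def)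
   have Bc: "x \<bullet> y = y \<bullet> x" if "x \<in> B" "y \<in> B" for x y using Tcomm that B(4) by blast
   show "c = \<zero>"
    by (rule reduced_finite_abelian[OF B(1,2) Bc card_subgroup_invertible[OF nm B(1,2)] cB c(2)])
  qed
  have "u \<in> FS ?H" "inv u \<in> FS ?H" if "u \<in> S" for u
   using SA[OF that] that generate.incl[of _ ?S G] by (auto simp: FS_def)
  then show ?thesis using graded_units.nilpotent_units[OF gu c] S by blast
 qed
 then show ?thesis unfolding locally_nilpotent_group_def using V_group by blast
qed

end

section \<open>Unipotent automorphisms of finite fields\<close>

lemma prime_power_if_unique_prime_divisor:
 fixes n q :: nat
 assumes "n > 0" "Factorial_Ring.prime q" "\<And>r. Factorial_Ring.prime r \<Longrightarrow> r dvd n \<Longrightarrow> r = q"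
 shows "\<exists>m. n = q ^ m"
proof -
 have "q \<noteq> 0" "\<not> is_unit q" using assms(2) by auto
 then obtain k where k: "n = q ^ multiplicity q n * k" "\<not> q dvd k"
  using multiplicity_decompose'[of n q] assms(1) by auto
 have "k = 1"
 proof (rule ccontr)
  assume "k \<noteq> 1"
  then obtain r where r: "Factorial_Ring.prime r" "r dvd k" using prime_factor_nat by blast
  then have "r dvd n" using k(1) by (metis dvd_mult)
  then show False using assms(3) r k(2) by blast
 qed
 then show ?thesis using k(1) by auto
qed

lemma power_diff_geometric_nat: "(q - 1) * (\<Sum>j<n. q ^ j) = q ^ n - (1::nat)" if "q \<ge> 1"
proof (induction n)
 case (Suc n)
 have "q ^ n \<ge> 1" using that by simp
 have "(q - 1) * (\<Sum>j<Suc n. q ^ j) = q ^ n - 1 + (q - 1) * q ^ n" using Suc by (simp add: algebra_simps)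
 also have "\<dots> = q ^ Suc n - 1" using \<open>q ^ n \<ge> 1\<close> that by (simp add: diff_mult_distrib)
 finally show ?case .
qed simp

text \<open>
  Consequently an odd prime \<open>l\<close> that divides \<open>q - 1\<close> divides the geometric sum of
  \<open>l\<close> powers of \<open>q\<close> exactly once.
\<close>

lemma geometric_sum_mod_sq:
 fixes k l :: nat
 assumes "odd l"
 shows "(\<Sum>j<l. (1 + l * k) ^ j) mod (l * l) = l mod (l * l)"
proof -
 have pw: "[(1 + l * k) ^ j = 1 + j * (l * k)] (mod (l * l))" for j
 proof (induction j)
  case (Suc j)
  have "[(1 + l * k) * (1 + l * k) ^ j = (1 + l * k) * (1 + j * (l * k))] (mod (l * l))"
   using Suc by (rule cong_scalar_left)
  moreover have "(1 + l * k) * (1 + j * (l * k)) = 1 + Suc j * (l * k) + (l * l) * (k * k * j)"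
   by (simp add: algebra_simps)
  from this have "[(1 + l * k) * (1 + j * (l * k)) = 1 + Suc j * (l * k)] (mod (l * l))"
   by (simp only: cong_def mod_mult_self2)
  ultimately show ?case using cong_trans by (simp only: power_Suc) blast
 qed simp
 have "[(\<Sum>j<l. (1 + l * k) ^ j) = (\<Sum>j<l. 1 + j * (l * k))] (mod (l * l))"
  by (intro cong_sum pw)
 moreover obtain m where m: "l = 2 * m + 1" using assms by (elim oddE)
 have "(\<Sum>j<l. 1 + j * (l * k)) = (\<Sum>j<l. 1) + (\<Sum>j<l. j) * (l * k)"
  by (simp only: sum.distrib sum_distrib_right)
 then have "(\<Sum>j<l. 1 + j * (l * k)) = l + l * k * (\<Sum>j<l. j)" by (simp add: mult.commute)
 moreover have "(\<Sum>j<l. j) = l * m"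
 proof -
  have "2 * (\<Sum>j<n. j) = n * (n - 1)" for n :: nat
  proof (induction n)
   case (Suc n) then show ?case by (cases n) (auto simp: algebra_simps)
  qed simp
  from this[of l] have "2 * (\<Sum>j<l. j) = l * (l - 1)" .
  then show ?thesis using m by simp
 qed
 ultimately have "[(\<Sum>j<l. (1 + l * k) ^ j) = l + (l * l) * (k * m)] (mod (l * l))"
  by (simp add: algebra_simps)
 then show ?thesis unfolding cong_def by simp
qed

lemma odd_power_plus_one:
 fixes p :: nat
 assumes "odd p"
 shows "\<exists>c. odd c \<and> p ^ (2 * k + 1) + 1 = (p + 1) * c"
proof (induction k)
 case 0 then show ?case by (intro exI[of _ 1]) simp
next
 case (Suc k)
 then obtain c where c: "odd c" "p ^ (2 * k + 1) + 1 = (p + 1) * c" by blast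
 have p1: "p \<ge> 1" using assms by (cases p) auto
 have "c \<ge> 1" using c(1) by (cases c) auto
 then have "p * 1 \<le> p * (p * c)" using p1 by (intro mult_le_mono) auto
 then have "p * p * c \<ge> p - 1" unfolding mult.assoc by linarith
 have "int (p ^ (2 * Suc k + 1) + 1) = int p * int p * int (p ^ (2 * k + 1) + 1) - (int p * int p - 1)"
  by (simp add: algebra_simps)
 also have "\<dots> = (int p + 1) * (int p * int p * int c - (int p - 1))"
  unfolding c(2) by (simp add: algebra_simps)
 also have "int p * int p * int c - (int p - 1) = int (p * p * c - (p - 1))"
  using p1 \<open>p * p * c \<ge> p - 1\<close> by (simp only: of_nat_diff of_nat_mult)
 also have "(int p + 1) * int (p * p * c - (p - 1)) = int ((p + 1) * (p * p * c - (p - 1)))"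
  by (simp only: of_nat_mult of_nat_add of_nat_1)
 finally have "p ^ (2 * Suc k + 1) + 1 = (p + 1) * (p * p * c - (p - 1))" by (simp only: of_nat_eq_iff)
 moreover have "odd (p * p * c - (p - 1))"
  using assms c(1) \<open>p * p * c \<ge> p - 1\<close> by simp
 ultimately show ?case by blast
qed

text \<open>
  The elementary special case of Zsigmondy's theorem in which nothing but the prime divisors of \<open>q -
  1\<close>, \<open>q = p\<^sup>i\<close>, may divide \<open>q\<^sup>s - 1\<close>. The quotient of the two
  numbers is too large to consist of such primes, unless \<open>s = 2\<close> and \<open>q + 1\<close> is a power of two, and then also \<open>i = 1\<close>.
\<close>

lemma mersenne_of_no_new_primes:
 fixes p i s :: nat
 assumes p: "Factorial_Ring.prime p" and i: "i \<ge> 1" and s: "s \<ge> 2"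
  and no_new: "\<And>r. Factorial_Ring.prime r \<Longrightarrow> r dvd p ^ (i * s) - 1 \<Longrightarrow> r dvd p ^ i - 1"
 shows "i = 1 \<and> s = 2 \<and> (\<exists>t. p + 1 = 2 ^ t)"
proof -
 define q where "q = p ^ i"
 have p2: "p \<ge> 2" using prime_ge_2_nat[OF p] .
 have q2: "q \<ge> 2" using p2 i self_le_power[of p i] unfolding q_def by linarith
 have nn: "r dvd q - 1" if "Factorial_Ring.prime r" "r dvd q ^ s - 1" for r
  using no_new[OF that(1)] that(2) by (simp add: q_def power_mult)
 have dv: "q ^ a - 1 dvd q ^ s - 1" if a: "a dvd s" for a
 proof -
  obtain b where "s = a * b" using a by (elim dvdE)
  then have "q ^ s - 1 = (q ^ a - 1) * (\<Sum>j<b. (q ^ a) ^ j)"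
   using power_diff_geometric_nat[of "q ^ a" b] q2 by (simp add: power_mult)
  then show ?thesis by simp
 qed
 have cong_geo: "[(\<Sum>j<n. q ^ j) = n] (mod r)" if "r dvd q - 1" for r n
 proof -
  have "[q = 1] (mod r)" using that q2 by (simp add: cong_altdef_nat)
  then have "[q ^ j = 1 ^ j] (mod r)" for j by (rule cong_pow)
  then have "[(\<Sum>j<n. q ^ j) = (\<Sum>j<n. 1)] (mod r)" by (intro cong_sum) simp
  then show ?thesis by simp
 qed
 have two: "l = 2" if l: "Factorial_Ring.prime l" "l dvd s" for l
 proof (rule ccontr)
  assume "l \<noteq> 2"
  then have ol: "odd l" using l(1) by (metis dvd_refl prime_nat_iff two_is_prime_nat primes_dvd_imp_eq)
  have l2: "l \<ge> 2" using prime_ge_2_nat[OF l(1)] .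
  let ?G = "\<Sum>j<l. q ^ j"
  have Gdvd: "?G dvd q ^ s - 1"
   using power_diff_geometric_nat[of q l] q2 dv[OF l(2)] by (metis One_nat_def Suc_leD dvd_mult_right numeral_2_eq_2)
  have rl: "r = l" if r: "Factorial_Ring.prime r" "r dvd ?G" for r
  proof -
   have "r dvd q - 1" using nn[OF r(1)] r(2) Gdvd dvd_trans by blast
   then have "[?G = l] (mod r)" by (rule cong_geo)
   then have "r dvd l" using r(2) cong_dvd_iff by blast
   then show ?thesis using primes_dvd_imp_eq r(1) l(1) by blast
  qed
  have Gl: "?G > l"
  proof -
   have "(\<Sum>j<l. (1::nat)) < ?G"
    by (rule sum_strict_mono_ex1) (use q2 l2 in \<open>auto intro!: bexI[of _ 1]\<close>)
   then show ?thesis by simp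
  qed
  have "\<exists>m. ?G = l ^ m"
   by (rule prime_power_if_unique_prime_divisor[OF _ l(1)]) (use Gl in simp, rule rl)
  then obtain m where m: "?G = l ^ m" by blast
  have "m \<noteq> 0" "m \<noteq> 1" using Gl m l2 by (auto intro: ccontr)
  then have "m \<ge> 2" by simp
  then have "l ^ 2 dvd ?G" unfolding m by (rule le_imp_power_dvd)
  then have sq: "l * l dvd ?G" by (simp add: power2_eq_square)
  then have "l dvd ?G" by (rule dvd_mult_left)
  then have "l dvd q - 1" using nn[OF l(1)] Gdvd dvd_trans by blast
  then obtain k where "q - 1 = l * k" by (elim dvdE)
  then have "q = 1 + l * k" using q2 by simp
  then have "?G mod (l * l) = l mod (l * l)" using geometric_sum_mod_sq[OF ol] by simp
  then show False using sq l2 by (simp add: mod_eq_0_iff_dvd)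
 qed
 obtain l where l: "Factorial_Ring.prime l" "l dvd s" using prime_factor_nat[of s] s by auto
 then have "2 dvd s" using two by blast
 have "\<exists>m. q + 1 = 2 ^ m"
 proof (rule prime_power_if_unique_prime_divisor)
  fix r assume r: "Factorial_Ring.prime r" "r dvd q + 1"
  have e: "q ^ 2 - 1 = (q + 1) * (q - 1)" using q2 by (simp add: power2_eq_square algebra_simps)
  have "r dvd q ^ s - 1" using dv[OF \<open>2 dvd s\<close>] r(2) unfolding e by (meson dvd_mult2 dvd_trans)
  then have "r dvd q - 1" by (rule nn[OF r(1)])
  then have "r dvd (q + 1) - (q - 1)" using r(2) by (rule dvd_diff_nat[rotated])
  then have "r dvd 2" using q2 by simp
  then show "r = 2" using primes_dvd_imp_eq r(1) two_is_prime_nat by blast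
 qed simp_all
 then obtain m where m: "q + 1 = 2 ^ m" by blast
 have "m \<noteq> 0" using m q2 by (intro notI) simp
 then have "even ((2::nat) ^ m)" by simp
 then have oq: "odd q" unfolding m[symmetric] by simp
 have op: "odd p" using oq i unfolding q_def by auto
 have m2: "m \<ge> 2"
 proof (rule ccontr)
  assume "\<not> m \<ge> 2"
  then have "m = 1" using \<open>m \<noteq> 0\<close> by simp
  then show False using m q2 by simp
 qed
 then have four: "4 dvd q + 1" unfolding m using le_imp_power_dvd[of 2 m "2::nat"] by simp
 have sq1: "(x * x) mod 4 = 1" if ox: "odd x" for x :: nat
 proof -
  obtain y where "x = 2 * y + 1" using ox by (elim oddE)
  then have "x * x = 1 + 4 * (y * y + y)" by (simp add: algebra_simps)
  then show ?thesis by simp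
 qed
 have s2: "s = 2"
 proof -
  have "\<exists>j. s = 2 ^ j"
   by (rule prime_power_if_unique_prime_divisor[OF _ two_is_prime_nat]) (use s in simp, rule two)
  then obtain j where "s = 2 ^ j" by blast
  moreover have "\<not> 4 dvd s"
  proof
   assume "4 dvd s"
   have e: "q ^ 4 - 1 = (q * q + 1) * (q * q - 1)"
    using q2 by (simp add: power4_eq_xxxx algebra_simps)
   have "\<exists>m. q * q + 1 = 2 ^ m"
   proof (rule prime_power_if_unique_prime_divisor)
    fix r assume r: "Factorial_Ring.prime r" "r dvd q * q + 1"
    have "r dvd q ^ s - 1" using dv[OF \<open>4 dvd s\<close>] r(2) unfolding e by (meson dvd_mult2 dvd_trans)
    then have "r dvd q - 1" by (rule nn[OF r(1)])
    moreover have "q * q + 1 - 2 = (q - 1) * (q + 1)" using q2 by (simp add: algebra_simps)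
    ultimately have "r dvd q * q + 1 - 2" by (metis dvd_mult2)
    then have "r dvd (q * q + 1) - (q * q + 1 - 2)" using r(2) by (rule dvd_diff_nat[rotated])
    moreover have "(q * q + 1) - (q * q + 1 - 2) = 2" using q2 by simp
    ultimately have "r dvd 2" by simp
    then show "r = 2" using primes_dvd_imp_eq r(1) two_is_prime_nat by blast
   qed simp_all
   then obtain m' where m': "q * q + 1 = 2 ^ m'" by blast
   have "(q * q + 1) mod 4 = 2" using sq1[OF oq] by presburger
   then have "\<not> m' \<ge> 2" unfolding m' using le_imp_power_dvd[of 2 m' "2::nat"] by (auto simp: dvd_eq_mod_eq_0)
   then have "2 ^ m' \<le> (2::nat)" by (cases m') (auto simp: not_less_eq_eq)
   moreover have "q * q \<ge> 4" using mult_le_mono[OF q2 q2] by simp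
   ultimately show False using m' by simp
  qed
  ultimately have "j < 2" using le_imp_power_dvd[of 2 j "2::nat"] by (auto simp: not_less[symmetric])
  then show ?thesis using \<open>s = 2 ^ j\<close> s by (cases j) (auto simp: less_Suc_eq)
 qed
 have "odd i"
 proof
  assume "even i"
  then obtain k where "i = 2 * k" by (elim evenE)
  then have "q = p ^ k * p ^ k" unfolding q_def by (simp add: power_add mult_2)
  moreover have "odd (p ^ k)" using op by simp
  ultimately have "q mod 4 = 1" using sq1 by simp
  then have "(q + 1) mod 4 = 2" by presburger
  then show False using four by (simp add: dvd_eq_mod_eq_0)
 qed
 then obtain k where k: "i = 2 * k + 1" by (elim oddE)
 obtain c where c: "odd c" "q + 1 = (p + 1) * c" using odd_power_plus_one[OF op, of k] unfolding q_def k by blast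
 have "c dvd 2 ^ m" using c(2) m by (metis dvd_triv_right)
 then obtain j where "c = 2 ^ j" using divides_primepow_nat[OF two_is_prime_nat] by blast
 then have "c = 1" using c(1) by (cases j) auto
 then have "p ^ i = p" "p + 1 = 2 ^ m" using c(2) m unfolding q_def by auto
 then have "i = 1" using p2 power_inject_exp[of p i 1] by simp
 then show ?thesis using s2 \<open>p + 1 = 2 ^ m\<close> by blast
qed

text \<open>
  Let \<open>z = y / \<sigma> y\<close> be the last nontrivial element of the sequence of iterates. It is
  fixed by \<open>\<sigma>\<close>, so \<open>\<sigma>\<^sup>s y = y\<close> says that \<open>z\<^sup>s =
  1\<close>. Hence the sequence that starts from \<open>x\<^sup>s\<close> ends one step earlier, and induction
  applies.
\<close>

lemma (in comm_group) unipotent_power: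
 assumes \<sigma>: "\<And>x. x \<in> carrier G \<Longrightarrow> \<sigma> x \<in> carrier G"
  "\<And>x y. x \<in> carrier G \<Longrightarrow> y \<in> carrier G \<Longrightarrow> \<sigma> (x \<otimes> y) = \<sigma> x \<otimes> \<sigma> y"
  and s: "\<And>x. x \<in> carrier G \<Longrightarrow> (\<sigma> ^^ s) x = x"
  and x: "x \<in> carrier G" "((\<lambda>y. y \<otimes> inv (\<sigma> y)) ^^ m) x = \<one>"
 shows "\<exists>j. (x \<otimes> inv (\<sigma> x)) [^] (s ^ j :: nat) = \<one>"
 using x
proof (induction m arbitrary: x rule: less_induct)
 case (less m)
 let ?f = "\<lambda>y. y \<otimes> inv (\<sigma> y)"
 have h: "group_hom G G \<sigma>"
  using \<sigma> by (simp add: group_hom_def group_hom_axioms_def is_group hom_def)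
 interpret h: group_hom G G \<sigma> by (rule h)
 have fc: "?f y \<in> carrier G" if "y \<in> carrier G" for y using that by simp
 have fm: "?f (y \<otimes> z) = ?f y \<otimes> ?f z" if "y \<in> carrier G" "z \<in> carrier G" for y z
  using that by (simp add: inv_mult m_ac)
 have fkc: "(?f ^^ k) y \<in> carrier G" if "y \<in> carrier G" for k y using that fc by (induction k) auto
 have f1: "?f \<one> = \<one>" by simp
 have fp: "?f (y [^] n) = ?f y [^] n" if "y \<in> carrier G" for y and n :: nat
  using that fm fc f1 by (induction n) auto
 have fkp: "(?f ^^ k) (y [^] n) = (?f ^^ k) y [^] n" if "y \<in> carrier G" for y k and n :: nat
 proof (induction k)
  case (Suc k) then show ?case using fp[OF fkc[OF that, of k], of n] by simp
 qed simp
 consider "m = 0" | "m = 1" | k where "m = Suc (Suc k)" by (metis One_nat_def not0_implies_Suc)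
 then show ?case
 proof cases
  case 1 then show ?thesis using less by simp
 next
  case 2 then show ?thesis using less by simp
 next
  case 3
  let ?y = "(?f ^^ k) x"
  have yc: "?y \<in> carrier G" by (rule fkc[OF less(2)])
  obtain y where y: "y = ?y" "y \<in> carrier G" using yc by blast
  let ?z = "?f y"
  have zc: "?z \<in> carrier G" using y(2) by simp
  have "?f ?z = \<one>" using less(3) 3 y by simp
  then have sz: "\<sigma> ?z = ?z" using zc h.hom_closed[OF zc] by (metis inv_inv inv_equality inv_closed r_inv inv_solve_right' l_one)
  obtain z where z: "z = ?z" "z \<in> carrier G" "\<sigma> z = z" using zc sz by blast
  have "\<sigma> y = inv z \<otimes> y" unfolding z(1) using y(2) by (simp add: inv_mult_group m_assoc)
  have it: "(\<sigma> ^^ n) y = inv z [^] n \<otimes> y" for n :: nat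
  proof (induction n)
   case (Suc n)
   have "\<sigma> (inv z [^] n \<otimes> y) = inv z [^] n \<otimes> \<sigma> y"
    using z(2,3) y(2) by (simp add: h.hom_nat_pow)
   then show ?case using Suc \<open>\<sigma> y = inv z \<otimes> y\<close> z(2) y(2) by (simp add: m_assoc)
  qed (use y in simp)
  have "inv z [^] s \<otimes> y = y" by (rule trans[OF it[symmetric] s[OF y(2)]])
  then have "inv z [^] s = \<one>" using z(2) y(2) by (metis inv_closed nat_pow_closed r_cancel_one)
  then have zs: "z [^] s = \<one>" using z(2) by (simp add: nat_pow_inv)
  have "(?f ^^ Suc k) (x [^] s) = \<one>" using fkp[OF less(2), of "Suc k" s] zs unfolding z(1) y(1) by simp
  then obtain j where "?f (x [^] s) [^] (s ^ j) = \<one>"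
   using less(1)[of "Suc k" "x [^] s"] 3 less(2) by auto
  then have "?f x [^] (s ^ Suc j) = \<one>" using fp[OF less(2), of s] less(2) by (simp add: nat_pow_pow)
  then show ?thesis by blast
 qed
qed

lemma (in group) order_of_exponent_prime:
 assumes fin: "finite (carrier G)" and p: "Factorial_Ring.prime p" and e: "\<And>x. x \<in> carrier G \<Longrightarrow> x [^] (p::nat) = \<one>"
 shows "\<exists>d. order G = p ^ d"
proof (rule prime_power_if_unique_prime_divisor[OF _ p])
 show "order G > 0" using fin order_gt_0_iff_finite by blast
 fix r assume r: "Factorial_Ring.prime r" "r dvd order G"
 then obtain x where x: "x \<in> carrier G" "ord x = r" using cauchy_prime_order[OF fin] by blast
 have "r dvd p" using e[OF x(1)] pow_eq_id[OF x(1), of p] x(2) by simp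
 then show "r = p" using primes_dvd_imp_eq r(1) p by blast
qed

text \<open>
  Let \<open>\<sigma>\<close> have order \<open>s\<close> and fixed field of \<open>p\<^sup>i\<close>
  elements. Unipotency leads from an element of prime order \<open>r\<close> of the multiplicative group to a
  fixed element of the same order, so every prime divisor of \<open>p\<^sup>i\<^sup>s - 1\<close> already
  divides \<open>p\<^sup>i - 1\<close>. The arithmetic lemma then forces \<open>i = 1\<close> and \<open>s =
  2\<close>.
\<close>

lemma (in field) unipotent_automorphism:
 fixes \<sigma> :: "'a \<Rightarrow> 'a"
 assumes fin: "finite (carrier R)" and p: "Factorial_Ring.prime (p::nat)" "add_pow R p \<one> = \<zero>"
  and \<sigma>: "\<sigma> \<in> ring_hom R R" and nt: "z0 \<in> carrier R" "\<sigma> z0 \<noteq> z0"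
  and uni: "\<And>x. x \<in> carrier R \<Longrightarrow> x \<noteq> \<zero> \<Longrightarrow> \<exists>m. ((\<lambda>y. y \<otimes> inv (\<sigma> y)) ^^ m) x = \<one>"
 shows "\<exists>t. p + 1 = 2 ^ t" "z \<in> carrier R \<Longrightarrow> z [^] (p * p) = z"
  "z \<in> carrier R \<Longrightarrow> \<sigma> z = z \<or> \<sigma> z = z [^] p" "z \<in> carrier R \<Longrightarrow> \<sigma> z = z \<Longrightarrow> \<exists>k::nat. z = add_pow R k \<one>"
proof -
 interpret h: ring_hom_cring R R \<sigma>
  using \<sigma> is_cring by (simp add: ring_hom_cring_def ring_hom_cring_axioms_def)
 interpret M: group "Multiplicative_Group.mult_of R" by (rule field_mult_group)
 let ?K = "{x \<in> carrier R. \<sigma> x = x}"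
 have char: "add_pow R p x = \<zero>" if "x \<in> carrier R" for x using add_pow_eq_mult[OF that] p(2) that by simp
 have snz: "\<sigma> x \<noteq> \<zero>" if x: "x \<in> carrier R" "x \<noteq> \<zero>" for x
 proof
  assume "\<sigma> x = \<zero>"
  have "inv x \<otimes> x = \<one>" "inv x \<in> carrier R" using x field_Units by auto
  then have "\<sigma> (inv x) \<otimes> \<sigma> x = \<one>" using x(1) h.hom_mult[of "inv x" x] by simp
  then show False using \<open>\<sigma> x = \<zero>\<close> \<open>inv x \<in> carrier R\<close> by simp
 qed
 have U: "x \<in> Units R" if "x \<in> carrier R" "x \<noteq> \<zero>" for x using that field_Units by auto
 have minv: "inv\<^bsub>Multiplicative_Group.mult_of R\<^esub> x = inv x" if "x \<in> carrier R" "x \<noteq> \<zero>" for x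
  by (rule M.inv_equality) (use that U[OF that] Units_inv_Units[OF U[OF that]] field_Units in auto)
 obtain d where d: "card (carrier R) = p ^ d"
  using add.order_of_exponent_prime[OF _ p(1)] fin char by (auto simp: order_def)
 have Ksub: "subgroup ?K (add_monoid R)"
  by (rule add.subgroupI) (auto simp: h.hom_add intro: exI[of _ \<zero>])
 then interpret Kg: group "(add_monoid R)\<lparr>carrier := ?K\<rparr>" by (rule subgroup.subgroup_is_group[OF _ add.is_group])
 obtain i where i: "card ?K = p ^ i"
 proof -
  have "x [^]\<^bsub>(add_monoid R)\<lparr>carrier := ?K\<rparr>\<^esub> p = \<zero>" if "x \<in> ?K" for x
   using char[of x] that by (simp only: add.nat_pow_consistent[symmetric]) simp
  then have "\<exists>i. order ((add_monoid R)\<lparr>carrier := ?K\<rparr>) = p ^ i"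
   using fin by (intro Kg.order_of_exponent_prime[OF _ p(1)]) auto
  then show ?thesis using that by (auto simp: order_def)
 qed
 have K01: "\<zero> \<in> ?K" "\<one> \<in> ?K" by auto
 have Kfin: "finite ?K" using fin by simp
 have pi1: "p ^ i \<ge> 2"
  using card_mono[OF Kfin, of "{\<zero>, \<one>}"] K01 i by simp
 have i1: "i \<ge> 1" using pi1 by (cases i) auto
 have Kmsub: "subgroup (?K - {\<zero>}) (Multiplicative_Group.mult_of R)"
 proof (rule M.subgroupI)
  fix a assume a: "a \<in> ?K - {\<zero>}"
  have "\<sigma> (inv a) \<otimes> a = \<one>" using a U[of a] h.hom_mult[of "inv a" a] by auto
  then have "\<sigma> (inv a) = inv a" using a U[of a] comm_inv_char[of a "\<sigma> (inv a)"] by (simp add: m_comm)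
  then show "inv\<^bsub>Multiplicative_Group.mult_of R\<^esub> a \<in> ?K - {\<zero>}" using a U[of a] minv[of a] Units_inv_Units[of a] field_Units by auto
 qed (auto simp: integral_iff)
 have cM: "card (carrier (Multiplicative_Group.mult_of R)) = p ^ d - 1" using d fin by (simp add: card_Diff_singleton)
 have cK: "card (?K - {\<zero>}) = p ^ i - 1" using i Kfin K01 by (simp add: card_Diff_singleton)
 have finM: "finite (carrier (Multiplicative_Group.mult_of R))" using fin by simp
 have dvd: "p ^ i - 1 dvd p ^ d - 1"
 proof -
  have "card (?K - {\<zero>}) dvd order (Multiplicative_Group.mult_of R)"
   unfolding M.lagrange[OF Kmsub, symmetric] by simp
  then show ?thesis unfolding order_def cM cK .
 qed
 have p2: "p \<ge> 2" using prime_ge_2_nat[OF p(1)] .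
 have new: "r dvd p ^ i - 1" if r: "Factorial_Ring.prime r" "r dvd p ^ d - 1" for r
 proof -
  obtain x where x: "x \<in> carrier (Multiplicative_Group.mult_of R)" "M.ord x = r"
   using M.cauchy_prime_order[OF finM r(1)] r(2) cM by (auto simp: order_def)
  let ?f = "\<lambda>y. y \<otimes> inv (\<sigma> y)"
  have xc: "x \<in> carrier R" "x \<noteq> \<zero>" using x by auto
  have xr: "x [^] r = \<one>" using M.pow_ord_eq_1[OF x(1)] x(2) by (simp add: Multiplicative_Group.nat_pow_mult_of)
  have x1: "x \<noteq> \<one>" using x M.ord_eq_1[of x] r(1) by auto
  have step: "?f y \<in> carrier R \<and> ?f y \<noteq> \<zero> \<and> ?f y [^] r = \<one>" if y: "y \<in> carrier R \<and> y \<noteq> \<zero> \<and> y [^] r = \<one>" for y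
  proof -
   have sy: "\<sigma> y \<in> Units R" "\<sigma> y \<in> carrier R" using y snz[of y] U[of "\<sigma> y"] by auto
   have "\<sigma> y [^] r = \<one>"
   proof -
    have "\<sigma> (y [^] n) = \<sigma> y [^] n" for n :: nat using y by (induction n) simp_all
    from this[of r] show ?thesis using y by simp
   qed
   moreover have "(\<sigma> y \<otimes> inv (\<sigma> y)) [^] r = \<sigma> y [^] r \<otimes> inv (\<sigma> y) [^] r"
    using sy by (intro nat_pow_distrib) auto
   ultimately have "inv (\<sigma> y) [^] r = \<one>" using sy by simp
   moreover have "?f y [^] r = y [^] r \<otimes> inv (\<sigma> y) [^] r" using y sy by (intro nat_pow_distrib) auto
   ultimately have "?f y [^] r = \<one>" using y by simp
   moreover have "?f y \<noteq> \<zero>" using y sy Units_inv_Units[OF sy(1)] field_Units by (auto simp: integral_iff)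
   ultimately show ?thesis using y sy by auto
  qed
  have it: "(?f ^^ k) x \<in> carrier R \<and> (?f ^^ k) x \<noteq> \<zero> \<and> (?f ^^ k) x [^] r = \<one>" for k
  proof (induction k)
   case (Suc k) then show ?case using step[OF Suc] by simp
  qed (use xc xr in simp)
  define m where "m = (LEAST m. (?f ^^ m) x = \<one>)"
  have m: "(?f ^^ m) x = \<one>" unfolding m_def by (rule LeastI_ex[OF uni[OF xc]])
  have "m \<noteq> 0" using m x1 by (intro notI) simp
  then obtain k where k: "m = Suc k" by (cases m) auto
  have nk: "(?f ^^ k) x \<noteq> \<one>"
   using not_less_Least[of k "\<lambda>m. (?f ^^ m) x = \<one>"] k unfolding m_def[symmetric] by simp
  obtain y where y: "y = (?f ^^ k) x" by blast
  have yc: "y \<in> carrier R" "y \<noteq> \<zero>" "y [^] r = \<one>" "y \<noteq> \<one>" using it[of k] nk y by auto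
  have "?f y = \<one>" using m k y by simp
  then have "y \<otimes> inv (\<sigma> y) \<otimes> \<sigma> y = \<sigma> y" using yc by simp
  then have "\<sigma> y = y" using yc snz[of y] U[of "\<sigma> y"] by (simp add: m_assoc)
  then have yK: "y \<in> ?K - {\<zero>}" using yc by simp
  interpret KM: group "(Multiplicative_Group.mult_of R)\<lparr>carrier := ?K - {\<zero>}\<rparr>" by (rule subgroup.subgroup_is_group[OF Kmsub M.is_group])
  have "y [^]\<^bsub>(Multiplicative_Group.mult_of R)\<lparr>carrier := ?K - {\<zero>}\<rparr>\<^esub> r = \<one>"
   using yc(3) by (simp only: M.nat_pow_consistent[symmetric] Multiplicative_Group.nat_pow_mult_of)
  then have "KM.ord y dvd r" using KM.pow_eq_id[of y r] yK by simp
  moreover have "KM.ord y \<noteq> 1" using KM.ord_eq_1[of y] yK yc(4) by simp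
  ultimately have "KM.ord y = r" using r(1) unfolding prime_nat_iff by metis
  then have "r dvd order ((Multiplicative_Group.mult_of R)\<lparr>carrier := ?K - {\<zero>}\<rparr>)" using KM.ord_dvd_group_order[of y] yK by simp
  then show ?thesis using cK by (simp add: order_def)
 qed
 have id: "i dvd d"
 proof -
  have c: "[p ^ (i * a) = 1] (mod (p ^ i - 1))" for a
  proof -
   have "[p ^ i = 1] (mod (p ^ i - 1))" using pi1 by (simp add: cong_altdef_nat)
   then have "[(p ^ i) ^ a = 1 ^ a] (mod (p ^ i - 1))" by (rule cong_pow)
   then show ?thesis by (simp add: power_mult)
  qed
  have "[p ^ d = 1] (mod (p ^ i - 1))" using dvd p2 by (simp add: cong_altdef_nat)
  moreover have "p ^ d = p ^ (i * (d div i)) * p ^ (d mod i)" by (simp flip: power_add)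
  moreover have "[p ^ (i * (d div i)) * p ^ (d mod i) = 1 * p ^ (d mod i)] (mod (p ^ i - 1))"
   using c by (rule cong_scalar_right)
  ultimately have "[p ^ (d mod i) = 1] (mod (p ^ i - 1))" by (metis cong_sym cong_trans mult_1)
  then have dv: "p ^ i - 1 dvd p ^ (d mod i) - 1" using p2 by (simp add: cong_altdef_nat)
  have "d mod i < i" using i1 by simp
  then have "p ^ (d mod i) < p ^ i" using p2 by (intro power_strict_increasing) auto
  then have "p ^ (d mod i) - 1 < p ^ i - 1" using p2 by (simp add: diff_less_mono)
  then have "p ^ (d mod i) - 1 = 0" using dv by (metis dvd_imp_le neq0_conv not_le)
  moreover have "p ^ (d mod i) \<ge> 1" using p2 by simp
  ultimately have "p ^ (d mod i) = 1" by simp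
  then have "d mod i = 0" using p2 by (metis nat_power_eq_Suc_0_iff One_nat_def Suc_1 not_less_eq_eq le_refl)
  then show ?thesis by auto
 qed
 then obtain s where s: "d = i * s" by (elim dvdE)
 have "card ?K < card (carrier R)" using nt fin by (intro psubset_card_mono) auto
 then have "p ^ i < p ^ d" using i d by simp
 then have "i < d" using p2 by (simp add: power_less_imp_less_exp)
 then have "s \<ge> 2" using s i1 by (cases s; cases "s - 1") auto
 then have nt: "i = 1 \<and> s = 2 \<and> (\<exists>t. p + 1 = 2 ^ t)"
  using mersenne_of_no_new_primes[OF p(1) i1 _ new] unfolding s by blast
 then show "\<exists>t. p + 1 = 2 ^ t" by blast
 have dd: "p ^ d = p * p" using nt s by (simp add: power2_eq_square)
 have pp: "z [^] (p * p) = z" if z: "z \<in> carrier R" for z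
 proof (cases "z = \<zero>")
  case True then show ?thesis using p2 by (simp add: nat_pow_zero)
 next
  case False
  have "z [^]\<^bsub>Multiplicative_Group.mult_of R\<^esub> order (Multiplicative_Group.mult_of R) = \<one>" using M.pow_order_eq_1[of z] z False by simp
  then have "z [^] (p * p - 1) = \<one>" using cM dd by (simp add: order_def Multiplicative_Group.nat_pow_mult_of)
  then have zs: "z [^] Suc (p * p - 1) = z" using z by simp
  have "Suc (p * p - 1) = p * p" using p2 by simp
  then show ?thesis using zs by (simp only:)
 qed
 then show "z \<in> carrier R \<Longrightarrow> z [^] (p * p) = z" by blast
 have ci: "card (?K - {\<zero>}) = p - 1" using cK nt by simp
 have Kp1: "z [^] (p - 1) = \<one>" if z: "z \<in> ?K - {\<zero>}" for z
 proof -
  interpret KM: group "(Multiplicative_Group.mult_of R)\<lparr>carrier := ?K - {\<zero>}\<rparr>" by (rule subgroup.subgroup_is_group[OF Kmsub M.is_group])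
  have "z [^]\<^bsub>(Multiplicative_Group.mult_of R)\<lparr>carrier := ?K - {\<zero>}\<rparr>\<^esub> order ((Multiplicative_Group.mult_of R)\<lparr>carrier := ?K - {\<zero>}\<rparr>) = \<one>"
   using KM.pow_order_eq_1[of z] z by simp
  then have "z [^] order ((Multiplicative_Group.mult_of R)\<lparr>carrier := ?K - {\<zero>}\<rparr>) = \<one>"
   by (simp only: M.nat_pow_consistent[symmetric] Multiplicative_Group.nat_pow_mult_of)
  then show ?thesis using ci by (simp add: order_def)
 qed
 have pS: "p = Suc (p - 1)" using p2 by simp
 have PM: "card ((\<lambda>k::nat. add_pow R k \<one>) ` {..<p}) = p"
 proof -
  have "inj_on (\<lambda>k::nat. add_pow R k \<one>) {..<p}"
  proof (rule inj_onI)
   fix k l :: nat assume kl: "k \<in> {..<p}" "l \<in> {..<p}" "add_pow R k \<one> = add_pow R l \<one>"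
   have char_p: "ring_characteristic R = p"
   proof -
    have "ring_characteristic R dvd p" using characteristic_dvd[of p] p(2) by simp
    moreover have "ring_characteristic R \<noteq> 1" using characteristic_dvd[of 1] by auto
    ultimately show ?thesis using p(1) unfolding prime_nat_iff by blast
   qed
   have *: "m = n" if "m \<le> n" "n < p" "add_pow R m \<one> = add_pow R n \<one>" for m n :: nat
   proof -
    have "add_pow R m \<one> \<oplus> add_pow R (n - m) \<one> = add_pow R m \<one> \<oplus> \<zero>"
    proof -
     have "add_pow R m \<one> \<oplus> add_pow R (n - m) \<one> = add_pow R n \<one>"
      using add.nat_pow_mult[of \<one> m "n - m"] that(1) by simp
     then show ?thesis using that(3) by simp
    qed
    then have "add_pow R (n - m) \<one> = \<zero>"
     using add.l_cancel[of "add_pow R m \<one>" "add_pow R (n - m) \<one>" \<zero>] by simp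
    then have "p dvd n - m" using characteristic_dvd char_p by simp
    then show ?thesis using that by (auto dest: dvd_imp_le)
   qed
   have "k < p" "l < p" using kl(1,2) by simp_all
   then show "k = l" using *[OF _ _ kl(3)] *[OF _ _ kl(3)[symmetric]] nat_le_linear[of k l] by metis
  qed
  then show ?thesis by (simp add: card_image)
 qed
 have PK: "(\<lambda>k::nat. add_pow R k \<one>) ` {..<p} \<subseteq> ?K"
 proof -
  have "\<sigma> (add_pow R k \<one>) = add_pow R k \<one>" for k :: nat
  proof (induction k)
   case 0
   have "\<sigma> (add_pow R (0::nat) \<one>) = \<sigma> \<zero>" by (rule arg_cong[OF add.nat_pow_0])
   also have "\<dots> = \<zero>" by (rule h.hom_zero)
   also have "\<dots> = add_pow R (0::nat) \<one>" by (rule add.nat_pow_0[symmetric])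
   finally show ?case .
  next
   case (Suc k)
   have c: "add_pow R k \<one> \<in> carrier R" by (rule add.nat_pow_closed[OF one_closed])
   have "\<sigma> (add_pow R (Suc k) \<one>) = \<sigma> (add_pow R k \<one> \<oplus> \<one>)" by (rule arg_cong[OF add.nat_pow_Suc])
   also have "\<dots> = \<sigma> (add_pow R k \<one>) \<oplus> \<sigma> \<one>" by (rule h.hom_add[OF c one_closed])
   also have "\<dots> = add_pow R k \<one> \<oplus> \<one>" unfolding Suc h.hom_one ..
   also have "\<dots> = add_pow R (Suc k) \<one>" by (rule add.nat_pow_Suc[symmetric])
   finally show ?case .
  qed
  then have "add_pow R k \<one> \<in> ?K" for k :: nat using add.nat_pow_closed[OF one_closed, of k] by blast
  then show ?thesis by blast
 qed
 have Kp: "card ?K = p" by (rule trans[OF i]) (simp only: conjunct1[OF nt] power_one_right)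
 have KE: "(\<lambda>k::nat. add_pow R k \<one>) ` {..<p} = ?K" by (rule card_subset_eq[OF Kfin PK trans[OF PM sym[OF Kp]]])
 show "\<exists>k::nat. z = add_pow R k \<one>" if "z \<in> carrier R" "\<sigma> z = z"
 proof -
  have "z \<in> (\<lambda>k::nat. add_pow R k \<one>) ` {..<p}" unfolding KE using that by simp
  then show ?thesis by blast
 qed
 have pK: "\<sigma> z = z" if z: "z \<in> carrier R" "z [^] p = z" for z
 proof (cases "z = \<zero>")
  case False
  let ?S = "{x \<in> carrier R. x [^] (p - 1) = \<one>}"
  have "z [^] (p - 1) \<otimes> z = z [^] Suc (p - 1)" by simp
  then have "z [^] (p - 1) \<otimes> z = z" unfolding pS[symmetric] z(2) .
  then have "z [^] (p - 1) \<otimes> z = \<one> \<otimes> z" using z by simp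
  then have "z [^] (p - 1) = \<one>" using z False m_rcancel[of z "z [^] (p - 1)" \<one>] by simp
  then have "z \<in> ?S" using z by simp
  have "card ?S \<le> p - 1" using num_roots_le_deg[OF fin, of "p - 1"] p2 by simp
  moreover have "?K - {\<zero>} \<subseteq> ?S" using Kp1 by blast
  ultimately have "?K - {\<zero>} = ?S" using ci fin by (intro card_seteq) auto
  then show ?thesis using \<open>z \<in> ?S\<close> by blast
 qed simp
 show "\<sigma> z = z \<or> \<sigma> z = z [^] p" if z: "z \<in> carrier R"
 proof -
  have zpp: "(z [^] p) [^] p = z" using pp[OF z] z by (simp add: nat_pow_pow)
  let ?s = "z \<oplus> z [^] p" and ?n = "z \<otimes> z [^] p"
  have "?s [^] p = z [^] p \<oplus> (z [^] p) [^] p"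
   using frobenius_add[OF p(1) char, of z "z [^] p"] z by (simp add: m_comm)
  then have "?s [^] p = ?s" using zpp z by (simp add: a_comm)
  then have s: "\<sigma> ?s = ?s" using pK z by simp
  have "?n [^] p = z [^] p \<otimes> (z [^] p) [^] p" using z by (simp add: nat_pow_distrib)
  then have "?n [^] p = ?n" using zpp z by (simp add: m_comm)
  then have n: "\<sigma> ?n = ?n" using pK z by simp
  let ?w = "\<sigma> z"
  have wc: "?w \<in> carrier R" "\<sigma> (z [^] p) \<in> carrier R" using z by auto
  have s': "?w \<oplus> \<sigma> (z [^] p) = ?s" using s z by simp
  have n': "?w \<otimes> \<sigma> (z [^] p) = ?n" using n z by simp
  have "(?w \<ominus> z) \<otimes> (?w \<ominus> z [^] p) = ?w \<otimes> ?w \<ominus> ?w \<otimes> ?s \<oplus> ?n"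
   using z wc by (simp only: minus_eq l_distr r_distr l_minus r_minus minus_minus minus_add a_ac m_ac m_closed a_closed a_inv_closed nat_pow_closed)
  also have "\<dots> = ?w \<otimes> ?w \<ominus> ?w \<otimes> (?w \<oplus> \<sigma> (z [^] p)) \<oplus> ?w \<otimes> \<sigma> (z [^] p)" unfolding s' n' ..
  also have "\<dots> = \<zero>"
  proof -
   obtain v where v: "v = \<sigma> (z [^] p)" "v \<in> carrier R" using wc by blast
   show ?thesis unfolding v(1)[symmetric] using v(2) wc(1) by algebra
  qed
  finally have "?w \<ominus> z = \<zero> \<or> ?w \<ominus> z [^] p = \<zero>" using z wc integral by (meson minus_closed nat_pow_closed)
  then show ?thesis using z wc by simp
 qed
qed

text \<open>
  A finite commutative ring with \<open>x\<^sup>Q = x\<close> is a product of fields. The factor is selected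
  by a nonzero idempotent multiple of \<open>N\<close> that generates an ideal of least cardinality.
\<close>

lemma (in cring) field_component:
 assumes fin: "finite (carrier R)" and Q: "Q \<ge> (2::nat)" "\<And>x. x \<in> carrier R \<Longrightarrow> x [^] Q = x"
  and N: "N \<in> carrier R" "N \<noteq> \<zero>"
 shows "\<exists>e \<in> carrier R. e \<noteq> \<zero> \<and> e \<otimes> e = e \<and> (\<exists>y \<in> carrier R. e = N \<otimes> y) \<and>
  (\<forall>x \<in> carrier R. x \<otimes> e \<noteq> \<zero> \<longrightarrow> (\<exists>y \<in> carrier R. x \<otimes> y \<otimes> e = e))"
proof -
 obtain k where k: "Q = Suc (Suc k)" using le_Suc_ex[OF Q(1)] by auto
 have idem: "x [^] Suc k \<otimes> x = x" "x [^] Suc k \<otimes> x [^] Suc k = x [^] Suc k" if x: "x \<in> carrier R" for x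
 proof -
  show 1: "x [^] Suc k \<otimes> x = x" using Q(2)[OF x] k by simp
  have "x [^] Suc k \<otimes> x [^] Suc k = (x [^] Suc k \<otimes> x) \<otimes> x [^] k"
   using x by (simp add: m_ac)
  then show "x [^] Suc k \<otimes> x [^] Suc k = x [^] Suc k" unfolding 1 using x by (simp add: m_comm)
 qed
 let ?I = "{e \<in> carrier R. e \<noteq> \<zero> \<and> e \<otimes> e = e \<and> (\<exists>y \<in> carrier R. e = N \<otimes> y)}"
 let ?f = "\<lambda>e. card ((\<lambda>x. e \<otimes> x) ` carrier R)"
 have "N [^] Suc k \<in> ?I"
 proof -
  have "N [^] Suc k \<noteq> \<zero>" using idem(1)[OF N(1)] N by (metis l_null)
  moreover have "N [^] Suc k = N \<otimes> N [^] k" using N by (simp add: m_comm)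
  ultimately show ?thesis using idem(2)[OF N(1)] N(1) by (auto simp del: nat_pow_Suc)
 qed
 then obtain e where e: "e \<in> ?I" "\<And>f. f \<in> ?I \<Longrightarrow> ?f e \<le> ?f f"
  using arg_min_natI[of "\<lambda>e. e \<in> ?I" _ ?f] arg_min_nat_le[of "\<lambda>e. e \<in> ?I" _ ?f] by blast
 have ec: "e \<in> carrier R" "e \<otimes> e = e" "e \<noteq> \<zero>" using e by auto
 obtain n where n: "n \<in> carrier R" "e = N \<otimes> n" using e(1) by blast
 have "\<exists>y \<in> carrier R. x \<otimes> y \<otimes> e = e" if x: "x \<in> carrier R" "x \<otimes> e \<noteq> \<zero>" for x
 proof -
  let ?x = "x \<otimes> e"
  have xc: "?x \<in> carrier R" using x ec by simp
  let ?g = "?x [^] Suc k"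
  have gc: "?g \<in> carrier R" using xc by simp
  have g0: "?g \<noteq> \<zero>" using idem(1)[OF xc] x(2) xc by (metis l_null)
  have ge: "?g = e \<otimes> (x \<otimes> ?x [^] k)" using x ec by (simp add: m_ac)
  have "?g = N \<otimes> (n \<otimes> (x \<otimes> ?x [^] k))" unfolding ge n(2)[symmetric] using n x ec N(1)
   by (simp add: n(2) m_assoc)
  then have "?g \<in> ?I" using g0 gc idem(2)[OF xc] n x ec by (auto simp del: nat_pow_Suc)
  then have le: "?f e \<le> ?f ?g" by (rule e(2))
  have ege: "e \<otimes> ?g = ?g" unfolding ge using ec x by (simp flip: m_assoc)
  have "(\<lambda>x. ?g \<otimes> x) ` carrier R \<subseteq> (\<lambda>x. e \<otimes> x) ` carrier R"
  proof
   fix y assume "y \<in> (\<lambda>x. ?g \<otimes> x) ` carrier R"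
   then obtain z where z: "z \<in> carrier R" "y = ?g \<otimes> z" by blast
   then have "y = e \<otimes> (?g \<otimes> z)" using ege ec gc by (metis m_assoc)
   then show "y \<in> (\<lambda>x. e \<otimes> x) ` carrier R" using z gc by blast
  qed
  then have "(\<lambda>x. ?g \<otimes> x) ` carrier R = (\<lambda>x. e \<otimes> x) ` carrier R"
   using le fin by (intro card_seteq) auto
  then have "e \<in> (\<lambda>x. ?g \<otimes> x) ` carrier R" using ec by (metis imageI)
  then obtain z where z: "z \<in> carrier R" "e = ?g \<otimes> z" by blast
  have "?g \<otimes> e = e" using z idem(2)[OF xc] gc by (metis m_assoc)
  moreover obtain w where w: "w = x \<otimes> ?x [^] k" "w \<in> carrier R" using x xc by blast
  moreover have "(e \<otimes> w) \<otimes> e = w \<otimes> (e \<otimes> e)" using w(2) ec(1) by (simp only: m_ac m_closed)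
  ultimately have "w \<otimes> e = e" using ge ec(2) by metis
  then have "x \<otimes> (?x [^] k) \<otimes> e = e" unfolding w(1) .
  then show ?thesis using x xc by blast
 qed
 then show ?thesis using ec n by blast
qed

section \<open>Torsion units of an Engel unit group\<close>

locale engel_units = grpalg F G A
 for F :: "('f, 'b) ring_scheme" and G :: "('g, 'c) monoid_scheme" and A :: "('g \<Rightarrow> 'f) ring" (structure) +
 assumes V_locally_nilpotent: "locally_nilpotent_group V"
  and nonmodular: "\<not> modular_group_algebra F G"
begin

lemma G_locally_nilpotent: "locally_nilpotent_group G"
proof (rule locally_nilpotent_inj_hom[OF _ _ V_locally_nilpotent])
 show "group_hom G V dl"
  using G.is_group V_group by (auto simp: group_hom_def group_hom_axioms_def hom_def dl_Units dl_mult)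
 show "inj_on dl (carrier G)" using dl_inject by (auto simp: inj_on_def)
qed

abbreviation cm where "cm z y \<equiv> z \<otimes> y \<otimes> inv z \<otimes> inv y"

text \<open>
  The Engel condition for an arbitrary unit \<open>x\<close>: its augmentation need not be one, but its first
  commutator is a normalized unit.
\<close>

lemma engel_Units:
 assumes x: "x \<in> Units A" and y: "y \<in> Units A" "aug y = \<one>\<^sub>F"
 shows "\<exists>n. ((\<lambda>z. cm z y) ^^ Suc n) x = \<one>"
proof -
 have c: "x \<in> carrier A" "y \<in> carrier A" "inv x \<in> carrier A" "inv y \<in> carrier A" using x y by (auto simp: A.Units_closed)
 have "aug x \<otimes>\<^sub>F aug (inv x) = aug (x \<otimes> inv x)" using c by simp
 then have ax: "aug x \<otimes>\<^sub>F aug (inv x) = \<one>\<^sub>F" using x by simp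
 have "cm x y \<in> Units A" using x y by (simp add: A.Units_inv_Units)
 moreover have "aug (cm x y) = \<one>\<^sub>F" using c ax y aug_inv[OF y] by simp
 ultimately have cV: "cm x y \<in> carrier V" by simp
 have yV: "y \<in> carrier V" using y by simp
 interpret V: group V by (rule V_group)
 have e: "((\<lambda>z. comm_of V z y) ^^ n) (cm x y) = ((\<lambda>z. cm z y) ^^ n) (cm x y) \<and>
  ((\<lambda>z. comm_of V z y) ^^ n) (cm x y) \<in> carrier V" for n
 proof (induction n)
  case 0 then show ?case using cV by simp
 next
  case (Suc n)
  obtain z where z: "z = ((\<lambda>z. comm_of V z y) ^^ n) (cm x y)" "z = ((\<lambda>z. cm z y) ^^ n) (cm x y)" "z \<in> carrier V"
   using Suc by blast
  have "comm_of V z y = cm z y" using z(3) y by simp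
  moreover have "comm_of V z y \<in> carrier V"
   using V.m_closed[OF V.m_closed[OF V.m_closed[OF z(3) yV] V.inv_closed[OF z(3)]] V.inv_closed[OF yV]] .
  moreover have "((\<lambda>z. comm_of V z y) ^^ Suc n) (cm x y) = comm_of V z y"
   by (simp only: funpow.simps(2) comp_apply z(1)[symmetric])
  moreover have "((\<lambda>z. cm z y) ^^ Suc n) (cm x y) = cm z y"
   by (simp only: funpow.simps(2) comp_apply z(2)[symmetric])
  ultimately show ?case by (simp only: simp_thms)
 qed
 obtain n where "((\<lambda>z. comm_of V z y) ^^ n) (cm x y) = \<one>\<^bsub>V\<^esub>"
  using locally_nilpotent_engel[OF V_locally_nilpotent cV yV] by (elim exE)
 then have "((\<lambda>z. cm z y) ^^ n) (cm x y) = \<one>" using e[of n] by simp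
 then have "((\<lambda>z. cm z y) ^^ Suc n) x = \<one>" by (simp only: funpow_Suc_right comp_apply)
 then show ?thesis by blast
qed

abbreviation geom where "geom w n \<equiv> (\<Oplus>i\<in>{..<n::nat}. w [^] i)"

lemma geom_Suc: "w \<in> carrier A \<Longrightarrow> geom w (Suc n) = w [^] n \<oplus> geom w n"
 unfolding lessThan_Suc by (intro A.finsum_insert) auto

lemma geom_closed: "w \<in> carrier A \<Longrightarrow> geom w n \<in> carrier A" by (intro A.finsum_closed) auto

lemma geom_telescope:
 assumes w: "w \<in> carrier A"
 shows "w \<otimes> geom w n \<oplus> \<one> = geom w n \<oplus> w [^] n" "geom w n \<otimes> w = w \<otimes> geom w n"
proof -
 have "w \<otimes> geom w n \<oplus> \<one> = geom w n \<oplus> w [^] n \<and> geom w n \<otimes> w = w \<otimes> geom w n"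
 proof (induction n)
  case 0 then show ?case using w by simp
 next
  case (Suc n)
  have g: "geom w n \<in> carrier A" by (rule geom_closed[OF w])
  have ww: "w \<otimes> w [^] n = w [^] Suc n" using w A.nat_pow_Suc2 by simp
  have "w \<otimes> geom w (Suc n) \<oplus> \<one> = w [^] Suc n \<oplus> (w \<otimes> geom w n \<oplus> \<one>)"
   using w g ww by (simp add: geom_Suc A.r_distr A.a_assoc)
  also have "\<dots> = geom w (Suc n) \<oplus> w [^] Suc n"
   using Suc w g by (simp add: geom_Suc A.a_ac)
  finally have 1: "w \<otimes> geom w (Suc n) \<oplus> \<one> = geom w (Suc n) \<oplus> w [^] Suc n" .
  have "geom w (Suc n) \<otimes> w = w \<otimes> geom w (Suc n)"
   using Suc w g ww by (simp add: geom_Suc A.l_distr A.r_distr)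
  then show ?case using 1 by blast
 qed
 then show "w \<otimes> geom w n \<oplus> \<one> = geom w n \<oplus> w [^] n" "geom w n \<otimes> w = w \<otimes> geom w n" by auto
qed

lemma geom_absorb:
 assumes w: "w \<in> carrier A" "w [^] n = \<one>"
 shows "w \<otimes> geom w n = geom w n" "geom w n \<otimes> w = geom w n"
proof -
 have g: "geom w n \<in> carrier A" by (rule geom_closed[OF w(1)])
 show "w \<otimes> geom w n = geom w n"
  using geom_telescope(1)[OF w(1), of n] w g A.add.r_cancel[of \<one> "w \<otimes> geom w n" "geom w n"] by simp
 then show "geom w n \<otimes> w = geom w n" using geom_telescope(2)[OF w(1), of n] by simp
qed

lemma geom_square:
 assumes w: "w \<in> carrier A" "w [^] n = \<one>"
 shows "geom w n \<otimes> geom w n = sc (add_pow F n \<one>\<^sub>F) (geom w n)"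
proof -
 let ?S = "geom w n"
 have g: "geom w m \<in> carrier A" for m by (rule geom_closed[OF w(1)])
 have wi: "w [^] i \<otimes> ?S = ?S" for i :: nat
  using w g geom_absorb[OF w] by (induction i) (simp_all add: A.m_assoc)
 have "geom w m \<otimes> ?S = add_pow A m ?S" for m :: nat
 proof (induction m)
  case 0 then show ?case using g by simp
 next
  case (Suc m)
  then show ?case using w g wi[of m] by (simp add: geom_Suc A.l_distr A.a_comm)
 qed
 then show ?thesis using add_pow_sc[OF g] by simp
qed

text \<open>
  Here \<open>n - S\<close> is written as a multiple of \<open>1 - w\<close>, by adding up \<open>1 -
  w\<^sup>i\<close>.
\<close>

lemma defect_factor:
 assumes w: "w \<in> carrier A"
 shows "\<exists>s \<in> carrier A. s \<otimes> w = w \<otimes> s \<and> add_pow A n \<one> \<ominus> geom w n = s \<otimes> (\<one> \<ominus> w)"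
proof (induction n)
 case 0 then show ?case using w by (intro bexI[of _ \<zero>]) (simp_all add: A.minus_eq)
next
 case (Suc n)
 then obtain s where s: "s \<in> carrier A" "s \<otimes> w = w \<otimes> s" "add_pow A n \<one> \<ominus> geom w n = s \<otimes> (\<one> \<ominus> w)" by blast
 have g: "geom w n \<in> carrier A" by (rule geom_closed[OF w])
 have "w \<otimes> geom w n \<oplus> \<one> = geom w n \<oplus> w [^] n" by (rule geom_telescope(1)[OF w])
 then have "(w \<otimes> geom w n \<oplus> \<one>) \<ominus> w \<otimes> geom w n \<ominus> w [^] n = (geom w n \<oplus> w [^] n) \<ominus> w \<otimes> geom w n \<ominus> w [^] n" by simp
 then have "\<one> \<ominus> w [^] n = geom w n \<ominus> w \<otimes> geom w n"
 proof -
  obtain p q where pq: "p = w \<otimes> geom w n" "q = w [^] n" "p \<in> carrier A" "q \<in> carrier A" using w g by simp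
  have "(p \<oplus> \<one>) \<ominus> p \<ominus> q = \<one> \<ominus> q" using pq(3,4) by algebra
  moreover have "(geom w n \<oplus> q) \<ominus> p \<ominus> q = geom w n \<ominus> p" using pq(3,4) g by algebra
  ultimately show ?thesis using \<open>(w \<otimes> geom w n \<oplus> \<one>) \<ominus> w \<otimes> geom w n \<ominus> w [^] n = (geom w n \<oplus> w [^] n) \<ominus> w \<otimes> geom w n \<ominus> w [^] n\<close>
   unfolding pq(1,2) by simp
 qed
 also have "\<dots> = geom w n \<otimes> (\<one> \<ominus> w)"
  using w g geom_telescope(2)[OF w, of n] by (simp add: A.minus_eq A.r_distr A.r_minus)
 finally have e: "\<one> \<ominus> w [^] n = geom w n \<otimes> (\<one> \<ominus> w)" .
 have "add_pow A (Suc n) \<one> \<ominus> geom w (Suc n) = (add_pow A n \<one> \<ominus> geom w n) \<oplus> (\<one> \<ominus> w [^] n)"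
  using w g by (simp add: geom_Suc A.minus_eq A.minus_add A.a_ac)
 also have "\<dots> = (s \<oplus> geom w n) \<otimes> (\<one> \<ominus> w)" unfolding s(3) e using s(1) g w by (simp add: A.l_distr)
 finally show ?case using s g w geom_telescope(2)[OF w, of n]
  by (intro bexI[of _ "s \<oplus> geom w n"]) (simp_all add: A.l_distr A.r_distr)
qed

text \<open>
  Let \<open>S = 1 + w + \<dots> + w\<^sup>n\<^sup>-\<^sup>1\<close> and \<open>N = (n - S) x S\<close>. Then
  \<open>1 + N\<close> is a unit because \<open>N\<^sup>2 = 0\<close>, and a commutator with \<open>w\<close>
  replaces \<open>N\<close> by \<open>(1 - w) N\<close>. By the Engel condition some \<open>(1 - w)\<^sup>k
  N\<close> vanishes; as \<open>n - S\<close> is a multiple of \<open>1 - w\<close> and acts on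
  \<open>N\<close> as the invertible scalar \<open>n\<close>, already \<open>N = 0\<close>.
\<close>

theorem torsion_unit_average:
 assumes w: "w \<in> Units A" "aug w = \<one>\<^sub>F" "w [^] n = \<one>"
  and inv: "add_pow F n \<one>\<^sub>F \<noteq> \<zero>\<^sub>F" and x: "x \<in> carrier A"
 shows "geom w n \<otimes> x \<otimes> geom w n = sc (add_pow F n \<one>\<^sub>F) (x \<otimes> geom w n)"
proof -
 let ?S = "geom w n" and ?\<nu> = "add_pow F n \<one>\<^sub>F" and ?c = "add_pow A n \<one>"
 have wc: "w \<in> carrier A" "inv w \<in> carrier A" using w by (auto simp: A.Units_closed)
 have S: "?S \<in> carrier A" by (rule geom_closed[OF wc(1)])
 have wS: "w \<otimes> ?S = ?S" "?S \<otimes> w = ?S" using geom_absorb[OF wc(1) w(3)] by auto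
 have nuc: "?\<nu> \<in> carrier F" by simp
 have c: "?c = single ?\<nu> \<one>\<^sub>G" using add_pow_sc[of \<one> n] by simp
 have SS: "?S \<otimes> ?S = ?c \<otimes> ?S" unfolding c by (rule geom_square[OF wc(1) w(3)])
 have cc: "?c \<otimes> u = u \<otimes> ?c" if "u \<in> carrier A" for u unfolding c by (rule scalar_commute[OF nuc that])
 have ccl: "?c \<in> carrier A" by simp
 obtain s where s: "s \<in> carrier A" "s \<otimes> w = w \<otimes> s" "?c \<ominus> ?S = s \<otimes> (\<one> \<ominus> w)" using defect_factor[OF wc(1)] by blast
 let ?D = "?c \<ominus> ?S" and ?E = "\<one> \<ominus> w"
 have D: "?D \<in> carrier A" and E: "?E \<in> carrier A" using S wc by auto
 have SD: "?S \<otimes> ?D = \<zero>" using S SS cc[OF S] by (simp add: A.minus_eq A.r_distr A.r_minus A.r_neg)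
 have SE: "?S \<otimes> ?E = \<zero>" using S wS wc by (simp add: A.minus_eq A.r_distr A.r_minus A.r_neg)
 let ?N = "?D \<otimes> x \<otimes> ?S"
 have N: "?N \<in> carrier A" using D x S by simp
 define P where "P k = ?E [^] k \<otimes> ?N" for k :: nat
 have P: "P k \<in> carrier A" for k unfolding P_def using E N by simp
 have PS: "P (Suc k) = ?E \<otimes> P k" for k
  unfolding P_def using E N A.nat_pow_Suc2[OF E, of k] by (simp add: A.m_assoc del: A.nat_pow_Suc)
 have SP: "?S \<otimes> P k = \<zero>" for k
 proof (cases k)
  case 0
  have "?S \<otimes> (?D \<otimes> x \<otimes> ?S) = (?S \<otimes> ?D) \<otimes> (x \<otimes> ?S)" using S D x by (simp add: A.m_assoc)
  then show ?thesis unfolding 0 P_def using SD S x D N by simp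
 next
  case (Suc j)
  have "?S \<otimes> (?E \<otimes> P j) = (?S \<otimes> ?E) \<otimes> P j" using S E P by (simp add: A.m_assoc)
  then show ?thesis unfolding Suc PS using SE P by simp
 qed
 have iS: "?S \<otimes> inv w = ?S"
 proof -
  have "?S \<otimes> inv w = (?S \<otimes> w) \<otimes> inv w" using wS by simp
  also have "\<dots> = ?S" using S wc w by (simp add: A.m_assoc)
  finally show ?thesis .
 qed
 have Pf: "\<exists>q \<in> carrier A. P k = q \<otimes> ?S" for k
  unfolding P_def using E D x S by (intro bexI[of _ "?E [^] k \<otimes> (?D \<otimes> x)"]) (simp_all add: A.m_assoc)
 have PP: "P k \<otimes> P k = \<zero>" and PwP: "P k \<otimes> (w \<otimes> P k) = \<zero>" and Pi: "P k \<otimes> inv w = P k" for k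
 proof -
  obtain q where q: "q \<in> carrier A" "P k = q \<otimes> ?S" using Pf by blast
  obtain r where r: "r = P k" "r \<in> carrier A" using P by blast
  have "P k \<otimes> r = q \<otimes> (?S \<otimes> r)" unfolding q(2) using q S r by (simp add: A.m_assoc)
  then show "P k \<otimes> P k = \<zero>" using SP[of k] q(1) r by simp
  have "P k \<otimes> (w \<otimes> r) = q \<otimes> ((?S \<otimes> w) \<otimes> r)" unfolding q(2) using q(1) S r(2) wc by (simp add: A.m_assoc)
  then show "P k \<otimes> (w \<otimes> P k) = \<zero>" using SP[of k] q(1) r wS by simp
  show "P k \<otimes> inv w = P k" unfolding q(2) using q(1) S wc iS by (simp add: A.m_assoc)
 qed
 define U where "U k = \<one> \<oplus> P k" for k
 have U1: "U k \<otimes> (\<one> \<ominus> P k) = \<one>" "(\<one> \<ominus> P k) \<otimes> U k = \<one>" for k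
  unfolding U_def using P[of k] PP[of k]
  by (simp_all add: A.minus_eq A.l_distr A.r_distr A.r_minus A.l_minus A.a_assoc A.r_neg A.l_neg)
 have Uc: "U k \<in> carrier A" "\<one> \<ominus> P k \<in> carrier A" for k unfolding U_def using P by auto
 have UU: "U k \<in> Units A" for k unfolding Units_def using U1 Uc by blast
 have Ui: "inv (U k) = \<one> \<ominus> P k" for k by (rule A.inv_char[OF Uc U1])
 have step: "cm (U k) w = U (Suc k)" for k
 proof -
  obtain r where r: "r = P k" "r \<in> carrier A" using P by blast
  have rr: "r \<otimes> (w \<otimes> r) = \<zero>" "r \<otimes> inv w = r" using PwP Pi r by auto
  have "cm (U k) w = (\<one> \<oplus> r) \<otimes> (w \<otimes> (\<one> \<ominus> r) \<otimes> inv w)"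
   unfolding Ui unfolding U_def r(1)[symmetric] using wc r(2) by (simp add: A.m_assoc)
  also have "w \<otimes> (\<one> \<ominus> r) \<otimes> inv w = \<one> \<ominus> w \<otimes> r"
   using wc r(2) rr(2) w(1) by (simp add: A.minus_eq A.r_distr A.l_distr A.r_minus A.l_minus A.m_assoc)
  also have "(\<one> \<oplus> r) \<otimes> (\<one> \<ominus> w \<otimes> r) = \<one> \<oplus> (r \<ominus> w \<otimes> r)"
   using wc r(2) rr(1) by (simp add: A.minus_eq A.r_distr A.l_distr A.r_minus A.a_ac)
  also have "r \<ominus> w \<otimes> r = ?E \<otimes> r" using wc r(2) by (simp add: A.minus_eq A.l_distr A.l_minus)
  finally show ?thesis unfolding U_def PS r(1)[symmetric] .
 qed
 have it: "((\<lambda>z. cm z w) ^^ k) (U 0) = U k" for k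
  by (induction k) (simp_all add: step)
 obtain k where "((\<lambda>z. cm z w) ^^ Suc k) (U 0) = \<one>" using engel_Units[OF UU w(1,2)] by blast
 then have "U (Suc k) = \<one>" by (simp only: it)
 then have "\<one> \<oplus> P (Suc k) = \<one> \<oplus> \<zero>" unfolding U_def by simp
 then have P0: "P (Suc k) = \<zero>" using P[of "Suc k"] A.add.l_cancel[of \<one> "P (Suc k)" \<zero>] by simp
 have sE: "s \<otimes> ?E = ?E \<otimes> s" using s(1,2) wc by (simp add: A.minus_eq A.l_distr A.r_distr A.l_minus A.r_minus)
 have Dk: "?D [^] k = s [^] k \<otimes> ?E [^] k" for k :: nat
  unfolding s(3) by (rule A.pow_mult_distrib[OF sE s(1) E])
 have "?D [^] Suc k \<otimes> ?N = s [^] Suc k \<otimes> P (Suc k)" unfolding Dk P_def using s(1) E N by (simp add: A.m_assoc del: A.nat_pow_Suc)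
 then have D0: "?D [^] Suc k \<otimes> ?N = \<zero>" using P0 s(1) by (simp del: A.nat_pow_Suc)
 have DN: "?D \<otimes> ?N = ?c \<otimes> ?N"
  using SP[of 0] S N unfolding P_def by (simp add: A.minus_eq A.l_distr A.l_minus del: A.m_assoc)
 have nz: "u = \<zero>" if "?c \<otimes> u = \<zero>" "u \<in> carrier A" for u
  using sc_eq_zeroD[OF nuc inv that(2)] that(1) unfolding c by simp
 have "?N = \<zero>" if "?D [^] j \<otimes> ?N = \<zero>" for j :: nat
  using that
 proof (induction j)
  case 0 then show ?case using N by simp
 next
  case (Suc j)
  have Dj: "?D [^] j \<in> carrier A" using D by simp
  have "?D [^] Suc j \<otimes> ?N = ?D [^] j \<otimes> (?c \<otimes> ?N)"
   using DN A.m_assoc[OF Dj D N] by simp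
  also have "\<dots> = ?c \<otimes> (?D [^] j \<otimes> ?N)" using cc[OF Dj] A.m_assoc[OF Dj ccl N] A.m_assoc[OF ccl Dj N] by simp
  finally have "?D [^] j \<otimes> ?N = \<zero>" using Suc(2) nz Dj N by simp
  then show ?case by (rule Suc(1))
 qed
 then have "?N = \<zero>" using D0 by blast
 then have "?c \<otimes> (x \<otimes> ?S) \<ominus> ?S \<otimes> x \<otimes> ?S = \<zero>"
  using S x by (simp add: A.minus_eq A.l_distr A.l_minus A.m_assoc)
 then show ?thesis using S x unfolding c by simp
qed

abbreviation cyc where "cyc a \<equiv> generate G {a}"
abbreviation tors where "tors \<equiv> torsion_part G"

lemma torsD: assumes "a \<in> tors" shows "a \<in> carrier G" "G.ord a > 0"
proof -
 obtain n :: nat where n: "a \<in> carrier G" "n > 0" "a [^]\<^sub>G n = \<one>\<^sub>G" using assms unfolding torsion_part_def by blast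
 show "a \<in> carrier G" by fact
 have "G.ord a dvd n" using n G.pow_eq_id by blast
 then show "G.ord a > 0" using n(2) by (metis dvd_0_left neq0_conv)
qed

lemma torsI: "a \<in> carrier G \<Longrightarrow> (n::nat) > 0 \<Longrightarrow> a [^]\<^sub>G n = \<one>\<^sub>G \<Longrightarrow> a \<in> tors"
 unfolding torsion_part_def by blast

lemma cyc_powers: "a \<in> tors \<Longrightarrow> cyc a = range (\<lambda>k::nat. a [^]\<^sub>G k)"
 using G.generate_pow_nat[of a] torsD[of a] by auto

lemma cyc_subgroup: "a \<in> tors \<Longrightarrow> subgroup (cyc a) G"
 using torsD by (intro G.generate_is_subgroup) auto

lemma cyc_card: "a \<in> tors \<Longrightarrow> card (cyc a) = G.ord a"
 using G.generate_pow_card torsD by simp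

lemma cyc_finite: "a \<in> tors \<Longrightarrow> finite (cyc a)"
 using cyc_card torsD(2) card_ge_0_finite by metis

lemma cyc_carrier: "a \<in> tors \<Longrightarrow> cyc a \<subseteq> carrier G"
 using cyc_subgroup subgroup.subset by blast

lemma cyc_pow: "a \<in> tors \<Longrightarrow> a [^]\<^sub>G (k::nat) \<in> cyc a" by (simp add: cyc_powers)

lemma cyc_self: "a \<in> tors \<Longrightarrow> a \<in> cyc a" using generate.incl[of a "{a}" G] by simp

lemma cyc_commute: assumes "a \<in> tors" "x \<in> cyc a" "y \<in> cyc a" shows "x \<bullet> y = y \<bullet> x"
proof -
 obtain k l :: nat where "x = a [^]\<^sub>G k" "y = a [^]\<^sub>G l" using assms cyc_powers by auto
 then show ?thesis using torsD(1)[OF assms(1)] G.nat_pow_comm by simp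
qed

lemma cyc_tors: assumes "a \<in> tors" "x \<in> cyc a" shows "x \<in> tors"
proof -
 obtain k :: nat where k: "x = a [^]\<^sub>G k" using assms cyc_powers by auto
 note t = torsD[OF assms(1)]
 have "x [^]\<^sub>G G.ord a = \<one>\<^sub>G" unfolding k using t(1) by (metis G.nat_pow_one G.nat_pow_pow G.pow_ord_eq_1 mult.commute)
 then show ?thesis using torsI[of x "G.ord a"] t k by simp
qed

lemma FC_commute: "a \<in> tors \<Longrightarrow> u \<in> FS (cyc a) \<Longrightarrow> v \<in> FS (cyc a) \<Longrightarrow> u \<otimes> v = v \<otimes> u"
 by (rule FS_commute[of "cyc a"]) (auto dest: subsetD[OF cyc_carrier] intro: cyc_commute)

text \<open>This is where non-modularity enters.\<close>

lemma ord_invertible: "a \<in> tors \<Longrightarrow> add_pow F (G.ord a) \<one>\<^sub>F \<noteq> \<zero>\<^sub>F"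
 using card_subgroup_invertible[OF nonmodular cyc_subgroup cyc_finite, of a] cyc_card by simp

abbreviation Sum where "Sum a \<equiv> geom (\<delta> a) (G.ord a)"

lemma Sum_FS: assumes a: "a \<in> tors" shows "Sum a \<in> FS (cyc a)"
proof (rule FS_finsum)
 show "\<delta> a [^] i \<in> FS (cyc a)" for i :: nat
  using cyc_pow[OF a, of i] torsD[OF a] FS_single[of "\<one>\<^sub>F"] by (simp add: dl_pow)
qed simp

lemma dl_pow_ord: "a \<in> tors \<Longrightarrow> \<delta> a [^] G.ord a = \<one>"
 using torsD[of a] by (simp add: dl_pow one_single)

lemma aug_Sum: assumes a: "a \<in> tors" shows "aug (Sum a) = add_pow F (G.ord a) \<one>\<^sub>F"
proof -
 have ac: "a \<in> carrier G" using torsD a by blast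
 have "aug (geom (\<delta> a) n) = add_pow F n \<one>\<^sub>F" for n
 proof (induction n)
  case (Suc n)
  have "aug (geom (\<delta> a) (Suc n)) = aug (\<delta> a [^] n) \<oplus>\<^sub>F aug (geom (\<delta> a) n)"
   unfolding geom_Suc[OF dl_closed] using geom_closed[of "\<delta> a" n] by simp
  then show ?case using ac unfolding Suc by (simp add: dl_pow F.a_comm)
 qed simp
 then show ?thesis .
qed

lemma mult_Sum: assumes a: "a \<in> tors" and u: "u \<in> FS (cyc a)" shows "u \<otimes> Sum a = sc (aug u) (Sum a)"
proof -
 have ac: "a \<in> carrier G" using torsD a by blast
 have S: "Sum a \<in> carrier A" by (rule geom_closed) simp
 have ab: "\<delta> (a [^]\<^sub>G k) \<otimes> Sum a = Sum a" for k :: nat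
 proof (induction k)
  case 0 then show ?case using S by (simp flip: one_single)
 next
  case (Suc k)
  have "\<delta> (a [^]\<^sub>G Suc k) \<otimes> Sum a = \<delta> (a [^]\<^sub>G k) \<otimes> (\<delta> a \<otimes> Sum a)"
   using ac S by (simp add: A.m_assoc flip: dl_mult)
  then show ?case using geom_absorb(1)[OF _ dl_pow_ord[OF a]] Suc by simp
 qed
 show ?thesis using u
 proof (induction rule: FS_induct)
  case zero
  have "single \<zero>\<^sub>F \<one>\<^sub>G = \<zero>" by (intro ga_eqI) (auto simp: single_apply)
  then show ?case using S by simp
 next
  case (add u v)
  have "single (aug u \<oplus>\<^sub>F aug v) \<one>\<^sub>G = single (aug u) \<one>\<^sub>G \<oplus> single (aug v) \<one>\<^sub>G"
   using FS_carrier[OF add(1)] FS_carrier[OF add(2)] by (intro ga_eqI) (auto simp: single_apply)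
  then show ?case using FS_carrier[OF add(1)] FS_carrier[OF add(2)] S add by (simp add: A.l_distr)
 next
  case (single c g)
  then obtain k :: nat where k: "g = a [^]\<^sub>G k" using cyc_powers[OF a] by auto
  have "single c g = single c \<one>\<^sub>G \<otimes> \<delta> g" using single by (simp add: single_mult_single)
  then show ?case using single ab[of k] k S by (simp add: A.m_assoc)
 qed
qed

text \<open>
  With \<open>w = a\<close> and \<open>x = g\<^sup>-\<^sup>1\<close> the averaging identity shows that
  \<open>g a g\<^sup>-\<^sup>1\<close> fixes the sum of the elements of the cyclic group of \<open>a\<close>,
  hence lies in it.
\<close>

lemma torsion_conj:
 assumes a: "a \<in> tors" and g: "g \<in> carrier G"
 shows "g \<bullet> a \<bullet> inv\<^sub>G g \<in> cyc a"
proof -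
 note t = torsD[OF a]
 let ?S = "Sum a" and ?\<nu> = "add_pow F (G.ord a) \<one>\<^sub>F" and ?b = "g \<bullet> a \<bullet> inv\<^sub>G g"
 have S: "?S \<in> carrier A" by (rule geom_closed) simp
 have bc: "?b \<in> carrier G" using g t by simp
 have av: "?S \<otimes> \<delta> (inv\<^sub>G g) \<otimes> ?S = sc ?\<nu> (\<delta> (inv\<^sub>G g) \<otimes> ?S)"
  by (rule torsion_unit_average[OF dl_Units _ dl_pow_ord[OF a] ord_invertible[OF a]]) (use t in auto)
 have aS: "\<delta> a \<otimes> ?S = ?S" by (rule geom_absorb(1)[OF _ dl_pow_ord[OF a]]) simp
 have "\<delta> a \<otimes> (?S \<otimes> \<delta> (inv\<^sub>G g) \<otimes> ?S) = ?S \<otimes> \<delta> (inv\<^sub>G g) \<otimes> ?S"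
  using S aS by (simp flip: A.m_assoc)
 then have "\<delta> a \<otimes> sc ?\<nu> (\<delta> (inv\<^sub>G g) \<otimes> ?S) = sc ?\<nu> (\<delta> (inv\<^sub>G g) \<otimes> ?S)" unfolding av .
 then have "sc ?\<nu> (\<delta> a \<otimes> (\<delta> (inv\<^sub>G g) \<otimes> ?S)) = sc ?\<nu> (\<delta> (inv\<^sub>G g) \<otimes> ?S)"
  using S scalar_commute[of ?\<nu> "\<delta> a"] A.m_assoc[of "single ?\<nu> \<one>\<^sub>G" "\<delta> a"] A.m_assoc[of "\<delta> a" "single ?\<nu> \<one>\<^sub>G"] by simp
 then have "sc ?\<nu> (\<delta> a \<otimes> (\<delta> (inv\<^sub>G g) \<otimes> ?S) \<ominus> \<delta> (inv\<^sub>G g) \<otimes> ?S) = \<zero>"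
  using S by (simp add: A.minus_eq A.r_distr A.r_minus A.r_neg)
 then have "\<delta> a \<otimes> (\<delta> (inv\<^sub>G g) \<otimes> ?S) \<ominus> \<delta> (inv\<^sub>G g) \<otimes> ?S = \<zero>"
  by (rule sc_eq_zeroD[OF _ ord_invertible[OF a], rotated 2]) (use S in simp_all)
 then have e: "\<delta> a \<otimes> (\<delta> (inv\<^sub>G g) \<otimes> ?S) = \<delta> (inv\<^sub>G g) \<otimes> ?S" using S by simp
 have "\<delta> ?b \<otimes> ?S = \<delta> g \<otimes> (\<delta> a \<otimes> (\<delta> (inv\<^sub>G g) \<otimes> ?S))" using g t S by (simp add: A.m_assoc flip: dl_mult)
 also have "\<dots> = ?S" unfolding e using g S by simp
 finally have bS: "\<delta> ?b \<otimes> ?S = ?S" .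
 show ?thesis
 proof (rule ccontr)
  assume n: "?b \<notin> cyc a"
  have "?S \<one>\<^sub>G = (\<delta> ?b \<otimes> ?S) ?b" using single_mult_apply[of "\<one>\<^sub>F" ?b ?S ?b] bc S by simp
  also have "\<dots> = \<zero>\<^sub>F" unfolding bS using FS_supp[OF Sum_FS[OF a]] n bc by (auto simp: supp_iff)
  finally have S1: "?S \<one>\<^sub>G = \<zero>\<^sub>F" .
  have "?S x = \<zero>\<^sub>F" if x: "x \<in> carrier G" for x
  proof (cases "x \<in> cyc a")
   case False then show ?thesis using FS_supp[OF Sum_FS[OF a]] x by (auto simp: supp_iff)
  next
   case True
   have "\<delta> x \<otimes> ?S = sc (aug (\<delta> x)) ?S" by (rule mult_Sum[OF a FS_single]) (use True in auto)
   then have "\<delta> x \<otimes> ?S = ?S" using x S by (simp flip: one_single)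
   then have "?S x = (\<delta> x \<otimes> ?S) x" by simp
   then show ?thesis using single_mult_apply[of "\<one>\<^sub>F" x ?S x] x S S1 by simp
  qed
  then have "?S = \<zero>" using S by (intro ga_eqI) auto
  then show False using aug_Sum[OF a] ord_invertible[OF a] by simp
 qed
qed

lemma conj_pow: "g \<in> carrier G \<Longrightarrow> a \<in> carrier G \<Longrightarrow>
 g \<bullet> (a [^]\<^sub>G (k::nat)) \<bullet> inv\<^sub>G g = (g \<bullet> a \<bullet> inv\<^sub>G g) [^]\<^sub>G k"
proof (induction k)
 case (Suc k)
 assume g: "g \<in> carrier G" "a \<in> carrier G"
 have "g \<bullet> (a [^]\<^sub>G Suc k) \<bullet> inv\<^sub>G g =
  (g \<bullet> (a [^]\<^sub>G k) \<bullet> inv\<^sub>G g) \<bullet> (g \<bullet> a \<bullet> inv\<^sub>G g)"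
  using g by (simp add: G.m_assoc)
 then show ?case using Suc g by simp
qed simp

lemma cyc_conj: assumes a: "a \<in> tors" and g: "g \<in> carrier G" and x: "x \<in> cyc a"
 shows "g \<bullet> x \<bullet> inv\<^sub>G g \<in> cyc a"
proof -
 obtain k :: nat where k: "x = a [^]\<^sub>G k" using x cyc_powers[OF a] by auto
 obtain l :: nat where l: "g \<bullet> a \<bullet> inv\<^sub>G g = a [^]\<^sub>G l" using torsion_conj[OF a g] cyc_powers[OF a] by auto
 show ?thesis unfolding k conj_pow[OF g torsD(1)[OF a]] l using torsD(1)[OF a] cyc_pow[OF a] by (simp add: G.nat_pow_pow)
qed

lemma cj_FC: "a \<in> tors \<Longrightarrow> g \<in> carrier G \<Longrightarrow> u \<in> FS (cyc a) \<Longrightarrow> cj g u \<in> FS (cyc a)"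
 by (rule cj_FS) (auto intro: cyc_conj)

text \<open>
  The element \<open>w = e + (1 - e) a\<close> is a torsion unit of augmentation one and its powers average to
  \<open>e\<close>, so the averaging identity applies.
\<close>

lemma idempotent_invariant_aux:
 assumes a: "a \<in> tors" and g: "g \<in> carrier G" and e: "e \<in> FS (cyc a)" "e \<otimes> e = e" "aug e = \<one>\<^sub>F"
 shows "e \<otimes> \<delta> g \<otimes> e = \<delta> g \<otimes> e"
proof -
 note t = torsD[OF a]
 let ?n = "G.ord a" and ?\<nu> = "add_pow F (G.ord a) \<one>\<^sub>F"
 have ec: "e \<in> carrier A" by (rule FS_carrier[OF e(1)])
 let ?f = "\<one> \<ominus> e"
 have f: "?f \<in> carrier A" "?f \<otimes> ?f = ?f" "e \<otimes> ?f = \<zero>" "?f \<otimes> e = \<zero>"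
  using ec e(2) by (simp_all add: A.minus_eq A.l_distr A.r_distr A.l_minus A.r_minus A.r_neg A.l_neg A.minus_add A.a_ac)
 have fe: "e \<oplus> ?f = \<one>" using ec by algebra
 define w where "w k = e \<oplus> ?f \<otimes> \<delta> (a [^]\<^sub>G k)" for k :: nat
 have wcl: "w k \<in> carrier A" for k unfolding w_def using ec f by simp
 have ae: "\<delta> x \<otimes> e = e \<otimes> \<delta> x" if "x \<in> cyc a" for x
  by (rule FC_commute[OF a FS_single e(1)]) (use that in auto)
 have af: "\<delta> x \<otimes> ?f = ?f \<otimes> \<delta> x" if "x \<in> cyc a" for x
  using ae[OF that] ec by (simp add: A.minus_eq A.l_distr A.r_distr A.l_minus A.r_minus)
 have wm: "w k \<otimes> w l = w (k + l)" for k l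
 proof -
  obtain x y where xy: "x = \<delta> (a [^]\<^sub>G k)" "y = \<delta> (a [^]\<^sub>G l)" "x \<in> carrier A" "y \<in> carrier A" by simp
  have x: "x \<otimes> e = e \<otimes> x" "x \<otimes> ?f = ?f \<otimes> x" using ae af cyc_pow[OF a] xy by auto
  have "w k \<otimes> w l = e \<otimes> e \<oplus> (e \<otimes> ?f) \<otimes> y \<oplus> (?f \<otimes> (x \<otimes> e) \<oplus> ?f \<otimes> (x \<otimes> ?f) \<otimes> y)"
   unfolding w_def xy(1,2)[symmetric] using xy(3,4) ec f(1) by (simp add: A.l_distr A.r_distr A.m_assoc A.a_ac)
  also have "\<dots> = e \<oplus> ((?f \<otimes> e) \<otimes> x \<oplus> (?f \<otimes> ?f) \<otimes> (x \<otimes> y))"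
   unfolding x using xy(3,4) ec f(1,3) e(2) by (simp add: A.m_assoc)
  also have "\<dots> = e \<oplus> ?f \<otimes> (x \<otimes> y)" using f xy(3,4) by simp
  also have "x \<otimes> y = \<delta> (a [^]\<^sub>G (k + l))" unfolding xy using t by (simp add: dl_mult G.nat_pow_mult)
  finally show ?thesis unfolding w_def .
 qed
 have w0: "w 0 = \<one>" unfolding w_def using f fe by (simp flip: one_single)
 have wn: "w ?n = \<one>" using w0 t unfolding w_def by simp
 have wp: "w 1 [^] k = w k" for k :: nat
  by (induction k) (simp_all add: w0 wm)
 have "w 1 \<otimes> w (?n - 1) = \<one>" "w (?n - 1) \<otimes> w 1 = \<one>" using wm t(2) wn by auto
 then have wU: "w 1 \<in> Units A" unfolding Units_def using wcl by blast
 have aw: "aug (w 1) = \<one>\<^sub>F" unfolding w_def using ec f(1) e(3) t by (simp add: A.minus_eq F.r_neg)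
 have "?f \<otimes> Sum a = \<zero>"
 proof -
  have "?f \<in> FS (cyc a)" unfolding A.minus_eq using FS_add[OF FS_one FS_minus[OF e(1)]] subgroup.one_closed[OF cyc_subgroup[OF a]] by blast
  then have "?f \<otimes> Sum a = sc (aug ?f) (Sum a)" by (rule mult_Sum[OF a])
  moreover have "aug ?f = \<zero>\<^sub>F" using ec e(3) by (simp add: A.minus_eq F.r_neg)
  moreover have "single \<zero>\<^sub>F \<one>\<^sub>G = \<zero>" by (intro ga_eqI) (auto simp: single_apply)
  ultimately show ?thesis using geom_closed[of "\<delta> a" ?n] by simp
 qed
 moreover have "geom (w 1) m = add_pow A m e \<oplus> ?f \<otimes> geom (\<delta> a) m" for m
 proof (induction m)
  case 0 then show ?case using f by simp
 next
  case (Suc m)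
  have g: "geom (\<delta> a) m \<in> carrier A" by (rule geom_closed) simp
  have d: "\<delta> a [^] m = \<delta> (a [^]\<^sub>G m)" by (rule dl_pow[OF t(1)])
  have "geom (w 1) (Suc m) = (e \<oplus> ?f \<otimes> \<delta> a [^] m) \<oplus> (add_pow A m e \<oplus> ?f \<otimes> geom (\<delta> a) m)"
  proof -
   have wm': "w m = e \<oplus> ?f \<otimes> \<delta> a [^] m" by (simp only: w_def d)
   have "geom (w 1) (Suc m) = w 1 [^] m \<oplus> geom (w 1) m" by (rule geom_Suc[OF wcl])
   also have "\<dots> = w m \<oplus> (add_pow A m e \<oplus> ?f \<otimes> geom (\<delta> a) m)"
    by (rule arg_cong2[where f = "ring.add A", OF wp Suc])
   finally show ?thesis unfolding wm' .
  qed
  also have "\<dots> = (e \<oplus> add_pow A m e) \<oplus> (?f \<otimes> \<delta> a [^] m \<oplus> ?f \<otimes> geom (\<delta> a) m)"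
  proof -
   obtain x y z where "x = ?f \<otimes> \<delta> a [^] m" "y = ?f \<otimes> geom (\<delta> a) m" "z = add_pow A m e"
    "x \<in> carrier A" "y \<in> carrier A" "z \<in> carrier A" using f(1) g ec by simp
   then show ?thesis using ec by (simp only: A.a_ac A.a_closed)
  qed
  also have "\<dots> = add_pow A (Suc m) e \<oplus> ?f \<otimes> geom (\<delta> a) (Suc m)"
   unfolding geom_Suc[OF dl_closed] using ec f(1) g A.r_distr[of "\<delta> a [^] m" "geom (\<delta> a) m" ?f]
   by (simp only: A.add.nat_pow_Suc A.a_comm A.nat_pow_closed dl_closed A.add.nat_pow_closed)
  finally show ?case .
 qed
 ultimately have S: "geom (w 1) ?n = sc ?\<nu> e" using add_pow_sc[OF ec] ec by simp
 have "geom (w 1) ?n \<otimes> \<delta> g \<otimes> geom (w 1) ?n = sc ?\<nu> (\<delta> g \<otimes> geom (w 1) ?n)"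
  by (rule torsion_unit_average[OF wU aw _ ord_invertible[OF a]]) (simp_all only: wp wn dl_closed)
 then have eq: "(sc ?\<nu> e) \<otimes> \<delta> g \<otimes> (sc ?\<nu> e) = sc ?\<nu> (\<delta> g \<otimes> (sc ?\<nu> e))" unfolding S .
 obtain c where c: "c = single ?\<nu> \<one>\<^sub>G" "c \<in> carrier A" by simp
 have cc: "u \<otimes> c = c \<otimes> u" if "u \<in> carrier A" for u unfolding c using scalar_commute[OF _ that, of ?\<nu>] by simp
 have "(c \<otimes> e) \<otimes> \<delta> g \<otimes> (c \<otimes> e) = c \<otimes> (e \<otimes> \<delta> g \<otimes> c) \<otimes> e" using c(2) ec by (simp add: A.m_assoc)
 also have "\<dots> = c \<otimes> (c \<otimes> (e \<otimes> \<delta> g \<otimes> e))" using cc[of "e \<otimes> \<delta> g"] c(2) ec by (simp add: A.m_assoc)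
 finally have 1: "(c \<otimes> e) \<otimes> \<delta> g \<otimes> (c \<otimes> e) = c \<otimes> (c \<otimes> (e \<otimes> \<delta> g \<otimes> e))" .
 have "c \<otimes> (\<delta> g \<otimes> (c \<otimes> e)) = c \<otimes> ((\<delta> g \<otimes> c) \<otimes> e)" using c(2) ec by (simp add: A.m_assoc)
 also have "\<dots> = c \<otimes> (c \<otimes> (\<delta> g \<otimes> e))" unfolding cc[OF dl_closed] using c(2) ec by (simp add: A.m_assoc)
 finally have "c \<otimes> (c \<otimes> (e \<otimes> \<delta> g \<otimes> e)) = c \<otimes> (c \<otimes> (\<delta> g \<otimes> e))" using eq 1 unfolding c(1)[symmetric] by simp
 then have "c \<otimes> (c \<otimes> (e \<otimes> \<delta> g \<otimes> e \<ominus> \<delta> g \<otimes> e)) = \<zero>"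
  using c(2) ec by (simp add: A.minus_eq A.r_distr A.r_minus A.r_neg)
 moreover have "e \<otimes> \<delta> g \<otimes> e \<ominus> \<delta> g \<otimes> e = \<zero>" if "c \<otimes> (c \<otimes> (e \<otimes> \<delta> g \<otimes> e \<ominus> \<delta> g \<otimes> e)) = \<zero>"
 proof -
  have z: "u = \<zero>" if "u \<in> carrier A" "c \<otimes> u = \<zero>" for u
   by (rule sc_eq_zeroD[OF _ ord_invertible[OF a] that(1) that(2)[unfolded c(1)]]) simp
  have "c \<otimes> (e \<otimes> \<delta> g \<otimes> e \<ominus> \<delta> g \<otimes> e) = \<zero>" by (rule z[OF _ that]) (use ec c(2) in simp)
  then show ?thesis by (rule z[rotated]) (use ec in simp)
 qed
 ultimately have "e \<otimes> \<delta> g \<otimes> e \<ominus> \<delta> g \<otimes> e = \<zero>" by blast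
 then show ?thesis using ec by simp
qed

text \<open>
  The two one-sided identities for \<open>g\<close> and \<open>g\<^sup>-\<^sup>1\<close> together say that
  \<open>e\<close> commutes with \<open>g\<close>. An idempotent has augmentation zero or one, and the first
  case follows from the second by passing to \<open>1 - e\<close>.
\<close>

lemma idempotent_invariant:
 assumes a: "a \<in> tors" and g: "g \<in> carrier G" and e: "e \<in> FS (cyc a)" "e \<otimes> e = e"
 shows "cj g e = e"
proof -
 have main: "cj g e = e" if e: "e \<in> FS (cyc a)" "e \<otimes> e = e" "aug e = \<one>\<^sub>F" for e
 proof -
  have ec: "e \<in> carrier A" by (rule FS_carrier[OF e(1)])
  have kc: "cj g e \<in> FS (cyc a)" by (rule cj_FC[OF a g e(1)])
  have 1: "e \<otimes> \<delta> (inv\<^sub>G g) \<otimes> e = \<delta> (inv\<^sub>G g) \<otimes> e"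
   using idempotent_invariant_aux[OF a _ e, of "inv\<^sub>G g"] g by simp
  have "cj g e \<otimes> e = \<delta> g \<otimes> (e \<otimes> \<delta> (inv\<^sub>G g) \<otimes> e)" using g ec by (simp add: cj_def A.m_assoc)
  then have A1: "cj g e \<otimes> e = e" unfolding 1 using g ec by simp
  have 2: "e \<otimes> \<delta> g \<otimes> e = \<delta> g \<otimes> e" by (rule idempotent_invariant_aux[OF a g e])
  have "e \<otimes> cj g e = (e \<otimes> \<delta> g \<otimes> e) \<otimes> \<delta> (inv\<^sub>G g)" using g ec by (simp add: cj_def A.m_assoc)
  then have A2: "e \<otimes> cj g e = cj g e" unfolding 2 by (simp add: cj_def)
  show ?thesis using A1 A2 FC_commute[OF a e(1) kc] by simp
 qed
 have ec: "e \<in> carrier A" by (rule FS_carrier[OF e(1)])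
 have "aug e \<otimes>\<^sub>F aug e = aug e" using aug_mult[OF ec ec] e(2) by simp
 then have "aug e \<otimes>\<^sub>F (aug e \<ominus>\<^bsub>F\<^esub> \<one>\<^sub>F) = \<zero>\<^sub>F" using ec by (simp add: F.minus_eq F.r_distr F.r_minus F.r_neg)
 then have "aug e = \<zero>\<^sub>F \<or> aug e = \<one>\<^sub>F" using ec F.integral by fastforce
 then show ?thesis
 proof
  assume z: "aug e = \<zero>\<^sub>F"
  have "cj g (\<one> \<ominus> e) = \<one> \<ominus> e"
  proof (rule main)
   show "\<one> \<ominus> e \<in> FS (cyc a)" unfolding A.minus_eq
    using FS_add[OF FS_one FS_minus[OF e(1)]] subgroup.one_closed[OF cyc_subgroup[OF a]] by blast
   show "(\<one> \<ominus> e) \<otimes> (\<one> \<ominus> e) = \<one> \<ominus> e"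
    using ec e(2) by (simp add: A.minus_eq A.l_distr A.r_distr A.l_minus A.r_minus A.r_neg A.l_neg A.a_ac)
   show "aug (\<one> \<ominus> e) = \<one>\<^sub>F" using z ec by (simp add: A.minus_eq)
  qed
  moreover have "cj g (\<one> \<ominus> e) = \<one> \<ominus> cj g e" using g ec by (simp add: cj_def A.minus_eq A.l_distr A.r_distr A.l_minus A.r_minus)
  ultimately have "\<one> \<ominus> cj g e = \<one> \<ominus> e" by simp
  then have "\<one> \<ominus> (\<one> \<ominus> cj g e) = \<one> \<ominus> (\<one> \<ominus> e)" by simp
  moreover have "\<one> \<ominus> (\<one> \<ominus> u) = u" if "u \<in> carrier A" for u using that by algebra
  ultimately show ?thesis using cj_closed[OF g ec] ec by simp
 qed (use main e in blast)
qed

end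

section \<open>Conjugation of commuting units\<close>

context engel_units
begin

lemma cj_Units: assumes g: "g \<in> carrier G" and y: "y \<in> Units A"
 shows "cj g y \<in> Units A" "inv (cj g y) = cj g (inv y)"
proof -
 have c: "y \<in> carrier A" "inv y \<in> carrier A" using y by (auto simp: A.Units_closed)
 have e: "cj g y \<otimes> cj g (inv y) = \<one>" "cj g (inv y) \<otimes> cj g y = \<one>"
  unfolding cj_mult[OF g c, symmetric] cj_mult[OF g c(2,1), symmetric] using y g by simp_all
 show "cj g y \<in> Units A" unfolding Units_def using e g c by auto
 show "inv (cj g y) = cj g (inv y)" by (rule A.inv_char) (use e g c in auto)
qed

lemma cm_dl: assumes g: "g \<in> carrier G" and y: "y \<in> Units A"
 shows "cm y (\<delta> g) = y \<otimes> inv (cj g y)"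
proof -
 have c: "y \<in> carrier A" "inv y \<in> carrier A" using y by (auto simp: A.Units_closed)
 show ?thesis unfolding cj_Units(2)[OF g y] using g c by (simp add: cj_def inv_dl A.m_assoc)
qed

text \<open>Commutators with a group element, expressed through the conjugation automorphism.\<close>

lemma engel_conjugation:
 assumes g: "g \<in> carrier G" and x: "x \<in> Units A"
 shows "\<exists>n. ((\<lambda>y. y \<otimes> inv (cj g y)) ^^ n) x = \<one>"
proof -
 obtain n where n: "((\<lambda>z. cm z (\<delta> g)) ^^ Suc n) x = \<one>"
  using engel_Units[OF x dl_Units[OF g]] g by auto
 have "((\<lambda>z. cm z (\<delta> g)) ^^ k) x = ((\<lambda>y. y \<otimes> inv (cj g y)) ^^ k) x \<and> ((\<lambda>z. cm z (\<delta> g)) ^^ k) x \<in> Units A" for k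
 proof (induction k)
  case 0 show ?case using x by simp
 next
  case (Suc k)
  obtain z where z: "z = ((\<lambda>z. cm z (\<delta> g)) ^^ k) x" "z = ((\<lambda>y. y \<otimes> inv (cj g y)) ^^ k) x" "z \<in> Units A"
   using Suc by blast
  have "((\<lambda>z. cm z (\<delta> g)) ^^ Suc k) x = cm z (\<delta> g)" by (simp only: funpow.simps(2) comp_apply z(1)[symmetric])
  moreover have "((\<lambda>y. y \<otimes> inv (cj g y)) ^^ Suc k) x = z \<otimes> inv (cj g z)" by (simp only: funpow.simps(2) comp_apply z(2)[symmetric])
  moreover have "z \<otimes> inv (cj g z) \<in> Units A" using z(3) cj_Units[OF g z(3)] A.Units_m_closed A.Units_inv_Units by metis
  ultimately show ?case using cm_dl[OF g z(3)] by (simp only: simp_thms)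
 qed
 then have "((\<lambda>y. y \<otimes> inv (cj g y)) ^^ Suc n) x = \<one>" using n by metis
 then show ?thesis by (rule exI)
qed

lemma cj_funpow: assumes g: "g \<in> carrier G" and u: "u \<in> carrier A"
 shows "(cj g ^^ s) u = cj (g [^]\<^sub>G s) u"
proof (induction s)
 case 0 show ?case using u by (simp add: cj_def flip: one_single)
next
 case (Suc s)
 have "(cj g ^^ Suc s) u = cj (g \<bullet> g [^]\<^sub>G s) u" using Suc cj_cj[OF g _ u, of "g [^]\<^sub>G s"] g by simp
 also have "g \<bullet> g [^]\<^sub>G s = g [^]\<^sub>G Suc s" using G.nat_pow_Suc2[OF g] by simp
 finally show ?case .
qed

text \<open>
  The conjugates of \<open>a\<close> by the powers of \<open>g\<close> all lie in the finite cyclic group of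
  \<open>a\<close>, so two of them agree.
\<close>

lemma power_commutes:
 assumes a: "a \<in> tors" and g: "g \<in> carrier G"
 shows "\<exists>s::nat. s > 0 \<and> g [^]\<^sub>G s \<bullet> a = a \<bullet> g [^]\<^sub>G s"
proof -
 note t = torsD[OF a]
 let ?f = "\<lambda>k::nat. g [^]\<^sub>G k \<bullet> a \<bullet> inv\<^sub>G (g [^]\<^sub>G k)"
 have "range ?f \<subseteq> cyc a" using torsion_conj[OF a] g by auto
 then have "finite (range ?f)" using cyc_finite[OF a] finite_subset by blast
 then have "\<not> inj ?f" using finite_imageD infinite_UNIV_nat by blast
 then obtain k l where "k \<noteq> l" "?f k = ?f l" unfolding inj_def by blast
 then obtain k l where kl: "k < l" "?f k = ?f l" by (metis linorder_neqE_nat)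
 obtain s where s: "l = k + s" "s > 0" using less_imp_add_positive[OF kl(1)] by blast
 obtain x y where xy: "x = g [^]\<^sub>G k" "y = g [^]\<^sub>G s" "x \<in> carrier G" "y \<in> carrier G" using g by simp
 have lx: "g [^]\<^sub>G l = x \<bullet> y" unfolding s xy using g by (simp add: G.nat_pow_mult)
 have "x \<bullet> a \<bullet> inv\<^sub>G x = x \<bullet> y \<bullet> a \<bullet> inv\<^sub>G (x \<bullet> y)" using kl(2) unfolding lx xy(1)[symmetric] .
 also have "\<dots> = x \<bullet> (y \<bullet> a \<bullet> inv\<^sub>G y) \<bullet> inv\<^sub>G x"
  using xy(3,4) t by (simp add: G.inv_mult_group G.m_assoc)
 finally have "a = y \<bullet> a \<bullet> inv\<^sub>G y" using xy(3,4) t by simp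
 then have "a \<bullet> y = y \<bullet> a \<bullet> inv\<^sub>G y \<bullet> y" by (rule arg_cong[where f = "\<lambda>z. z \<bullet> y"])
 also have "\<dots> = y \<bullet> a" using xy(4) t by (simp add: G.m_assoc)
 finally have "a \<bullet> y = y \<bullet> a" .
 then show ?thesis using s(2) xy(2) by metis
qed

text \<open>
  The units of the commutative algebra spanned by the cyclic group of \<open>a\<close> form an abelian group
  on which conjugation acts with period \<open>s\<close> and unipotently on \<open>u\<close>.
\<close>

theorem unit_power_invariant:
 assumes a: "a \<in> tors" and g: "g \<in> carrier G"
  and s: "g [^]\<^sub>G (s::nat) \<bullet> a = a \<bullet> g [^]\<^sub>G s"
  and u: "u \<in> FS (cyc a)" and v: "v \<in> FS (cyc a)" "u \<otimes> v = \<one>"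
 shows "\<exists>j. u [^] (s ^ j :: nat) = (cj g u) [^] (s ^ j)"
proof -
 let ?U = "{u \<in> FS (cyc a). \<exists>v \<in> FS (cyc a). u \<otimes> v = \<one>}"
 let ?H = "A\<lparr>carrier := ?U\<rparr>"
 note sub = cyc_subgroup[OF a] and com = FC_commute[OF a]
 have cU: "w \<in> carrier A" if "w \<in> ?U" for w using that FS_carrier by blast
 have inv_U: "w \<in> Units A \<and> inv w \<in> ?U" if w: "w \<in> ?U" for w
 proof -
  obtain x where x: "x \<in> FS (cyc a)" "w \<otimes> x = \<one>" using w by blast
  have xw: "x \<otimes> w = \<one>" using com[OF x(1)] w x(2) by auto
  have c: "w \<in> carrier A" "x \<in> carrier A" using w x FS_carrier by auto
  have "inv w = x" by (rule A.inv_char[OF c x(2) xw])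
  moreover have "w \<in> Units A" unfolding Units_def using c x(2) xw by blast
  ultimately show ?thesis using x xw w by blast
 qed
 have mU: "x \<otimes> y \<in> ?U" if x: "x \<in> ?U" and y: "y \<in> ?U" for x y
 proof -
  have i: "inv y \<otimes> inv x \<in> FS (cyc a)" using inv_U[OF x] inv_U[OF y] FS_subgroup_mult[OF sub] by blast
  have xu: "x \<in> Units A" "y \<in> Units A" using inv_U x y by auto
  have c: "x \<in> carrier A" "y \<in> carrier A" "inv x \<in> carrier A" "inv y \<in> carrier A" using xu by (auto simp: A.Units_closed)
  have "(x \<otimes> y) \<otimes> (inv y \<otimes> inv x) = x \<otimes> ((y \<otimes> inv y) \<otimes> inv x)" using c by (simp only: A.m_assoc A.m_closed)
  then have "(x \<otimes> y) \<otimes> (inv y \<otimes> inv x) = \<one>" using xu c by simp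
  then show ?thesis using i x y FS_subgroup_mult[OF sub] by blast
 qed
 have oU: "\<one> \<in> ?U" using FS_one[OF subgroup.one_closed[OF sub]] by (auto intro: bexI[of _ \<one>])
 interpret H: comm_group ?H
 proof (rule comm_groupI)
  fix x assume "x \<in> carrier ?H"
  then have x: "x \<in> ?U" by simp
  then have "inv x \<otimes> x = \<one>" using inv_U by auto
  then show "\<exists>y \<in> carrier ?H. y \<otimes>\<^bsub>?H\<^esub> x = \<one>\<^bsub>?H\<^esub>" using inv_U[OF x] by auto
 next
  fix x y assume "x \<in> carrier ?H" "y \<in> carrier ?H"
  then show "x \<otimes>\<^bsub>?H\<^esub> y = y \<otimes>\<^bsub>?H\<^esub> x" using com by auto
 next
  fix x y z assume "x \<in> carrier ?H" "y \<in> carrier ?H" "z \<in> carrier ?H"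
  then show "x \<otimes>\<^bsub>?H\<^esub> y \<otimes>\<^bsub>?H\<^esub> z = x \<otimes>\<^bsub>?H\<^esub> (y \<otimes>\<^bsub>?H\<^esub> z)" using cU A.m_assoc by auto
 qed (use mU oU cU in auto)
 have iH: "inv\<^bsub>?H\<^esub> w = inv w" if w: "w \<in> ?U" for w
 proof (rule H.inv_equality)
  show "inv w \<otimes>\<^bsub>?H\<^esub> w = \<one>\<^bsub>?H\<^esub>" using inv_U[OF w] by simp
 qed (use w inv_U[OF w] in auto)
 have cjU: "cj g w \<in> ?U" if w: "w \<in> ?U" for w
 proof -
  have i: "w \<in> Units A" "inv w \<in> FS (cyc a)" "w \<in> FS (cyc a)" using inv_U[OF w] w by auto
  have "cj g w \<otimes> cj g (inv w) = \<one>" using cj_Units[OF g i(1)] A.Units_r_inv by metis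
  then show ?thesis using cj_FC[OF a g] i by blast
 qed
 have uU: "u \<in> ?U" using u v by blast
 have uA: "u \<in> Units A" using inv_U[OF uU] by blast
 have fU: "w \<otimes> inv (cj g w) \<in> ?U" if w: "w \<in> ?U" for w using mU[OF w] inv_U cjU[OF w] by blast
 have it: "((\<lambda>y. y \<otimes>\<^bsub>?H\<^esub> inv\<^bsub>?H\<^esub> (cj g y)) ^^ k) u = ((\<lambda>y. y \<otimes> inv (cj g y)) ^^ k) u \<and>
  ((\<lambda>y. y \<otimes> inv (cj g y)) ^^ k) u \<in> ?U" for k
 proof (induction k)
  case 0 show ?case using uU by simp
 next
  case (Suc k)
  define z where "z = ((\<lambda>y. y \<otimes> inv (cj g y)) ^^ k) u"
  have z: "z = ((\<lambda>y. y \<otimes>\<^bsub>?H\<^esub> inv\<^bsub>?H\<^esub> (cj g y)) ^^ k) u" "z = ((\<lambda>y. y \<otimes> inv (cj g y)) ^^ k) u" "z \<in> ?U"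
   unfolding z_def by (rule conjunct1[OF Suc, symmetric], rule refl, rule conjunct2[OF Suc])
  have "((\<lambda>y. y \<otimes>\<^bsub>?H\<^esub> inv\<^bsub>?H\<^esub> (cj g y)) ^^ Suc k) u = z \<otimes>\<^bsub>?H\<^esub> inv\<^bsub>?H\<^esub> (cj g z)"
   by (simp only: funpow.simps(2) comp_apply z(1)[symmetric])
  also have "\<dots> = z \<otimes> inv (cj g z)" unfolding iH[OF cjU[OF z(3)]] by simp
  finally have 1: "((\<lambda>y. y \<otimes>\<^bsub>?H\<^esub> inv\<^bsub>?H\<^esub> (cj g y)) ^^ Suc k) u = z \<otimes> inv (cj g z)" .
  have 2: "((\<lambda>y. y \<otimes> inv (cj g y)) ^^ Suc k) u = z \<otimes> inv (cj g z)"
   by (simp only: funpow.simps(2) comp_apply z(2)[symmetric])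
  show ?case unfolding 1 2 by (rule conjI[OF refl fU[OF z(3)]])
 qed
 obtain m where "((\<lambda>y. y \<otimes> inv (cj g y)) ^^ m) u = \<one>" using engel_conjugation[OF g uA] by (elim exE)
 then have m: "((\<lambda>y. y \<otimes>\<^bsub>?H\<^esub> inv\<^bsub>?H\<^esub> (cj g y)) ^^ m) u = \<one>\<^bsub>?H\<^esub>"
  unfolding conjunct1[OF it[of m]] by simp
 have per: "(cj g ^^ s) w = w" if w: "w \<in> ?U" for w
 proof -
  have "cj (g [^]\<^sub>G s) w = w"
  proof (rule cj_centralizing)
   show "w \<in> FS (cyc a)" using w by blast
   fix x assume "x \<in> cyc a"
   then obtain k :: nat where k: "x = a [^]\<^sub>G k" using cyc_powers[OF a] by auto
   show "g [^]\<^sub>G s \<bullet> x = x \<bullet> g [^]\<^sub>G s"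
    unfolding k using G.group_commutes_pow[OF s[symmetric], of k] g torsD[OF a] by simp
  qed (use g in simp)
  then show ?thesis using cj_funpow[OF g cU[OF w]] by simp
 qed
 have "\<exists>j. (u \<otimes>\<^bsub>?H\<^esub> inv\<^bsub>?H\<^esub> (cj g u)) [^]\<^bsub>?H\<^esub> (s ^ j :: nat) = \<one>\<^bsub>?H\<^esub>"
 proof (rule H.unipotent_power[OF _ _ _ _ m])
  show "\<And>x. x \<in> carrier ?H \<Longrightarrow> cj g x \<in> carrier ?H" using cjU by simp
  show "\<And>x y. x \<in> carrier ?H \<Longrightarrow> y \<in> carrier ?H \<Longrightarrow> cj g (x \<otimes>\<^bsub>?H\<^esub> y) = cj g x \<otimes>\<^bsub>?H\<^esub> cj g y"
   using cj_mult[OF g cU cU] by simp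
  show "\<And>x. x \<in> carrier ?H \<Longrightarrow> (cj g ^^ s) x = x" using per by simp
  show "u \<in> carrier ?H" using uU by simp
 qed
 then obtain j where "(u \<otimes> inv (cj g u)) [^]\<^bsub>?H\<^esub> (s ^ j :: nat) = \<one>" using iH[OF cjU[OF uU]] by auto
 then have j: "(u \<otimes> inv (cj g u)) [^] (s ^ j :: nat) = \<one>" by (simp only: A.nat_pow_consistent[symmetric])
 obtain w where w: "w = u \<otimes> inv (cj g u)" "w \<in> FS (cyc a)" "w \<in> carrier A" using fU[OF uU] cU by blast
 have cu: "cj g u \<in> FS (cyc a)" "cj g u \<in> carrier A" "cj g u \<in> Units A" "u \<in> carrier A"
  using cjU[OF uU] cU uU inv_U by auto
 have "w \<otimes> cj g u = u" unfolding w(1) using cu uA by (simp add: A.m_assoc A.Units_closed)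
 then have "u [^] (s ^ j) = (w \<otimes> cj g u) [^] (s ^ j)" by simp
 also have "\<dots> = w [^] (s ^ j) \<otimes> (cj g u) [^] (s ^ j)"
  by (rule A.pow_mult_distrib[OF com[OF w(2) cu(1)] w(3) cu(2)])
 also have "\<dots> = (cj g u) [^] (s ^ j)" using j cu(2) unfolding w(1) by simp
 finally show ?thesis by blast
qed

end

section \<open>Characteristic zero\<close>

text \<open>
  From \<open>k\<close> times the binomial coefficient being a multiple of \<open>N\<close>, at most the
  2-part of \<open>k\<close> is lost, which is small compared with \<open>4\<^sup>k\<close>.
\<close>

lemma binomial_four_dvd:
 fixes k v N :: nat
 assumes k: "k \<ge> 2" and N: "2 ^ v dvd N"
 shows "2 ^ (v + 3) dvd (N choose k) * 4 ^ k"
proof -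
 let ?u = "multiplicity 2 k"
 obtain m where m: "k = 2 ^ ?u * m" "\<not> 2 dvd m"
  using multiplicity_decompose'[of k 2] k by auto
 have "2 ^ ?u \<le> k" using m k by (metis dvd_imp_le dvd_triv_left not_numeral_le_zero zero_less_iff_neq_zero)
 \<comment> \<open>So at most \<open>k - 1\<close> factors two are lost, and \<open>2 k - (k - 1) \<ge> 3\<close>.\<close>
 then have uk: "?u < k" using less_exp[of ?u] by linarith
 have "k * (N choose k) = N * ((N - 1) choose (k - 1))" using times_binomial_minus1_eq[of k N] k by simp
 then have "2 ^ v dvd k * (N choose k)" using N by simp
 then have "2 ^ v dvd m * (2 ^ ?u * (N choose k))" using m(1) by (metis mult.assoc mult.commute)
 moreover have "coprime (2 ^ v) m" using m(2) by (simp add: coprime_power_left_iff prime_imp_coprime)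
 ultimately have d: "2 ^ v dvd 2 ^ ?u * (N choose k)" by (simp add: coprime_dvd_mult_right_iff)
 obtain r where r: "2 * k = ?u + 3 + r" using le_Suc_ex[of "?u + 3" "2 * k"] uk k by auto
 have "(4::nat) ^ k = 2 ^ (2 * k)" by (simp add: power_mult)
 also have "\<dots> = 2 ^ ?u * 2 ^ 3 * 2 ^ r" unfolding r by (simp add: power_add)
 finally have "(N choose k) * 4 ^ k = (2 ^ ?u * (N choose k)) * 2 ^ 3 * 2 ^ r" by simp
 then show ?thesis unfolding power_add using d by (metis dvd_mult2 mult_dvd_mono dvd_refl)
qed

lemma (in field) add_pow_one_inj:
 assumes "ring_characteristic R = 0" "add_pow R (m::nat) \<one> = add_pow R (n::nat) \<one>"
 shows "m = n"
proof -
 have *: "m = n" if "m \<le> n" "add_pow R m \<one> = add_pow R n \<one>" for m n :: nat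
 proof -
  have "add_pow R m \<one> \<oplus> add_pow R (n - m) \<one> = add_pow R n \<one>"
   using add.nat_pow_mult[of \<one> m "n - m"] that(1) by simp
  then have "add_pow R (n - m) \<one> = \<zero>"
   using add.l_cancel[of "add_pow R m \<one>" "add_pow R (n - m) \<one>" \<zero>] that(2) by simp
  then have "n - m = 0" using characteristic_dvd[of "n - m"] assms(1) by simp
  then show ?thesis using that(1) by simp
 qed
 show ?thesis using *[OF _ assms(2)] *[OF _ assms(2)[symmetric]] nat_le_linear[of m n] by metis
qed

lemma (in field) add_pow_one_power: "add_pow R (m::nat) \<one> [^] (k::nat) = add_pow R (m ^ k) \<one>"
proof (induction k)
 case (Suc k)
 have "add_pow R m \<one> [^] Suc k = add_pow R (m ^ k) \<one> \<otimes> add_pow R m \<one>" using Suc by simp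
 then show ?case by (simp only: add_pow_one_mult[symmetric] power_Suc mult.commute)
qed simp

lemma (in field) finsum_add_pow_one:
 "finite I \<Longrightarrow> (\<Oplus>i\<in>I. add_pow R (f i :: nat) \<one>) = add_pow R (sum f I) \<one>"
 by (induction rule: finite_induct) (simp_all add: add.nat_pow_mult)

context engel_units
begin

lemma single_pow: "g \<in> carrier G \<Longrightarrow> c \<in> carrier F \<Longrightarrow>
 single c g [^] (n::nat) = single (c [^]\<^sub>F n) (g [^]\<^sub>G n)"
 by (induction n) (simp_all add: one_single single_mult_single)

lemma single_zero: "single \<zero>\<^sub>F g = \<zero>"
 by (intro ga_eqI) (auto simp: single_apply)

lemma single_uminus: "c \<in> carrier F \<Longrightarrow> g \<in> carrier G \<Longrightarrow> single (\<ominus>\<^bsub>F\<^esub> c) g = \<ominus> single c g"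
proof -
 assume c: "c \<in> carrier F" "g \<in> carrier G"
 have "single (\<ominus>\<^bsub>F\<^esub> c) g \<oplus> single c g = \<zero>" using c by (intro ga_eqI) (auto simp: single_apply F.l_neg)
 then show ?thesis using c by (metis A.minus_equality F.a_inv_closed single_closed)
qed

text \<open>
  A geometric series: the product of \<open>1 + l a\<close> with the sum of the powers of \<open>- l a\<close>
  below the order \<open>n\<close> of \<open>a\<close> is the scalar \<open>1 - (- l)\<^sup>n\<close>.
\<close>

lemma one_plus_unit:
 assumes a: "a \<in> tors" and l: "l \<in> carrier F" "(\<ominus>\<^bsub>F\<^esub> l) [^]\<^sub>F G.ord a \<noteq> \<one>\<^sub>F"
 shows "\<exists>v \<in> FS (cyc a). (\<one> \<oplus> single l a) \<otimes> v = \<one>"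
proof -
 note t = torsD[OF a]
 let ?n = "G.ord a"
 define w where "w = single (\<ominus>\<^bsub>F\<^esub> l) a"
 define d where "d = \<one>\<^sub>F \<ominus>\<^bsub>F\<^esub> (\<ominus>\<^bsub>F\<^esub> l) [^]\<^sub>F ?n"
 have w: "w \<in> carrier A" "w \<in> FS (cyc a)" unfolding w_def using t l FS_single[OF _ cyc_self[OF a]] by auto
 have d: "d \<in> carrier F" "d \<noteq> \<zero>\<^sub>F" unfolding d_def using l F.r_right_minus_eq by auto
 have i: "inv\<^bsub>F\<^esub> d \<in> carrier F" "d \<otimes>\<^sub>F inv\<^bsub>F\<^esub> d = \<one>\<^sub>F" using d F.field_Units F.Units_inv_closed F.Units_r_inv by auto
 have wn: "w [^] ?n = single ((\<ominus>\<^bsub>F\<^esub> l) [^]\<^sub>F ?n) \<one>\<^sub>G" unfolding w_def using single_pow[OF t(1)] l(1) t by simp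
 have S: "geom w ?n \<in> carrier A" by (rule geom_closed[OF w(1)])
 have SF: "geom w ?n \<in> FS (cyc a)" by (rule FS_finsum) (use FS_subgroup_pow[OF cyc_subgroup[OF a] w(2)] in auto)
 have tel: "w \<otimes> geom w ?n \<oplus> \<one> = geom w ?n \<oplus> w [^] ?n" by (rule geom_telescope(1)[OF w(1)])
 have e: "\<one> \<oplus> single l a = \<one> \<ominus> w" unfolding w_def A.minus_eq using single_uminus[OF l(1) t(1)] l t by simp
 have "(\<one> \<oplus> single l a) \<otimes> geom w ?n = \<one> \<ominus> w [^] ?n"
 proof -
  obtain x y z where xyz: "x = w \<otimes> geom w ?n" "y = geom w ?n" "z = w [^] ?n" "x \<in> carrier A" "y \<in> carrier A" "z \<in> carrier A"
   using w(1) S by simp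
  have "(\<one> \<ominus> w) \<otimes> geom w ?n = y \<ominus> x" unfolding xyz using w(1) S by (simp add: A.minus_eq A.l_distr A.l_minus)
  also have "\<dots> = (x \<oplus> \<one>) \<ominus> z \<ominus> x" unfolding tel[folded xyz(1-3)] using xyz(4-6) by algebra
  also have "\<dots> = \<one> \<ominus> z" using xyz(4-6) by algebra
  finally show ?thesis unfolding e xyz(3) .
 qed
 also have "\<one> \<ominus> w [^] ?n = single d \<one>\<^sub>G"
  unfolding wn d_def A.minus_eq F.minus_eq one_single using l(1)
  by (intro ga_eqI) (auto simp: single_apply simp flip: single_uminus)
 finally have "(\<one> \<oplus> single l a) \<otimes> geom w ?n = single d \<one>\<^sub>G" .
 then have "((\<one> \<oplus> single l a) \<otimes> geom w ?n) \<otimes> single (inv\<^bsub>F\<^esub> d) \<one>\<^sub>G = \<one>"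
  using d i by (simp add: single_mult_single one_single)
 then have "(\<one> \<oplus> single l a) \<otimes> (geom w ?n \<otimes> single (inv\<^bsub>F\<^esub> d) \<one>\<^sub>G) = \<one>"
  using S i l t by (simp add: A.m_assoc)
 moreover have "geom w ?n \<otimes> single (inv\<^bsub>F\<^esub> d) \<one>\<^sub>G \<in> FS (cyc a)"
  using FS_subgroup_mult[OF cyc_subgroup[OF a] SF] FS_single[OF i(1) subgroup.one_closed[OF cyc_subgroup[OF a]]] by blast
 ultimately show ?thesis by blast
qed

lemma cj_single: "g \<in> carrier G \<Longrightarrow> a \<in> carrier G \<Longrightarrow> l \<in> carrier F \<Longrightarrow>
 cj g (single l a) = single l (g \<bullet> a \<bullet> inv\<^sub>G g)"
 by (simp add: cj_def single_mult_single)

lemma cj_add: "g \<in> carrier G \<Longrightarrow> u \<in> carrier A \<Longrightarrow> v \<in> carrier A \<Longrightarrow> cj g (u \<oplus> v) = cj g u \<oplus> cj g v"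
 by (simp add: cj_def A.l_distr A.r_distr)

lemma one_plus_power_invariant:
 assumes a: "a \<in> tors" and g: "g \<in> carrier G"
  and s: "g [^]\<^sub>G (s::nat) \<bullet> a = a \<bullet> g [^]\<^sub>G s"
  and l: "l \<in> carrier F" "(\<ominus>\<^bsub>F\<^esub> l) [^]\<^sub>F G.ord a \<noteq> \<one>\<^sub>F"
 shows "\<exists>j. (\<one> \<oplus> single l a) [^] (s ^ j :: nat) = (\<one> \<oplus> single l (g \<bullet> a \<bullet> inv\<^sub>G g)) [^] (s ^ j)"
proof -
 have u: "\<one> \<oplus> single l a \<in> FS (cyc a)"
  using FS_add FS_one[OF subgroup.one_closed[OF cyc_subgroup[OF a]]] FS_single[OF l(1) cyc_self[OF a]] by blast
 obtain v where v: "v \<in> FS (cyc a)" "(\<one> \<oplus> single l a) \<otimes> v = \<one>" using one_plus_unit[OF a l] by blast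
 have "cj g (\<one> \<oplus> single l a) = \<one> \<oplus> single l (g \<bullet> a \<bullet> inv\<^sub>G g)"
  using cj_add[OF g] cj_single[OF g torsD(1)[OF a] l(1)] l(1) torsD(1)[OF a] g by simp
 then show ?thesis using unit_power_invariant[OF a g s u v] by simp
qed

lemma one_plus_power_coeff:
 assumes x: "x \<in> carrier G" and y: "y \<in> carrier G"
 shows "((\<one> \<oplus> single (add_pow F (m::nat) \<one>\<^sub>F) x) [^] (N::nat)) y =
  add_pow F (\<Sum>k\<le>N. if x [^]\<^sub>G k = y then (N choose k) * m ^ k else 0) \<one>\<^sub>F"
proof -
 let ?l = "add_pow F m \<one>\<^sub>F"
 have sc: "single ?l x \<in> carrier A" using x by simp
 have t: "add_pow A (N choose k) (single ?l x [^] k \<otimes> \<one> [^] (N - k)) y =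
  add_pow F (if x [^]\<^sub>G k = y then (N choose k) * m ^ k else 0) \<one>\<^sub>F" for k
 proof -
  have "single ?l x [^] k \<otimes> \<one> [^] (N - k) = single (add_pow F (m ^ k) \<one>\<^sub>F) (x [^]\<^sub>G k)"
   using x sc by (simp add: single_pow F.add_pow_one_power)
  then show ?thesis using x y F.add.nat_pow_pow[of "\<one>\<^sub>F" "N choose k" "m ^ k"]
   by (auto simp: add_pow_apply single_apply mult.commute)
 qed
 have "(\<one> \<oplus> single ?l x) [^] N = (single ?l x \<oplus> \<one>) [^] N" by (simp only: A.a_comm[OF A.one_closed sc])
 also have "\<dots> = (\<Oplus>k\<in>{..N}. add_pow A (N choose k) (single ?l x [^] k \<otimes> \<one> [^] (N - k)))"
  by (rule A.binomial_commuting) (use sc in auto)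
 finally have "((\<one> \<oplus> single ?l x) [^] N) y =
  (\<Oplus>\<^bsub>F\<^esub>k\<in>{..N}. add_pow F (if x [^]\<^sub>G k = y then (N choose k) * m ^ k else 0) \<one>\<^sub>F)"
  using sc y by (simp only: t finsum_apply finite_atMost A.add.nat_pow_closed A.m_closed A.nat_pow_closed A.one_closed)
 then show ?thesis by (simp only: F.finsum_add_pow_one finite_atMost)
qed

text \<open>
  The unit \<open>1 + 4 a\<close> and its conjugate \<open>1 + 4 c\<close> have a common power
  \<open>N\<close>. Comparing the integer coefficients at \<open>a\<close> 2-adically, the linear term
  \<open>4 N\<close> on one side exceeds all the other terms, while on the other side there is no linear term.
\<close>

theorem torsion_central_char_zero:
 assumes p: "ring_characteristic F = 0" and a: "a \<in> tors" and g: "g \<in> carrier G"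
 shows "g \<bullet> a \<bullet> inv\<^sub>G g = a"
proof (rule ccontr)
 let ?c = "g \<bullet> a \<bullet> inv\<^sub>G g" and ?l = "add_pow F (4::nat) \<one>\<^sub>F"
 assume ca: "?c \<noteq> a"
 note t = torsD[OF a]
 have cc: "?c \<in> carrier G" using g t by simp
 have a1: "a \<noteq> \<one>\<^sub>G" using ca g by auto
 have inj: "m = n" if "add_pow F m \<one>\<^sub>F = add_pow F n \<one>\<^sub>F" for m n :: nat
  by (rule F.add_pow_one_inj[OF p that])
 have "(\<ominus>\<^bsub>F\<^esub> ?l) [^]\<^sub>F G.ord a \<noteq> \<one>\<^sub>F"
 proof
  assume e: "(\<ominus>\<^bsub>F\<^esub> ?l) [^]\<^sub>F G.ord a = \<one>\<^sub>F"
  have lc: "?l \<in> carrier F" "\<ominus>\<^bsub>F\<^esub> ?l \<in> carrier F" by simp_all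
  have "(\<ominus>\<^bsub>F\<^esub> ?l) [^]\<^sub>F G.ord a \<otimes>\<^sub>F (\<ominus>\<^bsub>F\<^esub> ?l) [^]\<^sub>F G.ord a = \<one>\<^sub>F" unfolding e by simp
  then have "(\<ominus>\<^bsub>F\<^esub> ?l \<otimes>\<^sub>F \<ominus>\<^bsub>F\<^esub> ?l) [^]\<^sub>F G.ord a = \<one>\<^sub>F" using F.nat_pow_distrib[OF lc(2) lc(2)] by simp
  moreover have "\<ominus>\<^bsub>F\<^esub> ?l \<otimes>\<^sub>F \<ominus>\<^bsub>F\<^esub> ?l = add_pow F (16::nat) \<one>\<^sub>F"
   using lc F.add_pow_one_mult[of 4 4] by (simp add: F.l_minus F.r_minus)
  ultimately have "add_pow F ((16::nat) ^ G.ord a) \<one>\<^sub>F = add_pow F (1::nat) \<one>\<^sub>F"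
   by (simp add: F.add_pow_one_power)
  then have "(16::nat) ^ G.ord a = 1" by (rule inj)
  then show False using t(2) by simp
 qed
 moreover obtain s where s: "(s::nat) > 0" "g [^]\<^sub>G s \<bullet> a = a \<bullet> g [^]\<^sub>G s"
  using power_commutes[OF a g] by blast
 ultimately obtain j where j: "(\<one> \<oplus> single ?l a) [^] (s ^ j :: nat) = (\<one> \<oplus> single ?l ?c) [^] (s ^ j)"
  using one_plus_power_invariant[OF a g s(2), of ?l] by auto
 define N where "N = s ^ j"
 have N0: "N > 0" unfolding N_def using s(1) by simp
 \<comment> \<open>The \<open>k\<close>-th term of the coefficient at \<open>a\<close>; both \<open>a\<close> and \<open>c\<close> differ from the neutral element, so \<open>k = 0\<close> never contributes.\<close>
 let ?t = "\<lambda>x k. if x [^]\<^sub>G k = a then (N choose k) * 4 ^ k else (0::nat)"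
 have "((\<one> \<oplus> single ?l a) [^] N) a = ((\<one> \<oplus> single ?l ?c) [^] N) a" using j unfolding N_def by simp
 then have "add_pow F (\<Sum>k\<le>N. ?t a k) \<one>\<^sub>F = add_pow F (\<Sum>k\<le>N. ?t ?c k) \<one>\<^sub>F"
  unfolding one_plus_power_coeff[OF t(1) t(1)] one_plus_power_coeff[OF cc t(1)] .
 then have eq: "(\<Sum>k\<le>N. ?t a k) = (\<Sum>k\<le>N. ?t ?c k)" by (rule inj)
 obtain r where r: "N = 2 ^ multiplicity 2 N * r" "\<not> 2 dvd r"
  using multiplicity_decompose'[of N 2] N0 by auto
 define v where "v = multiplicity 2 N"
 have vN: "2 ^ v dvd N" unfolding v_def by (rule multiplicity_dvd)
 have big: "2 ^ (v + 3) dvd ?t x k" if "k \<ge> 2" for x k using binomial_four_dvd[OF that vN] by simp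
 have small: "2 ^ (v + 3) dvd ?t x k" if "k \<noteq> 1" for x k
 proof (cases "k = 0")
  case True then show ?thesis using a1 by simp
 next
  case False then show ?thesis using big[of k x] that by simp
 qed
 have "?t ?c 1 = 0" using ca cc by simp
 then have "2 ^ (v + 3) dvd ?t ?c k" for k using small[of k ?c] by (cases "k = 1") auto
 then have R: "2 ^ (v + 3) dvd (\<Sum>k\<le>N. ?t ?c k)" by (intro dvd_sum) blast
 have "(\<Sum>k\<le>N. ?t a k) = ?t a 1 + (\<Sum>k\<in>{..N} - {1}. ?t a k)" by (rule sum.remove) (use N0 in auto)
 then have "2 ^ (v + 3) dvd ?t a 1 + (\<Sum>k\<in>{..N} - {1}. ?t a k)" using R unfolding eq[symmetric] by (simp only:)
 moreover have "2 ^ (v + 3) dvd (\<Sum>k\<in>{..N} - {1}. ?t a k)" by (intro dvd_sum small) auto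
 ultimately have "2 ^ (v + 3) dvd ?t a 1" by (rule dvd_add_left_iff[THEN iffD1, rotated])
 moreover have "?t a 1 = 2 ^ v * 4 * r" using t(1) r(1) unfolding v_def[symmetric] by simp
 moreover have "(2::nat) ^ (v + 3) = 2 ^ v * 4 * 2" by (simp add: power_add)
 ultimately have "2 ^ v * 4 * 2 dvd 2 ^ v * 4 * r" by (simp only:)
 then show False using r(2) by simp
qed

end

section \<open>Positive characteristic: scalars fixed by a Frobenius power\<close>

lemma (in monoid) pow_fixed_iterate:
 assumes "x \<in> carrier G" "x [^] (q::nat) = x"
 shows "x [^] (q ^ k) = x"
proof (induction k)
 case (Suc k)
 have "x [^] (q ^ Suc k) = (x [^] (q ^ k)) [^] q" using assms(1) by (simp add: nat_pow_pow mult.commute)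
 then show ?case using Suc assms(2) by simp
qed (use assms in simp)

lemma (in ring) frobenius_iterate:
 assumes p: "Factorial_Ring.prime (p::nat)" and char: "\<And>z. z \<in> carrier R \<Longrightarrow> add_pow R p z = \<zero>"
  and c: "x \<in> carrier R" "y \<in> carrier R" "x \<otimes> y = y \<otimes> x"
 shows "(x \<oplus> y) [^] (p ^ r) = x [^] (p ^ r) \<oplus> y [^] (p ^ r)"
proof (induction r)
 case 0 then show ?case using c by simp
next
 case (Suc r)
 have s: "z [^] (p ^ Suc r) = (z [^] (p ^ r)) [^] p" if "z \<in> carrier R" for z
  using that by (simp add: nat_pow_pow mult.commute)
 have "x [^] (p ^ r) \<otimes> y = y \<otimes> x [^] (p ^ r)" using group_commutes_pow[OF c(3) c(1,2)] .
 then have "y [^] (p ^ r) \<otimes> x [^] (p ^ r) = x [^] (p ^ r) \<otimes> y [^] (p ^ r)"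
  using group_commutes_pow[of y "x [^] (p ^ r)" "p ^ r"] c by simp
 then have cm: "x [^] (p ^ r) \<otimes> y [^] (p ^ r) = y [^] (p ^ r) \<otimes> x [^] (p ^ r)" by (rule sym)
 have "(x [^] (p ^ r) \<oplus> y [^] (p ^ r)) [^] p = (x [^] (p ^ r)) [^] p \<oplus> (y [^] (p ^ r)) [^] p"
  by (rule frobenius_add[OF p char _ _ cm]) (use c in auto)
 then show ?case unfolding s[OF a_closed[OF c(1,2)]] s[OF c(1)] s[OF c(2)] Suc .
qed

lemma dvd_prime_power_minus_one:
 fixes p m :: nat
 assumes "Factorial_Ring.prime p" "coprime p m" "m > 0"
 shows "\<exists>r k. r > 0 \<and> p ^ r = Suc (m * k) \<and> k > 0"
proof -
 have "[p ^ totient m = 1] (mod m)" using euler_theorem[OF assms(2)] .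
 then have d: "m dvd p ^ totient m - 1" using cong_to_1_nat by blast
 have t: "totient m > 0" using assms(3) by simp
 have p2: "p \<ge> 2" using prime_ge_2_nat[OF assms(1)] .
 have "p ^ totient m > 1" using one_less_power[OF _ t, of p] p2 by linarith
 moreover obtain k where k: "p ^ totient m - 1 = m * k" using d by (elim dvdE)
 ultimately have "p ^ totient m = Suc (m * k)" "k > 0" by (linarith, cases k) auto
 then show ?thesis using t by blast
qed

context engel_units
begin

lemma char_prime: "ring_characteristic F = p \<Longrightarrow> p \<noteq> 0 \<Longrightarrow> Factorial_Ring.prime p"
 using F.characteristic_prime by simp

lemma ord_coprime: assumes p: "ring_characteristic F = p" "p \<noteq> 0" and a: "a \<in> tors"
 shows "coprime p (G.ord a)"
proof -
 have "\<not> p dvd G.ord a" using ord_invertible[OF a] F.characteristic_dvd p(1) by blast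
 then show ?thesis using prime_imp_coprime[OF char_prime[OF p]] by blast
qed

lemma cong_ord_pow: "a \<in> tors \<Longrightarrow> G.ord a dvd m \<Longrightarrow> a [^]\<^sub>G Suc m = a"
 using torsD[of a] G.pow_eq_id[of a m] by simp

text \<open>
  The units \<open>1 + l a\<close> and \<open>1 + l c\<close> have equal powers for some exponent prime to
  \<open>p\<close>, so their powers with a suitable exponent \<open>Q - 1\<close> agree, where
  \<open>Q\<close> is a power of \<open>p\<close>. Writing \<open>u\<^sup>Q = u\<^sup>Q\<^sup>-\<^sup>1
  u\<close> and using the Frobenius map gives \<open>(1 + l\<^sup>Q a) (1 + l c) = (1 + l\<^sup>Q c) (1 + l
  a)\<close>, and comparison of the coefficients at \<open>a\<close> gives \<open>l\<^sup>Q = l\<close>. If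
  \<open>1 + l a\<close> is not a unit, \<open>- l\<close> is a root of unity anyway.
\<close>

lemma coefficient_frobenius_fixed:
 assumes p: "ring_characteristic F = p" "odd p" and a: "a \<in> tors" and g: "g \<in> carrier G"
  and c: "g \<bullet> a \<bullet> inv\<^sub>G g \<noteq> a"
  and s: "g [^]\<^sub>G (s::nat) \<bullet> a = a \<bullet> g [^]\<^sub>G s" "coprime p s"
  and l: "l \<in> carrier F"
 shows "\<exists>r. r > 0 \<and> l [^]\<^sub>F (p ^ r) = l"
proof -
 note t = torsD[OF a]
 have p0: "p \<noteq> 0" using p(2) by (cases p) auto
 have pr: "Factorial_Ring.prime p" by (rule char_prime[OF p(1) p0])
 have co: "coprime p (G.ord a)" by (rule ord_coprime[OF p(1) p0 a])
 show ?thesis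
 proof (cases "(\<ominus>\<^bsub>F\<^esub> l) [^]\<^sub>F G.ord a = \<one>\<^sub>F")
  case True
  let ?n = "G.ord a"
  have nl: "\<ominus>\<^bsub>F\<^esub> l \<in> carrier F" using l by simp
  have "l [^]\<^sub>F (2 * ?n) = (l [^]\<^sub>F (2::nat)) [^]\<^sub>F ?n" using l by (simp add: F.nat_pow_pow)
  also have "l [^]\<^sub>F (2::nat) = (\<ominus>\<^bsub>F\<^esub> l) [^]\<^sub>F (2::nat)"
   using l by (simp add: numeral_2_eq_2 F.l_minus F.r_minus)
  also have "((\<ominus>\<^bsub>F\<^esub> l) [^]\<^sub>F (2::nat)) [^]\<^sub>F ?n = ((\<ominus>\<^bsub>F\<^esub> l) [^]\<^sub>F ?n) [^]\<^sub>F (2::nat)"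
   using nl by (simp add: F.nat_pow_pow mult.commute)
  finally have e: "l [^]\<^sub>F (2 * ?n) = \<one>\<^sub>F" unfolding True by simp
  have "coprime p (2 * ?n)" using co p(2) by simp
  then obtain r k where r: "r > 0" "p ^ r = Suc (2 * ?n * k)"
   using dvd_prime_power_minus_one[OF pr, of "2 * ?n"] t(2) by auto
  have "l [^]\<^sub>F (2 * ?n * k) = \<one>\<^sub>F" using e l by (simp flip: F.nat_pow_pow)
  then have "l [^]\<^sub>F (p ^ r) = l" unfolding r(2) using l by simp
  then show ?thesis using r(1) by blast
 next
  case False
  let ?c = "g \<bullet> a \<bullet> inv\<^sub>G g"
  have cc: "?c \<in> cyc a" "?c \<in> carrier G" using torsion_conj[OF a g] g t by auto
  obtain j where j: "(\<one> \<oplus> single l a) [^] (s ^ j :: nat) = (\<one> \<oplus> single l ?c) [^] (s ^ j)"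
   using one_plus_power_invariant[OF a g s(1) l False] by blast
  have s0: "s > 0" using s(2) pr by (cases s) auto
  have "coprime p (s ^ j * G.ord a)" using s(2) co by simp
  then obtain r k where r: "r > 0" "p ^ r = Suc (s ^ j * G.ord a * k)"
   using dvd_prime_power_minus_one[OF pr, of "s ^ j * G.ord a"] s0 t(2) by auto
  let ?n = "s ^ j * G.ord a * k"
  obtain U W where U: "U = \<one> \<oplus> single l a" "U \<in> carrier A" and W: "W = \<one> \<oplus> single l ?c" "W \<in> carrier A"
   using l t cc by simp
  have "U [^] (s ^ j * (G.ord a * k)) = W [^] (s ^ j * (G.ord a * k))"
   using j unfolding U(1)[symmetric] W(1)[symmetric] using U(2) W(2) by (simp flip: A.nat_pow_pow)
  then have n: "U [^] ?n = W [^] ?n" by (simp only: mult.assoc)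
  have aQ: "a [^]\<^sub>G (p ^ r) = a" unfolding r(2) by (rule cong_ord_pow[OF a]) simp
  have cQ: "?c [^]\<^sub>G (p ^ r) = ?c" using conj_pow[OF g t(1), of "p ^ r"] aQ by simp
  let ?L = "l [^]\<^sub>F (p ^ r)"
  have chA: "add_pow A p z = \<zero>" if "z \<in> carrier A" for z using characteristic_add_pow[OF p(1) that] .
  have fr: "(\<one> \<oplus> single l x) [^] (p ^ r) = \<one> \<oplus> single ?L x" if x: "x \<in> carrier G" "x [^]\<^sub>G (p ^ r) = x" for x
   using A.frobenius_iterate[OF pr chA, of \<one> "single l x" r] l x by (simp add: single_pow)
  have UQ: "U [^] (p ^ r) = \<one> \<oplus> single ?L a" unfolding U(1) by (rule fr[OF t(1) aQ])
  have WQ: "W [^] (p ^ r) = \<one> \<oplus> single ?L ?c" unfolding W(1) by (rule fr[OF cc(2) cQ])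
  have one: "\<one> \<in> FS (cyc a)" using FS_one[OF subgroup.one_closed[OF cyc_subgroup[OF a]]] .
  have "U \<in> FS (cyc a)" "W \<in> FS (cyc a)" unfolding U(1) W(1)
   using FS_add[OF one FS_single[OF l cyc_self[OF a]]] FS_add[OF one FS_single[OF l cc(1)]] by auto
  then have UW: "U \<otimes> W = W \<otimes> U" by (rule FC_commute[OF a])
  have "U [^] (p ^ r) \<otimes> W = U [^] ?n \<otimes> (U \<otimes> W)" unfolding r(2) using U(2) W(2) by (simp add: A.m_assoc)
  also have "\<dots> = W [^] ?n \<otimes> (W \<otimes> U)" unfolding n UW ..
  also have "\<dots> = W [^] (p ^ r) \<otimes> U" unfolding r(2) using U(2) W(2) by (simp add: A.m_assoc)
  finally have eq: "(\<one> \<oplus> single ?L a) \<otimes> (\<one> \<oplus> single l ?c) = (\<one> \<oplus> single ?L ?c) \<otimes> (\<one> \<oplus> single l a)"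
   unfolding UQ WQ unfolding U(1) W(1) .
  have Lc: "?L \<in> carrier F" using l by simp
  obtain b where b: "b = ?c" "b \<in> carrier G" "b \<noteq> a" using cc c by blast
  have ab: "a \<bullet> b = b \<bullet> a" unfolding b by (rule cyc_commute[OF a cyc_self[OF a] cc(1)])
  have x1: "(\<one> \<oplus> single ?L x) \<otimes> (\<one> \<oplus> single l y) = (single l y \<oplus> single ?L x) \<oplus> (\<one> \<oplus> single (?L \<otimes>\<^sub>F l) (x \<bullet> y))"
   if "x \<in> carrier G" "y \<in> carrier G" for x y
   using that l Lc by (simp add: A.l_distr A.r_distr single_mult_single A.a_ac)
  have "(single l b \<oplus> single ?L a) \<oplus> (\<one> \<oplus> single (?L \<otimes>\<^sub>F l) (a \<bullet> b)) = (single l a \<oplus> single ?L b) \<oplus> (\<one> \<oplus> single (?L \<otimes>\<^sub>F l) (a \<bullet> b))"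
   using eq unfolding b(1)[symmetric] x1[OF t(1) b(2)] x1[OF b(2) t(1)] ab[symmetric] .
  then have "single l b \<oplus> single ?L a = single l a \<oplus> single ?L b"
   by (rule A.add.right_cancel[THEN iffD1, rotated 3]) (use l Lc t b in simp_all)
  then have "(single l b \<oplus> single ?L a) a = (single l a \<oplus> single ?L b) a" by simp
  then have "?L = l" using t b(2,3) l Lc by (simp add: single_apply)
  then show ?thesis using r(1) by blast
 qed
qed

end

section \<open>Positive characteristic: reduction to a finite field\<close>

context engel_units
begin

text \<open>
  The additive group generated by the products of powers of \<open>l\<close> and powers of \<open>a\<close>.
  It is finite, as these products are finitely many and of additive order \<open>p\<close>, and every element
  is fixed by a suitable power of the Frobenius map because the generators are.
\<close>

lemma finite_frobenius_subring:
 assumes p: "ring_characteristic F = p" "p \<noteq> 0" and a: "a \<in> tors"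
  and l: "l \<in> carrier F" "l [^]\<^sub>F (p ^ r) = l" "r > 0"
 shows "\<exists>R Q. finite R \<and> R \<subseteq> FS (cyc a) \<and> subring R A \<and> Q \<ge> 2 \<and> (\<forall>x \<in> R. x [^] (Q::nat) = x) \<and>
  (\<forall>x \<in> cyc a. single l x \<in> R \<and> \<delta> x \<in> R) \<and> (\<forall>g \<in> carrier G. \<forall>x \<in> R. cj g x \<in> R)"
proof -
 note t = torsD[OF a] and sub = cyc_subgroup[OF a]
 have pr: "Factorial_Ring.prime p" by (rule char_prime[OF p])
 have chA: "add_pow A p z = \<zero>" if "z \<in> carrier A" for z using characteristic_add_pow[OF p(1) that] .
 obtain r' k where r': "r' > 0" "p ^ r' = Suc (G.ord a * k)"
  using dvd_prime_power_minus_one[OF pr ord_coprime[OF p a] t(2)] by auto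
 \<comment> \<open>A common Frobenius power fixing \<open>l\<close> and all powers of \<open>a\<close>.\<close>
 define Q where "Q = p ^ (r * r')"
 have Q1: "Q = (p ^ r) ^ r'" "Q = (p ^ r') ^ r" unfolding Q_def by (simp_all add: power_mult[symmetric] mult.commute)
 have Q2: "Q \<ge> 2"
  using one_less_power[of p "r * r'"] prime_ge_2_nat[OF pr] l(3) r'(1) unfolding Q_def by simp
 have lQ: "l [^]\<^sub>F Q = l" unfolding Q1(1) by (rule F.pow_fixed_iterate[OF l(1,2)])
 have aQ: "x [^]\<^sub>G Q = x" if x: "x \<in> cyc a" for x
 proof -
  obtain j :: nat where j: "x = a [^]\<^sub>G j" using x cyc_powers[OF a] by auto
  have "a [^]\<^sub>G (p ^ r') = a" unfolding r'(2) by (rule cong_ord_pow[OF a]) simp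
  then have "a [^]\<^sub>G Q = a" unfolding Q1(2) by (rule G.pow_fixed_iterate[OF t(1)])
  moreover have "x [^]\<^sub>G Q = (a [^]\<^sub>G Q) [^]\<^sub>G j" unfolding j using t(1) by (simp add: G.nat_pow_pow mult.commute)
  ultimately show ?thesis using j by simp
 qed
 define L where "L = range (\<lambda>i::nat. l [^]\<^sub>F i)"
 have Lc: "y \<in> carrier F" if "y \<in> L" for y using that l(1) unfolding L_def by auto
 have Lm: "y \<otimes>\<^sub>F z \<in> L" if "y \<in> L" "z \<in> L" for y z
  using that l(1) unfolding L_def by (auto simp: F.nat_pow_mult)
 have L1: "l \<in> L" "\<one>\<^sub>F \<in> L" unfolding L_def using l(1) by (auto intro: image_eqI[of _ _ 1] image_eqI[of _ _ 0])
 have LQ: "y [^]\<^sub>F Q = y" if "y \<in> L" for y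
 proof -
  obtain i :: nat where i: "y = l [^]\<^sub>F i" using \<open>y \<in> L\<close> unfolding L_def by blast
  have "y [^]\<^sub>F Q = (l [^]\<^sub>F Q) [^]\<^sub>F i" unfolding i using l(1) by (simp add: F.nat_pow_pow mult.commute)
  then show ?thesis using lQ i by simp
 qed
 have "l [^]\<^sub>F i \<in> (\<lambda>i::nat. l [^]\<^sub>F i) ` {..<Q}" for i :: nat
 proof (induction i rule: less_induct)
  case (less i)
  show ?case
  proof (cases "i < Q")
   case False
   then have "l [^]\<^sub>F i = l [^]\<^sub>F (i - Q) \<otimes>\<^sub>F l [^]\<^sub>F Q" using l(1) by (simp add: F.nat_pow_mult)
   then have "l [^]\<^sub>F i = l [^]\<^sub>F Suc (i - Q)" unfolding lQ by simp
   moreover have "Suc (i - Q) < i" using False Q2 by linarith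
   ultimately show ?thesis using less[of "Suc (i - Q)"] by (simp only:)
  qed blast
 qed
 then have "L \<subseteq> (\<lambda>i::nat. l [^]\<^sub>F i) ` {..<Q}" unfolding L_def by blast
 then have Lf: "finite L" by (rule finite_subset) simp
 define T where "T = (\<lambda>(y, x). single y x) ` (L \<times> cyc a)"
 have Tf: "finite T" unfolding T_def using Lf cyc_finite[OF a] by simp
 have Ti: "single y x \<in> T" if "y \<in> L" "x \<in> cyc a" for x y using that unfolding T_def by force
 have Te: "\<exists>y x. h = single y x \<and> y \<in> L \<and> x \<in> cyc a \<and> y \<in> carrier F \<and> x \<in> carrier G" if "h \<in> T" for h
  using that Lc cyc_carrier[OF a] unfolding T_def by auto
 have TF: "T \<subseteq> FS (cyc a)" using Te FS_single by blast
 define R where "R = generate (add_monoid A) T"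
 have Tc: "T \<subseteq> carrier A" using TF FS_carrier by auto
 have Rz: "\<zero> \<in> R" unfolding R_def using generate.one[of "add_monoid A" T] by simp
 have Rt: "h \<in> T \<Longrightarrow> h \<in> R" for h unfolding R_def by (rule generate.incl)
 have Ra: "x \<oplus> y \<in> R" if "x \<in> R" "y \<in> R" for x y
  using generate.eng[of x "add_monoid A" T y] that unfolding R_def by simp
 have Rm: "\<ominus> x \<in> R" if "x \<in> R" for x
  using A.add.generate_m_inv_closed[OF Tc, of x] that unfolding R_def by simp
 have ind: "P x" if x: "x \<in> R" and P: "P \<zero>" "\<And>h. h \<in> T \<Longrightarrow> P h" "\<And>h. h \<in> T \<Longrightarrow> P (\<ominus> h)"
  "\<And>x y. \<lbrakk>x \<in> R; y \<in> R; P x; P y\<rbrakk> \<Longrightarrow> P (x \<oplus> y)" for P x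
  using x unfolding R_def
 proof (induction rule: generate.induct)
  case one then show ?case using P(1) by simp
 next
  case (inv h) then show ?case using P(3)[OF inv] by (simp add: a_inv_def)
 next
  case (eng x y) then show ?case using P(4)[of x y] unfolding R_def by simp
 qed (rule P(2))
 have RF: "x \<in> FS (cyc a)" if "x \<in> R" for x
  by (rule ind[OF that]) (use TF FS_zero FS_minus FS_add in blast)+
 have Rc: "x \<in> carrier A" if "x \<in> R" for x using FS_carrier[OF RF[OF that]] .
 have Rcom: "x \<otimes> y = y \<otimes> x" if "x \<in> R" "y \<in> R" for x y by (rule FC_commute[OF a RF[OF that(1)] RF[OF that(2)]])
 have Rfin: "finite R"
 proof -
  have D: "subgroup (carrier A) (add_monoid A)" using A.add.subgroup_self by simp
  have "\<exists>B. subgroup B (add_monoid A) \<and> finite B \<and> T \<subseteq> B \<and> B \<subseteq> carrier A"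
  proof (rule A.add.finite_abelian_torsion_hull[OF D])
   fix x assume "x \<in> carrier A"
   then show "\<exists>n>0. add_pow A (n::nat) x = \<zero>"
    using chA[of x] p(2) by (intro exI[of _ p]) simp
  next
   show "finite T" by (rule Tf)
   show "T \<subseteq> carrier A" by (rule Tc)
   show "\<And>x y. x \<in> carrier A \<Longrightarrow> y \<in> carrier A \<Longrightarrow> x \<oplus> y = y \<oplus> x" by (rule A.a_comm)
  qed
  then obtain B where B: "subgroup B (add_monoid A)" "finite B" "T \<subseteq> B" by (elim exE conjE)
  have "R \<subseteq> B" unfolding R_def by (rule A.add.generate_subgroup_incl[OF B(3,1)])
  then show ?thesis using B(2) finite_subset by blast
 qed
 have zQ: "\<zero> [^] Q = \<zero>" using A.nat_pow_zero[of Q] Q2 by simp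
 have fQ: "(x \<oplus> y) [^] Q = x [^] Q \<oplus> y [^] Q" if "x \<in> FS (cyc a)" "y \<in> FS (cyc a)" for x y
  unfolding Q_def by (rule A.frobenius_iterate[OF pr chA FS_carrier[OF that(1)] FS_carrier[OF that(2)] FC_commute[OF a that]])
 have TQ: "h [^] Q = h" if "h \<in> T" for h
  using Te[OF that] single_pow LQ aQ by metis
 have RQ: "x [^] Q = x" if "x \<in> R" for x
 proof (rule ind[of x "\<lambda>x. x [^] Q = x", OF that zQ TQ])
  fix h assume h: "h \<in> T"
  have hF: "h \<in> FS (cyc a)" "h \<in> carrier A" using TF h FS_carrier by auto
  have "h [^] Q \<oplus> (\<ominus> h) [^] Q = \<zero>" using fQ[OF hF(1) FS_minus[OF hF(1)]] zQ A.r_neg[OF hF(2)] by simp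
  then have "h \<oplus> (\<ominus> h) [^] Q = \<zero>" unfolding TQ[OF h] .
  then show "(\<ominus> h) [^] Q = \<ominus> h" using hF(2) by (metis A.minus_equality A.a_comm A.a_inv_closed A.nat_pow_closed)
 next
  fix x y assume xy: "x \<in> R" "y \<in> R" "x [^] Q = x" "y [^] Q = y"
  then show "(x \<oplus> y) [^] Q = x \<oplus> y" using fQ[OF RF[OF xy(1)] RF[OF xy(2)]] by simp
 qed
 have Tm: "h \<otimes> k \<in> T" if hk: "h \<in> T" "k \<in> T" for h k
 proof -
  obtain y x z w where e: "h = single y x" "y \<in> L" "x \<in> cyc a" "y \<in> carrier F" "x \<in> carrier G"
   "k = single z w" "z \<in> L" "w \<in> cyc a" "z \<in> carrier F" "w \<in> carrier G" using Te[OF hk(1)] Te[OF hk(2)] by blast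
  then have "h \<otimes> k = single (y \<otimes>\<^sub>F z) (x \<bullet> w)" by (simp add: single_mult_single)
  then show ?thesis using Ti[OF Lm[OF e(2,7)] subgroup.m_closed[OF sub e(3,8)]] by simp
 qed
 have Tcc: "h \<in> carrier A" if "h \<in> T" for h using Rc[OF Rt[OF that]] .
 have TR: "h \<otimes> x \<in> R" if h: "h \<in> T" and x: "x \<in> R" for h x
 proof (rule ind[OF x])
  show "h \<otimes> \<zero> \<in> R" using Tcc[OF h] Rz by simp
  show "\<And>k. k \<in> T \<Longrightarrow> h \<otimes> k \<in> R" using Rt Tm[OF h] by blast
  show "h \<otimes> \<ominus> k \<in> R" if "k \<in> T" for k
   using Rm[OF Rt[OF Tm[OF h that]]] Tcc[OF h] Tcc[OF that] by (simp add: A.r_minus)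
  show "h \<otimes> (x \<oplus> y) \<in> R" if "x \<in> R" "y \<in> R" "h \<otimes> x \<in> R" "h \<otimes> y \<in> R" for x y
   unfolding A.r_distr[OF Rc[OF that(1)] Rc[OF that(2)] Tcc[OF h]] by (rule Ra[OF that(3,4)])
 qed
 have RR: "x \<otimes> y \<in> R" if x: "x \<in> R" and y: "y \<in> R" for x y
 proof (rule ind[OF x])
  show "\<zero> \<otimes> y \<in> R" using Rc[OF y] Rz by simp
  show "\<And>k. k \<in> T \<Longrightarrow> k \<otimes> y \<in> R" using TR y by blast
  show "(\<ominus> k) \<otimes> y \<in> R" if "k \<in> T" for k
   using Rm[OF TR[OF that y]] Rc[OF y] Tcc[OF that] by (simp add: A.l_minus)
  show "(x \<oplus> z) \<otimes> y \<in> R" if "x \<in> R" "z \<in> R" "x \<otimes> y \<in> R" "z \<otimes> y \<in> R" for x z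
   unfolding A.l_distr[OF Rc[OF that(1)] Rc[OF that(2)] Rc[OF y]] by (rule Ra[OF that(3,4)])
 qed
 have Rcj: "cj g x \<in> R" if g: "g \<in> carrier G" and x: "x \<in> R" for g x
 proof (rule ind[OF x])
  show "cj g \<zero> \<in> R" using g Rz by (simp add: cj_def)
  have cT: "cj g h \<in> T" if h: "h \<in> T" for h
  proof -
   obtain y x where e: "h = single y x" "y \<in> L" "x \<in> cyc a" "y \<in> carrier F" "x \<in> carrier G" using Te[OF h] by blast
   show ?thesis unfolding e(1) cj_single[OF g e(5,4)] by (rule Ti[OF e(2) cyc_conj[OF a g e(3)]])
  qed
  then show "cj g h \<in> R" if "h \<in> T" for h using Rt that by blast
  show "cj g (\<ominus> h) \<in> R" if h: "h \<in> T" for h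
  proof -
   have "cj g (\<ominus> h) = \<ominus> cj g h" using g Tcc[OF h] by (simp add: cj_def A.l_minus A.r_minus)
   then show ?thesis using Rm[OF Rt[OF cT[OF h]]] by simp
  qed
  show "cj g (x \<oplus> y) \<in> R" if "x \<in> R" "y \<in> R" "cj g x \<in> R" "cj g y \<in> R" for x y
   unfolding cj_add[OF g Rc[OF that(1)] Rc[OF that(2)]] by (rule Ra[OF that(3,4)])
 qed
 have R1: "\<one> \<in> R" unfolding one_single using Rt[OF Ti[OF L1(2) subgroup.one_closed[OF sub]]] .
 have "subring R A" by (rule A.subringI) (use Rc R1 Rm RR Ra in auto)
 moreover have "single l x \<in> R" "\<delta> x \<in> R" if "x \<in> cyc a" for x using Rt Ti[OF L1(1) that] Ti[OF L1(2) that] by auto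
 ultimately show ?thesis using Rfin RF Q2 RQ Rcj
  by (intro exI[of _ R] exI[of _ Q]) (simp add: subset_eq)
qed

text \<open>
  Cut the finite ring of the preceding lemma down to a field by an idempotent \<open>e\<close> that is a
  multiple of \<open>N\<close>. The first factor of \<open>N\<close> guarantees that \<open>g\<close> moves
  \<open>a e\<close>, the second is free to detect a further group element \<open>d\<close>. Idempotents are
  invariant, so conjugation by \<open>g\<close> is an automorphism of this field, and the Engel condition
  makes it unipotent on the multiplicative group, which is embedded in the unit group by \<open>x \<mapsto> x
  + (1 - e)\<close>.
\<close>

theorem moved_component:
 assumes p: "ring_characteristic F = p" "p \<noteq> 0" and a: "a \<in> tors" and g: "g \<in> carrier G"
  and c: "c = g \<bullet> a \<bullet> inv\<^sub>G g"
  and l: "l \<in> carrier F" "l [^]\<^sub>F (p ^ r) = l" "r > 0"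
  and d: "d \<in> cyc a"
  and N: "N = (\<delta> (c \<bullet> inv\<^sub>G a) \<ominus> \<one>) \<otimes> (\<delta> d \<ominus> \<one>)" "N \<noteq> \<zero>"
 shows "\<exists>e \<in> FS (cyc a). e \<noteq> \<zero> \<and> e \<otimes> e = e \<and> (\<exists>y \<in> FS (cyc a). e = N \<otimes> y) \<and> (\<exists>t. p + 1 = 2 ^ t) \<and>
  \<delta> (a [^]\<^sub>G (p * p)) \<otimes> e = \<delta> a \<otimes> e \<and> \<delta> c \<otimes> e = \<delta> (a [^]\<^sub>G p) \<otimes> e \<and>
  (\<exists>k::nat. single l \<one>\<^sub>G \<otimes> e = add_pow A k e)"
proof -
 note t = torsD[OF a] and sub = cyc_subgroup[OF a]
 have pr: "Factorial_Ring.prime p" by (rule char_prime[OF p])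
 obtain R Q where R: "finite R" "R \<subseteq> FS (cyc a)" "subring R A" and Q: "Q \<ge> 2" "\<forall>x \<in> R. x [^] (Q::nat) = x"
  and Rs: "\<forall>x \<in> cyc a. single l x \<in> R \<and> \<delta> x \<in> R" and Rcj: "\<forall>g \<in> carrier G. \<forall>x \<in> R. cj g x \<in> R"
  using finite_frobenius_subring[OF p a l] by (elim exE conjE) blast
 have RF: "x \<in> FS (cyc a)" if "x \<in> R" for x using R(2) that by blast
 have Rc: "x \<in> carrier A" if "x \<in> R" for x using FS_carrier[OF RF[OF that]] .
 have com: "x \<otimes> y = y \<otimes> x" if "x \<in> R" "y \<in> R" for x y by (rule FC_commute[OF a RF[OF that(1)] RF[OF that(2)]])
 note Rops = subringE(2-7)[OF R(3)]
 have Ra: "x \<oplus> y \<in> R" and Rm: "x \<otimes> y \<in> R" if "x \<in> R" "y \<in> R" for x y using subringE(6,7)[OF R(3)] that by auto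
 have Rn: "\<ominus> x \<in> R" if "x \<in> R" for x using subringE(5)[OF R(3)] that by auto
 have R1: "\<one> \<in> R" "\<zero> \<in> R" using subringE(2,3)[OF R(3)] by auto
 have Rmi: "x \<ominus> y \<in> R" if "x \<in> R" "y \<in> R" for x y unfolding A.minus_eq using Ra Rn that by blast
 let ?S = "A\<lparr>carrier := R\<rparr>"
 interpret S: ring ?S by (rule A.subring_is_ring[OF R(3)])
 have crS: "cring ?S"
 proof (rule cringI[OF S.is_abelian_group])
  show "comm_monoid ?S"
  proof (rule comm_monoidI)
   show "\<And>x y z. x \<in> carrier ?S \<Longrightarrow> y \<in> carrier ?S \<Longrightarrow> z \<in> carrier ?S \<Longrightarrow>
    x \<otimes>\<^bsub>?S\<^esub> y \<otimes>\<^bsub>?S\<^esub> z = x \<otimes>\<^bsub>?S\<^esub> (y \<otimes>\<^bsub>?S\<^esub> z)" using A.m_assoc Rc by simp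
   show "\<And>x y. x \<in> carrier ?S \<Longrightarrow> y \<in> carrier ?S \<Longrightarrow> x \<otimes>\<^bsub>?S\<^esub> y = y \<otimes>\<^bsub>?S\<^esub> x" using com by simp
  qed (use Rm R1 Rc in auto)
  show "\<And>x y z. x \<in> carrier ?S \<Longrightarrow> y \<in> carrier ?S \<Longrightarrow> z \<in> carrier ?S \<Longrightarrow>
   (x \<oplus>\<^bsub>?S\<^esub> y) \<otimes>\<^bsub>?S\<^esub> z = x \<otimes>\<^bsub>?S\<^esub> z \<oplus>\<^bsub>?S\<^esub> y \<otimes>\<^bsub>?S\<^esub> z" using A.l_distr Rc by simp
 qed
 have cC: "c \<in> cyc a" "c \<in> carrier G" unfolding c using torsion_conj[OF a g] g t by auto
 have ia: "inv\<^sub>G a \<in> cyc a" by (rule subgroup.m_inv_closed[OF sub cyc_self[OF a]])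
 have yC: "c \<bullet> inv\<^sub>G a \<in> cyc a" by (rule subgroup.m_closed[OF sub cC(1) ia])
 let ?Y = "\<delta> (c \<bullet> inv\<^sub>G a) \<ominus> \<one>" and ?D = "\<delta> d \<ominus> \<one>"
 have YR: "?Y \<in> R" "?D \<in> R" using Rs yC d R1 Rmi by auto
 have NR: "N \<in> R" unfolding N(1) using Rm YR by blast
 obtain e where e: "e \<in> R" "e \<noteq> \<zero>" "e \<otimes> e = e" "\<exists>y \<in> R. e = N \<otimes> y"
  "\<forall>x \<in> R. x \<otimes> e \<noteq> \<zero> \<longrightarrow> (\<exists>y \<in> R. x \<otimes> y \<otimes> e = e)"
  using cring.field_component[OF crS _ Q(1) _ _, of N] R(1) Q(2) NR N(2)
  by (auto simp: A.nat_pow_consistent[symmetric])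
 have ec: "e \<in> carrier A" using Rc[OF e(1)] .
 have ge: "cj g e = e" by (rule idempotent_invariant[OF a g RF[OF e(1)] e(3)])
 define KC where "KC = {x \<in> R. x \<otimes> e = x}"
 have KI: "x \<in> KC" if "x \<in> R" "x \<otimes> e = x" for x unfolding KC_def using that by simp
 have KR: "x \<in> R" and Ke: "x \<otimes> e = x" and Kc: "x \<in> carrier A" if "x \<in> KC" for x using that Rc unfolding KC_def by auto
 have RK: "x \<otimes> e \<in> KC" if "x \<in> R" for x
  by (rule KI[OF Rm[OF that e(1)]]) (use Rc[OF that] ec e(3) in \<open>simp add: A.m_assoc\<close>)
 have eK: "e \<in> KC" by (rule KI[OF e(1,3)])
 have zK: "\<zero> \<in> KC" by (rule KI[OF R1(2)]) (use ec in simp)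
 have aK: "x \<oplus> y \<in> KC" if "x \<in> KC" "y \<in> KC" for x y
  by (rule KI[OF Ra[OF KR KR]]) (use that Kc Ke ec in \<open>simp_all add: A.l_distr\<close>)
 have nK: "\<ominus> x \<in> KC" if "x \<in> KC" for x
  by (rule KI[OF Rn[OF KR]]) (use that Kc Ke ec in \<open>simp_all add: A.l_minus\<close>)
 have mK: "x \<otimes> y \<in> KC" if "x \<in> KC" "y \<in> KC" for x y
  by (rule KI[OF Rm[OF KR KR]]) (use that Kc Ke ec in \<open>simp_all add: A.m_assoc\<close>)
 have Kcom: "x \<otimes> y = y \<otimes> x" if "x \<in> KC" "y \<in> KC" for x y by (rule com[OF KR[OF that(1)] KR[OF that(2)]])
 have eKl: "e \<otimes> x = x" if "x \<in> KC" for x using Kcom[OF eK that] Ke[OF that] by simp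
 have Kfin: "finite KC" using R(1) KR finite_subset[of KC R] by blast
 define K where "K = A\<lparr>carrier := KC, one := e\<rparr>"
 have K[simp]: "carrier K = KC" "x \<otimes>\<^bsub>K\<^esub> y = x \<otimes> y" "x \<oplus>\<^bsub>K\<^esub> y = x \<oplus> y" "\<one>\<^bsub>K\<^esub> = e" "\<zero>\<^bsub>K\<^esub> = \<zero>" for x y
  unfolding K_def by simp_all
 have crK: "cring K"
 proof (rule cringI)
  show "abelian_group K"
  proof (rule abelian_groupI)
   fix x assume x: "x \<in> carrier K"
   show "\<exists>y \<in> carrier K. y \<oplus>\<^bsub>K\<^esub> x = \<zero>\<^bsub>K\<^esub>"
    by (rule bexI[of _ "\<ominus> x"]) (use x nK Kc A.l_neg in simp_all)
   show "\<And>y z. y \<in> carrier K \<Longrightarrow> z \<in> carrier K \<Longrightarrow>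
    x \<oplus>\<^bsub>K\<^esub> y \<oplus>\<^bsub>K\<^esub> z = x \<oplus>\<^bsub>K\<^esub> (y \<oplus>\<^bsub>K\<^esub> z)" using A.a_assoc Kc x by simp
   show "\<And>y. y \<in> carrier K \<Longrightarrow> x \<oplus>\<^bsub>K\<^esub> y = y \<oplus>\<^bsub>K\<^esub> x" using A.a_comm Kc x by simp
  qed (use aK zK Kc in auto)
  show "comm_monoid K"
  proof (rule comm_monoidI)
   show "\<And>x y z. x \<in> carrier K \<Longrightarrow> y \<in> carrier K \<Longrightarrow> z \<in> carrier K \<Longrightarrow>
    x \<otimes>\<^bsub>K\<^esub> y \<otimes>\<^bsub>K\<^esub> z = x \<otimes>\<^bsub>K\<^esub> (y \<otimes>\<^bsub>K\<^esub> z)" using A.m_assoc Kc by simp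
   show "\<And>x y. x \<in> carrier K \<Longrightarrow> y \<in> carrier K \<Longrightarrow> x \<otimes>\<^bsub>K\<^esub> y = y \<otimes>\<^bsub>K\<^esub> x" using Kcom by simp
  qed (use mK eK eKl in auto)
  show "\<And>x y z. x \<in> carrier K \<Longrightarrow> y \<in> carrier K \<Longrightarrow> z \<in> carrier K \<Longrightarrow>
   (x \<oplus>\<^bsub>K\<^esub> y) \<otimes>\<^bsub>K\<^esub> z = x \<otimes>\<^bsub>K\<^esub> z \<oplus>\<^bsub>K\<^esub> y \<otimes>\<^bsub>K\<^esub> z" using A.l_distr Kc by simp
 qed
 have "field K"
 proof (rule cring.cring_fieldI2[OF crK])
  show "\<zero>\<^bsub>K\<^esub> \<noteq> \<one>\<^bsub>K\<^esub>" using e(2) by simp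
  fix x assume x: "x \<in> carrier K" "x \<noteq> \<zero>\<^bsub>K\<^esub>"
  then have xK: "x \<in> KC" by simp
  obtain y where y: "y \<in> R" "x \<otimes> y \<otimes> e = e" using e(5) x(2) KR[OF xK] Ke[OF xK] by auto
  have "x \<otimes> (y \<otimes> e) = e" using y Kc[OF xK] Rc ec by (simp add: A.m_assoc)
  then show "\<exists>y \<in> carrier K. x \<otimes>\<^bsub>K\<^esub> y = \<one>\<^bsub>K\<^esub>" using RK[OF y(1)] by auto
 qed
 then interpret K: field K .
 have Kadd: "add_pow K k x = add_pow A k x" for k :: nat and x
  by (induction k) (simp_all add: add_pow_def)
 have Kpow: "(x \<otimes> e) [^]\<^bsub>K\<^esub> k = x [^] k \<otimes> e" if x: "x \<in> R" for x and k :: nat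
 proof (induction k)
  case 0 show ?case using ec by simp
 next
  case (Suc k)
  have k: "x [^] k \<in> carrier A" using Rc[OF x] by simp
  have "(x \<otimes> e) [^]\<^bsub>K\<^esub> Suc k = x [^] k \<otimes> (e \<otimes> x) \<otimes> e" using Suc k Rc[OF x] ec by (simp add: A.m_assoc)
  also have "\<dots> = x [^] Suc k \<otimes> e" unfolding com[OF e(1) x] using k Rc[OF x] ec e(3) by (simp add: A.m_assoc)
  finally show ?case .
 qed
 let ?s = "cj g"
 have sK: "?s x \<in> KC" if "x \<in> KC" for x
 proof (rule KI)
  show "?s x \<in> R" using Rcj g KR[OF that] by blast
  show "?s x \<otimes> e = ?s x" using cj_mult[OF g Kc[OF that] ec] unfolding Ke[OF that] ge by simp
 qed
 have sh: "?s \<in> ring_hom K K"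
  by (rule ring_hom_memI) (use sK cj_mult[OF g] cj_add[OF g] Kc ge in auto)
 let ?f = "\<one> \<ominus> e"
 have f: "?f \<in> carrier A" "?f \<otimes> ?f = ?f" "e \<otimes> ?f = \<zero>" "?f \<otimes> e = \<zero>"
  using ec e(3) by (simp_all add: A.minus_eq A.l_distr A.r_distr A.l_minus A.r_minus A.r_neg A.l_neg A.minus_add A.a_ac)
 have ef: "e \<oplus> ?f = \<one>" using ec by algebra
 have fR: "?f \<in> R" using Rmi R1 e(1) by blast
 have gf: "?s ?f = ?f" by (rule idempotent_invariant[OF a g RF[OF fR] f(2)])
 \<comment> \<open>The embedding of the units of the field into those of the whole algebra.\<close>
 define \<phi> where "\<phi> x = x \<oplus> ?f" for x
 have \<phi>e: "\<phi> e = \<one>" unfolding \<phi>_def by (rule ef)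
 have xf: "x \<otimes> ?f = \<zero>" "?f \<otimes> x = \<zero>" if "x \<in> KC" for x
 proof -
  have "x \<otimes> ?f = x \<otimes> (e \<otimes> ?f)" using Ke[OF that] Kc[OF that] ec f(1) by (metis A.m_assoc)
  then show "x \<otimes> ?f = \<zero>" unfolding f(3) using Kc[OF that] by simp
  then show "?f \<otimes> x = \<zero>" using com[OF fR KR[OF that]] by simp
 qed
 have \<phi>c: "\<phi> x \<in> carrier A" if "x \<in> KC" for x unfolding \<phi>_def using Kc[OF that] f(1) by simp
 have \<phi>m: "\<phi> x \<otimes> \<phi> y = \<phi> (x \<otimes> y)" if "x \<in> KC" "y \<in> KC" for x y
  unfolding \<phi>_def using Kc[OF that(1)] Kc[OF that(2)] f(1,2) xf[OF that(1)] xf[OF that(2)]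
  by (simp add: A.l_distr A.r_distr)
 have inK: "inv\<^bsub>K\<^esub> x \<in> KC" "x \<otimes> inv\<^bsub>K\<^esub> x = e" "inv\<^bsub>K\<^esub> x \<noteq> \<zero>" if "x \<in> KC" "x \<noteq> \<zero>" for x
 proof -
  have u: "x \<in> Units K" using that by (simp add: K.field_Units)
  show i: "inv\<^bsub>K\<^esub> x \<in> KC" using K.Units_inv_closed[OF u] by simp
  show m: "x \<otimes> inv\<^bsub>K\<^esub> x = e" using K.Units_r_inv[OF u] by simp
  show "inv\<^bsub>K\<^esub> x \<noteq> \<zero>" using m e(2) Kc[OF that(1)] by auto
 qed
 have \<phi>U: "\<phi> x \<in> Units A" "inv (\<phi> x) = \<phi> (inv\<^bsub>K\<^esub> x)" if x: "x \<in> KC" "x \<noteq> \<zero>" for x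
 proof -
  have 1: "\<phi> x \<otimes> \<phi> (inv\<^bsub>K\<^esub> x) = \<one>" using \<phi>m[OF x(1) inK(1)[OF x]] inK(2)[OF x] \<phi>e by simp
  have 2: "\<phi> (inv\<^bsub>K\<^esub> x) \<otimes> \<phi> x = \<one>"
   using \<phi>m[OF inK(1)[OF x] x(1)] inK(2)[OF x] Kcom[OF x(1) inK(1)[OF x]] \<phi>e by simp
  show "\<phi> x \<in> Units A" unfolding Units_def using 1 2 \<phi>c[OF x(1)] \<phi>c[OF inK(1)[OF x]] by blast
  show "inv (\<phi> x) = \<phi> (inv\<^bsub>K\<^esub> x)" by (rule A.inv_char[OF \<phi>c[OF x(1)] \<phi>c[OF inK(1)[OF x]] 1 2])
 qed
 have s\<phi>: "?s (\<phi> x) = \<phi> (?s x)" if "x \<in> KC" for x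
  unfolding \<phi>_def using cj_add[OF g Kc[OF that] f(1)] gf by simp
 have s0: "?s x \<noteq> \<zero>" if x: "x \<in> KC" "x \<noteq> \<zero>" for x
 proof
  assume z: "?s x = \<zero>"
  have "?s (x \<otimes> inv\<^bsub>K\<^esub> x) = \<zero> \<otimes> ?s (inv\<^bsub>K\<^esub> x)" unfolding cj_mult[OF g Kc[OF x(1)] Kc[OF inK(1)[OF x]]] z ..
  then have "?s e = \<zero>" unfolding inK(2)[OF x] using Kc[OF sK[OF inK(1)[OF x]]] by simp
  then show False using ge e(2) by simp
 qed
 have uni: "\<exists>m. ((\<lambda>y. y \<otimes>\<^bsub>K\<^esub> inv\<^bsub>K\<^esub> (?s y)) ^^ m) x = \<one>\<^bsub>K\<^esub>" if x: "x \<in> carrier K" "x \<noteq> \<zero>\<^bsub>K\<^esub>" for x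
 proof -
  have xK: "x \<in> KC" "x \<noteq> \<zero>" using x by simp_all
  let ?g = "\<lambda>y. y \<otimes>\<^bsub>K\<^esub> inv\<^bsub>K\<^esub> (?s y)" and ?h = "\<lambda>y. y \<otimes> inv (?s y)"
  have it: "((?h ^^ m) (\<phi> x) = \<phi> ((?g ^^ m) x)) \<and> (?g ^^ m) x \<in> KC \<and> (?g ^^ m) x \<noteq> \<zero>" for m
  proof (induction m)
   case 0 show ?case using xK by simp
  next
   case (Suc m)
   define z where "z = (?g ^^ m) x"
   have z: "(?h ^^ m) (\<phi> x) = \<phi> z" "z \<in> KC" "z \<noteq> \<zero>" unfolding z_def
    by (rule conjunct1[OF Suc], rule conjunct1[OF conjunct2[OF Suc]], rule conjunct2[OF conjunct2[OF Suc]])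
   have sz: "?s z \<in> KC" "?s z \<noteq> \<zero>" using sK[OF z(2)] s0[OF z(2,3)] by auto
   note i = inK[OF sz]
   have "(?g ^^ Suc m) x = z \<otimes>\<^bsub>K\<^esub> inv\<^bsub>K\<^esub> (?s z)" by (simp only: funpow.simps(2) comp_apply z_def)
   then have g1: "(?g ^^ Suc m) x = z \<otimes> inv\<^bsub>K\<^esub> (?s z)" unfolding K(2)[of z "inv\<^bsub>K\<^esub> (?s z)"] .
   have "(?h ^^ Suc m) (\<phi> x) = \<phi> z \<otimes> inv (?s (\<phi> z))" by (simp only: funpow.simps(2) comp_apply z(1))
   also have "\<dots> = \<phi> z \<otimes> \<phi> (inv\<^bsub>K\<^esub> (?s z))" unfolding s\<phi>[OF z(2)] \<phi>U(2)[OF sz] ..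
   also have "\<dots> = \<phi> (z \<otimes> inv\<^bsub>K\<^esub> (?s z))" by (rule \<phi>m[OF z(2) i(1)])
   finally have h1: "(?h ^^ Suc m) (\<phi> x) = \<phi> (z \<otimes> inv\<^bsub>K\<^esub> (?s z))" .
   have "z \<otimes> inv\<^bsub>K\<^esub> (?s z) \<noteq> \<zero>" using K.integral[of z "inv\<^bsub>K\<^esub> (?s z)"] z(2,3) i by auto
   then show ?case unfolding g1 h1 using mK[OF z(2) i(1)] by (intro conjI refl)
  qed
  obtain m where "(?h ^^ m) (\<phi> x) = \<one>" using engel_conjugation[OF g \<phi>U(1)[OF xK]] by (elim exE)
  then have "\<phi> ((?g ^^ m) x) = \<phi> e" using it[of m] \<phi>e by metis
  moreover have "(?g ^^ m) x \<in> carrier A" using it[of m] Kc by blast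
  ultimately have "(?g ^^ m) x = e" unfolding \<phi>_def using A.add.r_cancel[of ?f "(?g ^^ m) x" e] f(1) ec by simp
  then show ?thesis by (intro exI[of _ m]) simp
 qed
 obtain y0 where y0: "y0 \<in> R" "e = N \<otimes> y0" using e(4) by blast
 have aR: "\<delta> a \<in> R" "\<delta> c \<in> R" "single l \<one>\<^sub>G \<in> R"
  using Rs cyc_self[OF a] cC(1) subgroup.one_closed[OF sub] by auto
 have za: "?s (\<delta> a \<otimes> e) = \<delta> c \<otimes> e"
  using cj_mult[OF g dl_closed ec] cj_single[OF g t(1), of "\<one>\<^sub>F"] ge unfolding c by simp
 have moved: "?s (\<delta> a \<otimes> e) \<noteq> \<delta> a \<otimes> e"
 proof
  assume "?s (\<delta> a \<otimes> e) = \<delta> a \<otimes> e"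
  then have "\<delta> (inv\<^sub>G a) \<otimes> (\<delta> c \<otimes> e) = \<delta> (inv\<^sub>G a) \<otimes> (\<delta> a \<otimes> e)" unfolding za by simp
  then have "\<delta> (inv\<^sub>G a \<bullet> c) \<otimes> e = e" using t cC ec by (simp add: dl_mult flip: A.m_assoc one_single)
  then have "\<delta> (c \<bullet> inv\<^sub>G a) \<otimes> e = e" using cyc_commute[OF a cC(1) ia] by simp
  then have Ye: "?Y \<otimes> e = \<zero>" using ec by (simp add: A.minus_eq A.l_distr A.l_minus A.r_neg)
  have "N \<otimes> e = ?D \<otimes> (?Y \<otimes> e)"
   unfolding N(1) com[OF YR] by (rule A.m_assoc[OF Rc[OF YR(2)] Rc[OF YR(1)] ec])
  then have "N \<otimes> e = \<zero>" unfolding Ye using Rc[OF YR(2)] by simp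
  moreover have "e = (N \<otimes> e) \<otimes> y0"
  proof -
   have "e = e \<otimes> (N \<otimes> y0)" using e(3) y0(2) by simp
   also have "\<dots> = (e \<otimes> N) \<otimes> y0" using ec Rc[OF NR] Rc[OF y0(1)] by (simp add: A.m_assoc)
   finally show ?thesis unfolding com[OF e(1) NR] .
  qed
  ultimately have "e = \<zero> \<otimes> y0" by simp
  then show False using e(2) Rc[OF y0(1)] by simp
 qed
 have z0: "\<delta> a \<otimes> e \<in> carrier K" using RK[OF aR(1)] by simp
 have pK: "add_pow K p \<one>\<^bsub>K\<^esub> = \<zero>\<^bsub>K\<^esub>" using Kadd characteristic_add_pow[OF p(1) ec] by simp
 note ua = K.unipotent_automorphism[OF _ pr pK sh z0 moved uni]
 have fK: "finite (carrier K)" using Kfin by simp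
 have 1: "\<exists>t. p + 1 = 2 ^ t" by (rule ua(1)[OF fK])
 have "(\<delta> a \<otimes> e) [^]\<^bsub>K\<^esub> (p * p) = \<delta> a \<otimes> e" by (rule ua(2)[OF fK _ _ z0])
 then have 2: "\<delta> (a [^]\<^sub>G (p * p)) \<otimes> e = \<delta> a \<otimes> e" unfolding Kpow[OF aR(1)] dl_pow[OF t(1)] .
 have "?s (\<delta> a \<otimes> e) = \<delta> a \<otimes> e \<or> ?s (\<delta> a \<otimes> e) = (\<delta> a \<otimes> e) [^]\<^bsub>K\<^esub> p" by (rule ua(3)[OF fK _ _ z0])
 then have 3: "\<delta> c \<otimes> e = \<delta> (a [^]\<^sub>G p) \<otimes> e" using moved unfolding za Kpow[OF aR(1)] dl_pow[OF t(1)] by blast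
 have lK: "single l \<one>\<^sub>G \<otimes> e \<in> carrier K" using RK[OF aR(3)] by simp
 have sl: "?s (single l \<one>\<^sub>G \<otimes> e) = single l \<one>\<^sub>G \<otimes> e"
  using cj_mult[OF g _ ec, of "single l \<one>\<^sub>G"] cj_single[OF g _ l(1), of "\<one>\<^sub>G"] ge l(1) g by simp
 have "\<exists>k::nat. single l \<one>\<^sub>G \<otimes> e = add_pow K k \<one>\<^bsub>K\<^esub>" by (rule ua(4)[OF fK _ _ lK sl])
 then have 4: "\<exists>k::nat. single l \<one>\<^sub>G \<otimes> e = add_pow A k e" unfolding Kadd by simp
 show ?thesis using e(2,3) RF[OF e(1)] y0(2) RF[OF y0(1)] 1 2 3 4
  by (intro bexI[of _ e] conjI bexI[of _ y0])
qed

end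

section \<open>How torsion elements are moved\<close>

lemma (in group) commutator_power:
 assumes c: "u \<in> carrier G" "b \<in> carrier G" "z \<in> carrier G"
  and zb: "z \<otimes> b = b \<otimes> z" and bu: "b \<otimes> u = z \<otimes> (u \<otimes> b)"
 shows "b [^] (k::nat) \<otimes> u = z [^] k \<otimes> (u \<otimes> b [^] k)"
proof (induction k)
 case 0 then show ?case using c by simp
next
 case (Suc k)
 have zk: "b \<otimes> z [^] k = z [^] k \<otimes> b" using group_commutes_pow[OF zb c(3,2), of k] by simp
 have cs: "b [^] k \<in> carrier G" "z [^] k \<in> carrier G" using c by simp_all
 have "b [^] Suc k \<otimes> u = b \<otimes> (b [^] k \<otimes> u)" using c cs nat_pow_Suc2[OF c(2), of k] by (simp add: m_assoc del: nat_pow_Suc)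
 also have "\<dots> = (b \<otimes> z [^] k) \<otimes> (u \<otimes> b [^] k)" unfolding Suc using c cs by (simp add: m_assoc)
 also have "\<dots> = z [^] k \<otimes> ((b \<otimes> u) \<otimes> b [^] k)" unfolding zk using c cs by (simp add: m_assoc)
 also have "\<dots> = (z [^] k \<otimes> z) \<otimes> (u \<otimes> (b \<otimes> b [^] k))" unfolding bu using c cs by (simp add: m_assoc)
 also have "\<dots> = z [^] Suc k \<otimes> (u \<otimes> b [^] Suc k)" using nat_pow_Suc2[OF c(2), of k] by simp
 finally show ?case .
qed

lemma group_exponent_dvd:
 assumes H: "group H" and n: "n > 0" "\<And>x. x \<in> carrier H \<Longrightarrow> x [^]\<^bsub>H\<^esub> (n::nat) = \<one>\<^bsub>H\<^esub>"
 shows "group_exponent H dvd n"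
proof -
 interpret H: group H by (rule H)
 let ?P = "\<lambda>m::nat. m > 0 \<and> (\<forall>x \<in> carrier H. x [^]\<^bsub>H\<^esub> m = \<one>\<^bsub>H\<^esub>)"
 have Pn: "?P n" using n by blast
 define m where "m = (LEAST m. ?P m)"
 have e: "group_exponent H = m" unfolding group_exponent_def m_def by (rule if_P) (use Pn in blast)
 have Pm: "?P m" unfolding m_def by (rule LeastI[of ?P, OF Pn])
 have "n mod m = 0"
 proof (rule ccontr)
  assume r: "n mod m \<noteq> 0"
  have "x [^]\<^bsub>H\<^esub> (n mod m) = \<one>\<^bsub>H\<^esub>" if x: "x \<in> carrier H" for x
  proof -
   have d: "H.ord x dvd m" "H.ord x dvd n" using Pm Pn x H.pow_eq_id by auto
   then have "H.ord x dvd n mod m" by (simp add: dvd_mod)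
   then show ?thesis using x H.pow_eq_id by blast
  qed
  then have "?P (n mod m)" using r by blast
  then have "m \<le> n mod m" unfolding m_def by (rule Least_le)
  then show False using Pm by (meson mod_less_divisor not_le)
 qed
 then show ?thesis unfolding e by blast
qed

text \<open>
  Pigeonhole: the \<open>(p + 1) / 2\<close> squares and the equally many values \<open>- 1 -
  y\<^sup>2\<close> cannot be disjoint modulo \<open>p\<close>.
\<close>

lemma minus_one_sum_of_two_squares:
 fixes p :: nat
 assumes p: "Factorial_Ring.prime p" "odd p"
 shows "\<exists>u v. p dvd u ^ 2 + v ^ 2 + 1"
proof -
 obtain m where m: "p = 2 * m + 1" using p(2) by (elim oddE)
 let ?f = "\<lambda>x::nat. x ^ 2 mod p" and ?g = "\<lambda>y::nat. p - 1 - y ^ 2 mod p"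
 have p0: "p > 0" using m by simp
 have sq: "x = y" if xy: "x \<le> m" "y \<le> m" "?f x = ?f y" for x y
 proof -
  have *: "a = b" if ab: "a \<le> b" "b \<le> m" "?f a = ?f b" for a b
  proof (rule ccontr)
   assume n: "a \<noteq> b"
   have "a ^ 2 \<le> b ^ 2" using ab(1) by (simp add: power_mono)
   then have "p dvd b ^ 2 - a ^ 2" using ab(3) mod_eq_dvd_iff_nat by metis
   moreover have "b ^ 2 - a ^ 2 = (b + a) * (b - a)"
   proof -
    obtain r where "b = a + r" using le_Suc_ex[OF ab(1)] by blast
    then show ?thesis by (simp add: power2_eq_square algebra_simps)
   qed
   ultimately have "p dvd b + a \<or> p dvd b - a" using p(1) by (metis prime_dvd_mult_iff)
   then have "p \<le> b + a \<or> p \<le> b - a" using ab(1) n by (auto dest: dvd_imp_le)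
   then show False using ab m by linarith
  qed
  show ?thesis using *[of x y] *[of y x] xy by (metis nat_le_linear)
 qed
 have lt: "?f x < p" for x using p0 by simp
 have fi: "inj_on ?f {..m}" by (rule inj_onI) (use sq in auto)
 have gi: "inj_on ?g {..m}"
 proof (rule inj_onI)
  fix x y assume xy: "x \<in> {..m}" "y \<in> {..m}" "?g x = ?g y"
  have "?f x = ?f y" using xy(3) lt[of x] lt[of y] by linarith
  then show "x = y" using sq xy by simp
 qed
 have "?f ` {..m} \<inter> ?g ` {..m} \<noteq> {}"
 proof
  assume d: "?f ` {..m} \<inter> ?g ` {..m} = {}"
  have "card (?f ` {..m} \<union> ?g ` {..m}) = (m + 1) + (m + 1)"
   using d card_image[OF fi] card_image[OF gi] by (simp add: card_Un_disjoint)
  moreover have "?f ` {..m} \<union> ?g ` {..m} \<subseteq> {..<p}" using lt p0 by auto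
  then have "card (?f ` {..m} \<union> ?g ` {..m}) \<le> p" using card_mono[of "{..<p}"] by fastforce
  ultimately show False using m by linarith
 qed
 then obtain x y where xy: "?f x = ?g y" by blast
 have "x ^ 2 mod p + y ^ 2 mod p + 1 = p" using xy lt[of y] by linarith
 then have "(x ^ 2 mod p + y ^ 2 mod p + 1) mod p = 0" by simp
 moreover have "(x ^ 2 mod p + y ^ 2 mod p + 1) mod p = (x ^ 2 + y ^ 2 + 1) mod p"
  by (metis mod_add_eq mod_add_left_eq)
 ultimately have "(x ^ 2 + y ^ 2 + 1) mod p = 0" by (simp only:)
 then show ?thesis by blast
qed

context engel_units
begin

text \<open>Compare the coefficients at the neutral element.\<close>

lemma two_factors_zero:
 assumes y: "y \<in> carrier G" "y \<noteq> \<one>\<^sub>G" and d: "d \<in> carrier G" "d \<noteq> \<one>\<^sub>G"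
  and z: "(\<delta> y \<ominus> \<one>) \<otimes> (\<delta> d \<ominus> \<one>) = \<zero>"
 shows "y \<bullet> d = \<one>\<^sub>G \<and> add_pow F (2::nat) \<one>\<^sub>F = \<zero>\<^sub>F"
proof -
 have h: "(\<delta> y \<ominus> \<one>) \<otimes> (\<delta> d \<ominus> \<one>) = (\<delta> y \<otimes> \<delta> d \<oplus> \<one>) \<ominus> (\<delta> y \<oplus> \<delta> d)"
  by (simp add: A.minus_eq A.l_distr A.r_distr A.l_minus A.r_minus A.minus_add A.a_ac)
 have "(\<delta> y \<otimes> \<delta> d \<oplus> \<one>) \<ominus> (\<delta> y \<oplus> \<delta> d) = \<zero>" unfolding h[symmetric] by (rule z)
 then have "\<delta> y \<otimes> \<delta> d \<oplus> \<one> = \<delta> y \<oplus> \<delta> d" by simp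
 then have "(\<delta> (y \<bullet> d) \<oplus> \<delta> \<one>\<^sub>G) \<one>\<^sub>G = (\<delta> y \<oplus> \<delta> d) \<one>\<^sub>G" using y(1) d(1) by (simp add: dl_mult one_single)
 then have e: "(if y \<bullet> d = \<one>\<^sub>G then \<one>\<^sub>F else \<zero>\<^sub>F) \<oplus>\<^sub>F \<one>\<^sub>F = \<zero>\<^sub>F"
  using y(2) d(2) by (simp add: single_apply eq_commute[of "\<one>\<^sub>G"])
 have yd: "y \<bullet> d = \<one>\<^sub>G" using e by (cases "y \<bullet> d = \<one>\<^sub>G") simp_all
 then show ?thesis using e by (simp add: numeral_2_eq_2)
qed

text \<open>
  The conclusions hold in every field component that sees \<open>g a g\<^sup>-\<^sup>1 \<noteq> a\<close>. To
  lift an equation \<open>x = z\<close> of group elements from the components, choose, if it fails, a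
  component on which \<open>x z\<^sup>-\<^sup>1 - 1\<close> is invertible; such a component exists because
  products of two such factors do not vanish.
\<close>

theorem moved_torsion:
 assumes p: "ring_characteristic F = p" "p \<noteq> 0" and a: "a \<in> tors" and g: "g \<in> carrier G"
  and c: "g \<bullet> a \<bullet> inv\<^sub>G g \<noteq> a"
 shows "\<exists>t. p + 1 = 2 ^ t" "odd p" "g \<bullet> a \<bullet> inv\<^sub>G g = a [^]\<^sub>G p" "a [^]\<^sub>G (p * p) = a"
  "l \<in> carrier F \<Longrightarrow> \<exists>k::nat. l = add_pow F k \<one>\<^sub>F"
proof -
 note t = torsD[OF a] and sub = cyc_subgroup[OF a]
 have pr: "Factorial_Ring.prime p" by (rule char_prime[OF p])
 have p2: "p \<ge> 2" using prime_ge_2_nat[OF pr] .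
 define b where b: "b = g \<bullet> a \<bullet> inv\<^sub>G g"
 have bC: "b \<in> cyc a" "b \<in> carrier G" unfolding b using torsion_conj[OF a g] g t by auto
 define y where "y = b \<bullet> inv\<^sub>G a"
 have ia: "inv\<^sub>G x \<in> cyc a" if "x \<in> cyc a" for x by (rule subgroup.m_inv_closed[OF sub that])
 have cc: "x \<in> carrier G" if "x \<in> cyc a" for x using cyc_carrier[OF a] that by blast
 have mC: "x \<bullet> z \<in> cyc a" if "x \<in> cyc a" "z \<in> cyc a" for x z by (rule subgroup.m_closed[OF sub that])
 have aC: "a \<in> cyc a" by (rule cyc_self[OF a])
 have quo: "x \<bullet> inv\<^sub>G z = \<one>\<^sub>G \<longleftrightarrow> x = z" if "x \<in> carrier G" "z \<in> carrier G" for x z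
  using that G.inv_solve_right'[of "\<one>\<^sub>G" x z] by auto
 have yC: "y \<in> cyc a" "y \<in> carrier G" unfolding y_def using mC[OF bC(1) ia[OF aC]] bC t by auto
 have y1: "y \<noteq> \<one>\<^sub>G" unfolding y_def using quo[OF bC(2) t(1)] c[folded b] by blast
 let ?N = "\<lambda>d. (\<delta> y \<ominus> \<one>) \<otimes> (\<delta> d \<ominus> \<one>)"
 have comp: "\<exists>e \<in> FS (cyc a). e \<noteq> \<zero> \<and> e \<otimes> e = e \<and> (\<exists>y \<in> FS (cyc a). e = ?N d \<otimes> y) \<and> (\<exists>t. p + 1 = 2 ^ t) \<and>
  \<delta> (a [^]\<^sub>G (p * p)) \<otimes> e = \<delta> a \<otimes> e \<and> \<delta> b \<otimes> e = \<delta> (a [^]\<^sub>G p) \<otimes> e \<and>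
  (\<exists>k::nat. single l \<one>\<^sub>G \<otimes> e = add_pow A k e)"
  if "d \<in> cyc a" "?N d \<noteq> \<zero>" "l \<in> carrier F" "l [^]\<^sub>F (p ^ r) = l" "r > 0" for d l r
  by (rule moved_component[OF p a g b that(3,4,5,1) _ that(2)]) (simp add: y_def)
 have one_pow: "\<one>\<^sub>F [^]\<^sub>F (p ^ 1) = \<one>\<^sub>F" by simp
 have Ny: "?N y \<noteq> \<zero>"
 proof
  assume "?N y = \<zero>"
  then have yy: "y \<bullet> y = \<one>\<^sub>G" "add_pow F (2::nat) \<one>\<^sub>F = \<zero>\<^sub>F" using two_factors_zero[OF yC(2) y1 yC(2) y1] by auto
  have "p dvd 2" using yy(2) F.characteristic_dvd p(1) by blast
  then have "p = 2" using p2 by (auto dest: dvd_imp_le)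
  moreover have "G.ord y dvd 2" using yy(1) yC(2) G.pow_eq_id[of y 2] by (simp add: numeral_2_eq_2)
  ultimately have "G.ord y = 1" using ord_coprime[OF p cyc_tors[OF a yC(1)]] by (metis coprime_absorb_right nat_dvd_1_iff_1)
  then show False using y1 yC(2) G.ord_eq_1 by blast
 qed
 show ex: "\<exists>t. p + 1 = 2 ^ t" using comp[OF yC(1) Ny F.one_closed one_pow] by auto
 then obtain k where k: "p + 1 = 2 ^ k" by blast
 show po: "odd p"
 proof -
  have "k \<noteq> 0" using k p2 by (cases k) auto
  then have "even (p + 1)" unfolding k by simp
  then show ?thesis by simp
 qed
 have two: "add_pow F (2::nat) \<one>\<^sub>F \<noteq> \<zero>\<^sub>F"
 proof
  assume "add_pow F (2::nat) \<one>\<^sub>F = \<zero>\<^sub>F"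
  then have "p dvd 2" using F.characteristic_dvd p(1) by blast
  then have "p = 2" using p2 by (auto dest: dvd_imp_le)
  then show False using po by simp
 qed
 \<comment> \<open>The factor belonging to \<open>x z\<^sup>-\<^sup>1\<close> annihilates \<open>e\<close>, although \<open>e\<close> is a multiple of it.\<close>
 have lift: "x = z" if xz: "x \<in> cyc a" "z \<in> cyc a" and E: "\<And>e. \<lbrakk>\<delta> (a [^]\<^sub>G (p * p)) \<otimes> e = \<delta> a \<otimes> e;
  \<delta> b \<otimes> e = \<delta> (a [^]\<^sub>G p) \<otimes> e\<rbrakk> \<Longrightarrow> \<delta> x \<otimes> e = \<delta> z \<otimes> e" for x z
 proof (rule ccontr)
  assume n: "x \<noteq> z"
  let ?d = "x \<bullet> inv\<^sub>G z"
  have xzc: "x \<in> carrier G" "z \<in> carrier G" using cc xz by auto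
  have dC: "?d \<in> cyc a" "?d \<in> carrier G" using mC[OF xz(1) ia[OF xz(2)]] xzc by auto
  have d1: "?d \<noteq> \<one>\<^sub>G" using quo[OF xzc] n by blast
  have Nd: "?N ?d \<noteq> \<zero>" using two_factors_zero[OF yC(2) y1 dC(2) d1] two by blast
  obtain e w where e: "e \<in> FS (cyc a)" "e \<noteq> \<zero>" "e \<otimes> e = e" "w \<in> FS (cyc a)" "e = ?N ?d \<otimes> w"
   "\<delta> (a [^]\<^sub>G (p * p)) \<otimes> e = \<delta> a \<otimes> e" "\<delta> b \<otimes> e = \<delta> (a [^]\<^sub>G p) \<otimes> e"
   using comp[OF dC(1) Nd F.one_closed one_pow] by auto
  have ec: "e \<in> carrier A" "w \<in> carrier A" using e FS_carrier by auto
  have "\<delta> x \<otimes> e = \<delta> z \<otimes> e" by (rule E[OF e(6,7)])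
  then have "\<delta> (inv\<^sub>G z) \<otimes> (\<delta> x \<otimes> e) = \<delta> (inv\<^sub>G z) \<otimes> (\<delta> z \<otimes> e)" by simp
  then have "\<delta> (inv\<^sub>G z \<bullet> x) \<otimes> e = e" using xzc ec by (simp add: dl_mult flip: A.m_assoc one_single)
  then have "\<delta> ?d \<otimes> e = e" using cyc_commute[OF a xz(1) ia[OF xz(2)]] by simp
  then have De: "(\<delta> ?d \<ominus> \<one>) \<otimes> e = \<zero>" using ec by (simp add: A.minus_eq A.l_distr A.l_minus A.r_neg)
  obtain Y D where YD: "Y = \<delta> y \<ominus> \<one>" "D = \<delta> ?d \<ominus> \<one>" "Y \<in> carrier A" "D \<in> carrier A" by simp
  have we: "w \<otimes> e = e \<otimes> w" by (rule FC_commute[OF a e(4,1)])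
  have "e = (Y \<otimes> D \<otimes> w) \<otimes> e" using e(3,5) unfolding YD(1,2) by simp
  also have "\<dots> = Y \<otimes> ((D \<otimes> e) \<otimes> w)" using YD(3,4) ec we by (simp add: A.m_assoc)
  also have "\<dots> = \<zero>" using De YD ec by simp
  finally show False using e(2) by simp
 qed
 show app: "a [^]\<^sub>G (p * p) = a" by (rule lift[OF cyc_pow[OF a] aC])
 have bp: "b = a [^]\<^sub>G p" by (rule lift[OF bC(1) cyc_pow[OF a]])
 then show "g \<bullet> a \<bullet> inv\<^sub>G g = a [^]\<^sub>G p" unfolding b .
 show "\<exists>k::nat. l = add_pow F k \<one>\<^sub>F" if l: "l \<in> carrier F"
 proof -
  have "g \<bullet> b \<bullet> inv\<^sub>G g = b [^]\<^sub>G p" using conj_pow[OF g t(1), of p] unfolding bp[symmetric] b[symmetric] .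
  also have "\<dots> = a" unfolding bp using app t(1) by (simp add: G.nat_pow_pow)
  finally have gb: "g \<bullet> b \<bullet> inv\<^sub>G g = a" .
  have "g [^]\<^sub>G (2::nat) \<bullet> a = (g \<bullet> b \<bullet> inv\<^sub>G g) \<bullet> g [^]\<^sub>G (2::nat)"
   unfolding b using g t by (simp add: numeral_2_eq_2 G.m_assoc)
  then have s: "g [^]\<^sub>G (2::nat) \<bullet> a = a \<bullet> g [^]\<^sub>G (2::nat)" unfolding gb .
  have "coprime p 2" using po by simp
  then obtain r where r: "r > 0" "l [^]\<^sub>F (p ^ r) = l"
   using coefficient_frobenius_fixed[OF p(1) po a g c s _ l] by blast
  obtain e k where e: "e \<in> FS (cyc a)" "e \<noteq> \<zero>" "single l \<one>\<^sub>G \<otimes> e = add_pow A (k::nat) e"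
   using comp[OF yC(1) Ny l r(2,1)] by auto
  have ec: "e \<in> carrier A" by (rule FS_carrier[OF e(1)])
  let ?m = "add_pow F k \<one>\<^sub>F"
  have m: "?m \<in> carrier F" by simp
  have "single (l \<ominus>\<^bsub>F\<^esub> ?m) \<one>\<^sub>G \<otimes> e = \<zero>"
  proof -
   have "single (l \<ominus>\<^bsub>F\<^esub> ?m) \<one>\<^sub>G = single l \<one>\<^sub>G \<ominus> single ?m \<one>\<^sub>G"
    unfolding A.minus_eq F.minus_eq using l m by (intro ga_eqI) (auto simp: single_apply simp flip: single_uminus)
   then show ?thesis using e(3) ec l m unfolding add_pow_sc[OF ec] by (simp add: A.minus_eq A.l_distr A.l_minus A.r_neg)
  qed
  then have "l \<ominus>\<^bsub>F\<^esub> ?m = \<zero>\<^sub>F" using sc_eq_zeroD[of "l \<ominus>\<^bsub>F\<^esub> ?m" e] l m ec e(2) by blast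
  then have "l = ?m" using l m by simp
  then show ?thesis by blast
 qed
qed

text \<open>
  The element \<open>1 - e + t\<close> is an involution in the unit group with augmentation one. The averaging
  identity for it and for the involution belonging to \<open>- t\<close> gives two relations whose difference
  is \<open>2 t q = 2 q t\<close>.
\<close>

lemma corner_involution_central:
 assumes e: "e \<in> carrier A" "e \<otimes> e = e" "aug e = \<zero>\<^sub>F"
  and t: "t \<in> carrier A" "e \<otimes> t = t" "t \<otimes> e = t" "t \<otimes> t = e"
  and two: "add_pow F (2::nat) \<one>\<^sub>F \<noteq> \<zero>\<^sub>F"
  and q: "q \<in> carrier A" "e \<otimes> q = q" "q \<otimes> e = q"
 shows "t \<otimes> q = q \<otimes> t"
proof -
 have dbl: "sc (add_pow F (2::nat) \<one>\<^sub>F) u = u \<oplus> u" if "u \<in> carrier A" for u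
  using add_pow_sc[OF that, of 2] that by (simp add: numeral_2_eq_2)
 have key: "t \<otimes> q \<oplus> t \<otimes> q \<otimes> t = q \<oplus> q \<otimes> t"
  if t: "t \<in> carrier A" "e \<otimes> t = t" "t \<otimes> e = t" "t \<otimes> t = e" for t
 proof -
  define w where "w = (\<one> \<ominus> e) \<oplus> t"
  have wc: "w \<in> carrier A" unfolding w_def using e(1) t(1) by simp
  have at: "aug t = \<zero>\<^sub>F" using aug_mult[OF e(1) t(1)] t(2) e(3) t(1) by simp
  have ew: "e \<otimes> w = t" "w \<otimes> e = t" unfolding w_def using e(1,2) t by (simp_all add: A.minus_eq A.l_distr A.r_distr A.l_minus A.r_minus A.r_neg)
  have tw: "t \<otimes> w = e" using t e(1,2) unfolding w_def by (simp add: A.minus_eq A.r_distr A.r_minus A.r_neg)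
  have "w \<otimes> w = (w \<ominus> t) \<oplus> e"
  proof -
   have "w \<otimes> w = ((\<one> \<ominus> e) \<oplus> t) \<otimes> w" unfolding w_def ..
   also have "\<dots> = w \<ominus> e \<otimes> w \<oplus> t \<otimes> w" using e(1) t(1) wc by (simp add: A.minus_eq A.l_distr A.l_minus)
   finally show ?thesis unfolding ew tw .
  qed
  also have "\<dots> = \<one>" unfolding w_def using e(1) t(1) by algebra
  finally have ww: "w \<otimes> w = \<one>" .
  have wU: "w \<in> Units A" unfolding Units_def using ww wc by blast
  have aw: "aug w = \<one>\<^sub>F" unfolding w_def using e(1,3) at t(1) by (simp add: A.minus_eq)
  have g: "geom w 2 = \<one> \<oplus> w" using wc by (simp add: numeral_2_eq_2 geom_Suc A.a_comm)
  have "(\<one> \<oplus> w) \<otimes> q \<otimes> (\<one> \<oplus> w) = sc (add_pow F (2::nat) \<one>\<^sub>F) (q \<otimes> (\<one> \<oplus> w))"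
   unfolding g[symmetric] by (rule torsion_unit_average[OF wU aw _ two q(1)]) (use ww wc in \<open>simp add: numeral_2_eq_2\<close>)
  then have av: "(\<one> \<oplus> w) \<otimes> q \<otimes> (\<one> \<oplus> w) = q \<otimes> (\<one> \<oplus> w) \<oplus> q \<otimes> (\<one> \<oplus> w)"
   using dbl[of "q \<otimes> (\<one> \<oplus> w)"] q(1) wc by simp
  have wq: "w \<otimes> q = t \<otimes> q"
  proof -
   have "w \<otimes> q = (w \<otimes> e) \<otimes> q" using q wc e(1) by (simp add: A.m_assoc)
   then show ?thesis unfolding ew .
  qed
  have qw: "q \<otimes> w = q \<otimes> t"
  proof -
   have "q \<otimes> w = q \<otimes> (e \<otimes> w)" using q wc e(1) by (simp flip: A.m_assoc)
   then show ?thesis unfolding ew .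
  qed
  have r: "q \<otimes> (\<one> \<oplus> w) = q \<oplus> q \<otimes> t" using q wc qw by (simp add: A.r_distr)
  have tqw: "(t \<otimes> q) \<otimes> w = t \<otimes> q \<otimes> t" using t(1) q(1) wc qw by (simp add: A.m_assoc)
  have "(\<one> \<oplus> w) \<otimes> q = q \<oplus> t \<otimes> q" using q wc wq by (simp add: A.l_distr)
  then have "(\<one> \<oplus> w) \<otimes> q \<otimes> (\<one> \<oplus> w) = (q \<oplus> t \<otimes> q) \<oplus> (q \<otimes> t \<oplus> t \<otimes> q \<otimes> t)"
   using q(1) wc t(1) tqw qw by (simp add: A.l_distr A.r_distr)
  then have "(q \<oplus> q \<otimes> t) \<oplus> (t \<otimes> q \<oplus> t \<otimes> q \<otimes> t) = (q \<oplus> q \<otimes> t) \<oplus> (q \<oplus> q \<otimes> t)"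
   using av q(1) t(1) unfolding r by (simp add: A.a_ac)
  then show ?thesis using q(1) t(1) A.add.l_cancel[of "q \<oplus> q \<otimes> t" "t \<otimes> q \<oplus> t \<otimes> q \<otimes> t" "q \<oplus> q \<otimes> t"] by simp
 qed
 have k1: "t \<otimes> q \<oplus> t \<otimes> q \<otimes> t = q \<oplus> q \<otimes> t" by (rule key[OF t])
 have "(\<ominus> t) \<otimes> q \<oplus> (\<ominus> t) \<otimes> q \<otimes> (\<ominus> t) = q \<oplus> q \<otimes> (\<ominus> t)"
  by (rule key) (use t e(1) in \<open>simp_all add: A.l_minus A.r_minus\<close>)
 then have k2: "\<ominus> (t \<otimes> q) \<oplus> t \<otimes> q \<otimes> t = q \<ominus> q \<otimes> t" using t(1) q(1) by (simp add: A.l_minus A.r_minus A.minus_eq)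
 obtain x y z where xyz: "x = t \<otimes> q" "y = q \<otimes> t" "z = t \<otimes> q \<otimes> t" "x \<in> carrier A" "y \<in> carrier A" "z \<in> carrier A"
  using t(1) q(1) by simp
 have "x \<oplus> x = (x \<oplus> z) \<ominus> (\<ominus> x \<oplus> z)" using xyz(4-6) by algebra
 also have "\<dots> = (q \<oplus> y) \<ominus> (q \<ominus> y)"
 proof -
  have "x \<oplus> z = q \<oplus> y" "\<ominus> x \<oplus> z = q \<ominus> y" using k1 k2 by (simp_all only: xyz(1-3))
  then show ?thesis by (simp only:)
 qed
 also have "\<dots> = y \<oplus> y" using xyz(5) q(1) by algebra
 finally have "(x \<ominus> y) \<oplus> (x \<ominus> y) = \<zero>"
 proof -
  assume h: "x \<oplus> x = y \<oplus> y"
  have "(x \<ominus> y) \<oplus> (x \<ominus> y) = (x \<oplus> x) \<ominus> (y \<oplus> y)" using xyz(4,5) by algebra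
  then show ?thesis unfolding h using xyz(5) by simp
 qed
 then have "sc (add_pow F (2::nat) \<one>\<^sub>F) (x \<ominus> y) = \<zero>" using dbl[of "x \<ominus> y"] xyz(4,5) by simp
 then have "x \<ominus> y = \<zero>" using sc_eq_zeroD[OF _ two, of "x \<ominus> y"] xyz(4,5) by simp
 then show ?thesis using xyz(4,5) unfolding xyz(1,2)[symmetric] by simp
qed

text \<open>
  Modulo the normal subgroup generated by \<open>a\<close>, the powers of \<open>a b\<close> and of
  \<open>b\<close> agree.
\<close>

lemma tors_mult: assumes a: "a \<in> tors" and b: "b \<in> tors" shows "a \<bullet> b \<in> tors"
proof -
 have ab: "a \<in> carrier G" "b \<in> carrier G" using torsD a b by auto
 have *: "(a \<bullet> b) [^]\<^sub>G k \<bullet> inv\<^sub>G (b [^]\<^sub>G k) \<in> cyc a" for k :: nat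
 proof (induction k)
  case 0 show ?case using subgroup.one_closed[OF cyc_subgroup[OF a]] by simp
 next
  case (Suc k)
  obtain u v where uv: "u = (a \<bullet> b) [^]\<^sub>G k" "v = b [^]\<^sub>G k" "u \<in> carrier G" "v \<in> carrier G" using ab by simp
  have "(a \<bullet> b) [^]\<^sub>G Suc k = (a \<bullet> b) \<bullet> u" unfolding uv(1) using ab by (intro G.nat_pow_Suc2) simp
  moreover have "b [^]\<^sub>G Suc k = b \<bullet> v" unfolding uv(2) using ab by (intro G.nat_pow_Suc2) simp
  ultimately have "(a \<bullet> b) [^]\<^sub>G Suc k \<bullet> inv\<^sub>G (b [^]\<^sub>G Suc k) =
   a \<bullet> (b \<bullet> (u \<bullet> inv\<^sub>G v) \<bullet> inv\<^sub>G b)"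
   using ab uv(3,4) by (simp add: G.m_assoc G.inv_mult_group)
  moreover have "b \<bullet> (u \<bullet> inv\<^sub>G v) \<bullet> inv\<^sub>G b \<in> cyc a"
   using cyc_conj[OF a ab(2) Suc] unfolding uv(1,2) .
  ultimately show ?case using subgroup.m_closed[OF cyc_subgroup[OF a] cyc_self[OF a]] by simp
 qed
 have "(a \<bullet> b) [^]\<^sub>G G.ord b \<in> cyc a" using *[of "G.ord b"] ab by simp
 then have "(a \<bullet> b) [^]\<^sub>G G.ord b \<in> tors" by (rule cyc_tors[OF a])
 note m = torsD[OF this]
 let ?m = "G.ord ((a \<bullet> b) [^]\<^sub>G G.ord b)"
 have "(a \<bullet> b) [^]\<^sub>G (G.ord b * ?m) = \<one>\<^sub>G"
  using G.pow_ord_eq_1[OF m(1)] unfolding G.nat_pow_pow[OF G.m_closed[OF ab]] .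
 then show ?thesis using torsI[of "a \<bullet> b" "G.ord b * ?m"] ab m(2) torsD(2)[OF b] by simp
qed

lemma tors_subgroup: "subgroup tors G"
proof (rule G.subgroupI)
 show "tors \<subseteq> carrier G" using torsD by blast
 show "tors \<noteq> {}" using torsI[of "\<one>\<^sub>G" 1] by auto
 show "inv\<^sub>G a \<in> tors" if a: "a \<in> tors" for a
  using subgroup.m_inv_closed[OF cyc_subgroup[OF a] cyc_self[OF a]] cyc_tors[OF a] by blast
qed (rule tors_mult)

end

section \<open>Torsion elements commute\<close>

context engel_units
begin

lemma sc_mult_sc:
 assumes "b \<in> carrier F" "d \<in> carrier F" "u \<in> carrier A" "v \<in> carrier A"
 shows "sc b u \<otimes> sc d v = sc (b \<otimes>\<^sub>F d) (u \<otimes> v)"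
proof -
 obtain B D where BD: "B = single b \<one>\<^sub>G" "D = single d \<one>\<^sub>G" "B \<in> carrier A" "D \<in> carrier A" using assms by simp
 have com: "u \<otimes> D = D \<otimes> u" unfolding BD using scalar_commute[OF assms(2,3)] by simp
 have "(B \<otimes> u) \<otimes> (D \<otimes> v) = B \<otimes> (u \<otimes> D) \<otimes> v" using assms BD(3,4) by (simp add: A.m_assoc)
 also have "\<dots> = (B \<otimes> D) \<otimes> (u \<otimes> v)" unfolding com using assms BD(3,4) by (simp add: A.m_assoc)
 also have "B \<otimes> D = single (b \<otimes>\<^sub>F d) \<one>\<^sub>G" unfolding BD using assms by (simp add: single_mult_single)
 finally show ?thesis unfolding BD .
qed

lemma mult_sc:
 assumes "b \<in> carrier F" "w \<in> carrier A" "v \<in> carrier A"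
 shows "w \<otimes> sc b v = sc b (w \<otimes> v)"
proof -
 obtain B where B: "B = single b \<one>\<^sub>G" "B \<in> carrier A" using assms by simp
 have com: "w \<otimes> B = B \<otimes> w" unfolding B(1) using scalar_commute[OF assms(1,2)] by simp
 have "w \<otimes> (B \<otimes> v) = (w \<otimes> B) \<otimes> v" using assms B(2) by (simp add: A.m_assoc)
 also have "\<dots> = B \<otimes> (w \<otimes> v)" unfolding com using assms B(2) by (simp add: A.m_assoc)
 finally show ?thesis unfolding B(1) .
qed

lemma sc_add_left:
 assumes "b \<in> carrier F" "d \<in> carrier F" "u \<in> carrier A"
 shows "sc (b \<oplus>\<^sub>F d) u = sc b u \<oplus> sc d u"
proof -
 have "single (b \<oplus>\<^sub>F d) \<one>\<^sub>G = single b \<one>\<^sub>G \<oplus> single d \<one>\<^sub>G"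
  using assms by (intro ga_eqI) (auto simp: single_apply)
 then show ?thesis using assms by (simp add: A.l_distr)
qed

text \<open>
  If \<open>u\<^sup>2 + v\<^sup>2 = -1\<close> in the prime field then \<open>u P + v R\<close> is an
  involution in the corner of \<open>e\<close>, hence commutes with \<open>P\<close> and \<open>R\<close>;
  since \<open>P\<close> and \<open>R\<close> anticommute, \<open>u = v = 0\<close>.
\<close>

lemma no_quaternion_corner:
 assumes p: "ring_characteristic F = p" "odd p"
  and e: "e \<in> carrier A" "e \<noteq> \<zero>" "e \<otimes> e = e" "aug e = \<zero>\<^sub>F"
  and P: "P \<in> carrier A" "e \<otimes> P = P" "P \<otimes> e = P" "P \<otimes> P = \<ominus> e"
  and R: "R \<in> carrier A" "e \<otimes> R = R" "R \<otimes> e = R" "R \<otimes> R = \<ominus> e"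
  and PR: "R \<otimes> P = \<ominus> (P \<otimes> R)"
 shows False
proof -
 have p0: "p \<noteq> 0" using p(2) by (cases p) auto
 have pr: "Factorial_Ring.prime p" by (rule char_prime[OF p(1) p0])
 have two: "add_pow F (2::nat) \<one>\<^sub>F \<noteq> \<zero>\<^sub>F"
 proof
  assume "add_pow F (2::nat) \<one>\<^sub>F = \<zero>\<^sub>F"
  then have "p dvd 2" using F.characteristic_dvd p(1) by blast
  then have "p = 2" using prime_ge_2_nat[OF pr] by (auto dest: dvd_imp_le)
  then show False using p(2) by simp
 qed
 obtain m n where mn: "p dvd m ^ 2 + n ^ 2 + 1" using minus_one_sum_of_two_squares[OF pr p(2)] by blast
 define u where "u = add_pow F m \<one>\<^sub>F"
 define v where "v = add_pow F n \<one>\<^sub>F"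
 have uv: "u \<in> carrier F" "v \<in> carrier F" unfolding u_def v_def by simp_all
 have "add_pow F (m ^ 2 + n ^ 2 + 1) \<one>\<^sub>F = \<zero>\<^sub>F" using mn F.characteristic_dvd p(1) by blast
 then have "add_pow F (m * m) \<one>\<^sub>F \<oplus>\<^sub>F add_pow F (n * n) \<one>\<^sub>F \<oplus>\<^sub>F \<one>\<^sub>F = \<zero>\<^sub>F"
  by (simp add: power2_eq_square F.add.nat_pow_mult[symmetric] del: F.add.nat_pow_mult)
 then have sum: "u \<otimes>\<^sub>F u \<oplus>\<^sub>F v \<otimes>\<^sub>F v \<oplus>\<^sub>F \<one>\<^sub>F = \<zero>\<^sub>F"
  unfolding F.add_pow_one_mult u_def v_def .
 have scm: "sc b (\<ominus> w) = \<ominus> sc b w" if "b \<in> carrier F" "w \<in> carrier A" for b w using that by (simp add: A.r_minus)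
 define t where "t = sc u P \<oplus> sc v R"
 define M where "M = P \<otimes> R"
 have M: "M \<in> carrier A" "R \<otimes> P = \<ominus> M" unfolding M_def using P(1) R(1) PR by auto
 have c: "sc u P \<in> carrier A" "sc v R \<in> carrier A" "sc u M \<in> carrier A" "sc v M \<in> carrier A" using uv P(1) R(1) M(1) by simp_all
 have tc: "t \<in> carrier A" unfolding t_def using c by simp
 have e_sc: "e \<otimes> sc b w = sc b (e \<otimes> w)" if "b \<in> carrier F" "w \<in> carrier A" for b w by (rule mult_sc[OF that(1) e(1) that(2)])
 have et: "e \<otimes> t = t" unfolding t_def A.r_distr[OF c(1,2) e(1)] e_sc[OF uv(1) P(1)] e_sc[OF uv(2) R(1)] P(2) R(2) ..
 have te: "t \<otimes> e = t" unfolding t_def using uv P(1,3) R(1,3) e(1) by (simp add: A.l_distr A.m_assoc)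
 have "t \<otimes> t = (sc u P \<otimes> sc u P \<oplus> sc u P \<otimes> sc v R) \<oplus> (sc v R \<otimes> sc u P \<oplus> sc v R \<otimes> sc v R)"
  unfolding t_def using c by (simp add: A.l_distr A.r_distr A.a_ac)
 also have "\<dots> = (\<ominus> sc (u \<otimes>\<^sub>F u) e \<oplus> sc (u \<otimes>\<^sub>F v) M) \<oplus> (\<ominus> sc (u \<otimes>\<^sub>F v) M \<oplus> \<ominus> sc (v \<otimes>\<^sub>F v) e)"
  unfolding sc_mult_sc[OF uv(1) uv(1) P(1) P(1)] sc_mult_sc[OF uv P(1) R(1)] sc_mult_sc[OF uv(2,1) R(1) P(1)]
   sc_mult_sc[OF uv(2) uv(2) R(1) R(1)] P(4) R(4) M(2) M_def[symmetric] F.m_comm[OF uv(2,1)]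
  using scm uv e(1) M(1) by simp
 also have "\<dots> = \<ominus> (sc (u \<otimes>\<^sub>F u) e \<oplus> sc (v \<otimes>\<^sub>F v) e)"
 proof -
  obtain x y z where "x = sc (u \<otimes>\<^sub>F u) e" "y = sc (u \<otimes>\<^sub>F v) M" "z = sc (v \<otimes>\<^sub>F v) e"
   "x \<in> carrier A" "y \<in> carrier A" "z \<in> carrier A" using uv e(1) M(1) by simp
  moreover from this(4-6) have "(\<ominus> x \<oplus> y) \<oplus> (\<ominus> y \<oplus> \<ominus> z) = \<ominus> (x \<oplus> z)" by algebra
  ultimately show ?thesis by simp
 qed
 also have "\<dots> = e"
 proof -
  let ?q = "u \<otimes>\<^sub>F u \<oplus>\<^sub>F v \<otimes>\<^sub>F v"
  have q: "?q \<in> carrier F" using uv by simp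
  have "sc (?q \<oplus>\<^sub>F \<one>\<^sub>F) e = sc ?q e \<oplus> e" using sc_add_left[OF q F.one_closed e(1)] e(1) by (simp flip: one_single)
  then have z: "sc ?q e \<oplus> e = \<zero>" unfolding sum using e(1) by (simp add: single_zero)
  have s: "sc ?q e = sc (u \<otimes>\<^sub>F u) e \<oplus> sc (v \<otimes>\<^sub>F v) e" using sc_add_left[of "u \<otimes>\<^sub>F u" "v \<otimes>\<^sub>F v" e] uv e(1) by simp
  have qc: "sc ?q e \<in> carrier A" using q e(1) by simp
  have "\<ominus> sc ?q e = e" using z qc e(1) by (metis A.minus_equality A.a_comm)
  then show ?thesis unfolding s .
 qed
 finally have tt: "t \<otimes> t = e" .
 have cR: "t \<otimes> R = R \<otimes> t" by (rule corner_involution_central[OF e(1,3,4) tc et te tt two R(1-3)])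
 have cP: "t \<otimes> P = P \<otimes> t" by (rule corner_involution_central[OF e(1,3,4) tc et te tt two P(1-3)])
 have sc_r: "w \<otimes> sc b x = sc b (w \<otimes> x)" if "b \<in> carrier F" "w \<in> carrier A" "x \<in> carrier A" for b w x by (rule mult_sc[OF that])
 have MM: "M \<otimes> M = \<ominus> e"
 proof -
  have "M \<otimes> M = P \<otimes> (R \<otimes> P) \<otimes> R" unfolding M_def using P(1) R(1) by (simp add: A.m_assoc)
  also have "\<dots> = \<ominus> ((P \<otimes> P) \<otimes> (R \<otimes> R))" unfolding PR using P(1) R(1) by (simp add: A.l_minus A.r_minus A.m_assoc)
  also have "\<dots> = \<ominus> e" unfolding P(4) R(4) using e(1,3) by (simp add: A.l_minus A.r_minus)
  finally show ?thesis .
 qed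
 have kill: "b = \<zero>\<^sub>F" if b: "b \<in> carrier F" and z: "sc b M \<oplus> sc b M = \<zero>" for b
 proof -
  have "(sc b M \<oplus> sc b M) \<otimes> M = \<zero>" unfolding z using M(1) by simp
  then have "sc b (\<ominus> e) \<oplus> sc b (\<ominus> e) = \<zero>" using b M(1) MM by (simp add: A.l_distr A.m_assoc)
  then have "add_pow A (2::nat) (sc b (\<ominus> e)) = \<zero>" using b e(1) by (simp add: numeral_2_eq_2)
  then have "sc (add_pow F (2::nat) \<one>\<^sub>F) (sc b (\<ominus> e)) = \<zero>" using add_pow_sc[of "sc b (\<ominus> e)" 2] b e(1) by simp
  then have "sc b (\<ominus> e) = \<zero>" by (rule sc_eq_zeroD[OF _ two, rotated 2]) (use b e(1) in simp_all)
  then have "\<not> b \<noteq> \<zero>\<^sub>F" using sc_eq_zeroD[OF b, of "\<ominus> e"] e(1,2) by (metis A.a_inv_closed A.minus_minus A.minus_zero)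
  then show ?thesis by blast
 qed
 have "t \<otimes> R = sc u M \<oplus> sc v (\<ominus> e)" unfolding t_def M_def R(4)[symmetric] using uv P(1) R(1) by (simp add: A.l_distr A.m_assoc)
 moreover have "R \<otimes> t = \<ominus> sc u M \<oplus> sc v (\<ominus> e)"
  unfolding t_def A.r_distr[OF c(1,2) R(1)] sc_r[OF uv(1) R(1) P(1)] sc_r[OF uv(2) R(1) R(1)] M(2) R(4) scm[OF uv(1) M(1)] ..
 ultimately have "sc u M = \<ominus> sc u M" using cR c(3) uv e(1) A.add.r_cancel[of "sc v (\<ominus> e)" "sc u M" "\<ominus> sc u M"] by simp
 then have "sc u M \<oplus> sc u M = \<ominus> sc u M \<oplus> sc u M" by (rule arg_cong[where f = "\<lambda>x. x \<oplus> sc u M"])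
 then have u0: "u = \<zero>\<^sub>F" using kill[OF uv(1)] A.l_neg[OF c(3)] by simp
 have "P \<otimes> t = sc u (\<ominus> e) \<oplus> sc v M"
  unfolding t_def A.r_distr[OF c(1,2) P(1)] sc_r[OF uv(1) P(1) P(1)] sc_r[OF uv(2) P(1) R(1)] M_def P(4) ..
 moreover have "t \<otimes> P = sc u (\<ominus> e) \<oplus> \<ominus> sc v M"
 proof -
  have "t \<otimes> P = sc u P \<otimes> P \<oplus> sc v R \<otimes> P" unfolding t_def by (rule A.l_distr[OF c(1,2) P(1)])
  also have "sc u P \<otimes> P = sc u (\<ominus> e)" unfolding P(4)[symmetric] using uv P(1) by (intro A.m_assoc) simp_all
  also have "sc v R \<otimes> P = sc v (R \<otimes> P)" using uv P(1) R(1) by (intro A.m_assoc) simp_all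
  finally show ?thesis unfolding M(2) scm[OF uv(2) M(1)] .
 qed
 ultimately have "sc u (\<ominus> e) \<oplus> \<ominus> sc v M = sc u (\<ominus> e) \<oplus> sc v M" using cP by (simp only:)
 then have "\<ominus> sc v M = sc v M"
  by (rule A.add.l_cancel) (use uv e(1) M(1) in simp_all)
 then have "\<ominus> sc v M \<oplus> sc v M = sc v M \<oplus> sc v M" by (rule arg_cong[where f = "\<lambda>x. x \<oplus> sc v M"])
 then have v0: "v = \<zero>\<^sub>F" using kill[OF uv(2)] A.l_neg[OF c(4)] by simp
 show False using sum unfolding u0 v0 by simp
qed

text \<open>
  The idempotent \<open>(1 - z) / 2\<close> turns the quaternion relations of the group into those of a
  quaternion algebra.
\<close>

lemma no_quaternion_subgroup:
 assumes p: "ring_characteristic F = p" "odd p" and c: "x \<in> carrier G" "y \<in> carrier G" "z \<in> carrier G"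
  and z: "z \<bullet> z = \<one>\<^sub>G" "z \<noteq> \<one>\<^sub>G" "x \<bullet> x = z" "y \<bullet> y = z"
  and yx: "y \<bullet> x = z \<bullet> (x \<bullet> y)"
 shows False
proof -
 have p0: "p \<noteq> 0" using p(2) by (cases p) auto
 have pr: "Factorial_Ring.prime p" by (rule char_prime[OF p(1) p0])
 have two: "add_pow F (2::nat) \<one>\<^sub>F \<noteq> \<zero>\<^sub>F"
 proof
  assume "add_pow F (2::nat) \<one>\<^sub>F = \<zero>\<^sub>F"
  then have "p dvd 2" using F.characteristic_dvd p(1) by blast
  then have "p = 2" using prime_ge_2_nat[OF pr] by (auto dest: dvd_imp_le)
  then show False using p(2) by simp
 qed
 obtain h where h: "h \<in> carrier F" "h \<otimes>\<^sub>F add_pow F (2::nat) \<one>\<^sub>F = \<one>\<^sub>F"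
  using two F.field_Units F.Units_l_inv F.Units_inv_closed by (metis DiffI F.add.nat_pow_closed F.one_closed singletonD)
 have h0: "h \<noteq> \<zero>\<^sub>F" using h by auto
 obtain \<xi> \<eta> \<zeta> where XYZ: "\<xi> = \<delta> x" "\<eta> = \<delta> y" "\<zeta> = \<delta> z" by blast
 have cA: "\<xi> \<in> carrier A" "\<eta> \<in> carrier A" "\<zeta> \<in> carrier A" unfolding XYZ by simp_all
 have ZZ: "\<zeta> \<otimes> \<zeta> = \<one>" and XX: "\<xi> \<otimes> \<xi> = \<zeta>" and YY: "\<eta> \<otimes> \<eta> = \<zeta>"
  unfolding XYZ using c z by (simp_all add: dl_mult one_single)
 have YX: "\<eta> \<otimes> \<xi> = \<zeta> \<otimes> (\<xi> \<otimes> \<eta>)" unfolding XYZ using c yx by (simp add: dl_mult)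
 have ZX: "\<zeta> \<otimes> \<xi> = \<xi> \<otimes> \<zeta>" unfolding XX[symmetric] using cA by (simp add: A.m_assoc)
 have ZY: "\<zeta> \<otimes> \<eta> = \<eta> \<otimes> \<zeta>" unfolding YY[symmetric] using cA by (simp add: A.m_assoc)
 define k where "k = single h \<one>\<^sub>G"
 have kc: "k \<in> carrier A" unfolding k_def using h(1) by simp
 have kcom: "w \<otimes> k = k \<otimes> w" if "w \<in> carrier A" for w unfolding k_def using scalar_commute[OF h(1) that] by simp
 have k2: "k \<oplus> k = \<one>"
 proof -
  have "h \<oplus>\<^sub>F h = \<one>\<^sub>F" using h by (simp add: numeral_2_eq_2 F.r_distr)
  then show ?thesis unfolding k_def one_single using h(1) by (intro ga_eqI) (auto simp: single_apply)
 qed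
 define e where "e = k \<otimes> (\<one> \<ominus> \<zeta>)"
 have ec: "e \<in> carrier A" unfolding e_def using kc cA by simp
 have Ze: "\<zeta> \<otimes> e = \<ominus> e"
 proof -
  have "\<zeta> \<otimes> (k \<otimes> (\<one> \<ominus> \<zeta>)) = (\<zeta> \<otimes> k) \<otimes> (\<one> \<ominus> \<zeta>)" using kc cA by (simp add: A.m_assoc)
  also have "\<dots> = k \<otimes> (\<zeta> \<otimes> (\<one> \<ominus> \<zeta>))" unfolding kcom[OF cA(3)] using kc cA by (simp add: A.m_assoc)
  also have "\<zeta> \<otimes> (\<one> \<ominus> \<zeta>) = \<ominus> (\<one> \<ominus> \<zeta>)" using cA(3) ZZ by (simp add: A.minus_eq A.r_distr A.r_minus A.minus_add A.a_comm)
  finally show ?thesis unfolding e_def using kc cA(3) by (simp add: A.r_minus)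
 qed
 have eW: "e \<otimes> w = w \<otimes> e" if w: "w \<in> carrier A" "\<zeta> \<otimes> w = w \<otimes> \<zeta>" for w
 proof -
  have "(\<one> \<ominus> \<zeta>) \<otimes> w = w \<otimes> (\<one> \<ominus> \<zeta>)" using w cA(3) by (simp add: A.minus_eq A.l_distr A.r_distr A.l_minus A.r_minus)
  then have "e \<otimes> w = k \<otimes> (w \<otimes> (\<one> \<ominus> \<zeta>))" unfolding e_def using w kc cA(3) by (simp add: A.m_assoc)
  also have "\<dots> = (w \<otimes> k) \<otimes> (\<one> \<ominus> \<zeta>)" unfolding kcom[OF w(1)] using w kc cA(3) by (simp add: A.m_assoc)
  finally show ?thesis unfolding e_def using w kc cA(3) by (simp add: A.m_assoc)
 qed
 have ee: "e \<otimes> e = e"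
 proof -
  have "e \<otimes> e = k \<otimes> ((\<one> \<ominus> \<zeta>) \<otimes> e)" unfolding e_def using kc cA(3) by (simp add: A.m_assoc)
  also have "(\<one> \<ominus> \<zeta>) \<otimes> e = e \<oplus> e" using Ze ec cA(3) by (simp add: A.minus_eq A.l_distr A.l_minus)
  also have "k \<otimes> (e \<oplus> e) = (k \<oplus> k) \<otimes> e" using kc ec by (simp add: A.l_distr A.r_distr)
  finally show ?thesis unfolding k2 using ec by simp
 qed
 have ae: "aug e = \<zero>\<^sub>F" unfolding e_def XYZ using kc c by (simp add: A.minus_eq F.r_neg)
 have e0: "e \<noteq> \<zero>"
 proof
  assume "e = \<zero>"
  then have "\<one> \<ominus> \<zeta> = \<zero>" using sc_eq_zeroD[OF h(1) h0, of "\<one> \<ominus> \<zeta>"] cA(3) unfolding e_def k_def by simp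
  then have "\<zeta> = \<one>" using cA(3) by simp
  then show False using dl_inject[OF c(3), of "\<one>\<^sub>G"] z(2) unfolding XYZ one_single by blast
 qed
 note eX = eW[OF cA(1) ZX] and eY = eW[OF cA(2) ZY]
 have sq: "(e \<otimes> v) \<otimes> (e \<otimes> w) = e \<otimes> (v \<otimes> w)" if "v \<in> carrier A" "w \<in> carrier A" "e \<otimes> v = v \<otimes> e" for v w
 proof -
  have "(e \<otimes> v) \<otimes> (e \<otimes> w) = e \<otimes> (v \<otimes> e) \<otimes> w" using that(1,2) ec by (simp add: A.m_assoc)
  also have "\<dots> = (e \<otimes> e) \<otimes> (v \<otimes> w)" unfolding that(3)[symmetric] using that(1,2) ec by (simp add: A.m_assoc)
  finally show ?thesis unfolding ee .
 qed
 have eZ: "e \<otimes> \<zeta> = \<ominus> e" using eW[OF cA(3)] Ze by simp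
 have l: "e \<otimes> (e \<otimes> v) = e \<otimes> v" if "v \<in> carrier A" for v using A.m_assoc[OF ec ec that] ee by simp
 have r: "(e \<otimes> v) \<otimes> e = e \<otimes> v" if "v \<in> carrier A" "e \<otimes> v = v \<otimes> e" for v
  using l[OF that(1)] A.m_assoc[OF ec that(1) ec] that(2) by simp
 show False
 proof (rule no_quaternion_corner[OF p ec e0 ee ae, of "e \<otimes> \<xi>" "e \<otimes> \<eta>"])
  show "(e \<otimes> \<xi>) \<otimes> (e \<otimes> \<xi>) = \<ominus> e" unfolding sq[OF cA(1,1) eX] XX by (rule eZ)
  show "(e \<otimes> \<eta>) \<otimes> (e \<otimes> \<eta>) = \<ominus> e" unfolding sq[OF cA(2,2) eY] YY by (rule eZ)
  have "e \<otimes> (\<zeta> \<otimes> (\<xi> \<otimes> \<eta>)) = (e \<otimes> \<zeta>) \<otimes> (\<xi> \<otimes> \<eta>)" using ec cA by (simp add: A.m_assoc)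
  then show "(e \<otimes> \<eta>) \<otimes> (e \<otimes> \<xi>) = \<ominus> ((e \<otimes> \<xi>) \<otimes> (e \<otimes> \<eta>))"
   unfolding sq[OF cA(2,1) eY] sq[OF cA(1,2) eX] YX eZ using ec cA by (simp add: A.l_minus)
 qed (use ec cA l r[OF cA(1) eX] r[OF cA(2) eY] in simp_all)
qed

text \<open>
  Torsion elements normalize each other's cyclic groups. If \<open>a\<close> and \<open>b\<close> do not
  commute, each acts on the other as the \<open>p\<close>-th power map, and the powers of \<open>a\<close> and
  \<open>b\<close> with exponent \<open>(p - 1) / 2\<close>, an odd number, generate a quaternion group of
  order eight.
\<close>

theorem torsion_commute:
 assumes a: "a \<in> tors" and b: "b \<in> tors"
 shows "a \<bullet> b = b \<bullet> a"
proof (rule ccontr)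
 assume n: "a \<bullet> b \<noteq> b \<bullet> a"
 define p where "p = ring_characteristic F"
 have c: "a \<in> carrier G" "b \<in> carrier G" using torsD a b by auto
 have cv: "g \<bullet> w = v \<bullet> g" if "g \<bullet> w \<bullet> inv\<^sub>G g = v" "g \<in> carrier G" "w \<in> carrier G" for g v w
  using that G.m_assoc by force
 have ba: "b \<bullet> a \<bullet> inv\<^sub>G b \<noteq> a" using cv[OF _ c(2,1)] n by metis
 have ab: "a \<bullet> b \<bullet> inv\<^sub>G a \<noteq> b" using cv[OF _ c(1,2)] n by metis
 have p: "ring_characteristic F = p" "p \<noteq> 0" using torsion_central_char_zero[OF _ a c(2)] ba unfolding p_def by auto
 note m1 = moved_torsion[OF p a c(2) ba] and m2 = moved_torsion[OF p b c(1) ab]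
 have e1: "b \<bullet> a = a [^]\<^sub>G p \<bullet> b" by (rule cv[OF m1(3) c(2,1)])
 have e2: "a \<bullet> b = b [^]\<^sub>G p \<bullet> a" by (rule cv[OF m2(3) c])
 obtain t where t: "p + 1 = 2 ^ t" using m1(1) by blast
 have p3: "p \<ge> 3" using prime_ge_2_nat[OF char_prime[OF p]] m1(2) by (cases "p = 2") auto
 obtain t' where t': "t = Suc (Suc t')"
 proof -
  have "t \<noteq> 0" using t p3 by (intro notI) simp
  moreover have "t \<noteq> 1" using t p3 by (intro notI) simp
  ultimately have "t \<noteq> 0" "t \<noteq> 1" by blast+
  then show ?thesis using that[of "t - 2"] by simp
 qed
 \<comment> \<open>This is \<open>(p - 1) / 2\<close>, since \<open>p + 1 = 2\<^sup>t\<close> with \<open>t \<ge> 2\<close>.\<close>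
 define m where "m = 2 ^ Suc t' - (1::nat)"
 have pow1: "(2::nat) ^ t' \<ge> 1" by simp
 then obtain q where q: "(2::nat) ^ t' = Suc q" by (cases "(2::nat) ^ t'") auto
 have "p + 1 = 4 * Suc q" using t unfolding t' q[symmetric] by simp
 moreover have mq: "m = Suc (2 * q)" unfolding m_def using q by simp
 ultimately have pm: "p = Suc (m + m)" "odd m" "m = Suc (2 * q)" by simp_all
 define x where "x = a [^]\<^sub>G m"
 define y where "y = b [^]\<^sub>G m"
 define z where "z = a [^]\<^sub>G (m + m)"
 define z' where "z' = b [^]\<^sub>G (m + m)"
 have cc: "x \<in> carrier G" "y \<in> carrier G" "z \<in> carrier G" "z' \<in> carrier G" unfolding x_def y_def z_def z'_def using c by simp_all
 have xx: "x \<bullet> x = z" unfolding x_def z_def using c by (simp add: G.nat_pow_mult)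
 have yy: "y \<bullet> y = z'" unfolding y_def z'_def using c by (simp add: G.nat_pow_mult)
 have E1: "b \<bullet> a = z \<bullet> (a \<bullet> b)" using e1 c unfolding pm(1) z_def by (simp add: G.m_assoc)
 have E2: "a \<bullet> b = z' \<bullet> (b \<bullet> a)" using e2 c unfolding pm(1) z'_def by (simp add: G.m_assoc)
 have za: "z \<bullet> a = a \<bullet> z" unfolding z_def using G.group_commutes_pow[of a a] c by simp
 have zb': "z' \<bullet> b = b \<bullet> z'" unfolding z'_def using G.group_commutes_pow[of b b] c by simp
 have "z' \<bullet> z \<bullet> (a \<bullet> b) = z' \<bullet> (b \<bullet> a)" using E1 cc c by (simp add: G.m_assoc)
 also have "\<dots> = a \<bullet> b" by (rule E2[symmetric])
 also have "\<dots> = \<one>\<^sub>G \<bullet> (a \<bullet> b)" using c by simp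
 finally have "z' \<bullet> z \<bullet> (a \<bullet> b) = \<one>\<^sub>G \<bullet> (a \<bullet> b)" .
 then have z'z: "z' \<bullet> z = \<one>\<^sub>G"
  using G.r_cancel[of "a \<bullet> b" "z' \<bullet> z" "\<one>\<^sub>G"] c cc by simp
 then have zi: "z = inv\<^sub>G z'" using cc by (metis G.inv_equality G.inv_inv)
 have zb: "z \<bullet> b = b \<bullet> z"
 proof -
  have "b = inv\<^sub>G z' \<bullet> (z' \<bullet> b)" using c cc by simp
  also have "\<dots> = z \<bullet> b \<bullet> z'" unfolding zb' zi using c cc by (simp add: G.m_assoc)
  finally have "b \<bullet> z = z \<bullet> b \<bullet> z' \<bullet> z" by (rule arg_cong[where f = "\<lambda>w. w \<bullet> z"])
  also have "\<dots> = z \<bullet> b \<bullet> (z' \<bullet> z)" using c cc by (simp add: G.m_assoc)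
  finally show ?thesis unfolding z'z using c cc by simp
 qed
 have "z = b \<bullet> z \<bullet> inv\<^sub>G b" unfolding zb[symmetric] using c cc by (simp add: G.m_assoc)
 also have "\<dots> = (a [^]\<^sub>G p) [^]\<^sub>G (m + m)" unfolding z_def conj_pow[OF c(2,1)] m1(3) ..
 also have "\<dots> = z [^]\<^sub>G p" unfolding z_def using c by (simp add: G.nat_pow_pow mult.commute)
 finally have zp: "z [^]\<^sub>G p = z" by simp
 have "z [^]\<^sub>G (p + 1) \<bullet> a = a"
 proof -
  have "(m + m) * (p + 1) + 1 = p * p" unfolding pm(1) by (simp add: algebra_simps)
  then have "a [^]\<^sub>G ((m + m) * (p + 1)) \<bullet> a = a [^]\<^sub>G (p * p)" by (metis G.nat_pow_Suc Suc_eq_plus1)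
  then show ?thesis unfolding z_def using c m1(4) by (simp only: G.nat_pow_pow)
 qed
 then have "z [^]\<^sub>G (p + 1) \<bullet> a = \<one>\<^sub>G \<bullet> a" using c by simp
 then have "z [^]\<^sub>G (p + 1) = \<one>\<^sub>G" using G.r_cancel[of a "z [^]\<^sub>G (p + 1)" "\<one>\<^sub>G"] c cc by simp
 then have zz: "z \<bullet> z = \<one>\<^sub>G" using zp by simp
 have z'e: "z' = z" using z'z zz cc by (metis G.inv_equality)
 have zm: "z [^]\<^sub>G m = z"
 proof -
  have "z [^]\<^sub>G (2::nat) = \<one>\<^sub>G" using zz cc by (simp add: numeral_2_eq_2)
  then have "z [^]\<^sub>G (2 * q) = \<one>\<^sub>G" using cc by (metis G.nat_pow_one G.nat_pow_pow)
  then show ?thesis unfolding pm(3) using cc by simp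
 qed
 have z1: "z \<noteq> \<one>\<^sub>G" using E1 n c by auto
 have "x \<bullet> b = z \<bullet> (b \<bullet> x)"
  using G.commutator_power[OF c(2,1) cc(3) za, of m] E2 unfolding z'e zm x_def by simp
 then have "z \<bullet> (x \<bullet> b) = (z \<bullet> z) \<bullet> (b \<bullet> x)" using c cc by (simp add: G.m_assoc)
 then have bx: "b \<bullet> x = z \<bullet> (x \<bullet> b)" unfolding zz using c cc by simp
 have "y \<bullet> x = z \<bullet> (x \<bullet> y)"
  using G.commutator_power[OF cc(1) c(2) cc(3) zb bx, of m] unfolding zm y_def .
 then show False by (rule no_quaternion_subgroup[OF p(1) m1(2) cc(1,2,3) zz z1 xx yy[unfolded z'e]])
qed

text \<open>
  If a torsion element is moved by \<open>g\<close>, then \<open>g\<close> acts as the \<open>p\<close>-th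
  power map on all torsion elements: for an unmoved \<open>a\<close> and a moved \<open>b\<close> the product
  \<open>a b\<close> is moved, and comparison of the two actions gives \<open>a\<^sup>p = a\<close>.
\<close>

theorem necessity:
 assumes p: "ring_characteristic F = p"
 shows "subgroup tors G" "comm_group (G\<lparr>carrier := tors\<rparr>)"
  "tors \<subseteq> group_center G
   \<or>
   prime_field F \<and> (\<exists>t::nat. int p = 2 ^ t - 1) \<and>
   int (group_exponent (G\<lparr>carrier := tors\<rparr>)) dvd (int p) ^ 2 - 1 \<and>
   (\<forall>a \<in> tors. \<forall>g \<in> carrier G - centralizer G tors.
    inv\<^sub>G g \<bullet> a \<bullet> g = a [^]\<^sub>G p)"
proof -
 show sub: "subgroup tors G" by (rule tors_subgroup)
 interpret T: group "G\<lparr>carrier := tors\<rparr>" by (rule subgroup.subgroup_is_group[OF sub G.is_group])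
 show "comm_group (G\<lparr>carrier := tors\<rparr>)" by (rule T.group_comm_groupI) (simp add: torsion_commute)
 have tc: "a \<in> carrier G" if "a \<in> tors" for a using torsD(1)[OF that] .
 have cj_eq: "g \<bullet> a \<bullet> inv\<^sub>G g = a \<longleftrightarrow> g \<bullet> a = a \<bullet> g" if "a \<in> carrier G" "g \<in> carrier G" for a g
  using that G.inv_solve_right'[of a "g \<bullet> a" g] by auto
 show "tors \<subseteq> group_center G
   \<or>
   prime_field F \<and> (\<exists>t::nat. int p = 2 ^ t - 1) \<and>
   int (group_exponent (G\<lparr>carrier := tors\<rparr>)) dvd (int p) ^ 2 - 1 \<and>
   (\<forall>a \<in> tors. \<forall>g \<in> carrier G - centralizer G tors.
    inv\<^sub>G g \<bullet> a \<bullet> g = a [^]\<^sub>G p)"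
 proof (cases "\<forall>a \<in> tors. \<forall>g \<in> carrier G. g \<bullet> a = a \<bullet> g")
  case True
  have "tors \<subseteq> group_center G"
  proof
   fix a assume a: "a \<in> tors"
   have "a \<bullet> g = g \<bullet> a" if "g \<in> carrier G" for g using True a that by simp
   then show "a \<in> group_center G" unfolding group_center_def centralizer_def using tc[OF a] by simp
  qed
  then show ?thesis by (rule disjI1)
 next
  case False
  then obtain a0 g0 where 0: "a0 \<in> tors" "g0 \<in> carrier G" "g0 \<bullet> a0 \<noteq> a0 \<bullet> g0" by blast
  have mv0: "g0 \<bullet> a0 \<bullet> inv\<^sub>G g0 \<noteq> a0" using cj_eq[OF tc[OF 0(1)] 0(2)] 0(3) by blast
  have p0: "p \<noteq> 0" using torsion_central_char_zero[OF _ 0(1,2)] mv0 p by auto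
  note M0 = moved_torsion[OF p p0 0(1,2) mv0]
  have p2: "p \<ge> 2" using prime_ge_2_nat[OF char_prime[OF p p0]] .
  have all: "g \<bullet> a \<bullet> inv\<^sub>G g = a [^]\<^sub>G p \<and> a [^]\<^sub>G (p * p) = a"
   if a: "a \<in> tors" and g: "g \<in> carrier G" and b: "b \<in> tors" "g \<bullet> b \<noteq> b \<bullet> g" for a b g
  proof (cases "g \<bullet> a \<bullet> inv\<^sub>G g = a")
   case False
   then show ?thesis using moved_torsion(3,4)[OF p p0 a g False] by blast
  next
   case True
   note c = tc[OF a] tc[OF b(1)]
   have mb: "g \<bullet> b \<bullet> inv\<^sub>G g \<noteq> b" using cj_eq[OF c(2) g] b(2) by blast
   have bp: "g \<bullet> b \<bullet> inv\<^sub>G g = b [^]\<^sub>G p" by (rule moved_torsion(3)[OF p p0 b(1) g mb])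
   have "g \<bullet> (a \<bullet> b) \<bullet> inv\<^sub>G g = (g \<bullet> a \<bullet> inv\<^sub>G g) \<bullet> (g \<bullet> b \<bullet> inv\<^sub>G g)"
    using g c by (simp add: G.m_assoc)
   then have ab: "g \<bullet> (a \<bullet> b) \<bullet> inv\<^sub>G g = a \<bullet> b [^]\<^sub>G p" unfolding True bp .
   have "b [^]\<^sub>G p \<noteq> b" using mb bp by simp
   then have "g \<bullet> (a \<bullet> b) \<bullet> inv\<^sub>G g \<noteq> a \<bullet> b" unfolding ab using c by simp
   then have "g \<bullet> (a \<bullet> b) \<bullet> inv\<^sub>G g = (a \<bullet> b) [^]\<^sub>G p" by (rule moved_torsion(3)[OF p p0 tors_mult[OF a b(1)] g])
   also have "\<dots> = a [^]\<^sub>G p \<bullet> b [^]\<^sub>G p" by (rule G.pow_mult_distrib[OF torsion_commute[OF a b(1)] c])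
   finally have "a \<bullet> b [^]\<^sub>G p = a [^]\<^sub>G p \<bullet> b [^]\<^sub>G p" unfolding ab .
   then have ap: "a [^]\<^sub>G p = a" using G.r_cancel[of "b [^]\<^sub>G p" a "a [^]\<^sub>G p"] c by simp
   moreover have "a [^]\<^sub>G (p * p) = (a [^]\<^sub>G p) [^]\<^sub>G p" using c by (simp add: G.nat_pow_pow)
   ultimately show ?thesis using True by simp
  qed
  have pf: "prime_field F"
   unfolding prime_field_def
  proof (intro conjI allI impI)
   show "field F" by (rule F.field_axioms)
   fix K assume K: "subfield K F"
   have sr: "subring K F" by (rule subfieldE(1)[OF K])
   have "add_pow F k \<one>\<^sub>F \<in> K" for k :: nat
    by (induction k) (use subringE(2,3,7)[OF sr] in auto)
   then have "carrier F \<subseteq> K" using M0(5) by blast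
   then show "K = carrier F" using subringE(1)[OF sr] by blast
  qed
  have mers: "\<exists>t::nat. int p = 2 ^ t - 1"
  proof -
   obtain t where "p + 1 = 2 ^ t" using M0(1) by blast
   then have "int p + 1 = 2 ^ t" by (metis of_nat_1 of_nat_add of_nat_numeral of_nat_power)
   then show ?thesis by (intro exI[of _ t]) simp
  qed
  have pp: "Suc (p * p - 1) = p * p" using p2 by simp
  have a1: "a [^]\<^sub>G (p * p - 1) = \<one>\<^sub>G" if a: "a \<in> tors" for a
  proof -
   have "a [^]\<^sub>G (p * p - 1) \<bullet> a = a [^]\<^sub>G Suc (p * p - 1)" by simp
   also have "\<dots> = \<one>\<^sub>G \<bullet> a" unfolding pp using all[OF a 0(2) 0(1) 0(3)] tc[OF a] by simp
   finally show ?thesis using G.r_cancel[of a "a [^]\<^sub>G (p * p - 1)" "\<one>\<^sub>G"] tc[OF a] by simp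
  qed
  have p4: "p * p \<ge> 4" using mult_le_mono[OF p2 p2] by simp
  have "group_exponent (G\<lparr>carrier := tors\<rparr>) dvd p * p - 1"
  proof (rule group_exponent_dvd[OF T.is_group])
   show "p * p - 1 > 0" using p4 by simp
   show "x [^]\<^bsub>G\<lparr>carrier := tors\<rparr>\<^esub> (p * p - 1) = \<one>\<^bsub>G\<lparr>carrier := tors\<rparr>\<^esub>" if "x \<in> carrier (G\<lparr>carrier := tors\<rparr>)" for x
    using a1[of x] that by (simp add: G.nat_pow_consistent[symmetric])
  qed
  then have "int (group_exponent (G\<lparr>carrier := tors\<rparr>)) dvd int (p * p - 1)" by (simp only: int_dvd_int_iff)
  moreover have "int (p * p - 1) = (int p) ^ 2 - 1" using p2 by (subst of_nat_diff) (simp_all add: power2_eq_square)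
  ultimately have ex: "int (group_exponent (G\<lparr>carrier := tors\<rparr>)) dvd (int p) ^ 2 - 1" by (simp only:)
  have "inv\<^sub>G g \<bullet> a \<bullet> g = a [^]\<^sub>G p" if a: "a \<in> tors" and g: "g \<in> carrier G - centralizer G tors" for a g
  proof -
   have gc: "g \<in> carrier G" using g by blast
   obtain b where b: "b \<in> tors" "g \<bullet> b \<noteq> b \<bullet> g" using g unfolding centralizer_def by blast
   have "inv\<^sub>G g \<bullet> b \<noteq> b \<bullet> inv\<^sub>G g"
   proof
    assume i: "inv\<^sub>G g \<bullet> b = b \<bullet> inv\<^sub>G g"
    have "b \<bullet> g = g \<bullet> (inv\<^sub>G g \<bullet> b) \<bullet> g" using gc tc[OF b(1)] by simp
    also have "\<dots> = g \<bullet> b" unfolding i using gc tc[OF b(1)] by (simp add: G.m_assoc)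
    finally show False using b(2) by simp
   qed
   then have "inv\<^sub>G g \<bullet> a \<bullet> inv\<^sub>G (inv\<^sub>G g) = a [^]\<^sub>G p"
    using all[OF a _ b(1), of "inv\<^sub>G g"] gc by simp
   then show ?thesis using gc by simp
  qed
  then show ?thesis using pf mers ex by blast
 qed
qed

end

theorem theorem4:
  fixes F :: "('f, 'b) ring_scheme" and G :: "('g, 'c) monoid_scheme" and p :: nat
  assumes "field F" and "ring_characteristic F = p"
    and "group G"
    and "\<not> modular_group_algebra F G"
  shows "locally_nilpotent_group (normalized_units F G) \<longleftrightarrow>
    locally_nilpotent_group G \<and>
    (subgroup (torsion_part G) G \<and> comm_group (G\<lparr>carrier := torsion_part G\<rparr>)) \<and>
    (torsion_part G \<subseteq> group_center G
     \<or>
     prime_field F \<and> (\<exists>t::nat. int p = 2 ^ t - 1) \<and>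
     int (group_exponent (G\<lparr>carrier := torsion_part G\<rparr>)) dvd (int p) ^ 2 - 1 \<and>
     (\<forall>a \<in> torsion_part G. \<forall>g \<in> carrier G - centralizer G (torsion_part G).
        inv\<^bsub>G\<^esub> g \<otimes>\<^bsub>G\<^esub> a \<otimes>\<^bsub>G\<^esub> g = a [^]\<^bsub>G\<^esub> p))"
proof -
  interpret grpalg F G "group_algebra F G"
    by (rule grpalg.intro[OF assms(1,3) grpalg_axioms.intro]) (rule refl)
  show ?thesis
  proof (rule iffI)
    assume V: "locally_nilpotent_group (normalized_units F G)"
    interpret engel_units F G "group_algebra F G"
      by (rule engel_units.intro[OF grpalg_axioms engel_units_axioms.intro[OF V assms(4)]])
    show "locally_nilpotent_group G \<and>
      (subgroup (torsion_part G) G \<and> comm_group (G\<lparr>carrier := torsion_part G\<rparr>)) \<and>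
      (torsion_part G \<subseteq> group_center G
       \<or>
       prime_field F \<and> (\<exists>t::nat. int p = 2 ^ t - 1) \<and>
       int (group_exponent (G\<lparr>carrier := torsion_part G\<rparr>)) dvd (int p) ^ 2 - 1 \<and>
       (\<forall>a \<in> torsion_part G. \<forall>g \<in> carrier G - centralizer G (torsion_part G).
          inv\<^bsub>G\<^esub> g \<otimes>\<^bsub>G\<^esub> a \<otimes>\<^bsub>G\<^esub> g = a [^]\<^bsub>G\<^esub> p))"
      by (intro conjI G_locally_nilpotent necessity[OF assms(2)])
  next
    assume "locally_nilpotent_group G \<and>
      (subgroup (torsion_part G) G \<and> comm_group (G\<lparr>carrier := torsion_part G\<rparr>)) \<and>
      (torsion_part G \<subseteq> group_center G
       \<or>
       prime_field F \<and> (\<exists>t::nat. int p = 2 ^ t - 1) \<and>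
       int (group_exponent (G\<lparr>carrier := torsion_part G\<rparr>)) dvd (int p) ^ 2 - 1 \<and>
       (\<forall>a \<in> torsion_part G. \<forall>g \<in> carrier G - centralizer G (torsion_part G).
          inv\<^bsub>G\<^esub> g \<otimes>\<^bsub>G\<^esub> a \<otimes>\<^bsub>G\<^esub> g = a [^]\<^bsub>G\<^esub> p))"
    then show "locally_nilpotent_group (normalized_units F G)"
      by (elim conjE) (rule sufficiency[OF assms(4,2)])
  qed
qed

end
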